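(* Let $\varepsilon\in(0,1)$ and let $m_\varepsilon$ be the solution of $$\mathbf P\left\{\int_0^\infty Z(v)\,dv>m_\varepsilon\right\}=\varepsilon,$$ where $Z(u)=\exp\{W^H(u)-|u|^{2H}/2\}$. Consider the Bayes test BT2 $$\tilde\psi_n^\star(X^n)=\mathbb 1_{\{R_n(X^n)>m_\varepsilon\}},\qquad R_n(X^n)=\frac{\tilde L_n(X^n)}{p(\vartheta_1)\varphi_n},\qquad \tilde L_n(X^n)=\int_{\vartheta_1}^bL(\theta,\vartheta_1,X^n)p(\theta)\,d\theta .$$ Then $\tilde\psi_n^\star$ belongs to $\mathcal K_\varepsilon$, i.e. $\lim_{n\to\infty}\mathbf E_{\vartheta_1}\tilde\psi_n^\star(X^n)=\varepsilon$, and for every $u_*>0$ its power function under the local alternative $\vartheta=\vartheta_1+\varphi_nu_*$ satisfies, as $n\to\infty$, $$\beta(\tilde\psi_n^\star,u_* )=\mathbf E_{\vartheta_1+\varphi_nu_*}\tilde\psi_n^\star(X^n)\longrightarrow\tilde\beta^\star(u_* )=\mathbf P\left(Z(-u_* )^{-1}\int_{-u_*}^\infty Z(v)\,dv>m_\varepsilon\right).$$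
   Context: Model (cusp-type singularity). Fix $\tau>0$, $0<\vartheta_1<b\le\tau$, $\kappa\in(0,1/2)$, $a\ne0$, and a known positive bounded function $h$ on $[0,\tau]$. Let $\Theta=[\vartheta_1,b)$ and $$\lambda(\vartheta,t)=a|t-\vartheta|^\kappa+h(t),\qquad 0\le t\le\tau,\ \vartheta\in\Theta,$$ where the intensity is assumed separated from zero on $[0,\tau]$. Under $\mathbf P_\vartheta$ (expectation $\mathbf E_\vartheta$), the observation is $X^n=(X_1,\dots,X_n)$, where $X_j=(X_j(t),0\le t\le\tau)$ are independent inhomogeneous Poisson processes with intensity function $\lambda(\vartheta,\cdot)$. The likelihood is $$L(\vartheta,X^n)=\exp\left\{\sum_{j=1}^n\int_0^\tau\ln\lambda(\vartheta,t)\,dX_j(t)-n\int_0^\tau[\lambda(\vartheta,t)-1]\,dt\right\}$$ and $L(\vartheta,\vartheta_1,X^n)=L(\vartheta,X^n)/L(\vartheta_1,X^n)$. Prior: $p(\theta)$, $\vartheta_1\le\theta<b$, is a continuous and positive probability density. Normalization: $H=\kappa+\frac12$, $\varphi_n=n^{-\frac1{2H}}\Gamma_{\vartheta_1}^{-\frac1H}$, with $\Gamma_{\vartheta_1}>0$, $\Gamma_{\vartheta_1}^2=\frac{2a^2B(\kappa+1,\kappa+1)}{h(\vartheta_1)}\left[\frac1{\cos(\pi\kappa)}-1\right]$, $B$ being the Beta function. $W^H=(W^H(u),u\in\mathbb R)$ is a standard two-sided fractional Brownian motion with Hurst parameter $H$ (centered Gaussian, continuous, $W^H(0)=0$, $\mathbf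 E|W^H(u)-W^H(v)|^2=|u-v|^{2H}$), and $Z(u)=\exp\{W^H(u)-|u|^{2H}/2\}$, $u\in\mathbb R$. The problem is testing $\vartheta=\vartheta_1$ against $\vartheta>\vartheta_1$. A test $\bar\psi_n$ is a $[0,1]$-valued function of $X^n$ (the probability to reject $\vartheta=\vartheta_1$); $\mathcal K_\varepsilon$ is the class of (sequences of) tests with $\lim_{n\to\infty}\mathbf E_{\vartheta_1}\bar\psi_n(X^n)=\varepsilon$; for $u>0$ the power is $\beta(\bar\psi_n,u)=\mathbf E_{\vartheta_1+\varphi_nu}\bar\psi_n(X^n)$ (defined for $n$ so large that $\vartheta_1+\varphi_nu<b$).
   Formalization: The function h is also assumed Borel measurable on [0,τ] and continuous at ϑ₁; without regularity at ϑ₁ the claim fails, since changing h only at ϑ₁ alters Γ and φ_n but not the law of the observations. Separation from zero is taken uniformly in ϑ. *)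

theory Defs
  imports "HOL-Probability.Probability"
begin

text \<open>
  Trajectories are non-decreasing, right-continuous, \<open>nat\<close>-valued functions on \<open>[0,\<tau>]\<close> starting
  at 0, with the sigma-algebra generated by the evaluations. Jumps of size one are not imposed
  here: they are almost sure for a Poisson process with an intensity function.
\<close>

definition path_space :: "real \<Rightarrow> (real \<Rightarrow> nat) measure" where
  "path_space \<tau> = restrict_space (Pi\<^sub>M {0..\<tau>} (\<lambda>_. count_space UNIV))
     {x. x 0 = 0 \<and> mono_on {0..\<tau>} x \<and> (\<forall>t\<in>{0..<\<tau>}. continuous (at_right t) x)}"

definition poisson_process ::
  "'w measure \<Rightarrow> real \<Rightarrow> (real \<Rightarrow> real) \<Rightarrow> ('w \<Rightarrow> real \<Rightarrow> nat) \<Rightarrow> bool" where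
  "poisson_process M \<tau> lam N \<longleftrightarrow>
     prob_space M \<and> N \<in> M \<rightarrow>\<^sub>M path_space \<tau> \<and>
     (\<forall>s\<in>{0..\<tau>}. \<forall>t\<in>{0..\<tau>}. s < t \<longrightarrow>
        distr M (count_space UNIV) (\<lambda>\<omega>. N \<omega> t - N \<omega> s) =
          measure_pmf (poisson_pmf (LINT r:{s..t}|lborel. lam r))) \<and>
     (\<forall>k::nat. \<forall>t. t ` {..k} \<subseteq> {0..\<tau>} \<and> mono_on {..k} t \<longrightarrow>
        prob_space.indep_vars M (\<lambda>_. count_space UNIV)
          (\<lambda>i \<omega>. N \<omega> (t (Suc i)) - N \<omega> (t i)) {..<k})"

definition poisson_sample ::
  "'w measure \<Rightarrow> real \<Rightarrow> (real \<Rightarrow> real) \<Rightarrow> nat \<Rightarrow> (nat \<Rightarrow> 'w \<Rightarrow> real \<Rightarrow> nat) \<Rightarrow> bool" where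
  "poisson_sample M \<tau> lam n X \<longleftrightarrow>
     prob_space M \<and>
     (\<forall>j\<in>{1..n}. poisson_process M \<tau> lam (X j)) \<and>
     prob_space.indep_vars M (\<lambda>_. path_space \<tau>) X {1..n}"

text \<open>
  \<open>\<integral>\<^sub>0\<^sup>\<tau> f(t) dx(t)\<close> as a Lebesgue-Stieltjes integral. The path is extended to the whole line by its
  values at 0 and \<open>\<tau>\<close>, so that the measure lives on \<open>(0,\<tau>]\<close>; the integral is the sum of the values of
  \<open>f\<close> at the jumps of \<open>x\<close>, counted with their sizes.
\<close>

definition path_integral :: "real \<Rightarrow> (real \<Rightarrow> real) \<Rightarrow> (real \<Rightarrow> nat) \<Rightarrow> real" where
  "path_integral \<tau> f x =
     (LINT t:{0..\<tau>}|interval_measure (\<lambda>t. real (x (max 0 (min \<tau> t)))). f t)"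

definition cusp_intensity :: "real \<Rightarrow> real \<Rightarrow> (real \<Rightarrow> real) \<Rightarrow> real \<Rightarrow> real \<Rightarrow> real" where
  "cusp_intensity a \<kappa> h \<theta> t = a * \<bar>t - \<theta>\<bar> powr \<kappa> + h t"

definition likelihood ::
  "real \<Rightarrow> (real \<Rightarrow> real \<Rightarrow> real) \<Rightarrow> nat \<Rightarrow> real \<Rightarrow> (nat \<Rightarrow> real \<Rightarrow> nat) \<Rightarrow> real" where
  "likelihood \<tau> lam n \<theta> x =
     exp ((\<Sum>j=1..n. path_integral \<tau> (\<lambda>t. ln (lam \<theta> t)) (x j))
          - real n * (LINT t:{0..\<tau>}|lborel. lam \<theta> t - 1))"

definition likelihood_ratio ::
  "real \<Rightarrow> (real \<Rightarrow> real \<Rightarrow> real) \<Rightarrow> nat \<Rightarrow> real \<Rightarrow> real \<Rightarrow> (nat \<Rightarrow> real \<Rightarrow> nat) \<Rightarrow> real" where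
  "likelihood_ratio \<tau> lam n \<theta> \<theta>\<^sub>1 x = likelihood \<tau> lam n \<theta> x / likelihood \<tau> lam n \<theta>\<^sub>1 x"

text \<open>
  Only the pointwise value \<open>h \<theta>\<^sub>1\<close> enters, so this constant describes the local behaviour of the model only
  if \<open>h\<close> is continuous at \<open>\<theta>\<^sub>1\<close>.
\<close>

definition cusp_Gamma :: "real \<Rightarrow> real \<Rightarrow> (real \<Rightarrow> real) \<Rightarrow> real \<Rightarrow> real" where
  "cusp_Gamma a \<kappa> h \<theta>\<^sub>1 =
     sqrt (2 * a\<^sup>2 * Beta (\<kappa> + 1) (\<kappa> + 1) / h \<theta>\<^sub>1 * (1 / cos (pi * \<kappa>) - 1))"

definition hurst :: "real \<Rightarrow> real" where
  "hurst \<kappa> = \<kappa> + 1 / 2"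

definition cusp_rate :: "real \<Rightarrow> real \<Rightarrow> (real \<Rightarrow> real) \<Rightarrow> real \<Rightarrow> nat \<Rightarrow> real" where
  "cusp_rate a \<kappa> h \<theta>\<^sub>1 n =
     real n powr (- 1 / (2 * hurst \<kappa>)) * cusp_Gamma a \<kappa> h \<theta>\<^sub>1 powr (- 1 / hurst \<kappa>)"

text \<open>
  The \<open>n\<close>-th experiment consists of the measures \<open>P n \<theta>\<close> and the processes \<open>X n 1, \<dots>, X n n\<close>. A test is a
  function of the sample \<open>(X n 1, \<dots>, X n n)\<close>, i.e. a function on the \<open>n\<close>-fold product of the path space.
\<close>

definition test_expectation ::
  "(nat \<Rightarrow> real \<Rightarrow> 'w measure) \<Rightarrow> (nat \<Rightarrow> nat \<Rightarrow> 'w \<Rightarrow> real \<Rightarrow> nat) \<Rightarrow>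
   (nat \<Rightarrow> (nat \<Rightarrow> real \<Rightarrow> nat) \<Rightarrow> real) \<Rightarrow> nat \<Rightarrow> real \<Rightarrow> real" where
  "test_expectation P X \<psi> n \<theta> = (LINT \<omega>|P n \<theta>. \<psi> n (\<lambda>j\<in>{1..n}. X n j \<omega>))"

definition is_test :: "real \<Rightarrow> (nat \<Rightarrow> (nat \<Rightarrow> real \<Rightarrow> nat) \<Rightarrow> real) \<Rightarrow> bool" where
  "is_test \<tau> \<psi> \<longleftrightarrow>
     (\<forall>n. \<psi> n \<in> borel_measurable (Pi\<^sub>M {1..n} (\<lambda>_. path_space \<tau>)) \<and> (\<forall>x. \<psi> n x \<in> {0..1}))"

definition test_class ::
  "(nat \<Rightarrow> real \<Rightarrow> 'w measure) \<Rightarrow> (nat \<Rightarrow> nat \<Rightarrow> 'w \<Rightarrow> real \<Rightarrow> nat) \<Rightarrow> real \<Rightarrow> real \<Rightarrow> real \<Rightarrow>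
   (nat \<Rightarrow> (nat \<Rightarrow> real \<Rightarrow> nat) \<Rightarrow> real) set" where
  "test_class P X \<tau> \<theta>\<^sub>1 \<epsilon> =
     {\<psi>. is_test \<tau> \<psi> \<and> (\<lambda>n. test_expectation P X \<psi> n \<theta>\<^sub>1) \<longlonglongrightarrow> \<epsilon>}"

definition bayes_likelihood ::
  "real \<Rightarrow> real \<Rightarrow> (real \<Rightarrow> real \<Rightarrow> real) \<Rightarrow> (real \<Rightarrow> real) \<Rightarrow> real \<Rightarrow> nat \<Rightarrow>
   (nat \<Rightarrow> real \<Rightarrow> nat) \<Rightarrow> real" where
  "bayes_likelihood \<tau> b lam p \<theta>\<^sub>1 n x =
     (LINT \<theta>:{\<theta>\<^sub>1..<b}|lborel. likelihood_ratio \<tau> lam n \<theta> \<theta>\<^sub>1 x * p \<theta>)"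

definition bayes_statistic ::
  "real \<Rightarrow> real \<Rightarrow> (real \<Rightarrow> real \<Rightarrow> real) \<Rightarrow> (real \<Rightarrow> real) \<Rightarrow> (nat \<Rightarrow> real) \<Rightarrow> real \<Rightarrow> nat \<Rightarrow>
   (nat \<Rightarrow> real \<Rightarrow> nat) \<Rightarrow> real" where
  "bayes_statistic \<tau> b lam p \<phi> \<theta>\<^sub>1 n x =
     bayes_likelihood \<tau> b lam p \<theta>\<^sub>1 n x / (p \<theta>\<^sub>1 * \<phi> n)"

definition bayes_test2 ::
  "real \<Rightarrow> real \<Rightarrow> (real \<Rightarrow> real \<Rightarrow> real) \<Rightarrow> (real \<Rightarrow> real) \<Rightarrow> (nat \<Rightarrow> real) \<Rightarrow> real \<Rightarrow> real \<Rightarrow> nat \<Rightarrow>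
   (nat \<Rightarrow> real \<Rightarrow> nat) \<Rightarrow> real" where
  "bayes_test2 \<tau> b lam p \<phi> \<theta>\<^sub>1 m n x = of_bool (bayes_statistic \<tau> b lam p \<phi> \<theta>\<^sub>1 n x > m)"

text \<open>Constants count as (degenerate) Gaussian variables.\<close>

definition gaussian_variable :: "'s measure \<Rightarrow> ('s \<Rightarrow> real) \<Rightarrow> bool" where
  "gaussian_variable M Y \<longleftrightarrow> Y \<in> borel_measurable M \<and>
     ((\<exists>\<mu> \<sigma>. 0 < \<sigma> \<and> distributed M lborel Y (normal_density \<mu> \<sigma>)) \<or>
      (\<exists>\<mu>. AE \<omega> in M. Y \<omega> = \<mu>))"

definition centered_gaussian_process :: "'s measure \<Rightarrow> ('i \<Rightarrow> 's \<Rightarrow> real) \<Rightarrow> bool" where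
  "centered_gaussian_process M W \<longleftrightarrow>
     (\<forall>I c. finite I \<longrightarrow> gaussian_variable M (\<lambda>\<omega>. \<Sum>i\<in>I. c i * W i \<omega>)) \<and>
     (\<forall>i. (LINT \<omega>|M. W i \<omega>) = 0)"

definition fractional_brownian_motion ::
  "'s measure \<Rightarrow> real \<Rightarrow> (real \<Rightarrow> 's \<Rightarrow> real) \<Rightarrow> bool" where
  "fractional_brownian_motion M H W \<longleftrightarrow>
     prob_space M \<and> centered_gaussian_process M W \<and>
     (\<forall>\<omega>\<in>space M. continuous_on UNIV (\<lambda>u. W u \<omega>) \<and> W 0 \<omega> = 0) \<and>
     (\<forall>u v. (LINT \<omega>|M. \<bar>W u \<omega> - W v \<omega>\<bar>\<^sup>2) = \<bar>u - v\<bar> powr (2 * H))"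

text \<open>
  Integrals of \<open>limit_Z\<close> over half-lines are finite almost surely, so the value 0 of the Bochner integral
  of a non-integrable function does not affect the probabilities of events formed with them.
\<close>

definition limit_Z :: "real \<Rightarrow> (real \<Rightarrow> 's \<Rightarrow> real) \<Rightarrow> real \<Rightarrow> 's \<Rightarrow> real" where
  "limit_Z H W u \<omega> = exp (W u \<omega> - \<bar>u\<bar> powr (2 * H) / 2)"

end

theory Submission
  imports Defs
begin

text \<open>Both claims concern the truth \<open>\<theta>\<^sub>1 + \<phi> n * u\<close> with \<open>u \<ge> 0\<close>; the case \<open>u = 0\<close> is the null hypothesis. Let \<open>Z\<^sub>n w\<close> be the
  likelihood ratio of \<open>\<theta>\<^sub>1 + \<phi> n * w\<close> with respect to the true value. After the substitution \<open>\<theta> = \<theta>\<^sub>1 + \<phi> n * w\<close> the test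
  rejects if \<open>\<integral> Z\<^sub>n q\<^sub>n - m * Z\<^sub>n 0 > 0\<close>, where \<open>q\<^sub>n w = p (\<theta>\<^sub>1 + \<phi> n * w) / p \<theta>\<^sub>1\<close> tends to 1; hence no change of measure is needed.
  The Laplace functional of the Poisson process gives the characteristic functions of \<open>ln Z\<^sub>n\<close>, and the identity
  \<open>\<integral> (\<bar>s - 1\<bar> powr \<kappa> - \<bar>s\<bar> powr \<kappa>)\<^sup>2 ds = 2 * Beta (\<kappa> + 1) (\<kappa> + 1) * (1 / cos (pi * \<kappa>) - 1)\<close> shows that they converge to those of
  \<open>W (w - u) - \<bar>w - u\<bar> powr (2 * H) / 2\<close>. It also gives \<open>E (sqrt (Z\<^sub>n w * Z\<^sub>n v)) \<ge> 1 - C * \<bar>w - v\<bar>\<close> for \<open>\<bar>w - v\<bar> \<le> 1\<close>, so the integral over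
  a bounded interval is uniformly close in \<open>L\<^sup>1\<close> to its Riemann sums, and the superexponential decay of \<open>E (sqrt (Z\<^sub>n w))\<close> makes
  the remaining integral uniformly small in probability. Hence the statistic converges in law, and it remains to
  see that its limit has no atom at 0. For that, one increment of \<open>W\<close> is replaced by an independent copy, which does not
  change the law; given everything else, the limit is \<open>Z 0\<close> times a strictly increasing function of that Gaussian variable.\<close>

section \<open>Convergence of characteristic functions of random vectors\<close>

text \<open>The obstacle is the integral: it runs over an interval that grows with n, so convergence
  of finitely many values of \<open>Z\<^sub>n\<close> does not control it, and a limit theorem in a
  space of continuous functions would call for bounds on suprema. Instead every approximation error
  is bounded through Hellinger affinities, with constants that are common to all n and to the limit.
  These affinities are explicit, since the mean of the root of a product of two likelihood ratios
  does not depend on the true value. The rejection event is kept as the sign of a linear functional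
  of the process, so that Lipschitz test functions suffice. Tightness in the continuity theorem for
  characteristic functions comes from bounded means of |ln \<open>Z\<^sub>n\<close>|, which are
  deduced from the mean of the inverse likelihood ratio. The space that carries W need not carry
  anything independent of W. The independent copy therefore lives on a product space, and equality
  of laws is obtained by applying the convergence theorem to a constant sequence.\<close>

inductive trig_poly :: "nat \<Rightarrow> ((nat \<Rightarrow> real) \<Rightarrow> complex) \<Rightarrow> bool" for m where
  base: "trig_poly m (\<lambda>y. c * iexp (\<Sum>i<m. t i * y i))"
| add: "trig_poly m f \<Longrightarrow> trig_poly m g \<Longrightarrow> trig_poly m (\<lambda>y. f y + g y)"

lemma trig_poly_mult_base:
  assumes "trig_poly m g"
  shows "trig_poly m (\<lambda>y. (c * iexp (\<Sum>i<m. t i * y i)) * g y)"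
  using assms
proof induction
  case (base c' t')
  have "(\<lambda>y. (c * iexp (\<Sum>i<m. t i * y i)) * (c' * iexp (\<Sum>i<m. t' i * y i)))
      = (\<lambda>y. (c * c') * iexp (\<Sum>i<m. (t i + t' i) * y i))"
    by (intro ext) (simp add: exp_add[symmetric] sum.distrib algebra_simps)
  then show ?case by (simp only: trig_poly.base)
next
  case (add f g)
  then show ?case by (simp add: distrib_left trig_poly.add)
qed

lemma trig_poly_mult:
  assumes "trig_poly m f" "trig_poly m g"
  shows "trig_poly m (\<lambda>y. f y * g y)"
  using assms(1)
proof induction
  case (base c t)
  then show ?case using trig_poly_mult_base[OF assms(2)] by simp
next
  case (add f f')
  then show ?case by (simp add: distrib_right trig_poly.add)
qed

lemma trig_poly_const: "trig_poly m (\<lambda>y. c)"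
  using trig_poly.base[of m c "\<lambda>_. 0"] by simp

lemma trig_poly_sin:
  assumes "j < m"
  shows "trig_poly m (\<lambda>y. of_real (sin (\<alpha> * y j)))"
proof -
  have eq: "(\<Sum>i<m. (if i = j then \<beta> else 0) * y i) = \<beta> * y j" for \<beta> :: real and y
    using assms by (simp add: if_distrib[of "\<lambda>x. x * _"] cong: if_cong)
  have "(\<lambda>y. of_real (sin (\<alpha> * y j))) = (\<lambda>y. (- \<i> / 2) * iexp (\<Sum>i<m. (if i = j then \<alpha> else 0) * y i)
      + (\<i> / 2) * iexp (\<Sum>i<m. (if i = j then - \<alpha> else 0) * y i))"
    by (intro ext, simp only: eq, rule complex_eqI) (auto simp: Re_exp Im_exp)
  then show ?thesis
    by (simp only:) (intro trig_poly.intros)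
qed

lemma trig_poly_measurable:
  assumes "trig_poly m f" "\<And>i. i < m \<Longrightarrow> Y i \<in> borel_measurable M" "prob_space M"
  shows "integrable M (\<lambda>\<omega>. f (\<lambda>i. Y i \<omega>))"
  using assms(1)
proof induction
  interpret prob_space M by fact
  case (base c t)
  have [measurable]: "(\<lambda>\<omega>. \<Sum>i<m. t i * Y i \<omega>) \<in> borel_measurable M"
    using assms(2) by (intro borel_measurable_sum borel_measurable_times) auto
  show ?case
  proof (rule integrable_const_bound[where B = "norm c"])
    show "(\<lambda>\<omega>. c * iexp (\<Sum>i<m. t i * Y i \<omega>)) \<in> borel_measurable M" by measurable
  qed (auto simp: norm_mult)
next
  case (add f g)
  show ?case by (intro Bochner_Integration.integrable_add add.IH)
qed

lemma trig_poly_tendsto: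
  assumes "trig_poly m f"
    and "\<And>n. prob_space (M n)" "prob_space N"
    and "\<And>n i. i < m \<Longrightarrow> Y n i \<in> borel_measurable (M n)" "\<And>i. i < m \<Longrightarrow> Y' i \<in> borel_measurable N"
    and "\<And>t. (\<lambda>n. CLINT \<omega>|M n. iexp (\<Sum>i<m. t i * Y n i \<omega>)) \<longlonglongrightarrow> (CLINT \<omega>|N. iexp (\<Sum>i<m. t i * Y' i \<omega>))"
  shows "(\<lambda>n. CLINT \<omega>|M n. f (\<lambda>i. Y n i \<omega>)) \<longlonglongrightarrow> (CLINT \<omega>|N. f (\<lambda>i. Y' i \<omega>))"
  using assms(1)
proof induction
  case (base c t)
  show ?case using tendsto_mult_left[OF assms(6)[of t], of c] by simp
next
  case (add f g)
  have "integrable (M n) (\<lambda>\<omega>. f (\<lambda>i. Y n i \<omega>))" "integrable (M n) (\<lambda>\<omega>. g (\<lambda>i. Y n i \<omega>))"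
     "integrable N (\<lambda>\<omega>. f (\<lambda>i. Y' i \<omega>))" "integrable N (\<lambda>\<omega>. g (\<lambda>i. Y' i \<omega>))" for n
    using add assms by (auto intro!: trig_poly_measurable)
  with tendsto_add[OF add.IH] show ?case by simp
qed

text \<open>Vectors are functions on \<open>nat\<close> with the product topology, so the cube has
  infinitely many coordinates and its compactness is Tychonoff's theorem. In the application the
  coordinates from \<open>m\<close> on are set to 0.\<close>

lemma compact_cube: "compact {s :: nat \<Rightarrow> real. \<forall>i. s i \<in> {-1..1}}"
proof -
  have "{s :: nat \<Rightarrow> real. \<forall>i. s i \<in> {-1..1}} = (\<Pi>\<^sub>E i\<in>UNIV. {-1..1})"
    by (auto simp: PiE_def)
  then show ?thesis
    using compactin_PiE[of "\<lambda>_. euclideanreal" UNIV "\<lambda>_. {-1..1}"]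
    by (simp add: euclidean_product_topology compactin_euclidean_iff)
qed

text \<open>An error that grows linearly in the vector is harmless under bounded first moments:
  integrating the pointwise bound costs C' times the sum of the m moments. This takes the place of a
  separate tightness argument.\<close>

lemma bounded_cont_trig_approx:
  fixes K :: "'c measure" and F r :: "(nat \<Rightarrow> real) \<Rightarrow> real"
  assumes K: "prob_space K" and V: "\<And>i. i < m \<Longrightarrow> integrable K (V i)"
    and VB: "\<And>i. i < m \<Longrightarrow> (LINT \<omega>|K. \<bar>V i \<omega>\<bar>) \<le> B"
    and F: "continuous_on UNIV F" and FC: "\<And>y. \<bar>F y\<bar> \<le> C"
    and trig: "trig_poly m (\<lambda>y. of_real (r y))"
    and pw: "\<And>y. \<bar>F (\<lambda>i. if i < m then y i else 0) - r y\<bar> \<le> \<delta> + C' * (\<Sum>i<m. \<bar>y i\<bar>)" and C': "C' \<ge> 0"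
  shows "\<bar>(LINT \<omega>|K. F (\<lambda>i. if i < m then V i \<omega> else 0)) - (LINT \<omega>|K. r (\<lambda>i. V i \<omega>))\<bar> \<le> \<delta> + C' * (m * B)"
proof -
  interpret K: prob_space K by fact
  have [measurable]: "(\<lambda>\<omega> i. if i < m then V i \<omega> else 0) \<in> borel_measurable K"
  proof (rule measurable_coordinatewise_then_product)
    fix i show "(\<lambda>\<omega>. if i < m then V i \<omega> else 0) \<in> borel_measurable K"
      using V[of i] by (cases "i < m") (auto simp: borel_measurable_integrable)
  qed
  have [measurable]: "F \<in> borel_measurable borel" using F by (rule borel_measurable_continuous_onI)
  have i1: "integrable K (\<lambda>\<omega>. F (\<lambda>i. if i < m then V i \<omega> else 0))"
    by (rule K.integrable_const_bound[where B = C]) (auto simp: FC)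
  have "integrable K (\<lambda>\<omega>. complex_of_real (r (\<lambda>i. V i \<omega>)))"
    using trig_poly_measurable[OF trig _ K, of V] V by (auto simp: borel_measurable_integrable)
  from integrable_Re[OF this] have i2: "integrable K (\<lambda>\<omega>. r (\<lambda>i. V i \<omega>))" by simp
  have i3: "integrable K (\<lambda>\<omega>. \<delta> + C' * (\<Sum>i<m. \<bar>V i \<omega>\<bar>))"
    using V by (auto intro!: Bochner_Integration.integrable_add integrable_mult_right Bochner_Integration.integrable_sum)
  have "\<bar>(LINT \<omega>|K. F (\<lambda>i. if i < m then V i \<omega> else 0)) - (LINT \<omega>|K. r (\<lambda>i. V i \<omega>))\<bar>
     = \<bar>LINT \<omega>|K. F (\<lambda>i. if i < m then V i \<omega> else 0) - r (\<lambda>i. V i \<omega>)\<bar>"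
    using i1 i2 by simp
  also have "\<dots> \<le> (LINT \<omega>|K. \<bar>F (\<lambda>i. if i < m then V i \<omega> else 0) - r (\<lambda>i. V i \<omega>)\<bar>)"
    by (rule integral_abs_bound)
  also have "\<dots> \<le> (LINT \<omega>|K. \<delta> + C' * (\<Sum>i<m. \<bar>V i \<omega>\<bar>))"
    using i1 i2 i3 pw by (intro integral_mono) auto
  also have "\<dots> = \<delta> + C' * (\<Sum>i<m. (LINT \<omega>|K. \<bar>V i \<omega>\<bar>))"
  proof -
    have "integrable K (\<lambda>\<omega>. C' * (\<Sum>i<m. \<bar>V i \<omega>\<bar>))"
      using V by (intro integrable_mult_right Bochner_Integration.integrable_sum integrable_abs) auto
    moreover have "(LINT \<omega>|K. (\<Sum>i<m. \<bar>V i \<omega>\<bar>)) = (\<Sum>i<m. (LINT \<omega>|K. \<bar>V i \<omega>\<bar>))"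
      using V by (intro Bochner_Integration.integral_sum integrable_abs) auto
    ultimately show ?thesis by (simp add: K.prob_space)
  qed
  also have "\<dots> \<le> \<delta> + C' * (\<Sum>i<m. B)"
    using C' VB by (intro add_left_mono mult_left_mono sum_mono) auto
  finally show ?thesis by simp
qed

text \<open>Stone-Weierstrass on the cube approximates \<open>F\<close>, composed with a scaled arcsine, by polynomials in the sines of the
  scaled coordinates; the points where the arcsine does not invert the sine are controlled by the first moments.\<close>

theorem levy_continuity_multi:
  fixes M :: "nat \<Rightarrow> 'a measure" and N :: "'b measure" and F :: "(nat \<Rightarrow> real) \<Rightarrow> real"
  assumes M: "\<And>n. prob_space (M n)" and N: "prob_space N"
    and Y: "\<And>n i. i < m \<Longrightarrow> integrable (M n) (Y n i)" and Y': "\<And>i. i < m \<Longrightarrow> integrable N (Y' i)"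
    and YB: "\<And>n i. i < m \<Longrightarrow> (LINT \<omega>|M n. \<bar>Y n i \<omega>\<bar>) \<le> B" and YB': "\<And>i. i < m \<Longrightarrow> (LINT \<omega>|N. \<bar>Y' i \<omega>\<bar>) \<le> B"
    and char: "\<And>t. (\<lambda>n. CLINT \<omega>|M n. iexp (\<Sum>i<m. t i * Y n i \<omega>)) \<longlonglongrightarrow> (CLINT \<omega>|N. iexp (\<Sum>i<m. t i * Y' i \<omega>))"
    and F: "continuous_on UNIV F" and FC: "\<And>y. \<bar>F y\<bar> \<le> C"
  shows "(\<lambda>n. LINT \<omega>|M n. F (\<lambda>i. if i < m then Y n i \<omega> else 0))
     \<longlonglongrightarrow> (LINT \<omega>|N. F (\<lambda>i. if i < m then Y' i \<omega> else 0))"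
proof (rule LIMSEQ_I)
  fix \<epsilon> :: real assume \<epsilon>: "\<epsilon> > 0"
  define S where "S = {s :: nat \<Rightarrow> real. \<forall>i. s i \<in> {-1..1}}"
  \<comment> \<open>Outside the cube of half-width T the error can be as large as 2 C, but there it
    is at most 2 C / T times the sum of the |y_i|, whose mean is at most \<open>D / T\<close>. The
    choice of T makes this at most \<epsilon> / 6.\<close>
  define D where "D = 2 * \<bar>C\<bar> * real m * \<bar>B\<bar>"
  have D: "D \<ge> 0" by (simp add: D_def)
  define T where "T = 1 + 6 * D / \<epsilon>"
  have T: "T > 0" and TD: "D / T \<le> \<epsilon> / 6"
    using D \<epsilon> by (auto simp: T_def field_simps add_pos_nonneg)
  \<comment> \<open>With this scale |y| \<le> T puts \<alpha> * y into [- pi / 2, pi / 2], where the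
    arcsine inverts the sine.\<close>
  define \<alpha> where "\<alpha> = pi / (2 * T)"
  have \<alpha>: "\<alpha> > 0" using T by (simp add: \<alpha>_def)
  define \<Phi> where "\<Phi> s = F (\<lambda>i. if i < m then arcsin (s i) / \<alpha> else 0)" for s
  define fold where "fold y = (\<lambda>i. if i < m then sin (\<alpha> * y i) else 0)" for y
  have foldS: "fold y \<in> S" for y by (auto simp: fold_def S_def)
  define R where "R = {r. continuous_on S r \<and> trig_poly m (\<lambda>y. of_real (r (fold y)))}"
  interpret R: function_ring_on R S
  proof
    show "compact S" unfolding S_def by (rule compact_cube)
    show "continuous_on S f" if "f \<in> R" for f using that by (simp add: R_def)
    show "(\<lambda>x. f x + g x) \<in> R" if "f \<in> R" "g \<in> R" for f g
      using that by (auto simp: R_def intro!: continuous_on_add trig_poly.add)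
    show "(\<lambda>x. f x * g x) \<in> R" if "f \<in> R" "g \<in> R" for f g
      using that by (auto simp: R_def intro!: continuous_on_mult trig_poly_mult)
    show "(\<lambda>_. c) \<in> R" for c by (simp add: R_def trig_poly_const)
    fix x y assume "x \<in> S" "y \<in> S" "x \<noteq> y"
    then obtain i where i: "x i \<noteq> y i" by auto
    \<comment> \<open>For i \<ge> m the coordinate of \<open>fold\<close> is constantly 0 and thus a
      trigonometric polynomial as well; so all coordinates of the infinite cube belong to R and
      separate its points.\<close>
    have "(\<lambda>s. s i) \<in> R"
      unfolding R_def fold_def
      by (cases "i < m") (auto intro!: trig_poly_sin trig_poly_const continuous_on_product_coordinates
            intro: continuous_on_subset[OF continuous_on_product_coordinates])
    with i show "\<exists>f\<in>R. f x \<noteq> f y" by (intro bexI[of _ "\<lambda>s. s i"]) auto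
  qed
  have "continuous_on S \<Phi>"
    unfolding \<Phi>_def
  proof (rule continuous_on_compose2[OF F])
    show "continuous_on S (\<lambda>s i. if i < m then arcsin (s i) / \<alpha> else 0)"
    proof (rule continuous_on_coordinatewise_then_product)
      fix i show "continuous_on S (\<lambda>s. if i < m then arcsin (s i) / \<alpha> else 0)"
      proof (cases "i < m")
        case True
        have "continuous_on S (\<lambda>s. arcsin (s i))"
          by (rule continuous_on_compose2[OF continuous_on_arcsin'])
             (auto simp: S_def intro: continuous_on_subset[OF continuous_on_product_coordinates])
        with True \<alpha> show ?thesis by (auto intro!: continuous_intros)
      qed simp
    qed
  qed auto
  from R.Stone_Weierstrass_basic[OF this, of "\<epsilon> / 12"] \<epsilon>
  obtain r where r: "r \<in> R" "\<And>s. s \<in> S \<Longrightarrow> \<bar>\<Phi> s - r s\<bar> < \<epsilon> / 12" by auto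
  have trig: "trig_poly m (\<lambda>y. of_real (r (fold y)))" using r by (simp add: R_def)
  have C0: "C \<ge> 0" using FC[of "\<lambda>_. 0"] by linarith
  have pw: "\<bar>F (\<lambda>i. if i < m then y i else 0) - r (fold y)\<bar> \<le> \<epsilon> / 12 + 2 * C / T * (\<Sum>i<m. \<bar>y i\<bar>)" for y
  proof (cases "\<forall>i<m. \<bar>y i\<bar> \<le> T")
    case True
    have "arcsin (sin (\<alpha> * y i)) / \<alpha> = y i" if "i < m" for i
    proof -
      have "\<bar>\<alpha> * y i\<bar> \<le> pi / 2"
        using True that \<alpha> T by (auto simp: \<alpha>_def abs_mult field_simps)
      then show ?thesis using \<alpha> by (subst arcsin_sin) auto
    qed
    then have "\<Phi> (fold y) = F (\<lambda>i. if i < m then y i else 0)"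
      unfolding \<Phi>_def fold_def by (intro arg_cong[where f = F]) auto
    with r(2)[OF foldS[of y]] have "\<bar>F (\<lambda>i. if i < m then y i else 0) - r (fold y)\<bar> \<le> \<epsilon> / 12" by simp
    moreover have "2 * C / T * (\<Sum>i<m. \<bar>y i\<bar>) \<ge> 0"
      using C0 T by (auto intro!: divide_nonneg_nonneg mult_nonneg_nonneg sum_nonneg)
    ultimately show ?thesis by linarith
  next
    case False
    then obtain i where i: "i < m" "\<bar>y i\<bar> > T" by auto
    have "T \<le> (\<Sum>i<m. \<bar>y i\<bar>)"
      using i member_le_sum[of i "{..<m}" "\<lambda>i. \<bar>y i\<bar>"] by auto
    then have "2 * C * 1 \<le> 2 * C * ((\<Sum>i<m. \<bar>y i\<bar>) / T)"
      using T C0 by (intro mult_left_mono) auto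
    moreover have "\<bar>F (\<lambda>i. if i < m then y i else 0) - \<Phi> (fold y)\<bar> \<le> 2 * C"
      using FC[of "\<lambda>i. if i < m then y i else 0"] FC[of "\<lambda>i. if i < m then arcsin (fold y i) / \<alpha> else 0"]
      unfolding \<Phi>_def by linarith
    ultimately show ?thesis using r(2)[OF foldS[of y]] \<epsilon> by (simp add: abs_if split: if_splits)
  qed
  have "D / T = 2 * C / T * (m * \<bar>B\<bar>)" using C0 by (simp add: D_def)
  then have TD': "\<epsilon> / 12 + 2 * C / T * (m * \<bar>B\<bar>) \<le> \<epsilon> / 3"
    using TD \<epsilon> by linarith
  have CT: "2 * C / T \<ge> 0" using C0 T by simp
  have approxM: "\<bar>(LINT \<omega>|M n. F (\<lambda>i. if i < m then Y n i \<omega> else 0)) - (LINT \<omega>|M n. r (fold (\<lambda>i. Y n i \<omega>)))\<bar> \<le> \<epsilon> / 3" for n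
    by (rule order_trans[OF bounded_cont_trig_approx[where C = C and r = "\<lambda>y. r (fold y)" and B = "\<bar>B\<bar>", OF M Y _ F FC trig pw CT] TD'])
       (auto intro: order_trans[OF YB abs_ge_self])
  have approxN: "\<bar>(LINT \<omega>|N. F (\<lambda>i. if i < m then Y' i \<omega> else 0)) - (LINT \<omega>|N. r (fold (\<lambda>i. Y' i \<omega>)))\<bar> \<le> \<epsilon> / 3"
    by (rule order_trans[OF bounded_cont_trig_approx[where C = C and r = "\<lambda>y. r (fold y)" and B = "\<bar>B\<bar>", OF N Y' _ F FC trig pw CT] TD'])
       (auto intro: order_trans[OF YB' abs_ge_self])
  have "(\<lambda>n. CLINT \<omega>|M n. of_real (r (fold (\<lambda>i. Y n i \<omega>)))) \<longlonglongrightarrow> (CLINT \<omega>|N. of_real (r (fold (\<lambda>i. Y' i \<omega>))))"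
    using trig_poly_tendsto[OF trig M N, where Y = Y and Y' = Y'] Y Y' char by (auto simp: borel_measurable_integrable)
  then have "(\<lambda>n. LINT \<omega>|M n. (r (fold (\<lambda>i. Y n i \<omega>)))) \<longlonglongrightarrow> (LINT \<omega>|N. (r (fold (\<lambda>i. Y' i \<omega>))))"
    by (simp add: tendsto_of_real_iff)
  from LIMSEQ_D[OF this, of "\<epsilon> / 3"] \<epsilon> obtain n0 where n0:
    "\<And>n. n \<ge> n0 \<Longrightarrow> \<bar>(LINT \<omega>|M n. (r (fold (\<lambda>i. Y n i \<omega>)))) - (LINT \<omega>|N. (r (fold (\<lambda>i. Y' i \<omega>))))\<bar> < \<epsilon> / 3"
    by auto
  show "\<exists>n0. \<forall>n\<ge>n0. norm ((LINT \<omega>|M n. F (\<lambda>i. if i < m then Y n i \<omega> else 0))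
     - (LINT \<omega>|N. F (\<lambda>i. if i < m then Y' i \<omega> else 0))) < \<epsilon>"
  proof (intro exI[of _ n0] allI impI)
    fix n assume "n \<ge> n0"
    show "norm ((LINT \<omega>|M n. F (\<lambda>i. if i < m then Y n i \<omega> else 0))
     - (LINT \<omega>|N. F (\<lambda>i. if i < m then Y' i \<omega> else 0))) < \<epsilon>"
      using n0[OF \<open>n \<ge> n0\<close>] approxM[of n] approxN unfolding real_norm_def by linarith
  qed
qed

section \<open>Integrals of the cusp kernel\<close>

text \<open>A primitive of the squared kernel up to a multiple of a convergent beta integrand.
  Expanding the square would leave integrals over the half-line that diverge one by one. With
  \<open>d = (1 + x) powr \<kappa> - x powr \<kappa>\<close> the numerator equals
  \<open>d\<^sup>2 * (1 + x) + x powr \<kappa> * d\<close>, which tends to 0 at infinity because 2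
  \<kappa> < 1.\<close>

definition cusp_G :: "real \<Rightarrow> real \<Rightarrow> real" where
  "cusp_G \<kappa> x = (((1 + x) powr \<kappa> - x powr \<kappa>)\<^sup>2 * (1 + x) + x powr \<kappa> * (1 + x) powr \<kappa> - x powr (2 * \<kappa>)) / (2 * \<kappa> + 1)"

lemma cusp_G_deriv:
  assumes "\<kappa> > 0" "x > 0"
  shows "(cusp_G \<kappa> has_real_derivative ((1 + x) powr \<kappa> - x powr \<kappa>)\<^sup>2
     - \<kappa> / (2 * \<kappa> + 1) * (x powr (\<kappa> - 1) * (1 + x) powr (\<kappa> - 1))) (at x)"
proof -
  \<comment> \<open>After A and B are factored out, all powers are polynomials in x, A and B, and
    the derivative reduces to a polynomial identity.\<close>
  define A where "A = (1 + x) powr (\<kappa> - 1)"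
  define B where "B = x powr (\<kappa> - 1)"
  have A: "(1 + x) powr \<kappa> = (1 + x) * A" using assms by (simp add: A_def powr_mult_base)
  have B: "x powr \<kappa> = x * B" using assms by (simp add: B_def powr_mult_base)
  have B2: "x powr (2 * \<kappa> - 1) = x * B * B"
    using assms unfolding B_def by (simp add: powr_mult_base powr_add[symmetric])
  have k: "2 * \<kappa> + 1 \<noteq> 0" using assms by simp
  have d1: "((\<lambda>x. (1 + x) powr \<kappa>) has_real_derivative \<kappa> * A) (at x)"
    unfolding A_def using assms by (auto intro!: derivative_eq_intros)
  have d2: "((\<lambda>x. x powr \<kappa>) has_real_derivative \<kappa> * B) (at x)"
    unfolding B_def using assms by (auto intro!: derivative_eq_intros)
  have d3: "((\<lambda>x. x powr (2 * \<kappa>)) has_real_derivative 2 * \<kappa> * (x * B * B)) (at x)"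
    unfolding B2[symmetric] using assms by (auto intro!: derivative_eq_intros)
  have "((\<lambda>x. (((1 + x) powr \<kappa> - x powr \<kappa>)\<^sup>2 * (1 + x) + x powr \<kappa> * (1 + x) powr \<kappa> - x powr (2 * \<kappa>)) / (2 * \<kappa> + 1))
    has_real_derivative (2 * ((1 + x) * A - x * B) * (\<kappa> * A - \<kappa> * B) * (1 + x) + ((1 + x) * A - x * B)\<^sup>2
      + (\<kappa> * B * ((1 + x) * A) + x * B * (\<kappa> * A)) - 2 * \<kappa> * (x * B * B)) / (2 * \<kappa> + 1)) (at x)"
    by (rule derivative_eq_intros d1 d2 d3 refl)+ (simp_all add: A B k)
  also have "(2 * ((1 + x) * A - x * B) * (\<kappa> * A - \<kappa> * B) * (1 + x) + ((1 + x) * A - x * B)\<^sup>2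
      + (\<kappa> * B * ((1 + x) * A) + x * B * (\<kappa> * A)) - 2 * \<kappa> * (x * B * B)) / (2 * \<kappa> + 1)
    = (((1 + x) * A - x * B)\<^sup>2 * (2 * \<kappa> + 1) - \<kappa> * (B * A)) / (2 * \<kappa> + 1)"
    by (intro arg_cong2[where f = "(/)"] refl) algebra
  also have "\<dots> = ((1 + x) powr \<kappa> - x powr \<kappa>)\<^sup>2
     - \<kappa> / (2 * \<kappa> + 1) * (x powr (\<kappa> - 1) * (1 + x) powr (\<kappa> - 1))"
    using k unfolding A B by (simp add: diff_divide_distrib A_def B_def)
  finally show ?thesis unfolding cusp_G_def .
qed

text \<open>Each power is its base times a power with exponent \<kappa> - 1, so monotonicity of the
  latter suffices. The bound by \<open>(1 + x) powr (\<kappa> - 1)\<close> stays finite at 0 and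
  decays at infinity.\<close>

lemma powr_diff_le:
  assumes "0 < \<kappa>" "\<kappa> < 1" "(x::real) > 0"
  shows "0 \<le> (1 + x) powr \<kappa> - x powr \<kappa>" "(1 + x) powr \<kappa> - x powr \<kappa> \<le> (1 + x) powr (\<kappa> - 1)"
    "(1 + x) powr (\<kappa> - 1) \<le> x powr (\<kappa> - 1)"
proof -
  show le: "(1 + x) powr (\<kappa> - 1) \<le> x powr (\<kappa> - 1)"
    using assms by (intro powr_mono2') auto
  have "(1 + x) powr \<kappa> = (1 + x) * (1 + x) powr (\<kappa> - 1)" "x powr \<kappa> = x * x powr (\<kappa> - 1)"
    using assms by (simp_all add: powr_mult_base)
  moreover have "x * (1 + x) powr (\<kappa> - 1) \<le> x * x powr (\<kappa> - 1)"
    using le assms by (intro mult_left_mono) auto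
  ultimately show "(1 + x) powr \<kappa> - x powr \<kappa> \<le> (1 + x) powr (\<kappa> - 1)"
    by (simp add: algebra_simps)
  show "0 \<le> (1 + x) powr \<kappa> - x powr \<kappa>"
    using assms powr_mono2[of \<kappa> x "1 + x"] by simp
qed

text \<open>Substitution t = x / (1 + x), for which 1 - t = 1 / (1 + x) and dt = dx / (1 + x)^2. The
  second beta parameter is positive because \<kappa> < 1/2.\<close>

lemma beta_halfline:
  fixes \<kappa> :: real
  assumes "0 < \<kappa>" "\<kappa> < 1 / 2"
  shows "has_bochner_integral lborel (\<lambda>x. indicator {0<..} x * (x powr (\<kappa> - 1) * (1 + x) powr (\<kappa> - 1))) (Beta \<kappa> (1 - 2 * \<kappa>))"
proof -
  define f where "f = (\<lambda>t::real. t powr (\<kappa> - 1) * (1 - t) powr ((1 - 2 * \<kappa>) - 1))"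
  have hf: "(f has_integral Beta \<kappa> (1 - 2 * \<kappa>)) {0<..<1}"
    using has_integral_Beta_real[of \<kappa> "1 - 2 * \<kappa>"] assms by (simp add: has_integral_Icc_iff_Ioo f_def)
  have af: "f absolutely_integrable_on {0<..<1}"
    using hf by (intro nonnegative_absolutely_integrable_1) (auto simp: f_def)
  have im: "(\<lambda>x::real. x / (1 + x)) ` {0<..} = {0<..<1}"
  proof safe
    fix y :: real assume "y \<in> {0<..<1}"
    then show "y \<in> (\<lambda>x. x / (1 + x)) ` {0<..}"
      by (intro image_eqI[of _ _ "y / (1 - y)"]) (auto simp: field_simps)
  qed (auto simp: field_simps)
  have *: "(\<lambda>x. \<bar>1 / (1 + x)\<^sup>2\<bar> * f (x / (1 + x))) absolutely_integrable_on {0<..} \<and>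
      integral {0<..} (\<lambda>x. \<bar>1 / (1 + x)\<^sup>2\<bar> * f (x / (1 + x))) = Beta \<kappa> (1 - 2 * \<kappa>)"
  proof (rule has_absolute_integral_change_of_variables_1'[where g = "\<lambda>x. x / (1 + x)" and g' = "\<lambda>x. 1 / (1 + x)\<^sup>2" and f = f, THEN iffD2])
    show "inj_on (\<lambda>x::real. x / (1 + x)) {0<..}"
      by (auto simp: inj_on_def field_simps)
    show "((\<lambda>x. x / (1 + x)) has_real_derivative 1 / (1 + x)\<^sup>2) (at x within {0<..})" if "x \<in> {0<..}" for x
      using that by (auto intro!: derivative_eq_intros simp: field_simps power2_eq_square)
    show "f absolutely_integrable_on (\<lambda>x. x / (1 + x)) ` {0<..} \<and> integral ((\<lambda>x. x / (1 + x)) ` {0<..}) f = Beta \<kappa> (1 - 2 * \<kappa>)"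
      unfolding im using af hf by (auto simp: integral_unique)
  qed auto
  have eq: "\<bar>1 / (1 + x)\<^sup>2\<bar> * f (x / (1 + x)) = x powr (\<kappa> - 1) * (1 + x) powr (\<kappa> - 1)" if "x > 0" for x
  proof -
    define l where "l = ln x"
    define k where "k = ln (1 + x)"
    have x: "x = exp l" "1 + x = exp k" using that by (auto simp: l_def k_def)
    have r: "x / (1 + x) = exp (l - k)" unfolding exp_diff using x by simp
    have s: "1 - x / (1 + x) = exp (- k)"
      using that x(2) by (simp add: exp_minus field_simps)
    have t: "\<bar>1 / (1 + x)\<^sup>2\<bar> = exp (- 2 * k)"
    proof -
      have "exp (- 2 * k) = 1 / (exp k)\<^sup>2" by (simp add: exp_minus exp_double divide_inverse)
      with x(2) show ?thesis by simp
    qed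
    have "\<bar>1 / (1 + x)\<^sup>2\<bar> * f (x / (1 + x)) = exp (- 2 * k) * (exp ((\<kappa> - 1) * (l - k)) * exp ((1 - 2 * \<kappa> - 1) * (- k)))"
      unfolding f_def s t by (simp add: r powr_def)
    also have "\<dots> = exp ((\<kappa> - 1) * l) * exp ((\<kappa> - 1) * k)"
      unfolding exp_add[symmetric] by (intro arg_cong[where f = exp]) (simp add: algebra_simps)
    also have "\<dots> = x powr (\<kappa> - 1) * (1 + x) powr (\<kappa> - 1)"
      using that by (simp add: powr_def l_def k_def)
    finally show ?thesis .
  qed
  have "(\<lambda>x. x powr (\<kappa> - 1) * (1 + x) powr (\<kappa> - 1)) absolutely_integrable_on {0<..}"
     and I: "integral {0<..} (\<lambda>x. x powr (\<kappa> - 1) * (1 + x) powr (\<kappa> - 1)) = Beta \<kappa> (1 - 2 * \<kappa>)"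
  proof -
    have "(\<lambda>x. \<bar>1 / (1 + x)\<^sup>2\<bar> * f (x / (1 + x))) absolutely_integrable_on {0<..} \<longleftrightarrow>
       (\<lambda>x. x powr (\<kappa> - 1) * (1 + x) powr (\<kappa> - 1)) absolutely_integrable_on {0<..}"
      using eq by (intro set_integrable_cong) auto
    moreover have "integral {0<..} (\<lambda>x. \<bar>1 / (1 + x)\<^sup>2\<bar> * f (x / (1 + x))) = integral {0<..} (\<lambda>x. x powr (\<kappa> - 1) * (1 + x) powr (\<kappa> - 1))"
      using eq by (intro Henstock_Kurzweil_Integration.integral_cong) auto
    ultimately show "(\<lambda>x. x powr (\<kappa> - 1) * (1 + x) powr (\<kappa> - 1)) absolutely_integrable_on {0<..}"
       "integral {0<..} (\<lambda>x. x powr (\<kappa> - 1) * (1 + x) powr (\<kappa> - 1)) = Beta \<kappa> (1 - 2 * \<kappa>)"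
      using * by auto
  qed
  then have i: "set_integrable lborel {0<..} (\<lambda>x. x powr (\<kappa> - 1) * (1 + x) powr (\<kappa> - 1))"
    unfolding set_integrable_def by (subst (asm) integrable_completion) auto
  with I show ?thesis
    using set_borel_integral_eq_integral(2)[OF i]
    by (simp add: has_bochner_integral_iff set_integrable_def set_lebesgue_integral_def)
qed

text \<open>The fundamental theorem of calculus for \<open>cusp_G\<close>, whose limits are 1 / (2
  \<kappa> + 1) at 0 and 0 at infinity. The squared difference is dominated by the beta integrand,
  so the two parts of the derivative are integrable separately.\<close>

lemma cusp_tail_integral:
  fixes \<kappa> :: real
  assumes "0 < \<kappa>" "\<kappa> < 1 / 2"
  shows "has_bochner_integral lborel (\<lambda>x. indicator {0<..} x * ((1 + x) powr \<kappa> - x powr \<kappa>)\<^sup>2)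
    (\<kappa> / (2 * \<kappa> + 1) * Beta \<kappa> (1 - 2 * \<kappa>) - 1 / (2 * \<kappa> + 1))"
proof -
  define C where "C = \<kappa> / (2 * \<kappa> + 1)"
  define \<beta> where "\<beta> x = x powr (\<kappa> - 1) * (1 + x) powr (\<kappa> - 1)" for x :: real
  define d where "d x = (1 + x) powr \<kappa> - x powr \<kappa>" for x :: real
  have B: "has_bochner_integral lborel (\<lambda>x. indicator {0<..} x * \<beta> x) (Beta \<kappa> (1 - 2 * \<kappa>))"
    unfolding \<beta>_def by (rule beta_halfline[OF assms])
  have d0: "0 \<le> d x" "d x \<le> (1 + x) powr (\<kappa> - 1)" "(1 + x) powr (\<kappa> - 1) \<le> x powr (\<kappa> - 1)" if "x > 0" for x
    using powr_diff_le[of \<kappa> x] assms that by (auto simp: d_def)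
  have d2: "(d x)\<^sup>2 \<le> \<beta> x" if "x > 0" for x
  proof -
    have "(d x)\<^sup>2 \<le> (1 + x) powr (\<kappa> - 1) * (1 + x) powr (\<kappa> - 1)"
      unfolding power2_eq_square using d0[OF that] by (intro mult_mono) auto
    also have "\<dots> \<le> \<beta> x" unfolding \<beta>_def using d0[OF that] by (intro mult_right_mono) auto
    finally show ?thesis .
  qed
  have i1: "integrable lborel (\<lambda>x. indicator {0<..} x * (d x)\<^sup>2)"
  proof (rule Bochner_Integration.integrable_bound)
    show "integrable lborel (\<lambda>x. indicator {0<..} x * \<beta> x)" using B by (rule has_bochner_integral_iff[THEN iffD1, THEN conjunct1])
    show "(\<lambda>x. indicator {0<..} x * (d x)\<^sup>2) \<in> borel_measurable lborel" unfolding d_def by measurable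
    show "AE x in lborel. norm (indicator {0<..} x * (d x)\<^sup>2) \<le> norm (indicator {0<..} x * \<beta> x)"
      using d2 by (intro AE_I2) (auto simp: indicator_def intro: order_trans[OF _ abs_ge_self])
  qed
  have i2: "integrable lborel (\<lambda>x. indicator {0<..} x * (C * \<beta> x))"
    using has_bochner_integral_mult_right[OF B, of C]
    by (simp add: has_bochner_integral_iff algebra_simps)
  have e: "einterval 0 \<infinity> = {0<..}" by (auto simp: einterval_def)
  have lim0: "(cusp_G \<kappa> \<longlongrightarrow> 1 / (2 * \<kappa> + 1)) (at_right 0)"
  proof -
    have p: "((\<lambda>x::real. x powr c) \<longlongrightarrow> 0 powr c) (at_right 0)" if "c > 0" for c
      using that by (intro tendsto_powr2 tendsto_ident_at tendsto_const)
                    (auto simp: eventually_at_right intro!: exI[of _ 1])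
    have q: "((\<lambda>x::real. (1 + x) powr \<kappa>) \<longlongrightarrow> (1 + 0) powr \<kappa>) (at_right 0)"
      by (intro tendsto_intros) auto
    have "(cusp_G \<kappa> \<longlongrightarrow> (((1 + 0) powr \<kappa> - 0 powr \<kappa>)\<^sup>2 * (1 + 0) + 0 powr \<kappa> * (1 + 0) powr \<kappa> - 0 powr (2 * \<kappa>)) / (2 * \<kappa> + 1)) (at_right 0)"
      unfolding cusp_G_def using assms by (intro tendsto_intros p q) auto
    then show ?thesis by simp
  qed
  have liminf: "(cusp_G \<kappa> \<longlongrightarrow> 0) at_top"
  proof (rule Lim_null_comparison)
    show "\<forall>\<^sub>F x in at_top. norm (cusp_G \<kappa> x) \<le> 2 * (1 + x) powr (2 * \<kappa> - 1)"
      using eventually_gt_at_top[of 0]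
    proof eventually_elim
      fix x :: real assume x: "x > 0"
      have e1: "(d x)\<^sup>2 * (1 + x) \<le> (1 + x) powr (2 * \<kappa> - 1)"
      proof -
        have "(d x)\<^sup>2 * (1 + x) \<le> ((1 + x) powr (\<kappa> - 1) * (1 + x) powr (\<kappa> - 1)) * (1 + x) powr 1"
          unfolding power2_eq_square using d0[OF x] x by (intro mult_mono) auto
        also have "\<dots> = (1 + x) powr (2 * \<kappa> - 1)" by (simp only: powr_add[symmetric]) simp
        finally show ?thesis .
      qed
      have e2: "x powr \<kappa> * d x \<le> (1 + x) powr (2 * \<kappa> - 1)"
      proof -
        have "x powr \<kappa> * d x \<le> (1 + x) powr \<kappa> * (1 + x) powr (\<kappa> - 1)"
          using d0[OF x] x assms by (intro mult_mono powr_mono2) auto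
        also have "\<dots> = (1 + x) powr (2 * \<kappa> - 1)" by (simp add: powr_add[symmetric])
        finally show ?thesis .
      qed
      have "cusp_G \<kappa> x = ((d x)\<^sup>2 * (1 + x) + x powr \<kappa> * d x) / (2 * \<kappa> + 1)"
        by (simp add: cusp_G_def d_def algebra_simps powr_add[symmetric])
      moreover have "0 \<le> (d x)\<^sup>2 * (1 + x) + x powr \<kappa> * d x"
        using d0[OF x] x by auto
      ultimately have "norm (cusp_G \<kappa> x) \<le> ((d x)\<^sup>2 * (1 + x) + x powr \<kappa> * d x) / 1"
        using assms by (simp add: abs_of_nonneg) (intro divide_left_mono[where b = 1, simplified], auto)
      then show "norm (cusp_G \<kappa> x) \<le> 2 * (1 + x) powr (2 * \<kappa> - 1)" using e1 e2 by simp
    qed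
    have "((\<lambda>x::real. (1 + x) powr (2 * \<kappa> - 1)) \<longlongrightarrow> 0) at_top"
      using assms by (intro tendsto_neg_powr filterlim_tendsto_add_at_top[OF tendsto_const filterlim_ident]) auto
    then show "((\<lambda>x::real. 2 * (1 + x) powr (2 * \<kappa> - 1)) \<longlongrightarrow> 0) at_top"
      by (intro tendsto_mult_right_zero)
  qed
  have "(LBINT x=0..\<infinity>. (d x)\<^sup>2 - C * \<beta> x) = 0 - 1 / (2 * \<kappa> + 1)"
  proof (rule interval_integral_FTC_integrable[where F = "cusp_G \<kappa>"])
    fix x assume "0 < ereal x" "ereal x < \<infinity>"
    then have x: "x > 0" by simp
    show "(cusp_G \<kappa> has_vector_derivative (d x)\<^sup>2 - C * \<beta> x) (at x)"
      using cusp_G_deriv[of \<kappa> x] assms x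
      by (simp add: has_real_derivative_iff_has_vector_derivative C_def \<beta>_def d_def)
    show "isCont (\<lambda>x. (d x)\<^sup>2 - C * \<beta> x) x"
      unfolding d_def \<beta>_def using x by (intro continuous_intros) auto
  next
    have "integrable lborel (\<lambda>x. indicator {0<..} x * (d x)\<^sup>2 - indicator {0<..} x * (C * \<beta> x))"
      using i1 i2 by (rule Bochner_Integration.integrable_diff)
    then show "set_integrable lborel (einterval 0 \<infinity>) (\<lambda>x. (d x)\<^sup>2 - C * \<beta> x)"
      unfolding e set_integrable_def by (simp add: algebra_simps)
  qed (use lim0 liminf in \<open>auto simp: ereal_tendsto_simps zero_ereal_def\<close>)
  then have "(LINT x|lborel. indicator {0<..} x * (d x)\<^sup>2 - indicator {0<..} x * (C * \<beta> x)) = - 1 / (2 * \<kappa> + 1)"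
    by (simp add: interval_lebesgue_integral_def e set_lebesgue_integral_def algebra_simps)
  then have "(LINT x|lborel. indicator {0<..} x * (d x)\<^sup>2) - (LINT x|lborel. indicator {0<..} x * (C * \<beta> x)) = - 1 / (2 * \<kappa> + 1)"
    using i1 i2 by simp
  moreover have "(LINT x|lborel. indicator {0<..} x * (C * \<beta> x)) = C * Beta \<kappa> (1 - 2 * \<kappa>)"
    using has_bochner_integral_mult_right[OF B, of C]
    by (simp add: has_bochner_integral_iff algebra_simps)
  ultimately show ?thesis
    using i1 unfolding has_bochner_integral_iff d_def[symmetric] C_def[symmetric] by simp
qed

text \<open>On the unit interval the square can simply be expanded: all three terms are beta
  integrals.\<close>

lemma cusp_middle_integral:
  fixes \<kappa> :: real
  assumes "0 < \<kappa>" "\<kappa> < 1 / 2"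
  shows "has_bochner_integral lborel (\<lambda>x. indicator {0..1} x * ((1 - x) powr \<kappa> - x powr \<kappa>)\<^sup>2)
    (2 / (2 * \<kappa> + 1) - 2 * Beta (\<kappa> + 1) (\<kappa> + 1))"
proof -
  have b: "has_bochner_integral lborel (\<lambda>x. indicator {0..1} x * (x powr (a - 1) * (1 - x) powr (b - 1))) (Beta a b)"
    if "a > 0" "b > 0" for a b :: real
    using set_borel_integral_eq_integral(2)[OF integrable_Beta[OF that]] integrable_Beta[OF that] integral_unique[OF has_integral_Beta_real[OF that]]
    by (simp add: has_bochner_integral_iff set_integrable_def set_lebesgue_integral_def)
  have B1: "Beta (2 * \<kappa> + 1) 1 = 1 / (2 * \<kappa> + 1)"
  proof -
    have "2 * \<kappa> + 1 \<notin> \<int>\<^sub>\<le>\<^sub>0" using assms by (auto simp: nonpos_Ints_def)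
    then have "Gamma (2 * \<kappa> + 1 + 1) = (2 * \<kappa> + 1) * Gamma (2 * \<kappa> + 1)" by (rule Gamma_plus1)
    moreover have "Gamma (2 * \<kappa> + 1) > 0" using assms by (intro Gamma_real_pos) auto
    ultimately show ?thesis by (simp add: Beta_def)
  qed
  have "has_bochner_integral lborel (\<lambda>x. indicator {0..1} x * (x powr ((2 * \<kappa> + 1) - 1) * (1 - x) powr (1 - 1))
     + indicator {0..1} x * (x powr (1 - 1) * (1 - x) powr ((2 * \<kappa> + 1) - 1))
     - 2 * (indicator {0..1} x * (x powr ((\<kappa> + 1) - 1) * (1 - x) powr ((\<kappa> + 1) - 1))))
     (Beta (2 * \<kappa> + 1) 1 + Beta 1 (2 * \<kappa> + 1) - 2 * Beta (\<kappa> + 1) (\<kappa> + 1))"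
    using assms by (intro has_bochner_integral_add has_bochner_integral_diff has_bochner_integral_mult_right b) auto
  then have "has_bochner_integral lborel (\<lambda>x. indicator {0..1} x * (x powr ((2 * \<kappa> + 1) - 1) * (1 - x) powr (1 - 1))
     + indicator {0..1} x * (x powr (1 - 1) * (1 - x) powr ((2 * \<kappa> + 1) - 1))
     - 2 * (indicator {0..1} x * (x powr ((\<kappa> + 1) - 1) * (1 - x) powr ((\<kappa> + 1) - 1))))
     (2 / (2 * \<kappa> + 1) - 2 * Beta (\<kappa> + 1) (\<kappa> + 1))"
    by (simp add: B1 Beta_commute[of 1])
  then show ?thesis
  proof (rule has_bochner_integral_cong_AE[THEN iffD1, rotated 3])
    \<comment> \<open>The powers with exponent 1 - 1 are there to match the beta integrand. At a
      zero base they are \<open>0 powr 0 = 0\<close> and not 1, so the two end points are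
      excluded.\<close>
    show "AE x in lborel. indicator {0..1} x * (x powr ((2 * \<kappa> + 1) - 1) * (1 - x) powr (1 - 1))
     + indicator {0..1} x * (x powr (1 - 1) * (1 - x) powr ((2 * \<kappa> + 1) - 1))
     - 2 * (indicator {0..1} x * (x powr ((\<kappa> + 1) - 1) * (1 - x) powr ((\<kappa> + 1) - 1)))
      = indicator {0..1} x * ((1 - x) powr \<kappa> - x powr \<kappa>)\<^sup>2"
      using AE_lborel_singleton[of 0] AE_lborel_singleton[of 1]
    proof eventually_elim
      fix x :: real assume "x \<noteq> 0" "x \<noteq> 1"
      then show "indicator {0..1} x * (x powr ((2 * \<kappa> + 1) - 1) * (1 - x) powr (1 - 1))
     + indicator {0..1} x * (x powr (1 - 1) * (1 - x) powr ((2 * \<kappa> + 1) - 1))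
     - 2 * (indicator {0..1} x * (x powr ((\<kappa> + 1) - 1) * (1 - x) powr ((\<kappa> + 1) - 1)))
      = indicator {0..1} x * ((1 - x) powr \<kappa> - x powr \<kappa>)\<^sup>2"
        by (auto simp: indicator_def power2_eq_square algebra_simps powr_add[symmetric])
    qed
  qed auto
qed

text \<open>The reflection formula of the Gamma function at \<kappa> and at 2 \<kappa>; the
  double-angle formula for the sine leaves the factor 1 / cos (pi * \<kappa>). This turns the beta
  value of the half-line into the one that occurs in \<open>cusp_Gamma\<close>.\<close>

lemma beta_reflection:
  fixes \<kappa> :: real
  assumes "0 < \<kappa>" "\<kappa> < 1 / 2"
  shows "\<kappa> / (2 * \<kappa> + 1) * Beta \<kappa> (1 - 2 * \<kappa>) = Beta (\<kappa> + 1) (\<kappa> + 1) / cos (pi * \<kappa>)"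
proof -
  have refl: "Gamma z * Gamma (1 - z) = pi / sin (pi * z)" for z :: real
  proof -
    have "complex_of_real (Gamma z * Gamma (1 - z)) = Gamma (of_real z) * Gamma (1 - of_real z)"
      by (metis Gamma_complex_of_real of_real_1 of_real_diff of_real_mult)
    also have "\<dots> = of_real (pi / sin (pi * z))"
      unfolding Gamma_reflection_complex by (metis of_real_divide of_real_mult sin_of_real)
    finally have "complex_of_real (Gamma z * Gamma (1 - z)) = of_real (pi / sin (pi * z))" .
    then show ?thesis by (simp only: of_real_eq_iff)
  qed
  have ng: "x > 0 \<Longrightarrow> x \<notin> \<int>\<^sub>\<le>\<^sub>0" for x :: real by (auto simp: nonpos_Ints_def)
  have sin: "sin (pi * \<kappa>) > 0" "cos (pi * \<kappa>) > 0"
    using assms by (auto intro!: sin_gt_zero cos_gt_zero_pi) (auto simp: field_simps intro: less_trans[of _ 0])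
  have g1: "Gamma (\<kappa> + 1) = \<kappa> * Gamma \<kappa>" using assms ng by (intro Gamma_plus1) auto
  have g2: "Gamma (2 * \<kappa> + 1) = 2 * \<kappa> * Gamma (2 * \<kappa>)" using assms ng by (intro Gamma_plus1) auto
  have g3: "Gamma (2 * \<kappa> + 1 + 1) = (2 * \<kappa> + 1) * (2 * \<kappa> * Gamma (2 * \<kappa>))"
    using assms ng by (subst Gamma_plus1) (auto simp: g2)
  have r1: "Gamma \<kappa> * Gamma (1 - \<kappa>) = pi / sin (pi * \<kappa>)" by (rule refl)
  have "sin (pi * (2 * \<kappa>)) = 2 * sin (pi * \<kappa>) * cos (pi * \<kappa>)"
    using sin_double[of "pi * \<kappa>"] by (simp add: mult.left_commute)
  then have r2: "Gamma (2 * \<kappa>) * Gamma (1 - 2 * \<kappa>) = pi / (2 * sin (pi * \<kappa>) * cos (pi * \<kappa>))"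
    using refl[of "2 * \<kappa>"] by simp
  have pos: "Gamma \<kappa> > 0" "Gamma (1 - \<kappa>) > 0" "Gamma (2 * \<kappa>) > 0" using assms by (auto intro!: Gamma_real_pos)
  have e1: "Gamma (1 - \<kappa>) = pi / (sin (pi * \<kappa>) * Gamma \<kappa>)" using r1 pos sin by (simp add: field_simps)
  have e2: "Gamma (1 - 2 * \<kappa>) = pi / (2 * sin (pi * \<kappa>) * cos (pi * \<kappa>) * Gamma (2 * \<kappa>))" using r2 pos sin by (simp add: field_simps)
  have s1: "\<kappa> + (1 - 2 * \<kappa>) = 1 - \<kappa>" "\<kappa> + 1 + (\<kappa> + 1) = 2 * \<kappa> + 1 + 1" by auto
  show ?thesis
    unfolding Beta_def s1 g1 g3 e1 e2 using pos sin assms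
    by (simp add: divide_simps)
qed

text \<open>The part of the normalising constant that depends on \<kappa> alone: the square of
  \<open>cusp_Gamma\<close> is
  \<open>a\<^sup>2 * cusp_const \<kappa> / h \<theta>\<^sub>1\<close>.\<close>

definition cusp_const :: "real \<Rightarrow> real" where
  "cusp_const \<kappa> = 2 * Beta (\<kappa> + 1) (\<kappa> + 1) * (1 / cos (pi * \<kappa>) - 1)"

text \<open>The line is split at 0 and 1. A reflection and a translation carry the outer parts to
  the half-line integral, and the terms 1 / (2 \<kappa> + 1) cancel against the middle part.\<close>

lemma cusp_integral:
  fixes \<kappa> :: real
  assumes "0 < \<kappa>" "\<kappa> < 1 / 2"
  shows "has_bochner_integral lborel (\<lambda>s. (\<bar>s - 1\<bar> powr \<kappa> - \<bar>s\<bar> powr \<kappa>)\<^sup>2) (cusp_const \<kappa>)"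
proof -
  let ?J = "\<kappa> / (2 * \<kappa> + 1) * Beta \<kappa> (1 - 2 * \<kappa>) - 1 / (2 * \<kappa> + 1)"
  let ?f = "\<lambda>x::real. indicator {0<..} x * ((1 + x) powr \<kappa> - x powr \<kappa>)\<^sup>2"
  let ?g = "\<lambda>x::real. indicator {0..1} x * ((1 - x) powr \<kappa> - x powr \<kappa>)\<^sup>2"
  have 1: "has_bochner_integral lborel (\<lambda>s. ?f (0 + (-1) * s)) ?J"
    using cusp_tail_integral[OF assms] lborel_has_bochner_integral_real_affine_iff[of "-1" ?f ?J 0] by simp
  have 2: "has_bochner_integral lborel (\<lambda>s. ?f (-1 + 1 * s)) ?J"
    using cusp_tail_integral[OF assms] lborel_has_bochner_integral_real_affine_iff[of 1 ?f ?J "-1"] by simp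
  have "has_bochner_integral lborel (\<lambda>s. ?f (0 + (-1) * s) + ?g s + ?f (-1 + 1 * s))
     (?J + (2 / (2 * \<kappa> + 1) - 2 * Beta (\<kappa> + 1) (\<kappa> + 1)) + ?J)"
    by (intro has_bochner_integral_add 1 2 cusp_middle_integral assms)
  also have "(\<lambda>s. ?f (0 + (-1) * s) + ?g s + ?f (-1 + 1 * s)) = (\<lambda>s. (\<bar>s - 1\<bar> powr \<kappa> - \<bar>s\<bar> powr \<kappa>)\<^sup>2)"
    by (intro ext) (auto simp: indicator_def abs_if power2_commute algebra_simps)
  also have "?J + (2 / (2 * \<kappa> + 1) - 2 * Beta (\<kappa> + 1) (\<kappa> + 1)) + ?J = cusp_const \<kappa>"
    unfolding beta_reflection[OF assms] cusp_const_def by (simp add: algebra_simps)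
  finally show ?thesis .
qed

section \<open>Integrals with respect to Poisson processes\<close>

lemma powser_exp_weighted: "(\<lambda>k. real k * (x ^ k / fact k)) sums (x * exp x)" for x :: real
proof -
  have "(\<lambda>k. x * (x ^ k /\<^sub>R fact k)) sums (x * exp x)"
    by (intro sums_mult exp_converges)
  moreover have "x * (x ^ k /\<^sub>R fact k) = real (Suc k) * (x ^ Suc k / fact (Suc k))" for k
    unfolding fact_Suc of_nat_mult power_Suc by (simp add: field_simps del: of_nat_Suc)
  ultimately have "(\<lambda>k. real (Suc k) * (x ^ Suc k / fact (Suc k))) sums (x * exp x)" by simp
  then show ?thesis by (subst (asm) sums_Suc_iff) simp
qed

lemma nn_integral_poisson_mean:
  assumes "0 < r"
  shows "(\<integral>\<^sup>+k. ennreal (real k) \<partial>measure_pmf (poisson_pmf r)) = ennreal r"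
proof -
  have s: "(\<lambda>k. r ^ k / fact k * exp (- r) * real k) sums r"
    using sums_mult2[OF powser_exp_weighted[of r], of "exp (- r)"]
    by (simp add: exp_minus field_simps)
  have "(\<integral>\<^sup>+k. ennreal (real k) \<partial>measure_pmf (poisson_pmf r)) = (\<integral>\<^sup>+k. ennreal (r ^ k / fact k * exp (- r) * real k) \<partial>count_space UNIV)"
    using assms unfolding measure_pmf_eq_density
    by (subst nn_integral_density) (auto intro!: nn_integral_cong simp: ennreal_mult[symmetric] mult_ac)
  also have "\<dots> = ennreal r"
    by (subst nn_integral_count_space_nat, rule suminf_ennreal_eq[OF _ s]) (use assms in simp)
  finally show ?thesis .
qed

text \<open>The exponent is complex so that one formula yields both real exponential moments and
  characteristic functions.\<close>

lemma poisson_exp: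
  fixes z :: complex
  assumes "0 < r"
  shows "has_bochner_integral (measure_pmf (poisson_pmf r)) (\<lambda>k. exp (of_nat k * z)) (exp (of_real r * (exp z - 1)))"
proof -
  define w where "w = of_real r * exp z"
  have e: "(r ^ k / fact k * exp (- r)) *\<^sub>R exp (of_nat k * z) = (w ^ k /\<^sub>R fact k) * of_real (exp (- r))" for k
    unfolding exp_of_nat_mult by (simp add: w_def power_mult_distrib scaleR_conv_of_real field_simps)
  have s: "(\<lambda>k. (r ^ k / fact k * exp (- r)) *\<^sub>R exp (of_nat k * z)) sums (exp w * of_real (exp (- r)))"
    unfolding e by (intro sums_mult2 exp_converges)
  have n: "norm ((r ^ k / fact k * exp (- r)) *\<^sub>R exp (of_nat k * z)) = (norm w ^ k /\<^sub>R fact k) * exp (- r)" for k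
    unfolding e by (simp add: norm_mult norm_power norm_divide divide_inverse)
  have i: "integrable (count_space UNIV) (\<lambda>k. (r ^ k / fact k * exp (- r)) *\<^sub>R exp (of_nat k * z))"
    unfolding integrable_count_space_nat_iff n
    by (intro summable_mult2 sums_summable[OF exp_converges])
  have "(LINT k|count_space UNIV. (r ^ k / fact k * exp (- r)) *\<^sub>R exp (of_nat k * z)) = exp w * of_real (exp (- r))"
    using sums_integral_count_space_nat[OF i] s by (rule sums_unique2)
  also have "\<dots> = exp (of_real r * (exp z - 1))"
    by (simp add: w_def exp_of_real[symmetric] exp_add[symmetric] algebra_simps)
  finally show ?thesis
    using i assms unfolding measure_pmf_eq_density
    by (intro has_bochner_integral_density) (auto simp: has_bochner_integral_iff)
qed

section \<open>The jump measure of a path\<close>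

definition jump_measure :: "real \<Rightarrow> (real \<Rightarrow> nat) \<Rightarrow> real measure" where
  "jump_measure \<tau> x = interval_measure (\<lambda>t. real (x (max 0 (min \<tau> t))))"

lemma sets_jump_measure [simp, measurable_cong]: "sets (jump_measure \<tau> x) = sets borel"
  by (simp add: jump_measure_def)

lemma space_jump_measure [simp]: "space (jump_measure \<tau> x) = UNIV"
  by (simp add: jump_measure_def)

lemma path_integral_eq: "path_integral \<tau> f x = (LINT t:{0..\<tau>}|jump_measure \<tau> x. f t)"
  by (simp add: path_integral_def jump_measure_def)

lemma path_spaceD:
  assumes "x \<in> space (path_space \<tau>)"
  shows "x 0 = 0" "mono_on {0..\<tau>} x" "\<And>t. t \<in> {0..<\<tau>} \<Longrightarrow> continuous (at_right t) x"
  using assms by (auto simp: path_space_def space_restrict_space)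

lemma path_space_eval:
  assumes "t \<in> {0..\<tau>}"
  shows "(\<lambda>x. x t) \<in> path_space \<tau> \<rightarrow>\<^sub>M count_space UNIV"
  unfolding path_space_def using assms
  by (intro measurable_restrict_space1 measurable_component_singleton)

locale path =
  fixes \<tau> :: real and x :: "real \<Rightarrow> nat"
  assumes \<tau>: "0 < \<tau>" and x: "x \<in> space (path_space \<tau>)"
begin

abbreviation "F \<equiv> \<lambda>t. real (x (max 0 (min \<tau> t)))"

lemma F_mono: "s \<le> t \<Longrightarrow> F s \<le> F t"
  using path_spaceD(2)[OF x] \<tau> by (auto simp: mono_on_def)

lemma F_right_cont: "continuous (at_right t) F"
proof -
  have "eventually (\<lambda>s. F s = F t) (at_right t)"
  proof -
    consider "t < 0" | "t \<in> {0..<\<tau>}" | "t \<ge> \<tau>" by force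
    then show ?thesis
    proof cases
      case 1
      then show ?thesis unfolding eventually_at_right_field using \<tau> by (intro exI[of _ 0]) auto
    next
      case 2
      \<comment> \<open>Values in \<open>nat\<close> are discrete, so right-continuity means that
        the path is constant on some interval to the right.\<close>
      then have "eventually (\<lambda>s. x s = x t) (at_right t)"
        using path_spaceD(3)[OF x 2] by (simp add: continuous_within tendsto_discrete)
      moreover have "eventually (\<lambda>s. s \<in> {t<..<\<tau>}) (at_right t)"
        using 2 by (intro eventually_at_right_real) auto
      ultimately show ?thesis
        by eventually_elim (use 2 in auto)
    next
      case 3
      then show ?thesis unfolding eventually_at_right_field using \<tau> by (intro exI[of _ "t + 1"]) auto
    qed
  qed
  then show ?thesis unfolding continuous_within by (rule tendsto_eventually)
qed

lemma emeasure_Ioc: "a \<le> b \<Longrightarrow> emeasure (jump_measure \<tau> x) {a<..b} = ennreal (F b - F a)"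
  unfolding jump_measure_def by (rule emeasure_interval_measure_Ioc[OF _ F_mono F_right_cont])

lemma emeasure_UNIV: "emeasure (jump_measure \<tau> x) UNIV = ennreal (real (x \<tau>))"
proof -
  have "(\<lambda>n. emeasure (jump_measure \<tau> x) {- real n<..\<tau> + real n}) \<longlonglongrightarrow> emeasure (jump_measure \<tau> x) (\<Union>n. {- real n<..\<tau> + real n})"
    by (intro Lim_emeasure_incseq) (auto simp: incseq_def)
  moreover have "(\<Union>n. {- real n<..\<tau> + real n}) = UNIV"
  proof safe
    fix t :: real
    obtain n where "\<bar>t\<bar> < real n" using reals_Archimedean2 by blast
    then show "t \<in> (\<Union>n. {- real n<..\<tau> + real n})" using \<tau> by (intro UN_I[of n]) auto
  qed auto
  moreover have "emeasure (jump_measure \<tau> x) {- real n<..\<tau> + real n} = ennreal (real (x \<tau>))" for n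
    using \<tau> path_spaceD(1)[OF x] by (subst emeasure_Ioc) auto
  ultimately show ?thesis by (simp add: LIMSEQ_const_iff)
qed

lemma finite_measure_jump: "finite_measure (jump_measure \<tau> x)"
  by (rule finite_measureI) (simp add: emeasure_UNIV)

lemma measure_Ioc: "a \<le> b \<Longrightarrow> measure (jump_measure \<tau> x) {a<..b} = F b - F a"
  using emeasure_Ioc[of a b] F_mono[of a b] by (simp add: measure_def)

lemma measure_UNIV: "measure (jump_measure \<tau> x) UNIV = real (x \<tau>)"
  using emeasure_UNIV by (simp add: measure_def)

text \<open>The path vanishes at 0 and is extended by that value to the left, so 0 carries no mass.
  The closed window in \<open>path_integral\<close> can thus be exchanged for (0, \<tau>], which is
  partitioned by the half-open cells on which increments live.\<close>

lemma AE_jump_pos: "AE t in jump_measure \<tau> x. t \<noteq> 0"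
proof -
  have "emeasure (jump_measure \<tau> x) {-1<..0} = 0"
    using \<tau> path_spaceD(1)[OF x] by (subst emeasure_Ioc) auto
  then have "{0} \<in> null_sets (jump_measure \<tau> x)"
    using emeasure_mono[of "{0}" "{-1<..0}" "jump_measure \<tau> x"] by (simp add: null_sets_def)
  from AE_not_in[OF this] show ?thesis by simp
qed

lemma path_integral_Ioc:
  assumes [measurable]: "f \<in> borel_measurable borel"
  shows "path_integral \<tau> f x = (LINT t:{0<..\<tau>}|jump_measure \<tau> x. f t)"
  unfolding path_integral_eq set_lebesgue_integral_def
  using AE_jump_pos by (intro integral_cong_AE) (auto simp: indicator_def)

lemma integrable_jump:
  fixes B :: real
  assumes [measurable]: "f \<in> borel_measurable borel" and "\<And>t. t \<in> {0..\<tau>} \<Longrightarrow> \<bar>f t\<bar> \<le> B"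
  shows "integrable (jump_measure \<tau> x) (\<lambda>t. indicator {0..\<tau>} t * f t)"
proof -
  interpret finite_measure "jump_measure \<tau> x" by (rule finite_measure_jump)
  have "B \<ge> 0" using assms(2)[of 0] \<tau> by auto
  then show ?thesis
    using assms(2) by (intro integrable_const_bound[where B = B]) (auto simp: indicator_def abs_mult)
qed

lemma path_integral_bound:
  fixes B :: real
  assumes [measurable]: "f \<in> borel_measurable borel" and "\<And>t. t \<in> {0..\<tau>} \<Longrightarrow> \<bar>f t\<bar> \<le> B"
  shows "\<bar>path_integral \<tau> f x\<bar> \<le> B * real (x \<tau>)"
proof -
  interpret finite_measure "jump_measure \<tau> x" by (rule finite_measure_jump)
  have "B \<ge> 0" using assms(2)[of 0] \<tau> by auto
  have "\<bar>path_integral \<tau> f x\<bar> \<le> (LINT t|jump_measure \<tau> x. \<bar>indicator {0..\<tau>} t * f t\<bar>)"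
    unfolding path_integral_eq set_lebesgue_integral_def by (simp add: integral_abs_bound)
  also have "\<dots> \<le> (LINT t|jump_measure \<tau> x. B)"
    using assms(2) \<open>B \<ge> 0\<close> by (intro integral_mono integrable_abs integrable_jump[OF assms]) (auto simp: indicator_def)
  also have "\<dots> = B * real (x \<tau>)" by (simp add: measure_UNIV)
  finally show ?thesis .
qed

end

text \<open>Normalised, so that the measures depend measurably on the path as elements of \<open>subprob_algebra borel\<close>.\<close>

definition jump_kernel :: "real \<Rightarrow> (real \<Rightarrow> nat) \<Rightarrow> real measure" where
  "jump_kernel \<tau> x = density (jump_measure \<tau> x) (\<lambda>_. ennreal (1 / (1 + real (x \<tau>))))"

lemma measurable_nat_diff:
  fixes f g :: "'a \<Rightarrow> nat"
  assumes [measurable]: "f \<in> M \<rightarrow>\<^sub>M count_space UNIV" "g \<in> M \<rightarrow>\<^sub>M count_space UNIV"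
  shows "(\<lambda>\<omega>. f \<omega> - g \<omega>) \<in> M \<rightarrow>\<^sub>M count_space UNIV"
  by measurable

lemma Int_stable_Ioc: "Int_stable (range (\<lambda>(a, b). {a<..b::real}))"
proof (rule Int_stableI_image)
  fix i j :: "real \<times> real"
  show "\<exists>k\<in>UNIV. (case i of (a, b) \<Rightarrow> {a<..b}) \<inter> (case j of (a, b) \<Rightarrow> {a<..b}) = (case k of (a, b) \<Rightarrow> {a<..b})"
    by (intro bexI[of _ "(max (fst i) (fst j), min (snd i) (snd j))"]) (auto split: prod.split)
qed

text \<open>On half-open intervals, an intersection-stable generator, the mass is a normalised
  increment of the path and so a measurable function of finitely many evaluations.\<close>

lemma jump_kernel_measurable:
  assumes \<tau>: "0 < \<tau>"
  shows "jump_kernel \<tau> \<in> path_space \<tau> \<rightarrow>\<^sub>M subprob_algebra borel"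
proof (rule measurable_subprob_algebra_generated[where \<Omega> = UNIV and G = "range (\<lambda>(a, b). {a<..b::real})"])
  show "sets borel = sigma_sets UNIV (range (\<lambda>(a, b). {a<..b::real}))"
    unfolding borel_sigma_sets_Ioc by simp
  show "Int_stable (range (\<lambda>(a, b). {a<..b::real}))" by (rule Int_stable_Ioc)
  fix x assume x: "x \<in> space (path_space \<tau>)"
  interpret path \<tau> x using \<tau> x by unfold_locales
  have "emeasure (jump_kernel \<tau> x) UNIV = ennreal (1 / (1 + real (x \<tau>))) * ennreal (real (x \<tau>))"
    unfolding jump_kernel_def by (subst emeasure_density_const) (auto simp: emeasure_UNIV)
  also have "\<dots> \<le> 1" by (simp add: ennreal_mult[symmetric])
  finally show "subprob_space (jump_kernel \<tau> x)"
    by (intro subprob_spaceI) (auto simp: jump_kernel_def)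
next
  have cl: "max 0 (min \<tau> t) \<in> {0..\<tau>}" for t using \<tau> by auto
  have [measurable]: "(\<lambda>x. x (max 0 (min \<tau> t))) \<in> path_space \<tau> \<rightarrow>\<^sub>M count_space UNIV" for t
    by (rule path_space_eval[OF cl])
  have [measurable]: "(\<lambda>x. x \<tau>) \<in> path_space \<tau> \<rightarrow>\<^sub>M count_space UNIV"
    by (rule path_space_eval) (use \<tau> in auto)
  fix A assume "A \<in> range (\<lambda>(a, b). {a<..b::real})"
  then obtain a b where A: "A = {a<..b}" by auto
  have "emeasure (jump_kernel \<tau> x) A = (if a \<le> b then ennreal (1 / (1 + real (x \<tau>))) *
        ennreal (real (x (max 0 (min \<tau> b))) - real (x (max 0 (min \<tau> a)))) else 0)"
    if x: "x \<in> space (path_space \<tau>)" for x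
  proof -
    interpret path \<tau> x using \<tau> x by unfold_locales
    show ?thesis
      unfolding jump_kernel_def A by (subst emeasure_density_const) (auto simp: emeasure_Ioc)
  qed
  then show "(\<lambda>x. emeasure (jump_kernel \<tau> x) A) \<in> borel_measurable (path_space \<tau>)"
    by (subst measurable_cong) auto
next
  have [measurable]: "(\<lambda>x. x \<tau>) \<in> path_space \<tau> \<rightarrow>\<^sub>M count_space UNIV"
    by (rule path_space_eval) (use \<tau> in auto)
  have "emeasure (jump_kernel \<tau> x) UNIV = ennreal (1 / (1 + real (x \<tau>))) * ennreal (real (x \<tau>))"
    if x: "x \<in> space (path_space \<tau>)" for x
  proof -
    interpret path \<tau> x using \<tau> x by unfold_locales
    show ?thesis
      unfolding jump_kernel_def by (subst emeasure_density_const) (auto simp: emeasure_UNIV)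
  qed
  then show "(\<lambda>x. emeasure (jump_kernel \<tau> x) UNIV) \<in> borel_measurable (path_space \<tau>)"
    by (subst measurable_cong) auto
qed (auto simp: jump_kernel_def)

text \<open>An integral against a measurable kernel is measurable. The factor 1 + x(\<tau>) undoes
  the normalisation of the kernel, and the signs c = 1 and c = -1 select the positive and the
  negative part, since \<open>ennreal\<close> truncates at 0. The parameter y will be \<theta>,
  which makes the likelihood ratio jointly measurable in \<theta> and the sample.\<close>

lemma path_integral_measurable:
  assumes \<tau>: "0 < \<tau>" and f [measurable]: "(\<lambda>(y, t). f y t) \<in> borel_measurable (N \<Otimes>\<^sub>M borel)"
    and bdd: "\<And>y t. y \<in> space N \<Longrightarrow> t \<in> {0..\<tau>} \<Longrightarrow> \<bar>f y t\<bar> \<le> B"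
  shows "(\<lambda>(y, x). path_integral \<tau> (f y) x) \<in> borel_measurable (N \<Otimes>\<^sub>M path_space \<tau>)"
proof -
  have [measurable]: "(\<lambda>x. x \<tau>) \<in> path_space \<tau> \<rightarrow>\<^sub>M count_space UNIV"
    by (rule path_space_eval) (use \<tau> in auto)
  note [measurable] = jump_kernel_measurable[OF \<tau>]
  let ?I = "\<lambda>c yx. \<integral>\<^sup>+t. ennreal (c * (indicator {0..\<tau>} t * f (fst yx) t)) \<partial>jump_kernel \<tau> (snd yx)"
  have f1 [measurable]: "(\<lambda>z. f (fst (fst z)) (snd z)) \<in> borel_measurable ((N \<Otimes>\<^sub>M path_space \<tau>) \<Otimes>\<^sub>M borel)"
    using measurable_compose[OF _ f, of "\<lambda>z. (fst (fst z), snd z)" "(N \<Otimes>\<^sub>M path_space \<tau>) \<Otimes>\<^sub>M borel"]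
    by (simp add: split_beta')
  have [measurable]: "?I c \<in> borel_measurable (N \<Otimes>\<^sub>M path_space \<tau>)" for c
  proof (rule nn_integral_measurable_subprob_algebra2[where N = borel])
    show "(\<lambda>(yx, t). ennreal (c * (indicat_real {0..\<tau>} t * f (fst yx) t))) \<in> borel_measurable ((N \<Otimes>\<^sub>M path_space \<tau>) \<Otimes>\<^sub>M borel)"
      unfolding split_beta' by measurable
    show "(\<lambda>x. jump_kernel \<tau> (snd x)) \<in> N \<Otimes>\<^sub>M path_space \<tau> \<rightarrow>\<^sub>M subprob_algebra borel"
      by (rule measurable_compose[OF measurable_snd jump_kernel_measurable[OF \<tau>]])
  qed
  have "path_integral \<tau> (f (fst yx)) (snd yx) = (1 + real (snd yx \<tau>)) * (enn2real (?I 1 yx) - enn2real (?I (-1) yx))"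
    if yx: "yx \<in> space (N \<Otimes>\<^sub>M path_space \<tau>)" for yx
  proof -
    obtain y x where e: "yx = (y, x)" "y \<in> space N" "x \<in> space (path_space \<tau>)"
      using yx by (auto simp: space_pair_measure)
    interpret path \<tau> x using \<tau> e by unfold_locales
    have [measurable]: "f y \<in> borel_measurable borel"
      using e f by (simp add: split_beta')
    have i: "integrable (jump_measure \<tau> x) (\<lambda>t. indicator {0..\<tau>} t * f y t)"
      by (rule integrable_jump) (use bdd e in auto)
    have i': "integrable (jump_kernel \<tau> x) (\<lambda>t. indicator {0..\<tau>} t * f y t)"
      unfolding jump_kernel_def by (subst integrable_density) (use i in auto)
    have "path_integral \<tau> (f y) x = (1 + real (x \<tau>)) * (LINT t|jump_kernel \<tau> x. indicator {0..\<tau>} t * f y t)"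
      unfolding jump_kernel_def by (subst integral_density) (auto simp: path_integral_eq set_lebesgue_integral_def add_pos_nonneg)
    also have "(LINT t|jump_kernel \<tau> x. indicator {0..\<tau>} t * f y t) = enn2real (?I 1 yx) - enn2real (?I (-1) yx)"
      using real_lebesgue_integral_def[OF i'] by (simp add: e)
    finally show ?thesis by (simp add: e)
  qed
  note cong = this
  have "(\<lambda>yx. path_integral \<tau> (f (fst yx)) (snd yx)) \<in> borel_measurable (N \<Otimes>\<^sub>M path_space \<tau>)"
    by (subst measurable_cong[OF cong]) measurable
  then show ?thesis by (simp add: split_beta')
qed

lemma path_integral_measurable1:
  assumes \<tau>: "0 < \<tau>" and f: "f \<in> borel_measurable borel" and bdd: "\<And>t. t \<in> {0..\<tau>} \<Longrightarrow> \<bar>f t\<bar> \<le> B"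
  shows "path_integral \<tau> f \<in> borel_measurable (path_space \<tau>)"
proof -
  have "(\<lambda>(y, t). f t) \<in> borel_measurable (count_space {()} \<Otimes>\<^sub>M borel)"
    using f by (simp add: split_beta')
  from path_integral_measurable[OF \<tau> this, of B] bdd
  have "(\<lambda>(y, x). path_integral \<tau> f x) \<in> borel_measurable (count_space {()} \<Otimes>\<^sub>M path_space \<tau>)"
    by auto
  from measurable_compose[OF measurable_Pair1' this, of "()"] show ?thesis by simp
qed

text \<open>Step functions with the values at right end points converge boundedly. The general form
  serves two uses: the jump measure of a path, and the intensity measure with complex
  integrands.\<close>

lemma riemann_stieltjes:
  fixes F :: "real \<Rightarrow> 'a :: {banach, second_countable_topology}"
  assumes "finite_measure \<mu>" and sets [simp, measurable_cong]: "sets \<mu> = sets borel" and F: "continuous_on {0..\<tau>} F" and \<tau>: "0 < \<tau>"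
  shows "(\<lambda>k. \<Sum>i<k. measure \<mu> {real i * \<tau> / real k<..real (Suc i) * \<tau> / real k} *\<^sub>R F (real (Suc i) * \<tau> / real k))
    \<longlonglongrightarrow> (LINT t:{0<..\<tau>}|\<mu>. F t)"
proof -
  interpret finite_measure \<mu> by fact
  define I where "I k i = {real i * \<tau> / real k<..real (Suc i) * \<tau> / real k}" for k i :: nat
  define h where "h k t = (\<Sum>i<k. indicator (I k i) t *\<^sub>R F (real (Suc i) * \<tau> / real k))" for k t
  obtain C where C: "\<And>t. t \<in> {0..\<tau>} \<Longrightarrow> norm (F t) \<le> C" and C0: "C \<ge> 0"
  proof -
    obtain b where "b > 0" "\<forall>y\<in>F ` {0..\<tau>}. norm y \<le> b"
      using compact_imp_bounded[OF compact_continuous_image[OF F]] unfolding bounded_pos by auto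
    then show ?thesis by (intro that[of b]) auto
  qed
  have grid: "real (Suc i) * \<tau> / real k \<in> {0..\<tau>}" if "i < k" for i k
  proof -
    have "real (Suc i) * \<tau> \<le> real k * \<tau>" using that \<tau> by (intro mult_right_mono) auto
    then show ?thesis using that \<tau> by (simp add: divide_le_eq mult.commute del: of_nat_Suc)
  qed
  have h_in: "\<exists>s\<in>{t..t + \<tau> / real k}. s \<in> {0..\<tau>} \<and> h k t = F s" if t: "t \<in> {0<..\<tau>}" and k: "k > 0" for t k
  proof -
    define y where "y = real k * t / \<tau>"
    \<comment> \<open>The cells are open on the left, so t lies in cell i exactly if i < y \<le> i +
      1: hence the ceiling minus one and not the floor.\<close>
    define i where "i = nat (\<lceil>y\<rceil> - 1)"
    have pos: "y > 0" using t k \<tau> by (auto simp: y_def)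
    have ty: "t = y * \<tau> / real k" using k \<tau> by (simp add: y_def)
    have "\<lceil>y\<rceil> \<ge> 1" using pos by linarith
    then have ri: "real i = of_int \<lceil>y\<rceil> - 1" by (simp add: i_def)
    have le: "real i < y" "y \<le> real i + 1" unfolding ri by linarith+
    have iI: "t \<in> I k i"
      unfolding I_def ty greaterThanAtMost_iff using le \<tau> k
      by (intro conjI divide_strict_right_mono divide_right_mono mult_strict_right_mono mult_right_mono) auto
    have "y \<le> real k"
      unfolding y_def using t k \<tau> by (simp add: divide_le_eq)
    then have ik: "i < k" using le by linarith
    have other: "j = i" if "t \<in> I k j" for j
    proof -
      have "real j * \<tau> < real k * t" "real k * t \<le> (real j + 1) * \<tau>"
        using that k by (simp_all add: I_def divide_less_eq le_divide_eq mult.commute add.commute)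
      then have "real j < y" "y \<le> real j + 1"
        unfolding y_def using \<tau> by (simp_all add: divide_le_eq less_divide_eq)
      with le have "real j < real i + 1" "real i < real j + 1" by linarith+
      then show ?thesis by linarith
    qed
    have "indicator (I k j) t *\<^sub>R F (real (Suc j) * \<tau> / real k) = (if j = i then F (real (Suc i) * \<tau> / real k) else 0)" for j
      using other[of j] iI by (cases "j = i") (auto simp: indicator_def simp del: of_nat_Suc)
    then have "h k t = (\<Sum>j<k. if j = i then F (real (Suc i) * \<tau> / real k) else 0)"
      unfolding h_def by simp
    then have "h k t = F (real (Suc i) * \<tau> / real k)" using ik by simp
    moreover have "real (Suc i) * \<tau> / real k \<in> {t..t + \<tau> / real k}"
    proof -
      have "real (Suc i) * \<tau> / real k = real i * \<tau> / real k + \<tau> / real k"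
        by (simp add: distrib_right add_divide_distrib)
      then show ?thesis using iI by (auto simp: I_def)
    qed
    ultimately show ?thesis using grid[OF ik] by auto
  qed
  have h_out: "h k t = 0" if "t \<notin> {0<..\<tau>}" for t k
    unfolding h_def
  proof (intro sum.neutral ballI)
    fix i assume "i \<in> {..<k}"
    then have "real (Suc i) * \<tau> / real k \<le> \<tau>" "real i * \<tau> / real k \<ge> 0" using grid[of i k] \<tau> by auto
    then have "I k i \<subseteq> {0<..\<tau>}" unfolding I_def by (auto simp del: of_nat_Suc)
    then show "indicator (I k i) t *\<^sub>R F (real (Suc i) * \<tau> / real k) = 0"
      using that by (auto simp: indicator_def simp del: of_nat_Suc)
  qed
  have lim: "(\<lambda>k. h k t) \<longlonglongrightarrow> indicator {0<..\<tau>} t *\<^sub>R F t" for t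
  proof (cases "t \<in> {0<..\<tau>}")
    case True
    show ?thesis
    proof (rule metric_LIMSEQ_I)
      fix e :: real assume "e > 0"
      moreover have "t \<in> {0..\<tau>}" using True by auto
      ultimately have "\<exists>d>0. \<forall>s\<in>{0..\<tau>}. dist s t < d \<longrightarrow> dist (F s) (F t) < e"
        using F unfolding continuous_on_iff by blast
      then obtain d where d: "d > 0" "\<And>s. s \<in> {0..\<tau>} \<Longrightarrow> dist s t < d \<Longrightarrow> dist (F s) (F t) < e"
        by blast
      obtain n where n: "\<tau> / d < real n" using reals_Archimedean2 by blast
      have "dist (h k t) (F t) < e" if "k \<ge> max n 1" for k
      proof -
        have k: "k > 0" "\<tau> / d < real k" using that n by auto
        then have small: "\<tau> / real k < d" using d(1) by (simp add: divide_less_eq mult.commute)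
        from h_in[OF True k(1)] obtain s where s: "s \<in> {t..t + \<tau> / real k}" "s \<in> {0..\<tau>}" "h k t = F s"
          by blast
        have "dist s t < d" using s(1) small by (auto simp: dist_real_def)
        then show ?thesis using s d(2) by simp
      qed
      then show "\<exists>no. \<forall>k\<ge>no. dist (h k t) (indicator {0<..\<tau>} t *\<^sub>R F t) < e"
        using True by (intro exI[of _ "max n 1"]) simp
    qed
  next
    case False
    then show ?thesis using h_out[OF False] by simp
  qed
  have "(\<lambda>k. LINT t|\<mu>. h k t) \<longlonglongrightarrow> (LINT t|\<mu>. indicator {0<..\<tau>} t *\<^sub>R F t)"
  proof (rule integral_dominated_convergence[where w = "\<lambda>_. C"])
    have "continuous_on {0<..\<tau>} F" by (rule continuous_on_subset[OF F]) auto
    then show "(\<lambda>t. indicator {0<..\<tau>} t *\<^sub>R F t) \<in> borel_measurable \<mu>"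
      unfolding measurable_cong_sets[OF sets refl] by (intro borel_measurable_continuous_on_indicator) simp_all
    have "I k i \<in> sets \<mu>" for k i by (simp add: I_def)
    then show "h k \<in> borel_measurable \<mu>" for k
      unfolding h_def by (intro borel_measurable_sum borel_measurable_scaleR borel_measurable_indicator borel_measurable_const)
    show "AE t in \<mu>. norm (h k t) \<le> C" for k
    proof (intro AE_I2)
      fix t show "norm (h k t) \<le> C"
      proof (cases "t \<in> {0<..\<tau>} \<and> k > 0")
        case True
        then obtain s where "s \<in> {0..\<tau>}" "h k t = F s" using h_in[of t k] by blast
        then show ?thesis using C[of s] by simp
      next
        case False
        then have "h k t = 0" using h_out by (auto simp: h_def)
        then show ?thesis using C0 by simp
      qed
    qed
    show "AE t in \<mu>. (\<lambda>k. h k t) \<longlonglongrightarrow> indicator {0<..\<tau>} t *\<^sub>R F t"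
      using lim by (intro AE_I2)
    show "integrable \<mu> (\<lambda>_. C)" by simp
  qed
  moreover have "(LINT t|\<mu>. h k t) = (\<Sum>i<k. measure \<mu> (I k i) *\<^sub>R F (real (Suc i) * \<tau> / real k))" for k
  proof -
    have int: "integrable \<mu> (indicat_real (I k i))" for i
      unfolding I_def by (intro integrable_real_indicator) (auto simp: less_top[symmetric])
    have "integrable \<mu> (\<lambda>t. indicator (I k i) t *\<^sub>R F (real (Suc i) * \<tau> / real k))" for i
      unfolding I_def by (intro integrable_scaleR_left integrable_real_indicator) (auto simp: less_top[symmetric])
    then have "(LINT t|\<mu>. h k t) = (\<Sum>i<k. LINT t|\<mu>. indicator (I k i) t *\<^sub>R F (real (Suc i) * \<tau> / real k))"
      unfolding h_def by (intro Bochner_Integration.integral_sum)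
    also have "\<dots> = (\<Sum>i<k. measure \<mu> (I k i) *\<^sub>R F (real (Suc i) * \<tau> / real k))"
    proof (rule sum.cong[OF refl])
      fix i
      have "I k i \<in> sets \<mu>" by (simp add: I_def)
      moreover have "space \<mu> = UNIV" using sets_eq_imp_space_eq[OF sets] by simp
      ultimately show "(LINT t|\<mu>. indicator (I k i) t *\<^sub>R F (real (Suc i) * \<tau> / real k)) = measure \<mu> (I k i) *\<^sub>R F (real (Suc i) * \<tau> / real k)"
        using integral_scaleR_left[of "F (real (Suc i) * \<tau> / real k)" \<mu> "indicator (I k i)"] int[of i]
        by (simp del: of_nat_Suc add: less_top[symmetric])
    qed
    finally show ?thesis .
  qed
  ultimately show ?thesis unfolding I_def set_lebesgue_integral_def by simp
qed

section \<open>Intensity measure, increments and Campbell's formula\<close>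

locale poisson_path =
  fixes M :: "'w measure" and \<tau> c :: real and lam :: "real \<Rightarrow> real" and X :: "'w \<Rightarrow> real \<Rightarrow> nat"
  assumes pp: "poisson_process M \<tau> lam X" and \<tau>: "0 < \<tau>"
    and lam_int: "set_integrable lborel {0..\<tau>} lam" and c: "0 < c" and lam_ge: "\<And>t. t \<in> {0..\<tau>} \<Longrightarrow> c \<le> lam t"
begin

sublocale prob_space M using pp by (simp add: poisson_process_def)

definition \<mu> where "\<mu> = density lborel (\<lambda>t. ennreal (indicator {0..\<tau>} t * lam t))"

lemma lam_borel [measurable]: "(\<lambda>t. indicator {0..\<tau>} t * lam t) \<in> borel_measurable borel"
  using lam_int by (simp add: set_integrable_def borel_measurable_integrable[of lborel, simplified])

lemma lam_nonneg: "0 \<le> indicator {0..\<tau>} t * lam t"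
  using lam_ge[of t] c by (auto simp: indicator_def)

lemma sets_\<mu> [simp, measurable_cong]: "sets \<mu> = sets borel" and space_\<mu> [simp]: "space \<mu> = UNIV"
  by (simp_all add: \<mu>_def)

lemma emeasure_\<mu>: "A \<in> sets borel \<Longrightarrow> emeasure \<mu> A = (\<integral>\<^sup>+t. ennreal (indicator {0..\<tau>} t * lam t) * indicator A t \<partial>lborel)"
  unfolding \<mu>_def by (subst emeasure_density) auto

lemma emeasure_\<mu>_eq:
  assumes A: "A \<in> sets borel"
  shows "emeasure \<mu> A = ennreal (LINT t:A \<inter> {0..\<tau>}|lborel. lam t)"
proof -
  have [measurable]: "A \<in> sets borel" by fact
  have i: "integrable lborel (\<lambda>t. indicator A t * (indicator {0..\<tau>} t * lam t))"
    using integrable_real_mult_indicator[OF _ lam_int[unfolded set_integrable_def], of A] A by (simp add: mult.commute)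
  have "emeasure \<mu> A = (\<integral>\<^sup>+t. ennreal (indicator A t * (indicator {0..\<tau>} t * lam t)) \<partial>lborel)"
    unfolding emeasure_\<mu>[OF A] by (intro nn_integral_cong) (auto simp: indicator_def)
  also have "\<dots> = ennreal (LINT t|lborel. indicator A t * (indicator {0..\<tau>} t * lam t))"
    using i lam_nonneg by (intro nn_integral_eq_integral) auto
  also have "(LINT t|lborel. indicator A t * (indicator {0..\<tau>} t * lam t)) = (LINT t:A \<inter> {0..\<tau>}|lborel. lam t)"
    unfolding set_lebesgue_integral_def by (intro Bochner_Integration.integral_cong) (auto simp: indicator_def)
  finally show ?thesis .
qed

sublocale \<mu>: finite_measure \<mu>
  by (rule finite_measureI) (simp add: emeasure_\<mu>_eq)

lemma measure_\<mu>:
  assumes "A \<in> sets borel"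
  shows "measure \<mu> A = (LINT t:A \<inter> {0..\<tau>}|lborel. lam t)"
proof -
  have "0 \<le> (LINT t:A \<inter> {0..\<tau>}|lborel. lam t)"
    unfolding set_lebesgue_integral_def using lam_ge c
    by (intro integral_nonneg_AE AE_I2) (auto simp: indicator_def intro: order_trans less_imp_le)
  then show ?thesis using emeasure_\<mu>_eq[OF assms] by (simp add: measure_def)
qed

lemma X_space: "\<omega> \<in> space M \<Longrightarrow> X \<omega> \<in> space (path_space \<tau>)"
  using pp measurable_space[of X M "path_space \<tau>"] by (auto simp: poisson_process_def)

lemma X_meas [measurable]: "X \<in> M \<rightarrow>\<^sub>M path_space \<tau>"
  using pp by (simp add: poisson_process_def)

lemma X_path: "\<omega> \<in> space M \<Longrightarrow> path \<tau> (X \<omega>)"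
  using X_space \<tau> by unfold_locales

lemma X_eval: "t \<in> {0..\<tau>} \<Longrightarrow> (\<lambda>\<omega>. X \<omega> t) \<in> M \<rightarrow>\<^sub>M count_space UNIV"
  by (rule measurable_compose[OF X_meas path_space_eval])

lemma rate_pos:
  assumes "0 \<le> s" "s < t" "t \<le> \<tau>"
  shows "0 < (LINT r:{s..t}|lborel. lam r)"
proof -
  have i: "set_integrable lborel {s..t} lam" by (rule set_integrable_subset[OF lam_int]) (use assms in auto)
  have "0 < c * (t - s)" using c assms by simp
  also have "\<dots> = (LINT r:{s..t}|lborel. c)" using assms by (simp add: set_lebesgue_integral_def)
  also have "\<dots> \<le> (LINT r:{s..t}|lborel. lam r)"
    using i lam_ge assms by (intro set_integral_mono) (auto simp: set_integrable_def)
  finally show ?thesis .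
qed

lemma rate_eq:
  assumes "0 \<le> s" "s < t" "t \<le> \<tau>"
  shows "(LINT r:{s..t}|lborel. lam r) = measure \<mu> {s<..t}"
proof -
  have "(LINT r:{s..t}|lborel. lam r) = (LINT r:{s<..t} \<inter> {0..\<tau>}|lborel. lam r)"
    unfolding set_lebesgue_integral_def
  proof (rule integral_cong_AE)
    have "(\<lambda>r. indicator {s..t} r * (indicator {0..\<tau>} r * lam r)) \<in> borel_measurable lborel" by measurable
    also have "(\<lambda>r. indicator {s..t} r * (indicator {0..\<tau>} r * lam r)) = (\<lambda>r. indicator {s..t} r *\<^sub>R lam r)"
      using assms by (auto simp: indicator_def)
    finally show "(\<lambda>r. indicator {s..t} r *\<^sub>R lam r) \<in> borel_measurable lborel" .
    have "(\<lambda>r. indicator {s<..t} r * (indicator {0..\<tau>} r * lam r)) \<in> borel_measurable lborel" by measurable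
    also have "(\<lambda>r. indicator {s<..t} r * (indicator {0..\<tau>} r * lam r)) = (\<lambda>r. indicator ({s<..t} \<inter> {0..\<tau>}) r *\<^sub>R lam r)"
      using assms by (auto simp: indicator_def)
    finally show "(\<lambda>r. indicator ({s<..t} \<inter> {0..\<tau>}) r *\<^sub>R lam r) \<in> borel_measurable lborel" .
    show "AE r in lborel. indicator {s..t} r *\<^sub>R lam r = indicator ({s<..t} \<inter> {0..\<tau>}) r *\<^sub>R lam r"
      using AE_lborel_singleton[of s] by eventually_elim (use assms in \<open>auto simp: indicator_def\<close>)
  qed
  then show ?thesis by (simp add: measure_\<mu>)
qed

lemma increment_distr:
  assumes "0 \<le> s" "s < t" "t \<le> \<tau>"
  shows "distr M (count_space UNIV) (\<lambda>\<omega>. X \<omega> t - X \<omega> s) = measure_pmf (poisson_pmf (measure \<mu> {s<..t}))"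
    and "0 < measure \<mu> {s<..t}"
  using pp assms rate_eq[OF assms] rate_pos[OF assms] by (auto simp: poisson_process_def)

lemma increment_measurable:
  assumes "s \<in> {0..\<tau>}" "t \<in> {0..\<tau>}"
  shows "(\<lambda>\<omega>. X \<omega> t - X \<omega> s) \<in> M \<rightarrow>\<^sub>M count_space UNIV"
  using assms by (intro measurable_nat_diff X_eval)

lemma measure_\<mu>_singleton: "measure \<mu> {t} = 0"
proof -
  have "AE x in lborel. ennreal (indicator {0..\<tau>} x * lam x) * indicator {t} x = 0"
    using AE_lborel_singleton[of t] by eventually_elim simp
  then have "emeasure \<mu> {t} = 0"
    by (simp add: emeasure_\<mu> nn_integral_0_iff_AE)
  then show ?thesis by (simp add: measure_def)
qed

lemma increment_mean:
  assumes "0 \<le> s" "s \<le> t" "t \<le> \<tau>"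
  shows "(\<integral>\<^sup>+\<omega>. ennreal (real (X \<omega> t - X \<omega> s)) \<partial>M) = ennreal (measure \<mu> {s<..t})"
proof (cases "s = t")
  case False
  then have st: "s < t" using assms by simp
  have "(\<integral>\<^sup>+\<omega>. ennreal (real (X \<omega> t - X \<omega> s)) \<partial>M) = (\<integral>\<^sup>+k. ennreal (real k) \<partial>distr M (count_space UNIV) (\<lambda>\<omega>. X \<omega> t - X \<omega> s))"
    using assms by (subst nn_integral_distr) (auto intro: increment_measurable)
  then show ?thesis
    using increment_distr[OF assms(1) st assms(3)] by (simp add: nn_integral_poisson_mean)
qed simp

lemma increment_exp:
  fixes z :: complex
  assumes "0 \<le> s" "s \<le> t" "t \<le> \<tau>"
  shows "has_bochner_integral M (\<lambda>\<omega>. exp (of_nat (X \<omega> t - X \<omega> s) * z)) (exp (of_real (measure \<mu> {s<..t}) * (exp z - 1)))"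
proof (cases "s = t")
  case False
  then have st: "s < t" using assms by simp
  have "has_bochner_integral (distr M (count_space UNIV) (\<lambda>\<omega>. X \<omega> t - X \<omega> s)) (\<lambda>k. exp (of_nat k * z)) (exp (of_real (measure \<mu> {s<..t}) * (exp z - 1)))"
    using increment_distr[OF assms(1) st assms(3)] by (simp add: poisson_exp)
  then show ?thesis
    using assms by (subst (asm) has_bochner_integral_iff, subst has_bochner_integral_iff)
      (auto simp: integral_distr integrable_distr_eq increment_measurable)
qed (simp add: prob_space has_bochner_integral_iff)

lemma emeasure_jump_measurable [measurable]:
  assumes "A \<in> sets borel"
  shows "(\<lambda>\<omega>. emeasure (jump_measure \<tau> (X \<omega>)) A) \<in> borel_measurable M"
proof -
  have "(\<lambda>\<omega>. emeasure (jump_kernel \<tau> (X \<omega>)) A) \<in> borel_measurable M"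
    using measurable_compose[OF X_meas measurable_emeasure_kernel[OF jump_kernel_measurable[OF \<tau>] assms]] .
  moreover have [measurable]: "(\<lambda>\<omega>. X \<omega> \<tau>) \<in> M \<rightarrow>\<^sub>M count_space UNIV" using \<tau> by (intro X_eval) auto
  ultimately have "(\<lambda>\<omega>. ennreal (1 + real (X \<omega> \<tau>)) * emeasure (jump_kernel \<tau> (X \<omega>)) A) \<in> borel_measurable M"
    by measurable
  moreover have "ennreal (1 + real (X \<omega> \<tau>)) * emeasure (jump_kernel \<tau> (X \<omega>)) A = emeasure (jump_measure \<tau> (X \<omega>)) A" for \<omega>
  proof -
    have "ennreal (1 + real (X \<omega> \<tau>)) * ennreal (1 / (1 + real (X \<omega> \<tau>))) = 1"
      by (subst ennreal_mult[symmetric]) (auto simp: add_pos_nonneg)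
    then show ?thesis
      unfolding jump_kernel_def using assms by (subst emeasure_density_const) (auto simp: mult.assoc[symmetric])
  qed
  ultimately show ?thesis by simp
qed

text \<open>Campbell's formula: on half-open intervals it is the Poisson mean of an increment, and
  induction over the generated sigma-algebra extends it. It is used to see that a Lebesgue null set
  almost surely contains no jump.\<close>

lemma campbell:
  assumes "A \<in> sets borel"
  shows "(\<integral>\<^sup>+\<omega>. emeasure (jump_measure \<tau> (X \<omega>)) A \<partial>M) = emeasure \<mu> A"
proof -
  let ?G = "range (\<lambda>(a, b). {a<..b::real})"
  have 1: "Int_stable ?G"
    by (rule Int_stable_Ioc)
  have 2: "?G \<subseteq> Pow UNIV" by auto
  have gen: "sigma_sets UNIV ?G = sets borel" unfolding borel_sigma_sets_Ioc by simp
  then have 3: "A \<in> sigma_sets UNIV ?G" using assms by simp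
  have UN: "(\<integral>\<^sup>+\<omega>. emeasure (jump_measure \<tau> (X \<omega>)) UNIV \<partial>M) = emeasure \<mu> UNIV"
  proof -
    have "(\<integral>\<^sup>+\<omega>. emeasure (jump_measure \<tau> (X \<omega>)) UNIV \<partial>M) = (\<integral>\<^sup>+\<omega>. ennreal (real (X \<omega> \<tau> - X \<omega> 0)) \<partial>M)"
      using path.emeasure_UNIV[OF X_path] path_spaceD(1)[OF X_space] by (intro nn_integral_cong) simp
    also have "\<dots> = ennreal (measure \<mu> {0<..\<tau>})" using \<tau> by (intro increment_mean) auto
    also have "measure \<mu> {0<..\<tau>} = measure \<mu> UNIV"
      using rate_eq[of 0 \<tau>] \<tau> by (simp add: measure_\<mu>)
    finally show ?thesis by (simp add: \<mu>.emeasure_eq_measure)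
  qed
  from 1 2 3 show ?thesis
  proof (induction rule: sigma_sets_induct_disjoint)
    case (basic A)
    then obtain a b where A: "A = {a<..b}" by auto
    define cl where "cl t = max 0 (min \<tau> t)" for t
    show ?case
    proof (cases "a \<le> b")
      case True
      have cl: "0 \<le> cl a" "cl a \<le> cl b" "cl b \<le> \<tau>" using True \<tau> by (auto simp: cl_def)
      have "(\<integral>\<^sup>+\<omega>. emeasure (jump_measure \<tau> (X \<omega>)) A \<partial>M) = (\<integral>\<^sup>+\<omega>. ennreal (real (X \<omega> (cl b) - X \<omega> (cl a))) \<partial>M)"
      proof (rule nn_integral_cong)
        fix \<omega> assume "\<omega> \<in> space M"
        then interpret path \<tau> "X \<omega>" by (rule X_path)
        show "emeasure (jump_measure \<tau> (X \<omega>)) A = ennreal (real (X \<omega> (cl b) - X \<omega> (cl a)))"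
          unfolding A emeasure_Ioc[OF True] using F_mono[OF True] by (simp add: cl_def of_nat_diff)
      qed
      also have "\<dots> = ennreal (measure \<mu> {cl a<..cl b})" by (rule increment_mean[OF cl])
      \<comment> \<open>If the interval starts before 0, clamping it to the window loses the point
        0, which lies in (a, b] but not in (cl a, cl b]. This point has no
        \<open>\<mu>\<close>-mass.\<close>
      also have "measure \<mu> {cl a<..cl b} = measure \<mu> {a<..b}"
      proof (cases "a < 0 \<and> 0 \<le> b")
        case True
        then have "{a<..b} \<inter> {0..\<tau>} = {cl a..cl b}" using \<tau> by (auto simp: cl_def)
        moreover have "measure \<mu> {cl a<..cl b} = (LINT t:{cl a..cl b}|lborel. lam t)"
        proof (cases "cl a = cl b")
          case True
          then have "{cl b} \<inter> {0..\<tau>} = {cl a..cl b}" using cl by auto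
          then show ?thesis using measure_\<mu>[of "{cl b}"] measure_\<mu>_singleton[of "cl b"] True by simp
        next
          case False
          then show ?thesis using rate_eq[of "cl a" "cl b"] cl by simp
        qed
        ultimately show ?thesis by (simp add: measure_\<mu>)
      next
        case False
        then have "{a<..b} \<inter> {0..\<tau>} = {cl a<..cl b} \<inter> {0..\<tau>}" using \<tau> \<open>a \<le> b\<close> by (auto simp: cl_def)
        then show ?thesis by (simp add: measure_\<mu>)
      qed
      finally show ?thesis by (simp add: A \<mu>.emeasure_eq_measure)
    qed (simp add: A)
  next
    case empty
    then show ?case by simp
  next
    case (compl A)
    then have [measurable]: "A \<in> sets borel" by (simp add: gen)
    have "(\<integral>\<^sup>+\<omega>. emeasure (jump_measure \<tau> (X \<omega>)) (UNIV - A) \<partial>M) = (\<integral>\<^sup>+\<omega>. emeasure (jump_measure \<tau> (X \<omega>)) UNIV - emeasure (jump_measure \<tau> (X \<omega>)) A \<partial>M)"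
    proof (rule nn_integral_cong)
      fix \<omega> assume "\<omega> \<in> space M"
      then interpret path \<tau> "X \<omega>" by (rule X_path)
      interpret finite_measure "jump_measure \<tau> (X \<omega>)" by (rule finite_measure_jump)
      show "emeasure (jump_measure \<tau> (X \<omega>)) (UNIV - A) = emeasure (jump_measure \<tau> (X \<omega>)) UNIV - emeasure (jump_measure \<tau> (X \<omega>)) A"
        by (intro emeasure_Diff) auto
    qed
    also have "\<dots> = (\<integral>\<^sup>+\<omega>. emeasure (jump_measure \<tau> (X \<omega>)) UNIV \<partial>M) - (\<integral>\<^sup>+\<omega>. emeasure (jump_measure \<tau> (X \<omega>)) A \<partial>M)"
      by (intro nn_integral_diff) (auto simp: compl.IH intro!: AE_I2 emeasure_mono)
    also have "\<dots> = emeasure \<mu> (UNIV - A)"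
      unfolding compl.IH UN by (subst emeasure_Diff) auto
    finally show ?case .
  next
    case (union A)
    then have [measurable]: "\<And>i. A i \<in> sets borel" by (auto simp: gen)
    have "(\<integral>\<^sup>+\<omega>. emeasure (jump_measure \<tau> (X \<omega>)) (\<Union>i. A i) \<partial>M) = (\<integral>\<^sup>+\<omega>. (\<Sum>i. emeasure (jump_measure \<tau> (X \<omega>)) (A i)) \<partial>M)"
      using union by (intro nn_integral_cong suminf_emeasure[symmetric]) auto
    also have "\<dots> = (\<Sum>i. \<integral>\<^sup>+\<omega>. emeasure (jump_measure \<tau> (X \<omega>)) (A i) \<partial>M)"
      by (intro nn_integral_suminf) auto
    also have "\<dots> = emeasure \<mu> (\<Union>i. A i)"
      unfolding union.IH using union by (intro suminf_emeasure) auto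
    finally show ?case .
  qed
qed

lemma AE_jump_null:
  assumes "A \<in> null_sets lborel"
  shows "AE \<omega> in M. emeasure (jump_measure \<tau> (X \<omega>)) A = 0"
proof -
  have A: "A \<in> sets borel" "A \<in> null_sets lborel" using assms by auto
  have "emeasure \<mu> A = 0"
    unfolding \<mu>_def using absolutely_continuousI_density[of "\<lambda>t. ennreal (indicator {0..\<tau>} t * lam t)" lborel] A
    by (auto simp: absolutely_continuous_def null_sets_def)
  then have "(\<integral>\<^sup>+\<omega>. emeasure (jump_measure \<tau> (X \<omega>)) A \<partial>M) = 0" using campbell[OF A(1)] by simp
  then show ?thesis
    by (subst (asm) nn_integral_0_iff_AE) (auto intro: emeasure_jump_measurable A)
qed

end

text \<open>Logarithms of intensity ratios are only Borel, because h is, while Riemann sums need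
  continuity. Measurable functions are limits of continuous ones off a null set, and clipping at B
  keeps the sequence bounded.\<close>

lemma bounded_continuous_approx:
  fixes f :: "real \<Rightarrow> real"
  assumes "f \<in> borel_measurable borel" and B: "\<And>t. \<bar>f t\<bar> \<le> B"
  obtains h N where "N \<in> null_sets lborel" "\<And>n. continuous_on UNIV (h n)" "\<And>n t. \<bar>h n t\<bar> \<le> B"
    "\<And>t. t \<notin> N \<Longrightarrow> (\<lambda>n::nat. h n t) \<longlonglongrightarrow> f t"
proof -
  have "f \<in> borel_measurable lebesgue" using assms(1) by (intro measurable_completion) simp
  then have "f measurable_on UNIV" by (rule lebesgue_measurable_imp_measurable_on) simp
  then obtain N' g where N': "negligible N'" and g: "\<And>n. continuous_on UNIV (g n)"
    "\<And>t. t \<notin> N' \<Longrightarrow> (\<lambda>n::nat. g n t) \<longlonglongrightarrow> f t"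
    unfolding measurable_on_def by auto
  obtain N where N: "N \<in> null_sets lborel" "N' \<subseteq> N"
    using N' unfolding negligible_iff_null_sets null_sets_completion_iff2 by auto
  have "0 \<le> B" using B[of 0] by linarith
  show ?thesis
  proof (rule that[of N "\<lambda>n t. max (- B) (min B (g n t))"])
    show "continuous_on UNIV (\<lambda>t. max (- B) (min B (g n t)))" for n
      by (intro continuous_intros g)
    show "\<bar>max (- B) (min B (g n t))\<bar> \<le> B" for n t using \<open>0 \<le> B\<close> by auto
    fix t assume "t \<notin> N"
    then have "(\<lambda>n. max (- B) (min B (g n t))) \<longlonglongrightarrow> max (- B) (min B (f t))"
      using N by (intro tendsto_intros g) auto
    also have "max (- B) (min B (f t)) = f t" using B[of t] by auto
    finally show "(\<lambda>n. max (- B) (min B (g n t))) \<longlonglongrightarrow> f t" .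
  qed (rule N)
qed

section \<open>The Laplace functional\<close>

context poisson_path
begin

text \<open>Exponential moments of the total count dominate all the limits taken under M for the
  Laplace functional.\<close>

lemma count_exp_integrable: "integrable M (\<lambda>\<omega>. exp (B * real (X \<omega> \<tau>)))"
proof -
  have "integrable M (\<lambda>\<omega>. exp (of_nat (X \<omega> \<tau> - X \<omega> 0) * complex_of_real B))"
    using increment_exp[of 0 \<tau> "of_real B"] \<tau> by (auto simp: has_bochner_integral_iff)
  then have "integrable M (\<lambda>\<omega>. norm (exp (of_nat (X \<omega> \<tau> - X \<omega> 0) * complex_of_real B)))"
    by (rule integrable_norm)
  also have "?this \<longleftrightarrow> ?thesis"
    using path_spaceD(1)[OF X_space] by (intro Bochner_Integration.integrable_cong) (auto simp: mult.commute)
  finally show ?thesis .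
qed

lemma path_integral_X_measurable:
  assumes "f \<in> borel_measurable borel" "\<And>t. t \<in> {0..\<tau>} \<Longrightarrow> \<bar>f t\<bar> \<le> B"
  shows "(\<lambda>\<omega>. path_integral \<tau> f (X \<omega>)) \<in> borel_measurable M"
  by (rule measurable_compose[OF X_meas path_integral_measurable1[OF \<tau> assms]])

text \<open>Independence of increments over disjoint cells factorises the exponential. The exponents
  are arbitrary complex numbers, one for each cell.\<close>

lemma laplace_step:
  fixes z :: "nat \<Rightarrow> complex"
  shows "has_bochner_integral M (\<lambda>\<omega>. exp (\<Sum>i<k. of_nat (X \<omega> (real (Suc i) * \<tau> / real k) - X \<omega> (real i * \<tau> / real k)) * z i))
     (exp (\<Sum>i<k. of_real (measure \<mu> {real i * \<tau> / real k<..real (Suc i) * \<tau> / real k}) * (exp (z i) - 1)))"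
proof (cases "k = 0")
  case False
  define t where "t i = real i * \<tau> / real k" for i
  have t_range: "t i \<in> {0..\<tau>}" if "i \<le> k" for i
  proof -
    have "real i * \<tau> \<le> real k * \<tau>" using that \<tau> by (intro mult_right_mono) auto
    then show ?thesis using \<tau> False by (simp add: t_def divide_le_eq mult.commute)
  qed
  have t_mono: "t i \<le> t j" if "i \<le> j" for i j
    unfolding t_def using that \<tau> by (intro divide_right_mono mult_right_mono) auto
  have "indep_vars (\<lambda>_. count_space UNIV) (\<lambda>i \<omega>. X \<omega> (t (Suc i)) - X \<omega> (t i)) {..<k}"
    using pp t_range t_mono unfolding poisson_process_def
    by (intro mp[OF spec[OF spec[OF conjunct2[OF conjunct2[OF conjunct2[OF pp[unfolded poisson_process_def]]]], of k], of t]])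
       (auto simp: mono_on_def)
  from indep_vars_compose2[OF this, of "\<lambda>i d. exp (of_nat d * z i)" "\<lambda>_. borel"]
  have ind: "indep_vars (\<lambda>_. borel) (\<lambda>i \<omega>. exp (of_nat (X \<omega> (t (Suc i)) - X \<omega> (t i)) * z i)) {..<k}"
    by simp
  have ex: "has_bochner_integral M (\<lambda>\<omega>. exp (of_nat (X \<omega> (t (Suc i)) - X \<omega> (t i)) * z i))
       (exp (of_real (measure \<mu> {t i<..t (Suc i)}) * (exp (z i) - 1)))" if "i < k" for i
    using t_range[of i] t_range[of "Suc i"] t_mono[of i "Suc i"] that by (intro increment_exp) auto
  have "has_bochner_integral M (\<lambda>\<omega>. \<Prod>i<k. exp (of_nat (X \<omega> (t (Suc i)) - X \<omega> (t i)) * z i))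
     (\<Prod>i<k. exp (of_real (measure \<mu> {t i<..t (Suc i)}) * (exp (z i) - 1)))"
    using indep_vars_integrable[OF _ ind] indep_vars_lebesgue_integral[OF _ ind] ex
    by (auto simp: has_bochner_integral_iff)
  then show ?thesis by (simp add: exp_sum t_def)
qed (simp add: has_bochner_integral_iff prob_space)

text \<open>Both sides are limits of their step versions: the left exponent pathwise, the right one
  by Riemann sums for the intensity measure. B bounds f only, since the modulus of the exponential
  is determined by the real part. Keeping f and g apart serves exponential moments and
  characteristic functions at once.\<close>

lemma laplace_cont:
  assumes f: "continuous_on UNIV f" and g: "continuous_on UNIV g" and B: "\<And>t. \<bar>f t\<bar> \<le> B"
  shows "has_bochner_integral M (\<lambda>\<omega>. exp (of_real (path_integral \<tau> f (X \<omega>)) + \<i> * of_real (path_integral \<tau> g (X \<omega>))))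
     (exp (CLINT t|\<mu>. exp (of_real (f t) + \<i> * of_real (g t)) - 1))"
proof -
  define z where "z t = of_real (f t) + \<i> * of_real (g t)" for t
  define u where "u k i = real i * \<tau> / real k" for k i :: nat
  define L where "L k = (\<lambda>\<omega>. exp (\<Sum>i<k. of_nat (X \<omega> (u k (Suc i)) - X \<omega> (u k i)) * z (u k (Suc i))))" for k
  define G where "G = (\<lambda>\<omega>. exp (of_real (path_integral \<tau> f (X \<omega>)) + \<i> * of_real (path_integral \<tau> g (X \<omega>))))"
  have fb [measurable]: "f \<in> borel_measurable borel" "g \<in> borel_measurable borel"
    using f g by (auto intro: borel_measurable_continuous_onI)
  have u_range: "u k i \<in> {0..\<tau>}" if "i \<le> k" for i k
  proof (cases "k = 0")
    case False
    have "real i * \<tau> \<le> real k * \<tau>" using that \<tau> by (intro mult_right_mono) auto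
    then show ?thesis using \<tau> False by (simp add: u_def divide_le_eq mult.commute)
  qed (use \<tau> in \<open>simp add: u_def\<close>)
  have u_mono: "u k i \<le> u k j" if "i \<le> j" for i j k
    unfolding u_def using that \<tau> by (intro divide_right_mono mult_right_mono) auto
  have step: "has_bochner_integral M (L k) (exp (\<Sum>i<k. of_real (measure \<mu> {u k i<..u k (Suc i)}) * (exp (z (u k (Suc i))) - 1)))" for k
    unfolding L_def u_def by (rule laplace_step)
  have B0: "0 \<le> B" using B[of 0] by linarith
  have inc: "real (X \<omega> (u k (Suc i)) - X \<omega> (u k i)) = real (X \<omega> (u k (Suc i))) - real (X \<omega> (u k i))"
    if "\<omega> \<in> space M" "i < k" for \<omega> k i
    using mono_onD[OF path_spaceD(2)[OF X_space[OF that(1)]], of "u k i" "u k (Suc i)"] u_range[of i k] u_range[of "Suc i" k] u_mono[of i "Suc i" k] that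
    by (simp add: of_nat_diff)
  have jump: "measure (jump_measure \<tau> (X \<omega>)) {u k i<..u k (Suc i)} = real (X \<omega> (u k (Suc i)) - X \<omega> (u k i))"
    if "\<omega> \<in> space M" "i < k" for \<omega> k i
  proof -
    interpret path \<tau> "X \<omega>" by (rule X_path[OF that(1)])
    show ?thesis using measure_Ioc[OF u_mono[of i "Suc i" k]] u_range[of i k] u_range[of "Suc i" k] that inc[OF that]
      by simp
  qed
  have rs: "(\<lambda>k. \<Sum>i<k. real (X \<omega> (u k (Suc i)) - X \<omega> (u k i)) * v (u k (Suc i))) \<longlonglongrightarrow> path_integral \<tau> v (X \<omega>)"
    if "\<omega> \<in> space M" "continuous_on UNIV v" for \<omega> v
  proof -
    interpret path \<tau> "X \<omega>" by (rule X_path[OF that(1)])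
    have vm: "v \<in> borel_measurable borel" using that(2) by (rule borel_measurable_continuous_onI)
    have "(\<lambda>k. \<Sum>i<k. measure (jump_measure \<tau> (X \<omega>)) {u k i<..u k (Suc i)} *\<^sub>R v (u k (Suc i))) \<longlonglongrightarrow> path_integral \<tau> v (X \<omega>)"
      unfolding path_integral_Ioc[OF vm] u_def
      by (rule riemann_stieltjes[OF finite_measure_jump sets_jump_measure _ \<tau>]) (rule continuous_on_subset[OF that(2)], simp)
    moreover have "(\<Sum>i<k. measure (jump_measure \<tau> (X \<omega>)) {u k i<..u k (Suc i)} *\<^sub>R v (u k (Suc i)))
       = (\<Sum>i<k. real (X \<omega> (u k (Suc i)) - X \<omega> (u k i)) * v (u k (Suc i)))" for k
      using jump[OF that(1)] by (intro sum.cong) auto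
    ultimately show ?thesis by simp
  qed
  have lim: "(\<lambda>k. L k \<omega>) \<longlonglongrightarrow> G \<omega>" if "\<omega> \<in> space M" for \<omega>
  proof -
    have "(\<lambda>k. exp (of_real (\<Sum>i<k. real (X \<omega> (u k (Suc i)) - X \<omega> (u k i)) * f (u k (Suc i)))
         + \<i> * of_real (\<Sum>i<k. real (X \<omega> (u k (Suc i)) - X \<omega> (u k i)) * g (u k (Suc i))))) \<longlonglongrightarrow> G \<omega>"
      unfolding G_def using rs[OF that f] rs[OF that g] by (intro tendsto_intros)
    also have "(\<lambda>k. exp (of_real (\<Sum>i<k. real (X \<omega> (u k (Suc i)) - X \<omega> (u k i)) * f (u k (Suc i)))
         + \<i> * of_real (\<Sum>i<k. real (X \<omega> (u k (Suc i)) - X \<omega> (u k i)) * g (u k (Suc i))))) = (\<lambda>k. L k \<omega>)"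
      unfolding L_def z_def by (intro ext arg_cong[where f = exp]) (simp add: sum.distrib distrib_left sum_distrib_left mult_ac)
    finally show ?thesis .
  qed
  have bound: "norm (L k \<omega>) \<le> exp (B * real (X \<omega> \<tau>))" if "\<omega> \<in> space M" for k \<omega>
  proof -
    have "Re (\<Sum>i<k. of_nat (X \<omega> (u k (Suc i)) - X \<omega> (u k i)) * z (u k (Suc i)))
       = (\<Sum>i<k. real (X \<omega> (u k (Suc i)) - X \<omega> (u k i)) * f (u k (Suc i)))"
      by (simp add: z_def)
    also have "\<dots> \<le> (\<Sum>i<k. (real (X \<omega> (u k (Suc i))) - real (X \<omega> (u k i))) * B)"
    proof (intro sum_mono)
      fix i assume "i \<in> {..<k}"
      then have e: "real (X \<omega> (u k (Suc i))) - real (X \<omega> (u k i)) = real (X \<omega> (u k (Suc i)) - X \<omega> (u k i))"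
        using inc[OF that, of i k] by simp
      have "f (u k (Suc i)) \<le> B" using B[of "u k (Suc i)"] by linarith
      then show "real (X \<omega> (u k (Suc i)) - X \<omega> (u k i)) * f (u k (Suc i)) \<le> (real (X \<omega> (u k (Suc i))) - real (X \<omega> (u k i))) * B"
        unfolding e by (intro mult_left_mono) auto
    qed
    also have "\<dots> = (real (X \<omega> (u k k)) - real (X \<omega> (u k 0))) * B"
      unfolding sum_distrib_right[symmetric] by (subst sum_lessThan_telescope) simp
    \<comment> \<open>\<open>u k k\<close> is \<tau> for positive k, but 0 for k = 0 because
      division by zero yields 0. Monotonicity of the path covers both cases.\<close>
    also have "\<dots> \<le> real (X \<omega> \<tau>) * B"
    proof -
      have "X \<omega> (u k k) \<le> X \<omega> \<tau>"
        using mono_onD[OF path_spaceD(2)[OF X_space[OF that]], of "u k k" \<tau>] u_range[of k k] \<tau> by auto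
      then show ?thesis using B0 by (intro mult_right_mono) auto
    qed
    finally show ?thesis unfolding L_def by (simp add: norm_exp_eq_Re mult.commute)
  qed
  have Gm: "G \<in> borel_measurable M"
  proof -
    have "continuous_on {0..\<tau>} g" by (rule continuous_on_subset[OF g]) simp
    then have "bounded (g ` {0..\<tau>})" by (intro compact_imp_bounded compact_continuous_image) auto
    then obtain B' where "\<forall>t\<in>{0..\<tau>}. \<bar>g t\<bar> \<le> B'" unfolding bounded_iff by auto
    then have B': "\<And>t. t \<in> {0..\<tau>} \<Longrightarrow> \<bar>g t\<bar> \<le> B'" by blast
    have [measurable]: "(\<lambda>\<omega>. path_integral \<tau> f (X \<omega>)) \<in> borel_measurable M" "(\<lambda>\<omega>. path_integral \<tau> g (X \<omega>)) \<in> borel_measurable M"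
      by (rule path_integral_X_measurable[OF fb(1) B], rule path_integral_X_measurable[OF fb(2) B'])
    show ?thesis unfolding G_def by measurable
  qed
  have Lm: "L k \<in> borel_measurable M" for k using step[of k] by (auto simp: has_bochner_integral_iff)
  have dom: "AE \<omega> in M. norm (L k \<omega>) \<le> exp (B * real (X \<omega> \<tau>))" for k using bound by (intro AE_I2)
  have lim': "AE \<omega> in M. (\<lambda>k. L k \<omega>) \<longlonglongrightarrow> G \<omega>" using lim by (intro AE_I2)
  have "integrable M G"
    by (rule integrable_dominated_convergence[OF Gm Lm count_exp_integrable lim' dom])
  moreover have "(\<lambda>k. CLINT \<omega>|M. L k \<omega>) \<longlonglongrightarrow> (CLINT \<omega>|M. G \<omega>)"
    by (rule integral_dominated_convergence[OF Gm Lm count_exp_integrable lim' dom])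
  moreover have "(\<lambda>k. CLINT \<omega>|M. L k \<omega>) \<longlonglongrightarrow> exp (CLINT t|\<mu>. exp (z t) - 1)"
  proof -
    have zc: "continuous_on UNIV z" unfolding z_def by (intro continuous_intros f g)
    have "(\<lambda>k. \<Sum>i<k. measure \<mu> {u k i<..u k (Suc i)} *\<^sub>R (exp (z (u k (Suc i))) - 1)) \<longlonglongrightarrow> (CLINT t:{0<..\<tau>}|\<mu>. exp (z t) - 1)"
      unfolding u_def
      by (rule riemann_stieltjes[OF \<mu>.finite_measure_axioms sets_\<mu> _ \<tau>]) (intro continuous_intros continuous_on_subset[OF zc], simp)
    moreover have "(CLINT t:{0<..\<tau>}|\<mu>. exp (z t) - 1) = (CLINT t|\<mu>. exp (z t) - 1)"
    proof -
      have [measurable]: "z \<in> borel_measurable borel" using zc by (rule borel_measurable_continuous_onI)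
      have "AE t in \<mu>. t \<in> {0<..\<tau>}"
        unfolding \<mu>_def by (subst AE_density, simp) (use AE_lborel_singleton[of 0] in eventually_elim, auto simp: indicator_def)
      then show ?thesis
        unfolding set_lebesgue_integral_def by (intro integral_cong_AE) (auto simp: indicator_def)
    qed
    ultimately have "(\<lambda>k. exp (\<Sum>i<k. measure \<mu> {u k i<..u k (Suc i)} *\<^sub>R (exp (z (u k (Suc i))) - 1))) \<longlonglongrightarrow> exp (CLINT t|\<mu>. exp (z t) - 1)"
      by (intro tendsto_exp) simp
    moreover have "(CLINT \<omega>|M. L k \<omega>) = exp (\<Sum>i<k. measure \<mu> {u k i<..u k (Suc i)} *\<^sub>R (exp (z (u k (Suc i))) - 1))" for k
      using step[of k] by (simp add: has_bochner_integral_iff scaleR_conv_of_real)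
    ultimately show ?thesis by simp
  qed
  ultimately show ?thesis
    unfolding has_bochner_integral_iff G_def z_def using LIMSEQ_unique by blast
qed

text \<open>Continuous approximations converge off a Lebesgue null set, which by Campbell's formula
  almost surely contains no jump. Dominated convergence is then used three times: for the path
  integrals, for their exponentials under M, and for the intensity integral.\<close>

lemma laplace:
  assumes f: "f \<in> borel_measurable borel" and g: "g \<in> borel_measurable borel"
    and B: "\<And>t. \<bar>f t\<bar> \<le> B" "\<And>t. \<bar>g t\<bar> \<le> B"
  shows "has_bochner_integral M (\<lambda>\<omega>. exp (of_real (path_integral \<tau> f (X \<omega>)) + \<i> * of_real (path_integral \<tau> g (X \<omega>))))
     (exp (CLINT t|\<mu>. exp (of_real (f t) + \<i> * of_real (g t)) - 1))"
proof -
  obtain fn N where fn: "N \<in> null_sets lborel" "\<And>n. continuous_on UNIV (fn n)" "\<And>n t. \<bar>fn n t\<bar> \<le> B"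
    "\<And>t. t \<notin> N \<Longrightarrow> (\<lambda>n::nat. fn n t) \<longlonglongrightarrow> f t"
    using bounded_continuous_approx[OF f B(1)] by metis
  obtain gn N' where gn: "N' \<in> null_sets lborel" "\<And>n. continuous_on UNIV (gn n)" "\<And>n t. \<bar>gn n t\<bar> \<le> B"
    "\<And>t. t \<notin> N' \<Longrightarrow> (\<lambda>n::nat. gn n t) \<longlonglongrightarrow> g t"
    using bounded_continuous_approx[OF g B(2)] by metis
  have m: "fn n \<in> borel_measurable borel" "gn n \<in> borel_measurable borel" for n
    using fn(2) gn(2) by (auto intro: borel_measurable_continuous_onI)
  note [measurable] = m f g
  define NN where "NN = N \<union> N'"
  have NN: "NN \<in> null_sets lborel" unfolding NN_def using fn gn by (intro null_sets.Un)
  define L where "L n = (\<lambda>\<omega>. exp (of_real (path_integral \<tau> (fn n) (X \<omega>)) + \<i> * of_real (path_integral \<tau> (gn n) (X \<omega>))))" for n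
  define G where "G = (\<lambda>\<omega>. exp (of_real (path_integral \<tau> f (X \<omega>)) + \<i> * of_real (path_integral \<tau> g (X \<omega>))))"
  have pim [measurable]: "(\<lambda>\<omega>. path_integral \<tau> v (X \<omega>)) \<in> borel_measurable M"
    if "v \<in> borel_measurable borel" "\<And>t. \<bar>v t\<bar> \<le> B" for v
    using that by (rule path_integral_X_measurable)
  have Gm: "G \<in> borel_measurable M" unfolding G_def using pim[OF f B(1)] pim[OF g B(2)] by measurable
  have Lm: "L n \<in> borel_measurable M" for n unfolding L_def using pim[OF m(1) fn(3)] pim[OF m(2) gn(3)] by measurable
  have pl: "(\<lambda>n. path_integral \<tau> (vn n) (X \<omega>)) \<longlonglongrightarrow> path_integral \<tau> v (X \<omega>)"
    if w: "\<omega> \<in> space M" "emeasure (jump_measure \<tau> (X \<omega>)) NN = 0" and v: "v \<in> borel_measurable borel" "\<And>n. vn n \<in> borel_measurable borel"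
      "\<And>n t. \<bar>vn n t\<bar> \<le> B" "\<And>t. t \<notin> NN \<Longrightarrow> (\<lambda>n::nat. vn n t) \<longlonglongrightarrow> v t" for \<omega> vn v
  proof -
    interpret path \<tau> "X \<omega>" by (rule X_path[OF w(1)])
    interpret J: finite_measure "jump_measure \<tau> (X \<omega>)" by (rule finite_measure_jump)
    note [measurable] = v(1,2)
    have "NN \<in> null_sets (jump_measure \<tau> (X \<omega>))" using NN w by (auto simp: null_sets_def)
    from AE_not_in[OF this] have ae: "AE t in jump_measure \<tau> (X \<omega>). t \<notin> NN" .
    have B0: "B \<ge> 0" using B(1)[of 0] by linarith
    show ?thesis
      unfolding path_integral_eq set_lebesgue_integral_def
    proof (rule integral_dominated_convergence[where w = "\<lambda>_. B"])
      show "AE t in jump_measure \<tau> (X \<omega>). (\<lambda>n. indicat_real {0..\<tau>} t *\<^sub>R vn n t) \<longlonglongrightarrow> indicat_real {0..\<tau>} t *\<^sub>R v t"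
        using ae by eventually_elim (intro tendsto_intros v)
      show "AE t in jump_measure \<tau> (X \<omega>). norm (indicat_real {0..\<tau>} t *\<^sub>R vn n t) \<le> B" for n
        using v(3) B0 by (intro AE_I2) (auto simp: indicator_def)
      show "integrable (jump_measure \<tau> (X \<omega>)) (\<lambda>_. B)" by simp
    qed measurable
  qed
  have lim: "AE \<omega> in M. (\<lambda>n. L n \<omega>) \<longlonglongrightarrow> G \<omega>"
    using AE_jump_null[OF NN] AE_space
  proof eventually_elim
    fix \<omega> assume w: "\<omega> \<in> space M" "emeasure (jump_measure \<tau> (X \<omega>)) NN = 0"
    have "(\<lambda>n. path_integral \<tau> (fn n) (X \<omega>)) \<longlonglongrightarrow> path_integral \<tau> f (X \<omega>)"
      by (rule pl[OF w f m(1) fn(3)]) (auto intro: fn(4) simp: NN_def)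
    moreover have "(\<lambda>n. path_integral \<tau> (gn n) (X \<omega>)) \<longlonglongrightarrow> path_integral \<tau> g (X \<omega>)"
      by (rule pl[OF w g m(2) gn(3)]) (auto intro: gn(4) simp: NN_def)
    ultimately show "(\<lambda>n. L n \<omega>) \<longlonglongrightarrow> G \<omega>"
      unfolding L_def G_def by (intro tendsto_intros)
  qed
  have dom: "AE \<omega> in M. norm (L n \<omega>) \<le> exp (B * real (X \<omega> \<tau>))" for n
  proof (intro AE_I2)
    fix \<omega> assume w: "\<omega> \<in> space M"
    interpret path \<tau> "X \<omega>" by (rule X_path[OF w])
    show "norm (L n \<omega>) \<le> exp (B * real (X \<omega> \<tau>))"
      unfolding L_def using path_integral_bound[OF m(1) fn(3), of n] by (simp add: norm_exp_eq_Re)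
  qed
  have "integrable M G"
    by (rule integrable_dominated_convergence[OF Gm Lm count_exp_integrable lim dom])
  moreover have "(\<lambda>n. CLINT \<omega>|M. L n \<omega>) \<longlonglongrightarrow> (CLINT \<omega>|M. G \<omega>)"
    by (rule integral_dominated_convergence[OF Gm Lm count_exp_integrable lim dom])
  moreover have "(\<lambda>n. CLINT \<omega>|M. L n \<omega>) \<longlonglongrightarrow> exp (CLINT t|\<mu>. exp (of_real (f t) + \<i> * of_real (g t)) - 1)"
  proof -
    have "(CLINT \<omega>|M. L n \<omega>) = exp (CLINT t|\<mu>. exp (of_real (fn n t) + \<i> * of_real (gn n t)) - 1)" for n
      using laplace_cont[OF fn(2) gn(2) fn(3)] by (simp add: has_bochner_integral_iff L_def)
    moreover have "(\<lambda>n. CLINT t|\<mu>. exp (of_real (fn n t) + \<i> * of_real (gn n t)) - 1) \<longlonglongrightarrow> (CLINT t|\<mu>. exp (of_real (f t) + \<i> * of_real (g t)) - 1)"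
    proof (rule integral_dominated_convergence[where w = "\<lambda>_. exp B + 1"])
      have "AE t in lborel. t \<notin> NN" by (rule AE_not_in[OF NN])
      then have ae: "AE t in \<mu>. t \<notin> NN" unfolding \<mu>_def by (subst AE_density) auto
      show "AE t in \<mu>. (\<lambda>n. exp (of_real (fn n t) + \<i> * of_real (gn n t)) - 1) \<longlonglongrightarrow> exp (complex_of_real (f t) + \<i> * of_real (g t)) - 1"
        using ae
      proof eventually_elim
        fix t assume "t \<notin> NN"
        then show "(\<lambda>n. exp (of_real (fn n t) + \<i> * of_real (gn n t)) - 1) \<longlonglongrightarrow> exp (complex_of_real (f t) + \<i> * of_real (g t)) - 1"
          by (intro tendsto_intros fn(4) gn(4)) (auto simp: NN_def)
      qed
      show "AE t in \<mu>. norm (exp (complex_of_real (fn n t) + \<i> * of_real (gn n t)) - 1) \<le> exp B + 1" for n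
      proof (intro AE_I2)
        fix t
        have "norm (exp (complex_of_real (fn n t) + \<i> * of_real (gn n t)) - 1) \<le> norm (exp (complex_of_real (fn n t) + \<i> * of_real (gn n t))) + norm (1 :: complex)"
          by (rule norm_triangle_ineq4)
        also have "norm (exp (complex_of_real (fn n t) + \<i> * of_real (gn n t))) \<le> exp B"
          using fn(3)[of n t] by (simp add: norm_exp_eq_Re)
        finally show "norm (exp (complex_of_real (fn n t) + \<i> * of_real (gn n t)) - 1) \<le> exp B + 1" by simp
      qed
      show "integrable \<mu> (\<lambda>_. exp B + 1)" by simp
    qed measurable
    ultimately show ?thesis by (auto intro: tendsto_exp)
  qed
  ultimately show ?thesis
    unfolding has_bochner_integral_iff G_def using LIMSEQ_unique by blast
qed

end

lemma sample_laplace: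
  assumes ps: "poisson_sample M \<tau> lam n X" and \<tau>: "0 < \<tau>"
    and lam: "set_integrable lborel {0..\<tau>} lam" "0 < c" "\<And>t. t \<in> {0..\<tau>} \<Longrightarrow> c \<le> lam t"
    and f: "f \<in> borel_measurable borel" and g: "g \<in> borel_measurable borel"
    and B: "\<And>t. \<bar>f t\<bar> \<le> B" "\<And>t. \<bar>g t\<bar> \<le> B"
  shows "has_bochner_integral M (\<lambda>\<omega>. exp (of_real (\<Sum>j=1..n. path_integral \<tau> f (X j \<omega>)) + \<i> * of_real (\<Sum>j=1..n. path_integral \<tau> g (X j \<omega>))))
     (exp (of_nat n * (CLINT t|density lborel (\<lambda>t. ennreal (indicator {0..\<tau>} t * lam t)). exp (of_real (f t) + \<i> * of_real (g t)) - 1)))"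
proof -
  interpret prob_space M using ps by (simp add: poisson_sample_def)
  define E where "E = (CLINT t|density lborel (\<lambda>t. ennreal (indicator {0..\<tau>} t * lam t)). exp (complex_of_real (f t) + \<i> * of_real (g t)) - 1)"
  define \<Phi> where "\<Phi> x = exp (complex_of_real (path_integral \<tau> f x) + \<i> * of_real (path_integral \<tau> g x))" for x
  have [measurable]: "path_integral \<tau> f \<in> borel_measurable (path_space \<tau>)" "path_integral \<tau> g \<in> borel_measurable (path_space \<tau>)"
    using f g B by (auto intro!: path_integral_measurable1[OF \<tau>])
  have \<Phi>m: "\<Phi> \<in> borel_measurable (path_space \<tau>)" unfolding \<Phi>_def by measurable
  have "indep_vars (\<lambda>_. path_space \<tau>) X {1..n}" using ps by (simp add: poisson_sample_def)
  from indep_vars_compose2[OF this, of "\<lambda>_. \<Phi>" "\<lambda>_. borel"] \<Phi>m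
  have ind: "indep_vars (\<lambda>_. borel) (\<lambda>j \<omega>. \<Phi> (X j \<omega>)) {1..n}" by simp
  have one: "has_bochner_integral M (\<lambda>\<omega>. \<Phi> (X j \<omega>)) (exp E)" if "j \<in> {1..n}" for j
  proof -
    interpret poisson_path M \<tau> c lam "X j"
      using ps that lam \<tau> by unfold_locales (auto simp: poisson_sample_def)
    show ?thesis using laplace[OF f g B] unfolding \<Phi>_def E_def \<mu>_def .
  qed
  have "has_bochner_integral M (\<lambda>\<omega>. \<Prod>j=1..n. \<Phi> (X j \<omega>)) (\<Prod>j=1..n. exp E)"
    using indep_vars_integrable[OF _ ind] indep_vars_lebesgue_integral[OF _ ind] one
    by (auto simp: has_bochner_integral_iff)
  moreover have "(\<Prod>j=1..n. exp E) = exp (of_nat n * E)" by (simp add: exp_of_nat_mult)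
  moreover have "(\<Prod>j=1..n. \<Phi> (X j \<omega>)) = exp (of_real (\<Sum>j=1..n. path_integral \<tau> f (X j \<omega>)) + \<i> * of_real (\<Sum>j=1..n. path_integral \<tau> g (X j \<omega>)))" for \<omega>
    unfolding \<Phi>_def by (simp add: exp_sum[symmetric] sum.distrib sum_distrib_left)
  ultimately show ?thesis by (simp add: E_def)
qed

section \<open>Integrals of processes with Hellinger bounds\<close>

text \<open>Satisfied by the local likelihood ratio processes, uniformly in the sample size, and by their limit.\<close>

locale hellinger_process = prob_space M for M :: "'a measure" +
  fixes Z :: "real \<Rightarrow> 'a \<Rightarrow> real" and D :: "real set" and q :: "real \<Rightarrow> real" and A C0 C1 :: real
  assumes Z_measurable: "(\<lambda>(\<omega>, w). Z w \<omega>) \<in> borel_measurable (M \<Otimes>\<^sub>M lborel)"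
    and Z_nonneg: "0 \<le> Z w \<omega>"
    and D_borel [measurable]: "D \<in> sets borel"
    and D_nonneg: "w \<in> D \<Longrightarrow> 0 \<le> w"
    and D_down: "w \<in> D \<Longrightarrow> 0 \<le> v \<Longrightarrow> v \<le> w \<Longrightarrow> v \<in> D"
    and q_measurable [measurable]: "q \<in> borel_measurable borel"
    and q_nonneg: "0 \<le> q w"
    and q_block: "(\<integral>\<^sup>+w. ennreal (q w) * indicator (D \<inter> {real k..<real k + 1}) w \<partial>lborel) \<le> ennreal (A * 2 ^ k)"
    and Z_mean: "w \<in> D \<Longrightarrow> has_bochner_integral M (Z w) 1"
    and Z_affinity: "w \<in> D \<Longrightarrow> v \<in> D \<Longrightarrow> \<bar>w - v\<bar> \<le> 1 \<Longrightarrow> 1 - C1 * \<bar>w - v\<bar> \<le> expectation (\<lambda>\<omega>. sqrt (Z w \<omega> * Z v \<omega>))"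
    and Z_decay: "w \<in> D \<Longrightarrow> expectation (\<lambda>\<omega>. sqrt (Z w \<omega>)) \<le> C0 / 16 ^ nat \<lfloor>w\<rfloor>"
    and const_nonneg: "0 \<le> A" "0 \<le> C0" "0 \<le> C1"
begin

sublocale PS: pair_sigma_finite M lborel ..

lemma Z_meas_pair [measurable (raw)]:
  assumes "f \<in> N \<rightarrow>\<^sub>M M" "e \<in> borel_measurable N"
  shows "(\<lambda>x. Z (e x) (f x)) \<in> borel_measurable N"
proof -
  have "(\<lambda>x. (f x, e x)) \<in> N \<rightarrow>\<^sub>M M \<Otimes>\<^sub>M lborel" using assms by simp
  from measurable_compose[OF this Z_measurable] show ?thesis by simp
qed

lemma Z_integrable: "w \<in> D \<Longrightarrow> integrable M (Z w)" and Z_expectation: "w \<in> D \<Longrightarrow> expectation (Z w) = 1"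
  using Z_mean[of w] by (auto simp: has_bochner_integral_iff)

lemma Z_nn: "w \<in> D \<Longrightarrow> (\<integral>\<^sup>+\<omega>. ennreal (Z w \<omega>) \<partial>M) = 1"
  using nn_integral_eq_integral[OF Z_integrable] Z_nonneg Z_expectation by simp

lemma sqrt_prod_integrable:
  assumes "w \<in> D" "v \<in> D"
  shows "integrable M (\<lambda>\<omega>. sqrt (Z w \<omega> * Z v \<omega>))"
proof (rule Bochner_Integration.integrable_bound)
  show "integrable M (\<lambda>\<omega>. Z w \<omega> + Z v \<omega>)" using assms by (intro Bochner_Integration.integrable_add Z_integrable)
  show "AE \<omega> in M. norm (sqrt (Z w \<omega> * Z v \<omega>)) \<le> norm (Z w \<omega> + Z v \<omega>)"
  proof (intro AE_I2)
    fix \<omega>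
    have "sqrt (Z w \<omega> * Z v \<omega>) \<le> (Z w \<omega> + Z v \<omega>) / 2" by (rule arith_geo_mean_sqrt) (auto simp: Z_nonneg)
    then show "norm (sqrt (Z w \<omega> * Z v \<omega>)) \<le> norm (Z w \<omega> + Z v \<omega>)"
      using Z_nonneg[of w \<omega>] Z_nonneg[of v \<omega>] by simp
  qed
qed measurable

text \<open>The affinity bound in Hellinger form: both means are 1, so the mean square is 2 minus
  twice the affinity.\<close>

lemma sqrt_diff_sq:
  assumes "w \<in> D" "v \<in> D" "\<bar>w - v\<bar> \<le> 1"
  shows "integrable M (\<lambda>\<omega>. (sqrt (Z w \<omega>) - sqrt (Z v \<omega>))\<^sup>2)"
    and "expectation (\<lambda>\<omega>. (sqrt (Z w \<omega>) - sqrt (Z v \<omega>))\<^sup>2) \<le> 2 * C1 * \<bar>w - v\<bar>"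
proof -
  have eq: "(sqrt (Z w \<omega>) - sqrt (Z v \<omega>))\<^sup>2 = Z w \<omega> + Z v \<omega> - 2 * sqrt (Z w \<omega> * Z v \<omega>)" for \<omega>
    using Z_nonneg[of w \<omega>] Z_nonneg[of v \<omega>] by (simp add: power2_diff real_sqrt_mult)
  show "integrable M (\<lambda>\<omega>. (sqrt (Z w \<omega>) - sqrt (Z v \<omega>))\<^sup>2)"
    unfolding eq using sqrt_prod_integrable[OF assms(1,2)] Z_integrable assms by simp
  have "expectation (\<lambda>\<omega>. (sqrt (Z w \<omega>) - sqrt (Z v \<omega>))\<^sup>2) = 2 - 2 * expectation (\<lambda>\<omega>. sqrt (Z w \<omega> * Z v \<omega>))"
    unfolding eq using sqrt_prod_integrable[OF assms(1,2)] Z_integrable Z_expectation assms by simp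
  then show "expectation (\<lambda>\<omega>. (sqrt (Z w \<omega>) - sqrt (Z v \<omega>))\<^sup>2) \<le> 2 * C1 * \<bar>w - v\<bar>"
    using Z_affinity[OF assms] by simp
qed

lemma sqrt_diff_sq_nn:
  assumes "w \<in> D" "v \<in> D" "\<bar>w - v\<bar> \<le> 1"
  shows "(\<integral>\<^sup>+\<omega>. ennreal ((sqrt (Z w \<omega>) - sqrt (Z v \<omega>))\<^sup>2) \<partial>M) \<le> ennreal (2 * C1 * \<bar>w - v\<bar>)"
  using sqrt_diff_sq[OF assms] by (subst nn_integral_eq_integral) (auto intro: ennreal_leI)

text \<open>Passage from square roots to the process itself: |x^2 - y^2| = |x - y| * (x + y), and
  the product is split by the arithmetic-geometric mean inequality with weight sqrt \<delta>. The
  squared difference then contributes C1 * sqrt \<delta>, and the sum of the two means contributes 2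
  * sqrt \<delta>.\<close>

lemma abs_diff_nn:
  assumes "w \<in> D" "v \<in> D" "\<bar>w - v\<bar> \<le> 1"
  shows "(\<integral>\<^sup>+\<omega>. ennreal \<bar>Z w \<omega> - Z v \<omega>\<bar> \<partial>M) \<le> ennreal ((C1 + 2) * sqrt \<bar>w - v\<bar>)"
proof (cases "w = v")
  case False
  define \<delta> where "\<delta> = \<bar>w - v\<bar>"
  have \<delta>: "\<delta> > 0" using False by (simp add: \<delta>_def)
  have int: "integrable M (\<lambda>\<omega>. (1 / sqrt \<delta>) * (sqrt (Z w \<omega>) - sqrt (Z v \<omega>))\<^sup>2 / 2 + sqrt \<delta> * (2 * Z w \<omega> + 2 * Z v \<omega>) / 2)"
    using sqrt_diff_sq(1)[OF assms] Z_integrable assms by simp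
  have pw: "\<bar>Z w \<omega> - Z v \<omega>\<bar> \<le> (1 / sqrt \<delta>) * (sqrt (Z w \<omega>) - sqrt (Z v \<omega>))\<^sup>2 / 2 + sqrt \<delta> * (2 * Z w \<omega> + 2 * Z v \<omega>) / 2" for \<omega>
  proof -
    define x y s where "x = sqrt (Z w \<omega>)" and "y = sqrt (Z v \<omega>)" and "s = sqrt \<delta>"
    have s: "s > 0" using \<delta> by (simp add: s_def)
    have Z: "Z w \<omega> = x\<^sup>2" "Z v \<omega> = y\<^sup>2" using Z_nonneg by (auto simp: x_def y_def)
    have xy: "x \<ge> 0" "y \<ge> 0" using Z_nonneg by (auto simp: x_def y_def)
    have "2 * (\<bar>x - y\<bar> * (x + y)) \<le> (1 / s) * (x - y)\<^sup>2 + s * (x + y)\<^sup>2"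
    proof -
      have "0 \<le> (\<bar>x - y\<bar> - s * (x + y))\<^sup>2 / s" using s by simp
      also have "\<dots> = (1 / s) * (x - y)\<^sup>2 + s * (x + y)\<^sup>2 - 2 * (\<bar>x - y\<bar> * (x + y))"
        using s by (simp add: power2_diff power_mult_distrib add_divide_distrib diff_divide_distrib) (simp add: power2_eq_square)
      finally show ?thesis by simp
    qed
    moreover have "\<bar>x\<^sup>2 - y\<^sup>2\<bar> = \<bar>x - y\<bar> * (x + y)"
      using xy by (simp add: power2_eq_square square_diff_square_factored abs_mult mult.commute)
    moreover have "s * (x + y)\<^sup>2 \<le> s * (2 * x\<^sup>2 + 2 * y\<^sup>2)"
      using s sum_squares_bound[of x y] by (intro mult_left_mono) (auto simp: power2_sum)
    moreover have "a \<le> b / 2 + c / 2" if "2 * e \<le> b + d" "a = e" "d \<le> c" for a b c d e :: real using that by linarith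
    ultimately have "\<bar>x\<^sup>2 - y\<^sup>2\<bar> \<le> (1 / s) * (x - y)\<^sup>2 / 2 + s * (2 * x\<^sup>2 + 2 * y\<^sup>2) / 2" by blast
    moreover have "sqrt (x\<^sup>2) = x" "sqrt (y\<^sup>2) = y" using xy by simp_all
    ultimately show ?thesis unfolding Z s_def[symmetric] by simp
  qed
  have "(\<integral>\<^sup>+\<omega>. ennreal \<bar>Z w \<omega> - Z v \<omega>\<bar> \<partial>M) = ennreal (expectation (\<lambda>\<omega>. \<bar>Z w \<omega> - Z v \<omega>\<bar>))"
    using Z_integrable assms by (intro nn_integral_eq_integral) auto
  also have "expectation (\<lambda>\<omega>. \<bar>Z w \<omega> - Z v \<omega>\<bar>) \<le> expectation (\<lambda>\<omega>. (1 / sqrt \<delta>) * (sqrt (Z w \<omega>) - sqrt (Z v \<omega>))\<^sup>2 / 2 + sqrt \<delta> * (2 * Z w \<omega> + 2 * Z v \<omega>) / 2)"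
    using Z_integrable assms int pw by (intro integral_mono) auto
  also have "\<dots> = (1 / sqrt \<delta>) * expectation (\<lambda>\<omega>. (sqrt (Z w \<omega>) - sqrt (Z v \<omega>))\<^sup>2) / 2 + sqrt \<delta> * 2"
    using sqrt_diff_sq(1)[OF assms] Z_integrable Z_expectation assms by simp
  also have "\<dots> \<le> (1 / sqrt \<delta>) * (2 * C1 * \<delta>) / 2 + sqrt \<delta> * 2"
    using sqrt_diff_sq(2)[OF assms] \<delta> unfolding \<delta>_def[symmetric]
    by (intro add_right_mono divide_right_mono mult_left_mono) auto
  also have "\<dots> = (C1 + 2) * sqrt \<delta>"
  proof -
    have "(1 / sqrt \<delta>) * (2 * C1 * \<delta>) / 2 = C1 * (\<delta> / sqrt \<delta>)" by simp
    then show ?thesis using \<delta> by (simp add: real_div_sqrt algebra_simps)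
  qed
  finally show ?thesis by (simp add: \<delta>_def ennreal_leI)
qed simp

text \<open>On \<open>[k, k + 1)\<close> the process is compared with its values on the grid of mesh \<open>4 ^ - k\<close>. At a grid point \<open>sqrt Z\<close> exceeds
  \<open>2 ^ - k\<close> with probability at most \<open>C0 * 8 ^ - k\<close>, which survives the union over \<open>4 ^ k\<close> points. The weight \<open>q\<close> costs a
  factor \<open>2 ^ k\<close>, against \<open>4 ^ - k\<close> from the square of the bound at the grid point and from the mesh.\<close>

definition blk :: "real \<Rightarrow> nat" where "blk w = nat \<lfloor>w\<rfloor>"

definition disc :: "real \<Rightarrow> real" where "disc w = of_int \<lfloor>w * 4 ^ blk w\<rfloor> / 4 ^ blk w"

lemma blk_bounds: "0 \<le> w \<Longrightarrow> real (blk w) \<le> w" "0 \<le> w \<Longrightarrow> w < real (blk w) + 1"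
  unfolding blk_def by linarith+

lemma blk_measurable [measurable]: "blk \<in> borel \<rightarrow>\<^sub>M count_space UNIV"
  unfolding blk_def by measurable

lemma disc_measurable [measurable]: "disc \<in> borel_measurable borel"
  unfolding disc_def by measurable

lemma disc_bounds:
  assumes "0 \<le> w"
  shows "disc w \<le> w" "w - disc w \<le> 1 / 4 ^ blk w" "0 \<le> disc w"
    "\<exists>i<4 ^ blk w. disc w = real (blk w) + real i / 4 ^ blk w"
proof -
  define k where "k = blk w"
  define N :: real where "N = 4 ^ k"
  have N: "N > 0" by (simp add: N_def)
  define j where "j = \<lfloor>w * N\<rfloor>"
  have d: "disc w = of_int j / N" by (simp add: disc_def j_def N_def k_def)
  have jl: "of_int j \<le> w * N" "w * N < of_int j + 1" unfolding j_def by linarith+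
  show "disc w \<le> w" unfolding d using jl N by (simp add: divide_le_eq)
  have "w \<le> (of_int j + 1) / N" using jl N by (simp add: le_divide_eq)
  then show "w - disc w \<le> 1 / 4 ^ blk w" unfolding d k_def[symmetric] N_def[symmetric] by (simp add: add_divide_distrib)
  have kb: "real k \<le> w" "w < real k + 1" using blk_bounds[OF assms] by (auto simp: k_def)
  have "real k * N \<le> w * N" "w * N < (real k + 1) * N" using kb N by (auto intro: mult_right_mono)
  moreover have kN: "real k * N = of_int (int k * 4 ^ k)" "(real k + 1) * N = of_int ((int k + 1) * 4 ^ k)" by (simp_all add: N_def)
  ultimately have j: "int k * 4 ^ k \<le> j" "j < (int k + 1) * 4 ^ k"
    unfolding j_def le_floor_iff floor_less_iff by simp_all
  define i where "i = nat (j - int k * 4 ^ k)"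
  have ri: "real i = of_int j - real k * N" using j(1) unfolding kN by (simp add: i_def)
  have "i < 4 ^ k" using j by (simp add: i_def nat_less_iff algebra_simps)
  moreover have "disc w = real k + real i / N" unfolding d ri using N by (simp add: field_simps)
  ultimately show "\<exists>i<4 ^ blk w. disc w = real (blk w) + real i / 4 ^ blk w"
    unfolding k_def[symmetric] N_def[symmetric] by (intro exI[of _ i]) simp
  then show "0 \<le> disc w" by (auto simp: add_nonneg_nonneg)
qed

lemma disc_D: "w \<in> D \<Longrightarrow> disc w \<in> D" "w \<in> D \<Longrightarrow> \<bar>w - disc w\<bar> \<le> 1 / 4 ^ blk w" "w \<in> D \<Longrightarrow> \<bar>w - disc w\<bar> \<le> 1"
proof -
  assume w: "w \<in> D"
  note b = disc_bounds[OF D_nonneg[OF w]]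
  show "disc w \<in> D" using D_down[OF w] b by auto
  show 1: "\<bar>w - disc w\<bar> \<le> 1 / 4 ^ blk w" using b by auto
  have "(1::real) / 4 ^ blk w \<le> 1" by (simp add: one_le_power)
  with 1 show "\<bar>w - disc w\<bar> \<le> 1" by linarith
qed

text \<open>Summation over unit blocks: the factor 4 ^ - k against a block mass of at most A * 2 ^ k
  leaves a geometric series with ratio 1/2.\<close>

lemma nn_blocks:
  "(\<integral>\<^sup>+w. ennreal (1 / 4 ^ blk w) * ennreal (q w) * indicator (D \<inter> {real K..}) w \<partial>lborel) \<le> ennreal (2 * A / 2 ^ K)"
proof -
  define B where "B k = D \<inter> {real k..<real k + 1}" for k :: nat
  have Bm [measurable]: "B k \<in> sets borel" for k unfolding B_def by measurable
  have "(\<integral>\<^sup>+w. ennreal (1 / 4 ^ blk w) * ennreal (q w) * indicator (D \<inter> {real K..}) w \<partial>lborel)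
      \<le> (\<integral>\<^sup>+w. (\<Sum>j. ennreal (1 / 4 ^ (K + j)) * (ennreal (q w) * indicator (B (K + j)) w)) \<partial>lborel)"
  proof (intro nn_integral_mono)
    fix w :: real
    show "ennreal (1 / 4 ^ blk w) * ennreal (q w) * indicator (D \<inter> {real K..}) w \<le> (\<Sum>j. ennreal (1 / 4 ^ (K + j)) * (ennreal (q w) * indicator (B (K + j)) w))"
    proof (cases "w \<in> D \<inter> {real K..}")
      case True
      then have w: "w \<in> D" "real K \<le> w" "0 \<le> w" by auto
      note b = blk_bounds[OF w(3)]
      have Kb: "K \<le> blk w" using w b by linarith
      define j where "j = blk w - K"
      have j: "K + j = blk w" using Kb by (simp add: j_def)
      have "w \<in> B (K + j)" using w b by (simp add: B_def j)
      then have "ennreal (1 / 4 ^ blk w) * ennreal (q w) * indicator (D \<inter> {real K..}) w = ennreal (1 / 4 ^ (K + j)) * (ennreal (q w) * indicator (B (K + j)) w)"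
        using True by (simp add: j)
      also have "\<dots> = (\<Sum>j\<in>{j}. ennreal (1 / 4 ^ (K + j)) * (ennreal (q w) * indicator (B (K + j)) w))" by simp
      also have "\<dots> \<le> (\<Sum>j. ennreal (1 / 4 ^ (K + j)) * (ennreal (q w) * indicator (B (K + j)) w))"
        by (rule sum_le_suminf) auto
      finally show ?thesis .
    qed simp
  qed
  also have "\<dots> = (\<Sum>j. \<integral>\<^sup>+w. ennreal (1 / 4 ^ (K + j)) * (ennreal (q w) * indicator (B (K + j)) w) \<partial>lborel)"
    by (intro nn_integral_suminf) measurable
  also have "\<dots> \<le> (\<Sum>j. ennreal (A / 2 ^ K * (1 / 2) ^ j))"
  proof (intro suminf_le)
    fix j
    have "(\<integral>\<^sup>+w. ennreal (1 / 4 ^ (K + j)) * (ennreal (q w) * indicator (B (K + j)) w) \<partial>lborel)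
       = ennreal (1 / 4 ^ (K + j)) * (\<integral>\<^sup>+w. (ennreal (q w) * indicator (B (K + j)) w) \<partial>lborel)"
      by (intro nn_integral_cmult) measurable
    also have "\<dots> \<le> ennreal (1 / 4 ^ (K + j)) * ennreal (A * 2 ^ (K + j))"
      unfolding B_def by (intro mult_left_mono q_block) auto
    also have "\<dots> = ennreal (1 / 4 ^ (K + j) * (A * 2 ^ (K + j)))"
      using const_nonneg by (intro ennreal_mult[symmetric]) auto
    also have "1 / 4 ^ (K + j) * (A * 2 ^ (K + j)) = A / 2 ^ K * (1 / 2) ^ j"
    proof -
      have "(4::real) ^ (K + j) = 2 ^ (K + j) * 2 ^ (K + j)" by (simp add: power_mult_distrib[symmetric])
      then show ?thesis by (simp add: power_add power_one_over)
    qed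
    finally show "(\<integral>\<^sup>+w. ennreal (1 / 4 ^ (K + j)) * (ennreal (q w) * indicator (B (K + j)) w) \<partial>lborel) \<le> ennreal (A / 2 ^ K * (1 / 2) ^ j)" .
  qed auto
  also have "\<dots> = ennreal (A / 2 ^ K * 2)"
  proof (rule suminf_ennreal_eq)
    show "(\<lambda>j. A / 2 ^ K * (1 / 2) ^ j) sums (A / 2 ^ K * 2)"
      using geometric_sums[of "1 / 2 :: real"] by (intro sums_mult) simp
  qed (use const_nonneg in simp)
  finally show ?thesis by (simp add: mult.commute)
qed

definition bad :: "nat \<Rightarrow> nat \<Rightarrow> 'a set" where
  "bad k i = {\<omega>\<in>space M. real k + real i / 4 ^ k \<in> D \<and> 1 / 2 ^ k < sqrt (Z (real k + real i / 4 ^ k) \<omega>)}"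

lemma bad_measurable [measurable]: "bad k i \<in> events"
  unfolding bad_def by measurable

lemma prob_bad:
  assumes "i < 4 ^ k"
  shows "emeasure M (bad k i) \<le> ennreal (C0 / 8 ^ k)"
proof (cases "real k + real i / 4 ^ k \<in> D")
  case True
  define w where "w = real k + real i / 4 ^ k"
  have frac: "0 \<le> real i / 4 ^ k" "real i / 4 ^ k < 1"
    using assms by (auto simp: divide_less_eq)
  have fl: "nat \<lfloor>w\<rfloor> = k" unfolding w_def using frac by (simp add: floor_unique nat_eq_iff)
  have s: "integrable M (\<lambda>\<omega>. sqrt (Z w \<omega>))"
  proof (rule Bochner_Integration.integrable_bound)
    show "integrable M (\<lambda>\<omega>. 1 + Z w \<omega>)" using Z_integrable True by (simp add: w_def)
    show "AE \<omega> in M. norm (sqrt (Z w \<omega>)) \<le> norm (1 + Z w \<omega>)"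
    proof (intro AE_I2)
      fix \<omega>
      have "sqrt (1 * Z w \<omega>) \<le> (1 + Z w \<omega>) / 2" by (rule arith_geo_mean_sqrt) (auto simp: Z_nonneg)
      then show "norm (sqrt (Z w \<omega>)) \<le> norm (1 + Z w \<omega>)" using Z_nonneg[of w \<omega>] by simp
    qed
  qed measurable
  have "prob (bad k i) \<le> prob {\<omega>\<in>space M. 1 / 2 ^ k \<le> sqrt (Z w \<omega>)}"
    unfolding bad_def by (intro finite_measure_mono) (auto simp: w_def)
  also have "\<dots> \<le> expectation (\<lambda>\<omega>. sqrt (Z w \<omega>)) / (1 / 2 ^ k)"
    using s Z_nonneg by (intro integral_Markov_inequality_measure[where A = "{}"]) auto
  also have "\<dots> \<le> (C0 / 16 ^ k) / (1 / 2 ^ k)"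
    using Z_decay[of w] True fl by (intro divide_right_mono) (auto simp: w_def)
  also have "\<dots> = C0 / 8 ^ k"
  proof -
    have "(16::real) ^ k = 8 ^ k * 2 ^ k" by (simp add: power_mult_distrib[symmetric])
    then show ?thesis by simp
  qed
  finally show ?thesis by (simp add: emeasure_eq_measure ennreal_leI)
next
  case False
  then have "bad k i = {}" by (simp add: bad_def)
  then show ?thesis by simp
qed

definition Bad :: "nat \<Rightarrow> 'a set" where "Bad K = (\<Union>j. \<Union>i<4 ^ (K + j). bad (K + j) i)"

lemma Bad_measurable [measurable]: "Bad K \<in> events"
  unfolding Bad_def by measurable

lemma prob_Bad: "emeasure M (Bad K) \<le> ennreal (2 * C0 / 2 ^ K)"
proof -
  have "emeasure M (Bad K) \<le> (\<Sum>j. emeasure M (\<Union>i<4 ^ (K + j). bad (K + j) i))"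
    unfolding Bad_def by (intro emeasure_subadditive_countably) auto
  also have "\<dots> \<le> (\<Sum>j. ennreal (C0 / 2 ^ K * (1 / 2) ^ j))"
  proof (intro suminf_le)
    fix j
    have "emeasure M (\<Union>i<4 ^ (K + j). bad (K + j) i) \<le> (\<Sum>i<4 ^ (K + j). emeasure M (bad (K + j) i))"
      by (intro emeasure_subadditive_finite) auto
    also have "\<dots> \<le> (\<Sum>i<4 ^ (K + j)::nat. ennreal (C0 / 8 ^ (K + j)))"
      by (intro sum_mono prob_bad) auto
    also have "\<dots> = ennreal (4 ^ (K + j) * (C0 / 8 ^ (K + j)))"
    proof -
      have "(\<Sum>i<4 ^ (K + j)::nat. ennreal (C0 / 8 ^ (K + j))) = ennreal (real (4 ^ (K + j))) * ennreal (C0 / 8 ^ (K + j))"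
        unfolding ennreal_of_nat_eq_real_of_nat[symmetric] by simp
      also have "\<dots> = ennreal (real (4 ^ (K + j)) * (C0 / 8 ^ (K + j)))"
        using const_nonneg by (intro ennreal_mult[symmetric]) auto
      finally show ?thesis by simp
    qed
    also have "4 ^ (K + j) * (C0 / 8 ^ (K + j)) = C0 / 2 ^ K * (1 / 2) ^ j"
    proof -
      have "(8::real) ^ (K + j) = 4 ^ (K + j) * 2 ^ (K + j)" by (simp add: power_mult_distrib[symmetric])
      then show ?thesis by (simp add: power_add power_one_over)
    qed
    finally show "emeasure M (\<Union>i<4 ^ (K + j). bad (K + j) i) \<le> ennreal (C0 / 2 ^ K * (1 / 2) ^ j)" .
  qed auto
  also have "\<dots> = ennreal (C0 / 2 ^ K * 2)"
  proof (rule suminf_ennreal_eq)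
    show "(\<lambda>j. C0 / 2 ^ K * (1 / 2) ^ j) sums (C0 / 2 ^ K * 2)"
      using geometric_sums[of "1 / 2 :: real"] by (intro sums_mult) simp
  qed (use const_nonneg in simp)
  finally show ?thesis by (simp add: mult.commute)
qed

text \<open>Values in \<open>ennreal\<close> make the tail meaningful before any integrability is
  known.\<close>

definition tail :: "nat \<Rightarrow> 'a \<Rightarrow> ennreal" where
  "tail K \<omega> = (\<integral>\<^sup>+w. ennreal (Z w \<omega> * q w) * indicator (D \<inter> {real K..}) w \<partial>lborel)"

definition osc :: "nat \<Rightarrow> 'a \<Rightarrow> ennreal" where
  "osc K \<omega> = (\<integral>\<^sup>+w. ennreal ((sqrt (Z w \<omega>) - sqrt (Z (disc w) \<omega>))\<^sup>2) * ennreal (q w) * indicator (D \<inter> {real K..}) w \<partial>lborel)"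

lemma tail_measurable [measurable]: "tail K \<in> borel_measurable M"
  unfolding tail_def by measurable

lemma osc_measurable [measurable]: "osc K \<in> borel_measurable M"
  unfolding osc_def by measurable

text \<open>After exchanging the integrals, the Hellinger bound at distance at most 4 ^ - k produces
  exactly the factor summed in \<open>nn_blocks\<close>.\<close>

lemma osc_mean: "(\<integral>\<^sup>+\<omega>. osc K \<omega> \<partial>M) \<le> ennreal (4 * A * C1 / 2 ^ K)"
proof -
  have "(\<integral>\<^sup>+\<omega>. osc K \<omega> \<partial>M) = (\<integral>\<^sup>+w. (\<integral>\<^sup>+\<omega>. ennreal ((sqrt (Z w \<omega>) - sqrt (Z (disc w) \<omega>))\<^sup>2) * ennreal (q w) * indicator (D \<inter> {real K..}) w \<partial>M) \<partial>lborel)"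
    unfolding osc_def by (rule PS.Fubini'[symmetric]) measurable
  also have "\<dots> \<le> (\<integral>\<^sup>+w. ennreal (2 * C1) * (ennreal (1 / 4 ^ blk w) * ennreal (q w) * indicator (D \<inter> {real K..}) w) \<partial>lborel)"
  proof (intro nn_integral_mono)
    fix w :: real
    show "(\<integral>\<^sup>+\<omega>. ennreal ((sqrt (Z w \<omega>) - sqrt (Z (disc w) \<omega>))\<^sup>2) * ennreal (q w) * indicator (D \<inter> {real K..}) w \<partial>M)
       \<le> ennreal (2 * C1) * (ennreal (1 / 4 ^ blk w) * ennreal (q w) * indicator (D \<inter> {real K..}) w)"
    proof (cases "w \<in> D \<inter> {real K..}")
      case True
      then have w: "w \<in> D" by simp
      have "(\<integral>\<^sup>+\<omega>. ennreal ((sqrt (Z w \<omega>) - sqrt (Z (disc w) \<omega>))\<^sup>2) * ennreal (q w) * indicator (D \<inter> {real K..}) w \<partial>M)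
         = (\<integral>\<^sup>+\<omega>. ennreal ((sqrt (Z w \<omega>) - sqrt (Z (disc w) \<omega>))\<^sup>2) \<partial>M) * ennreal (q w)"
        using True by (simp add: nn_integral_multc)
      also have "\<dots> \<le> ennreal (2 * C1 * \<bar>w - disc w\<bar>) * ennreal (q w)"
        by (intro mult_right_mono sqrt_diff_sq_nn disc_D w) auto
      also have "\<dots> \<le> ennreal (2 * C1 * (1 / 4 ^ blk w)) * ennreal (q w)"
        using disc_D(2)[OF w] const_nonneg by (intro mult_right_mono ennreal_leI mult_left_mono) auto
      also have "\<dots> = ennreal (2 * C1) * (ennreal (1 / 4 ^ blk w) * ennreal (q w) * indicator (D \<inter> {real K..}) w)"
        using True const_nonneg by (subst ennreal_mult) (auto simp: mult_ac)
      finally show ?thesis .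
    qed simp
  qed
  also have "\<dots> = ennreal (2 * C1) * (\<integral>\<^sup>+w. (ennreal (1 / 4 ^ blk w) * ennreal (q w) * indicator (D \<inter> {real K..}) w) \<partial>lborel)"
    by (intro nn_integral_cmult) measurable
  also have "\<dots> \<le> ennreal (2 * C1) * ennreal (2 * A / 2 ^ K)"
    by (intro mult_left_mono nn_blocks) auto
  also have "\<dots> = ennreal (4 * A * C1 / 2 ^ K)"
    using const_nonneg by (subst ennreal_mult[symmetric]) (auto simp: mult_ac)
  finally show ?thesis .
qed

text \<open>Outside \<open>Bad K\<close> the value at the grid point is at most 4 ^ - k. The
  inequality x^2 \<le> 2 y^2 + 2 (x - y)^2 for the square roots transfers this to w, at the price of
  the oscillation term.\<close>

lemma tail_le:
  assumes "\<omega> \<in> space M" "\<omega> \<notin> Bad K"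
  shows "tail K \<omega> \<le> ennreal (4 * A / 2 ^ K) + 2 * osc K \<omega>"
proof -
  let ?o = "\<lambda>w. ennreal ((sqrt (Z w \<omega>) - sqrt (Z (disc w) \<omega>))\<^sup>2) * ennreal (q w) * indicator (D \<inter> {real K..}) w"
  let ?b = "\<lambda>w. ennreal (1 / 4 ^ blk w) * ennreal (q w) * indicator (D \<inter> {real K..}) w"
  have [measurable]: "(\<lambda>w. Z (e w) \<omega>) \<in> borel_measurable borel" if "e \<in> borel_measurable borel" for e
    using assms(1) that by (intro Z_meas_pair) auto
  have "tail K \<omega> \<le> (\<integral>\<^sup>+w. 2 * ?b w + 2 * ?o w \<partial>lborel)"
    unfolding tail_def
  proof (intro nn_integral_mono)
    fix w :: real
    show "ennreal (Z w \<omega> * q w) * indicator (D \<inter> {real K..}) w \<le> 2 * ?b w + 2 * ?o w"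
    proof (cases "w \<in> D \<inter> {real K..}")
      case True
      then have w: "w \<in> D" "real K \<le> w" "0 \<le> w" by auto
      obtain i where i: "i < 4 ^ blk w" "disc w = real (blk w) + real i / 4 ^ blk w"
        using disc_bounds(4)[OF w(3)] by auto
      have Kb: "K \<le> blk w" using w blk_bounds[OF w(3)] by linarith
      have "\<omega> \<notin> bad (K + (blk w - K)) i"
      proof -
        have "\<forall>j. \<forall>i<4 ^ (K + j). \<omega> \<notin> bad (K + j) i" using assms unfolding Bad_def by auto
        moreover have "i < 4 ^ (K + (blk w - K))" using i(1) Kb by simp
        ultimately show ?thesis by blast
      qed
      then have "\<omega> \<notin> bad (blk w) i" using Kb by simp
      then have s: "sqrt (Z (disc w) \<omega>) \<le> 1 / 2 ^ blk w"
        using assms(1) disc_D(1)[OF w(1)] i unfolding bad_def by (auto simp: not_less)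
      have "Z (disc w) \<omega> = (sqrt (Z (disc w) \<omega>))\<^sup>2" using Z_nonneg by simp
      also have "\<dots> \<le> (1 / 2 ^ blk w)\<^sup>2" using s Z_nonneg by (intro power_mono) auto
      also have "\<dots> = 1 / 4 ^ blk w" by (simp add: power2_eq_square power_mult_distrib[symmetric])
      finally have zd: "Z (disc w) \<omega> \<le> 1 / 4 ^ blk w" .
      define x y where "x = sqrt (Z w \<omega>)" and "y = sqrt (Z (disc w) \<omega>)"
      have "x\<^sup>2 \<le> 2 * y\<^sup>2 + 2 * (x - y)\<^sup>2"
        using zero_le_power2[of "x - 2 * y"] by (simp add: power2_eq_square algebra_simps)
      then have "Z w \<omega> \<le> 2 * (1 / 4 ^ blk w) + 2 * (x - y)\<^sup>2"
        using zd Z_nonneg by (simp add: x_def y_def)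
      then have "Z w \<omega> * q w \<le> (2 * (1 / 4 ^ blk w) + 2 * (x - y)\<^sup>2) * q w"
        using q_nonneg by (intro mult_right_mono)
      then have "ennreal (Z w \<omega> * q w) \<le> ennreal (2 * (1 / 4 ^ blk w * q w) + 2 * ((x - y)\<^sup>2 * q w))"
        by (intro ennreal_leI) (simp add: algebra_simps)
      also have "\<dots> = 2 * (ennreal (1 / 4 ^ blk w) * ennreal (q w)) + 2 * (ennreal ((x - y)\<^sup>2) * ennreal (q w))"
        using q_nonneg by (simp add: ennreal_mult ennreal_plus[symmetric] del: ennreal_plus)
          (simp add: ennreal_mult[symmetric] ennreal_plus[symmetric] ennreal_numeral[symmetric] del: ennreal_plus ennreal_numeral)
      finally show ?thesis using True by (simp add: x_def y_def)
    qed simp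
  qed
  also have "\<dots> = 2 * (\<integral>\<^sup>+w. ?b w \<partial>lborel) + 2 * osc K \<omega>"
    unfolding osc_def by (subst nn_integral_add) (simp_all add: nn_integral_cmult)
  also have "\<dots> \<le> 2 * ennreal (2 * A / 2 ^ K) + 2 * osc K \<omega>"
    by (intro add_right_mono mult_left_mono nn_blocks) auto
  also have "2 * ennreal (2 * A / 2 ^ K) = ennreal (4 * A / 2 ^ K)"
    using const_nonneg by (simp add: ennreal_mult[symmetric] ennreal_numeral[symmetric] del: ennreal_numeral)
  finally show ?thesis .
qed

text \<open>The level \<delta> is shared equally: the condition on K bounds the deterministic part
  by \<delta> / 2, and twice the oscillation stays below \<delta> / 2 unless the oscillation reaches
  \<delta> / 4, which Markov's inequality controls.\<close>

lemma prob_tail: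
  assumes \<delta>: "0 < \<delta>" "8 * A / 2 ^ K \<le> \<delta>"
  shows "prob {\<omega>\<in>space M. ennreal \<delta> < tail K \<omega>} \<le> 2 * C0 / 2 ^ K + 16 * A * C1 / (\<delta> * 2 ^ K)"
proof -
  let ?O = "{\<omega>\<in>space M. ennreal (\<delta> / 4) \<le> osc K \<omega>}"
  have "{\<omega>\<in>space M. ennreal \<delta> < tail K \<omega>} \<subseteq> Bad K \<union> ?O"
  proof (safe, rule ccontr)
    fix \<omega> assume w: "\<omega> \<in> space M" "ennreal \<delta> < tail K \<omega>" "\<omega> \<notin> Bad K" "\<not> ennreal (\<delta> / 4) \<le> osc K \<omega>"
    have "tail K \<omega> \<le> ennreal (4 * A / 2 ^ K) + 2 * osc K \<omega>" using w by (intro tail_le)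
    also have "\<dots> \<le> ennreal (\<delta> / 2) + 2 * ennreal (\<delta> / 4)"
      using w \<delta> by (intro add_mono mult_left_mono ennreal_leI) auto
    also have "\<dots> = ennreal \<delta>"
      using \<delta> by (simp add: ennreal_mult[symmetric] ennreal_plus[symmetric] ennreal_numeral[symmetric] del: ennreal_numeral ennreal_plus)
    finally show False using w by simp
  qed
  then have "emeasure M {\<omega>\<in>space M. ennreal \<delta> < tail K \<omega>} \<le> emeasure M (Bad K \<union> ?O)"
    by (intro emeasure_mono) auto
  also have "\<dots> \<le> emeasure M (Bad K) + emeasure M ?O" by (intro emeasure_subadditive) auto
  also have "\<dots> \<le> ennreal (2 * C0 / 2 ^ K) + ennreal (16 * A * C1 / (\<delta> * 2 ^ K))"
  proof (intro add_mono prob_Bad)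
    have "?O = {\<omega>\<in>space M. 1 \<le> ennreal (4 / \<delta>) * osc K \<omega>}"
    proof -
      have "ennreal (\<delta> / 4) \<le> x \<longleftrightarrow> 1 \<le> ennreal (4 / \<delta>) * x" for x
      proof (cases x)
        case (real r)
        then show ?thesis using \<delta> by (simp add: ennreal_mult[symmetric] ennreal_1[symmetric] field_simps del: ennreal_1)
      next
        case top
        then show ?thesis using \<delta> by (simp add: ennreal_mult_top)
      qed
      then show ?thesis by simp
    qed
    then have "emeasure M ?O \<le> ennreal (4 / \<delta>) * (\<integral>\<^sup>+\<omega>. osc K \<omega> * indicator (space M) \<omega> \<partial>M)"
      using nn_integral_Markov_inequality[of "osc K" "space M" M "ennreal (4 / \<delta>)"] by simp
    also have "(\<integral>\<^sup>+\<omega>. osc K \<omega> * indicator (space M) \<omega> \<partial>M) = (\<integral>\<^sup>+\<omega>. osc K \<omega> \<partial>M)"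
      by (intro nn_integral_cong) simp
    also have "ennreal (4 / \<delta>) * (\<integral>\<^sup>+\<omega>. osc K \<omega> \<partial>M) \<le> ennreal (4 / \<delta>) * ennreal (4 * A * C1 / 2 ^ K)"
      by (intro mult_left_mono osc_mean) auto
    also have "\<dots> = ennreal (16 * A * C1 / (\<delta> * 2 ^ K))"
      using \<delta> const_nonneg by (simp add: ennreal_mult[symmetric] mult_ac)
    finally show "emeasure M ?O \<le> ennreal (16 * A * C1 / (\<delta> * 2 ^ K))" .
  qed
  also have "\<dots> = ennreal (2 * C0 / 2 ^ K + 16 * A * C1 / (\<delta> * 2 ^ K))"
    using \<delta> const_nonneg by (subst ennreal_plus) auto
  finally show ?thesis
    using \<delta> const_nonneg by (subst (asm) emeasure_eq_measure, subst (asm) ennreal_le_iff) auto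
qed

end

text \<open>A Riemann sum at left end points is the integral of a step function, so its distance to
  the true integral can be estimated under a single integral sign.\<close>

lemma riemann_sum_has_bochner_integral:
  fixes f :: "real \<Rightarrow> real"
  assumes N: "0 < (N::nat)"
  shows "has_bochner_integral lborel (\<lambda>w. indicator {0..<real K} w * f (of_int \<lfloor>w * N\<rfloor> / N)) (\<Sum>i<K * N. f (real i / N) / N)"
proof -
  have one: "has_bochner_integral lborel (\<lambda>w. indicator {real i / N..<real (Suc i) / N} w * f (real i / N)) (f (real i / N) / N)" for i
  proof -
    have "has_bochner_integral lborel (\<lambda>w. indicator {real i / N..<real (Suc i) / N} w :: real) (measure lborel {real i / N..<real (Suc i) / N})"
      using N by (intro has_bochner_integral_real_indicator) (auto simp: divide_right_mono)
    moreover have "measure lborel {real i / N..<real (Suc i) / N} = 1 / N"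
      using N by (subst measure_lborel_Ico) (auto simp: divide_right_mono diff_divide_distrib[symmetric])
    ultimately have "has_bochner_integral lborel (\<lambda>w. indicator {real i / N..<real (Suc i) / N} w * f (real i / N)) (1 / N * f (real i / N))"
      by (intro has_bochner_integral_mult_left) auto
    then show ?thesis by simp
  qed
  have "has_bochner_integral lborel (\<lambda>w. \<Sum>i<K * N. indicator {real i / N..<real (Suc i) / N} w * f (real i / N)) (\<Sum>i<K * N. f (real i / N) / N)"
    by (rule has_bochner_integral_sum) (rule one)
  moreover have "(\<Sum>i<K * N. indicator {real i / N..<real (Suc i) / N} w * f (real i / N)) = indicator {0..<real K} w * f (of_int \<lfloor>w * N\<rfloor> / N)" for w :: real
  proof (cases "w \<in> {0..<real K}")
    case True
    define j where "j = nat \<lfloor>w * N\<rfloor>"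
    have w0: "0 \<le> w * N" using True by simp
    have rj: "real j = of_int \<lfloor>w * N\<rfloor>" using w0 by (simp add: j_def)
    have jb: "real j \<le> w * N" "w * N < real j + 1" unfolding rj by linarith+
    have "w * N < real K * N" using True N by simp
    then have "real j < real (K * N)" using jb by (simp only: of_nat_mult)
    then have jK: "j < K * N" by (simp only: of_nat_less_iff)
    have iff: "w \<in> {real i / N..<real (Suc i) / N} \<longleftrightarrow> i = j" for i
    proof -
      have "w \<in> {real i / N..<real (Suc i) / N} \<longleftrightarrow> real i \<le> w * N \<and> w * N < real i + 1"
        using N by (simp add: divide_le_eq less_divide_eq add.commute)
      also have "\<dots> \<longleftrightarrow> i = j" using jb by linarith
      finally show ?thesis .
    qed
    have "(\<Sum>i<K * N. indicator {real i / N..<real (Suc i) / N} w * f (real i / N)) = (\<Sum>i<K * N. if i = j then f (real j / N) else 0)"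
      by (intro sum.cong refl) (simp add: indicator_def iff del: of_nat_Suc atLeastLessThan_iff)
    then show ?thesis using True jK by (simp add: rj)
  next
    case False
    have "indicator {real i / N..<real (Suc i) / N} w * f (real i / N) = 0" if "i < K * N" for i
    proof -
      have "0 \<le> real i / N" by simp
      have "real (Suc i) \<le> real (K * N)" using that by (intro of_nat_mono) simp
      then have "real (Suc i) / N \<le> real K" using N by (simp add: divide_le_eq del: of_nat_Suc)
      then have "w \<notin> {real i / N..<real (Suc i) / N}"
        using False \<open>0 \<le> real i / N\<close> unfolding atLeastLessThan_iff by linarith
      then show ?thesis by (simp del: of_nat_Suc atLeastLessThan_iff)
    qed
    then have "(\<Sum>i<K * N. indicator {real i / N..<real (Suc i) / N} w * f (real i / N)) = 0"
      by (intro sum.neutral ballI) (simp del: of_nat_Suc)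
    also have "0 = indicator {0..<real K} w * f (of_int \<lfloor>w * N\<rfloor> / N)"
      using False by (simp del: atLeastLessThan_iff)
    finally show ?thesis .
  qed
  ultimately show ?thesis by simp
qed

section \<open>Approximation of the statistic by Riemann sums\<close>

context hellinger_process
begin

definition total :: "'a \<Rightarrow> ennreal" where
  "total \<omega> = (\<integral>\<^sup>+w. ennreal (Z w \<omega> * q w) * indicator D w \<partial>lborel)"

definition head :: "nat \<Rightarrow> 'a \<Rightarrow> ennreal" where
  "head K \<omega> = (\<integral>\<^sup>+w. ennreal (Z w \<omega> * q w) * indicator (D \<inter> {0..<real K}) w \<partial>lborel)"

text \<open>The weight q is left out: on a bounded interval it is within \<epsilon> of 1, and the
  difference is accounted for in \<open>head_approx\<close>.\<close>

definition riem :: "nat \<Rightarrow> nat \<Rightarrow> 'a \<Rightarrow> real" where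
  "riem K N \<omega> = (\<Sum>i<K * N. Z (real i / N) \<omega> / N)"

lemma total_measurable [measurable]: "total \<in> borel_measurable M"
  unfolding total_def by measurable

lemma head_measurable [measurable]: "head K \<in> borel_measurable M"
  unfolding head_def by measurable

lemma riem_measurable [measurable]: "riem K N \<in> borel_measurable M"
  unfolding riem_def by measurable

lemma section_measurable: "\<omega> \<in> space M \<Longrightarrow> e \<in> borel_measurable borel \<Longrightarrow> (\<lambda>w. Z (e w) \<omega>) \<in> borel_measurable borel"
  by (intro Z_meas_pair) auto

lemma total_split: assumes "\<omega> \<in> space M" shows "total \<omega> = head K \<omega> + tail K \<omega>"
proof -
  note [measurable] = section_measurable[OF assms]
  have "total \<omega> = (\<integral>\<^sup>+w. ennreal (Z w \<omega> * q w) * indicator (D \<inter> {0..<real K}) w + ennreal (Z w \<omega> * q w) * indicator (D \<inter> {real K..}) w \<partial>lborel)"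
    unfolding total_def using D_nonneg by (intro nn_integral_cong) (auto simp: indicator_def not_le)
  also have "\<dots> = head K \<omega> + tail K \<omega>"
    unfolding head_def tail_def by (intro nn_integral_add) measurable
  finally show ?thesis .
qed

text \<open>After exchanging the integrals it suffices to compare Z at w with Z at the grid point
  below it, at distance at most 1 / N. The bound involves the process only through C1, which is what
  makes the approximation uniform in the sample size.\<close>

lemma head_approx:
  assumes N: "0 < N" and sub: "{0..<real K} \<subseteq> D" and \<epsilon>: "\<And>w. w \<in> {0..<real K} \<Longrightarrow> \<bar>q w - 1\<bar> \<le> \<epsilon>" "0 \<le> \<epsilon>"
  shows "AE \<omega> in M. head K \<omega> < \<infinity>"
    and "integrable M (\<lambda>\<omega>. \<bar>enn2real (head K \<omega>) - riem K N \<omega>\<bar>)"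
    and "expectation (\<lambda>\<omega>. \<bar>enn2real (head K \<omega>) - riem K N \<omega>\<bar>) \<le> real K * ((C1 + 2) / sqrt N + \<epsilon>)"
proof -
  define I where "I = {0..<real K}"
  have DI: "D \<inter> {0..<real K} = I" using sub by (auto simp: I_def)
  have [measurable]: "I \<in> sets borel" by (simp add: I_def)
  define e where "e w = of_int \<lfloor>w * N\<rfloor> / real N" for w :: real
  have [measurable]: "e \<in> borel_measurable borel" unfolding e_def by measurable
  have eb: "0 \<le> e w" "e w \<le> w" "w - e w \<le> 1 / N" if "0 \<le> w" for w
  proof -
    have "of_int \<lfloor>w * N\<rfloor> \<le> w * N" "w * N \<le> of_int \<lfloor>w * N\<rfloor> + 1" by linarith+
    then have "of_int \<lfloor>w * N\<rfloor> / real N \<le> w * N / N" "w * N / N \<le> (of_int \<lfloor>w * N\<rfloor> + 1) / real N"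
      by - (rule divide_right_mono, assumption, simp)+
    then show "e w \<le> w" "w - e w \<le> 1 / N" using N by (auto simp: e_def add_divide_distrib)
    show "0 \<le> e w" using that by (simp add: e_def)
  qed
  have eD: "e w \<in> D" "w \<in> D" "\<bar>w - e w\<bar> \<le> 1 / N" "\<bar>w - e w\<bar> \<le> 1" if "w \<in> I" for w
  proof -
    show w: "w \<in> D" using that sub by (auto simp: I_def)
    show "e w \<in> D" using D_down[OF w] eb[of w] D_nonneg[OF w] by auto
    show 1: "\<bar>w - e w\<bar> \<le> 1 / N" using eb[of w] D_nonneg[OF w] by auto
    have "1 / real N \<le> 1" using N by simp
    with 1 show "\<bar>w - e w\<bar> \<le> 1" by linarith
  qed
  have qb: "q w \<le> 1 + \<epsilon>" if "w \<in> I" for w using \<epsilon>(1)[of w] that by (auto simp: I_def)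
  have "(\<integral>\<^sup>+\<omega>. head K \<omega> \<partial>M) = (\<integral>\<^sup>+w. (\<integral>\<^sup>+\<omega>. ennreal (Z w \<omega> * q w) * indicator I w \<partial>M) \<partial>lborel)"
    unfolding head_def DI by (rule PS.Fubini'[symmetric]) measurable
  also have "\<dots> \<le> (\<integral>\<^sup>+w. ennreal (1 + \<epsilon>) * indicator I w \<partial>lborel)"
  proof (intro nn_integral_mono)
    fix w :: real
    show "(\<integral>\<^sup>+\<omega>. ennreal (Z w \<omega> * q w) * indicator I w \<partial>M) \<le> ennreal (1 + \<epsilon>) * indicator I w"
    proof (cases "w \<in> I")
      case True
      then have "(\<integral>\<^sup>+\<omega>. ennreal (Z w \<omega> * q w) * indicator I w \<partial>M) = (\<integral>\<^sup>+\<omega>. ennreal (Z w \<omega>) * ennreal (q w) \<partial>M)"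
        using Z_nonneg q_nonneg by (simp add: ennreal_mult)
      also have "\<dots> = ennreal (q w)" using Z_nn[OF eD(2)[OF True]] by (subst nn_integral_multc) auto
      also have "\<dots> \<le> ennreal (1 + \<epsilon>)" by (intro ennreal_leI qb True)
      finally show ?thesis using True by simp
    qed simp
  qed
  also have "\<dots> < \<infinity>" by (simp add: nn_integral_cmult_indicator I_def ennreal_mult_less_top)
  finally have "AE \<omega> in M. head K \<omega> \<noteq> \<infinity>"
    by (intro nn_integral_PInf_AE) auto
  then show fin: "AE \<omega> in M. head K \<omega> < \<infinity>" by eventually_elim (simp add: less_top)
  have pw: "ennreal \<bar>enn2real (head K \<omega>) - riem K N \<omega>\<bar> \<le> (\<integral>\<^sup>+w. ennreal \<bar>Z w \<omega> * q w - Z (e w) \<omega>\<bar> * indicator I w \<partial>lborel)"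
    if w: "\<omega> \<in> space M" "head K \<omega> < \<infinity>" for \<omega>
  proof -
    note [measurable] = section_measurable[OF w(1)]
    have h: "head K \<omega> = (\<integral>\<^sup>+w. ennreal (indicator I w * (Z w \<omega> * q w)) \<partial>lborel)"
      unfolding head_def DI by (intro nn_integral_cong) (auto simp: indicator_def)
    have i1: "integrable lborel (\<lambda>w. indicator I w * (Z w \<omega> * q w))"
      using w(2) Z_nonneg q_nonneg unfolding h by (intro integrableI_nonneg) (auto simp: indicator_def)
    have e1: "enn2real (head K \<omega>) = (LINT w|lborel. indicator I w * (Z w \<omega> * q w))"
      unfolding h using Z_nonneg q_nonneg by (subst integral_eq_nn_integral) (auto simp: indicator_def)
    have hb: "has_bochner_integral lborel (\<lambda>w. indicator I w * Z (e w) \<omega>) (riem K N \<omega>)"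
      unfolding riem_def e_def I_def by (rule riemann_sum_has_bochner_integral[OF N])
    then have i2: "integrable lborel (\<lambda>w. indicator I w * Z (e w) \<omega>)" and e2: "riem K N \<omega> = (LINT w|lborel. indicator I w * Z (e w) \<omega>)"
      by (auto simp: has_bochner_integral_iff)
    have "\<bar>enn2real (head K \<omega>) - riem K N \<omega>\<bar> = \<bar>LINT w|lborel. indicator I w * (Z w \<omega> * q w) - indicator I w * Z (e w) \<omega>\<bar>"
      unfolding e1 e2 using i1 i2 by simp
    also have "\<dots> \<le> (LINT w|lborel. \<bar>indicator I w * (Z w \<omega> * q w) - indicator I w * Z (e w) \<omega>\<bar>)"
      by (rule integral_abs_bound)
    finally have "ennreal \<bar>enn2real (head K \<omega>) - riem K N \<omega>\<bar> \<le> ennreal (LINT w|lborel. \<bar>indicator I w * (Z w \<omega> * q w) - indicator I w * Z (e w) \<omega>\<bar>)"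
      by (rule ennreal_leI)
    also have "\<dots> = (\<integral>\<^sup>+w. ennreal \<bar>indicator I w * (Z w \<omega> * q w) - indicator I w * Z (e w) \<omega>\<bar> \<partial>lborel)"
      using i1 i2 by (intro nn_integral_eq_integral[symmetric]) auto
    also have "\<dots> = (\<integral>\<^sup>+w. ennreal \<bar>Z w \<omega> * q w - Z (e w) \<omega>\<bar> * indicator I w \<partial>lborel)"
      by (intro nn_integral_cong) (auto simp: indicator_def)
    finally show ?thesis .
  qed
  have "(\<integral>\<^sup>+\<omega>. ennreal \<bar>enn2real (head K \<omega>) - riem K N \<omega>\<bar> \<partial>M) \<le> (\<integral>\<^sup>+\<omega>. (\<integral>\<^sup>+w. ennreal \<bar>Z w \<omega> * q w - Z (e w) \<omega>\<bar> * indicator I w \<partial>lborel) \<partial>M)"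
  proof (rule nn_integral_mono_AE)
    show "AE \<omega> in M. ennreal \<bar>enn2real (head K \<omega>) - riem K N \<omega>\<bar> \<le> (\<integral>\<^sup>+w. ennreal \<bar>Z w \<omega> * q w - Z (e w) \<omega>\<bar> * indicator I w \<partial>lborel)"
      using fin AE_space by eventually_elim (rule pw)
  qed
  also have "\<dots> = (\<integral>\<^sup>+w. (\<integral>\<^sup>+\<omega>. ennreal \<bar>Z w \<omega> * q w - Z (e w) \<omega>\<bar> * indicator I w \<partial>M) \<partial>lborel)"
    by (rule PS.Fubini'[symmetric]) measurable
  also have "\<dots> \<le> (\<integral>\<^sup>+w. ennreal ((C1 + 2) / sqrt N + \<epsilon>) * indicator I w \<partial>lborel)"
  proof (intro nn_integral_mono)
    fix w :: real
    show "(\<integral>\<^sup>+\<omega>. ennreal \<bar>Z w \<omega> * q w - Z (e w) \<omega>\<bar> * indicator I w \<partial>M) \<le> ennreal ((C1 + 2) / sqrt N + \<epsilon>) * indicator I w"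
    proof (cases "w \<in> I")
      case True
      note d = eD[OF True]
      have "(\<integral>\<^sup>+\<omega>. ennreal \<bar>Z w \<omega> * q w - Z (e w) \<omega>\<bar> * indicator I w \<partial>M)
         \<le> (\<integral>\<^sup>+\<omega>. ennreal \<bar>Z w \<omega> - Z (e w) \<omega>\<bar> + ennreal \<epsilon> * ennreal (Z w \<omega>) \<partial>M)"
      proof (intro nn_integral_mono)
        fix \<omega>
        have "\<bar>Z w \<omega> * q w - Z (e w) \<omega>\<bar> = \<bar>(Z w \<omega> - Z (e w) \<omega>) + Z w \<omega> * (q w - 1)\<bar>" by (simp add: algebra_simps)
        also have "\<dots> \<le> \<bar>Z w \<omega> - Z (e w) \<omega>\<bar> + \<bar>Z w \<omega> * (q w - 1)\<bar>" by (rule abs_triangle_ineq)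
        also have "\<bar>Z w \<omega> * (q w - 1)\<bar> \<le> \<epsilon> * Z w \<omega>"
          using mult_right_mono[OF \<epsilon>(1)[of w], of "Z w \<omega>"] True Z_nonneg[of w \<omega>]
          by (simp add: abs_mult mult.commute I_def)
        finally have "ennreal \<bar>Z w \<omega> * q w - Z (e w) \<omega>\<bar> \<le> ennreal (\<bar>Z w \<omega> - Z (e w) \<omega>\<bar> + \<epsilon> * Z w \<omega>)" by (intro ennreal_leI) simp
        then show "ennreal \<bar>Z w \<omega> * q w - Z (e w) \<omega>\<bar> * indicator I w \<le> ennreal \<bar>Z w \<omega> - Z (e w) \<omega>\<bar> + ennreal \<epsilon> * ennreal (Z w \<omega>)"
          using True \<epsilon>(2) Z_nonneg by (simp add: ennreal_mult)
      qed
      also have "\<dots> = (\<integral>\<^sup>+\<omega>. ennreal \<bar>Z w \<omega> - Z (e w) \<omega>\<bar> \<partial>M) + ennreal \<epsilon>"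
        using Z_nn[OF d(2)] by (simp add: nn_integral_add nn_integral_cmult)
      also have "\<dots> \<le> ennreal ((C1 + 2) * sqrt \<bar>w - e w\<bar>) + ennreal \<epsilon>"
        by (intro add_right_mono abs_diff_nn d)
      also have "\<dots> \<le> ennreal ((C1 + 2) * sqrt (1 / N)) + ennreal \<epsilon>"
        using d(3) const_nonneg by (intro add_right_mono ennreal_leI mult_left_mono) auto
      also have "\<dots> = ennreal ((C1 + 2) / sqrt N + \<epsilon>)"
        using const_nonneg \<epsilon>(2) by (simp add: real_sqrt_divide)
      finally show ?thesis using True by simp
    qed simp
  qed
  also have "\<dots> = ennreal ((C1 + 2) / sqrt N + \<epsilon>) * ennreal (real K)"
    by (subst nn_integral_cmult_indicator) (auto simp: I_def)
  also have "\<dots> = ennreal (real K * ((C1 + 2) / sqrt N + \<epsilon>))"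
    using const_nonneg \<epsilon>(2) by (subst ennreal_mult[symmetric]) (auto simp: mult.commute)
  finally have nn: "(\<integral>\<^sup>+\<omega>. ennreal \<bar>enn2real (head K \<omega>) - riem K N \<omega>\<bar> \<partial>M) \<le> ennreal (real K * ((C1 + 2) / sqrt N + \<epsilon>))" .
  show int: "integrable M (\<lambda>\<omega>. \<bar>enn2real (head K \<omega>) - riem K N \<omega>\<bar>)"
  proof (rule integrableI_nonneg)
    show "(\<integral>\<^sup>+\<omega>. ennreal \<bar>enn2real (head K \<omega>) - riem K N \<omega>\<bar> \<partial>M) < \<infinity>" using nn by (simp add: order_le_less_trans)
  qed auto
  show "expectation (\<lambda>\<omega>. \<bar>enn2real (head K \<omega>) - riem K N \<omega>\<bar>) \<le> real K * ((C1 + 2) / sqrt N + \<epsilon>)"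
    using nn nn_integral_eq_integral[OF int] const_nonneg \<epsilon>(2) by (simp add: ennreal_le_iff)
qed

text \<open>Positive exactly if the ratio of the integral to Z at 0 exceeds m, provided that Z at 0
  is positive. Without the division it is linear in the process, and errors in the integral pass on
  unchanged.\<close>

definition stat :: "real \<Rightarrow> 'a \<Rightarrow> real" where "stat m \<omega> = enn2real (total \<omega>) - m * Z 0 \<omega>"

lemma stat_measurable [measurable]: "stat m \<in> borel_measurable M"
  unfolding stat_def by measurable

text \<open>Where the tail exceeds \<delta> the difference is at most 1, because g has values in
  [0, 1]. Elsewhere the tail costs L * \<delta>, and the head costs L times its distance to the
  Riemann sum.\<close>

lemma stat_approx:
  fixes g :: "real \<Rightarrow> real"
  assumes N: "0 < N" and sub: "{0..<real K} \<subseteq> D" and \<epsilon>: "\<And>w. w \<in> {0..<real K} \<Longrightarrow> \<bar>q w - 1\<bar> \<le> \<epsilon>" "0 \<le> \<epsilon>"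
    and g: "\<And>x y. \<bar>g x - g y\<bar> \<le> L * \<bar>x - y\<bar>" "\<And>x. 0 \<le> g x" "\<And>x. g x \<le> 1" and L: "0 \<le> L"
    and \<delta>: "0 < \<delta>" "8 * A / 2 ^ K \<le> \<delta>"
  shows "\<bar>expectation (\<lambda>\<omega>. g (stat m \<omega>)) - expectation (\<lambda>\<omega>. g (riem K N \<omega> - m * Z 0 \<omega>))\<bar>
     \<le> 2 * C0 / 2 ^ K + 16 * A * C1 / (\<delta> * 2 ^ K) + L * \<delta> + L * (real K * ((C1 + 2) / sqrt N + \<epsilon>))"
proof -
  have ha: "AE \<omega> in M. head K \<omega> < \<infinity>" "integrable M (\<lambda>\<omega>. \<bar>enn2real (head K \<omega>) - riem K N \<omega>\<bar>)"
    "expectation (\<lambda>\<omega>. \<bar>enn2real (head K \<omega>) - riem K N \<omega>\<bar>) \<le> real K * ((C1 + 2) / sqrt N + \<epsilon>)"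
    by (rule head_approx[OF N sub, of \<epsilon>]; use \<epsilon> in blast)+
  have [measurable]: "g \<in> borel_measurable borel"
  proof (rule borel_measurable_continuous_onI)
    have "L-lipschitz_on UNIV g" using g(1) L by (intro lipschitz_onI) (auto simp: dist_real_def)
    then show "continuous_on UNIV g" by (rule lipschitz_on_continuous_on)
  qed
  define B where "B = {\<omega>\<in>space M. ennreal \<delta> < tail K \<omega>}"
  have [measurable]: "B \<in> events" unfolding B_def by measurable
  let ?h = "\<lambda>\<omega>. \<bar>enn2real (head K \<omega>) - riem K N \<omega>\<bar>"
  have i1: "integrable M (\<lambda>\<omega>. g (stat m \<omega>))" and i2: "integrable M (\<lambda>\<omega>. g (riem K N \<omega> - m * Z 0 \<omega>))"
    using g(2,3) by (auto intro!: integrable_const_bound[where B = 1])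
  have pw: "AE \<omega> in M. \<bar>g (stat m \<omega>) - g (riem K N \<omega> - m * Z 0 \<omega>)\<bar> \<le> indicator B \<omega> + L * \<delta> + L * ?h \<omega>"
    using ha(1) AE_space
  proof eventually_elim
    fix \<omega> assume w: "\<omega> \<in> space M" "head K \<omega> < \<infinity>"
    show "\<bar>g (stat m \<omega>) - g (riem K N \<omega> - m * Z 0 \<omega>)\<bar> \<le> indicator B \<omega> + L * \<delta> + L * ?h \<omega>"
    proof (cases "\<omega> \<in> B")
      case True
      have "\<bar>g (stat m \<omega>) - g (riem K N \<omega> - m * Z 0 \<omega>)\<bar> \<le> 1"
        using g(2,3)[of "stat m \<omega>"] g(2,3)[of "riem K N \<omega> - m * Z 0 \<omega>"] by linarith
      moreover have "0 \<le> L * \<delta>" "0 \<le> L * ?h \<omega>" using L \<delta> by auto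
      ultimately show ?thesis using True by simp
    next
      case False
      then have t: "tail K \<omega> \<le> ennreal \<delta>" using w by (auto simp: B_def not_less)
      then have "tail K \<omega> < \<infinity>" by (simp add: order_le_less_trans)
      then have "enn2real (total \<omega>) = enn2real (head K \<omega>) + enn2real (tail K \<omega>)"
        unfolding total_split[OF w(1), of K] using w by (intro enn2real_plus) auto
      moreover have "0 \<le> enn2real (tail K \<omega>)" "enn2real (tail K \<omega>) \<le> \<delta>"
        using t \<delta> by (auto intro: enn2real_leI)
      ultimately have "\<bar>stat m \<omega> - (riem K N \<omega> - m * Z 0 \<omega>)\<bar> \<le> \<delta> + ?h \<omega>"
        unfolding stat_def by linarith
      then have "L * \<bar>stat m \<omega> - (riem K N \<omega> - m * Z 0 \<omega>)\<bar> \<le> L * (\<delta> + ?h \<omega>)" using L by (intro mult_left_mono)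
      with g(1)[of "stat m \<omega>" "riem K N \<omega> - m * Z 0 \<omega>"] False show ?thesis by (simp add: distrib_left)
    qed
  qed
  have iB: "integrable M (\<lambda>\<omega>. indicator B \<omega> + L * \<delta> + L * ?h \<omega>)"
    using ha(2) by (intro Bochner_Integration.integrable_add integrable_mult_right integrable_real_indicator) (auto simp: less_top[symmetric])
  have "\<bar>expectation (\<lambda>\<omega>. g (stat m \<omega>)) - expectation (\<lambda>\<omega>. g (riem K N \<omega> - m * Z 0 \<omega>))\<bar>
     = \<bar>expectation (\<lambda>\<omega>. g (stat m \<omega>) - g (riem K N \<omega> - m * Z 0 \<omega>))\<bar>" using i1 i2 by simp
  also have "\<dots> \<le> expectation (\<lambda>\<omega>. \<bar>g (stat m \<omega>) - g (riem K N \<omega> - m * Z 0 \<omega>)\<bar>)" by (rule integral_abs_bound)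
  also have "\<dots> \<le> expectation (\<lambda>\<omega>. indicator B \<omega> + L * \<delta> + L * ?h \<omega>)"
    using i1 i2 iB pw by (intro integral_mono_AE) auto
  also have "\<dots> = prob B + L * \<delta> + L * expectation ?h"
  proof -
    have "expectation (\<lambda>\<omega>. indicator B \<omega> + L * \<delta> + L * ?h \<omega>) = expectation (\<lambda>\<omega>. indicator B \<omega> + L * \<delta>) + expectation (\<lambda>\<omega>. L * ?h \<omega>)"
      using ha(2) by (intro Bochner_Integration.integral_add Bochner_Integration.integrable_add integrable_mult_right integrable_real_indicator) (auto simp: less_top[symmetric])
    also have "expectation (\<lambda>\<omega>. indicator B \<omega> + L * \<delta>) = prob B + L * \<delta>"
      by (subst Bochner_Integration.integral_add) (auto simp: prob_space less_top[symmetric] intro!: integrable_real_indicator)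
    finally show ?thesis by simp
  qed
  also have "\<dots> \<le> (2 * C0 / 2 ^ K + 16 * A * C1 / (\<delta> * 2 ^ K)) + L * \<delta> + L * (real K * ((C1 + 2) / sqrt N + \<epsilon>))"
    unfolding B_def using L by (intro add_mono prob_tail[OF \<delta>] mult_left_mono ha(3)) auto
  finally show ?thesis by simp
qed

text \<open>The head is almost surely finite for every K, so an infinite total forces an infinite
  tail. The probability of this is of order 2 ^ - K for every K, hence 0.\<close>

lemma AE_total_finite:
  assumes sub: "{0..} \<subseteq> D" and q1: "\<And>w. 0 \<le> w \<Longrightarrow> q w = 1"
  shows "AE \<omega> in M. total \<omega> < \<infinity>"
proof -
  \<comment> \<open>A level independent of K for which \<open>prob_tail\<close> applies with every
    K.\<close>
  define \<delta> where "\<delta> = 8 * A + 1"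
  have \<delta>: "0 < \<delta>" using const_nonneg by (simp add: \<delta>_def)
  have \<delta>K: "8 * A / 2 ^ K \<le> \<delta>" for K
  proof -
    have "8 * A / 2 ^ K \<le> 8 * A / 1" using const_nonneg by (intro divide_left_mono) (auto simp: one_le_power)
    then show ?thesis by (simp add: \<delta>_def)
  qed
  define I where "I = {\<omega>\<in>space M. total \<omega> = \<infinity>}"
  have [measurable]: "I \<in> events" unfolding I_def by measurable
  have bound: "prob I \<le> (2 * C0 + 16 * A * C1 / \<delta>) * (1 / 2) ^ K" for K
  proof -
    have "AE \<omega> in M. head K \<omega> < \<infinity>"
      by (rule head_approx(1)[of 1 K 0]) (use sub q1 in auto)
    then have "AE \<omega> in M. \<omega> \<in> I \<longrightarrow> \<omega> \<in> {\<omega>\<in>space M. ennreal \<delta> < tail K \<omega>}"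
    proof eventually_elim
      fix \<omega> assume h: "head K \<omega> < \<infinity>"
      show "\<omega> \<in> I \<longrightarrow> \<omega> \<in> {\<omega>\<in>space M. ennreal \<delta> < tail K \<omega>}"
      proof
        assume w: "\<omega> \<in> I"
        then have "tail K \<omega> = \<infinity>" using h total_split[of \<omega> K] ennreal_add_eq_top[of "head K \<omega>" "tail K \<omega>"] by (auto simp: I_def)
        then show "\<omega> \<in> {\<omega>\<in>space M. ennreal \<delta> < tail K \<omega>}" using w by (simp add: I_def)
      qed
    qed
    then have "prob I \<le> prob {\<omega>\<in>space M. ennreal \<delta> < tail K \<omega>}"
      by (intro finite_measure_mono_AE) auto
    also have "\<dots> \<le> 2 * C0 / 2 ^ K + 16 * A * C1 / (\<delta> * 2 ^ K)" by (rule prob_tail[OF \<delta> \<delta>K])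
    also have "\<dots> = (2 * C0 + 16 * A * C1 / \<delta>) * (1 / 2) ^ K" by (simp add: power_one_over field_simps)
    finally show ?thesis .
  qed
  have "(\<lambda>K. (2 * C0 + 16 * A * C1 / \<delta>) * (1 / 2) ^ K) \<longlonglongrightarrow> (2 * C0 + 16 * A * C1 / \<delta>) * 0"
    by (intro tendsto_mult_left LIMSEQ_realpow_zero) auto
  then have "prob I \<le> 0" using bound by (intro LIMSEQ_le_const[where X = "\<lambda>K. (2 * C0 + 16 * A * C1 / \<delta>) * (1 / 2) ^ K"]) auto
  then have "AE \<omega> in M. \<omega> \<notin> I" by (intro AE_not_in) (auto simp: null_sets_def emeasure_eq_measure measure_le_0_iff)
  with AE_space show ?thesis by eventually_elim (auto simp: I_def less_top)
qed

end

text \<open>Weakening the constants gives the prelimit processes and the limit the same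
  ones.\<close>

lemma hellinger_process_mono:
  assumes "hellinger_process M Z D q A C0 C1" and le: "A \<le> A'" "C0 \<le> C0'" "C1 \<le> C1'"
  shows "hellinger_process M Z D q A' C0' C1'"
proof -
  interpret hellinger_process M Z D q A C0 C1 by fact
  show ?thesis
  proof (unfold_locales, goal_cases)
    case (8 k)
    have "ennreal (A * 2 ^ k) \<le> ennreal (A' * 2 ^ k)" using le by (intro ennreal_leI mult_right_mono) auto
    with q_block[of k] show ?case by (rule order_trans)
  next
    case (10 w v)
    have "C1 * \<bar>w - v\<bar> \<le> C1' * \<bar>w - v\<bar>" using le by (intro mult_right_mono) auto
    with Z_affinity[OF 10] show ?case by linarith
  next
    case (11 w)
    have "C0 / 16 ^ nat \<lfloor>w\<rfloor> \<le> C0' / 16 ^ nat \<lfloor>w\<rfloor>" using le by (intro divide_right_mono) auto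
    with Z_decay[OF 11] show ?case by (rule order_trans)
  qed (erule (2) D_down | erule D_nonneg | erule Z_mean | rule Z_measurable Z_nonneg D_borel q_measurable q_nonneg
       | (use const_nonneg le in linarith))+
qed

section \<open>Weak convergence of the integral statistic\<close>

text \<open>Applied to k * x and to k * x + 1 it gives Lipschitz functions below and above the
  indicator of the positive half-line; both tend to that indicator away from 0 as k grows.\<close>

definition unit_clip :: "real \<Rightarrow> real" where "unit_clip x = max 0 (min 1 x)"

lemma unit_clip_bounds: "0 \<le> unit_clip x" "unit_clip x \<le> 1" "\<bar>unit_clip x - unit_clip y\<bar> \<le> \<bar>x - y\<bar>"
  by (auto simp: unit_clip_def)

lemma unit_clip_measurable [measurable]: "unit_clip \<in> borel_measurable borel"
  unfolding unit_clip_def by measurable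

lemma unit_clip_affine_lipschitz: "\<bar>unit_clip (real k * x + c) - unit_clip (real k * y + c)\<bar> \<le> real k * \<bar>x - y\<bar>"
proof -
  have "\<bar>unit_clip (real k * x + c) - unit_clip (real k * y + c)\<bar> \<le> \<bar>(real k * x + c) - (real k * y + c)\<bar>" by (rule unit_clip_bounds)
  also have "\<dots> = real k * \<bar>x - y\<bar>" by (simp add: abs_mult flip: right_diff_distrib)
  finally show ?thesis .
qed

lemma unit_clip_tendsto: "(\<lambda>k. unit_clip (real k * x + c)) \<longlonglongrightarrow> (if 0 < x then 1 else if x = 0 then unit_clip c else 0)"
proof -
  consider "0 < x" | "x = 0" | "x < 0" by linarith
  then show ?thesis
  proof cases
    case 1
    have "eventually (\<lambda>k. unit_clip (real k * x + c) = 1) sequentially"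
    proof -
      obtain n where n: "(1 - c) / x < real n" using reals_Archimedean2 by blast
      show ?thesis
      proof (rule eventually_sequentiallyI[of n])
        fix k assume "n \<le> k"
        then have "(1 - c) / x < real k" using n by linarith
        then have "1 < real k * x + c" using 1 by (simp add: divide_less_eq)
        then show "unit_clip (real k * x + c) = 1" by (simp add: unit_clip_def)
      qed
    qed
    then show ?thesis using 1 by (simp add: tendsto_eventually)
  next
    case 3
    have "eventually (\<lambda>k. unit_clip (real k * x + c) = 0) sequentially"
    proof -
      obtain n where n: "c / (- x) < real n" using reals_Archimedean2 by blast
      show ?thesis
      proof (rule eventually_sequentiallyI[of n])
        fix k assume "n \<le> k"
        then have "c / (- x) < real k" using n by linarith
        then have "c < real k * (- x)" using 3 by (subst (asm) pos_divide_less_eq) auto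
        then show "unit_clip (real k * x + c) = 0" by (simp add: unit_clip_def)
      qed
    qed
    then show ?thesis using 3 by (simp add: tendsto_eventually)
  qed simp
qed

lemma integral_indicator_Collect:
  "(LINT \<omega>|K. indicator {\<omega>\<in>space K. P \<omega>} \<omega>) = measure K {\<omega>\<in>space K. P \<omega>}"
proof -
  have "{\<omega>\<in>space K. P \<omega>} \<inter> space K = {\<omega>\<in>space K. P \<omega>}" by auto
  then show ?thesis by simp
qed

text \<open>The portmanteau argument for the event of being positive: the probability lies between
  the means of two Lipschitz functions, whose limits agree because the boundary point 0 has no mass
  under the limit law.\<close>

lemma prob_pos_tendsto:
  fixes M :: "nat \<Rightarrow> 'a measure" and N :: "'b measure" and T :: "nat \<Rightarrow> 'a \<Rightarrow> real" and T' :: "'b \<Rightarrow> real"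
  assumes M: "\<And>n. prob_space (M n)" and N: "prob_space N"
    and T [measurable]: "\<And>n. T n \<in> borel_measurable (M n)" and T' [measurable]: "T' \<in> borel_measurable N"
    and lim: "\<And>g L. 0 \<le> L \<Longrightarrow> (\<And>x y. \<bar>g x - g y\<bar> \<le> L * \<bar>x - y\<bar>) \<Longrightarrow> (\<And>x. 0 \<le> g x) \<Longrightarrow> (\<And>x. g x \<le> 1) \<Longrightarrow>
        (\<lambda>n. LINT \<omega>|M n. g (T n \<omega>)) \<longlonglongrightarrow> (LINT \<omega>|N. g (T' \<omega>))"
    and zero: "measure N {\<omega>\<in>space N. T' \<omega> = 0} = 0"
  shows "(\<lambda>n. measure (M n) {\<omega>\<in>space (M n). 0 < T n \<omega>}) \<longlonglongrightarrow> measure N {\<omega>\<in>space N. 0 < T' \<omega>}"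
proof (rule LIMSEQ_I)
  fix \<epsilon> :: real assume \<epsilon>: "\<epsilon> > 0"
  interpret N: prob_space N by fact
  define p where "p = measure N {\<omega>\<in>space N. 0 < T' \<omega>}"
  have lk: "(\<lambda>k. LINT \<omega>|N. unit_clip (real k * T' \<omega> + c)) \<longlonglongrightarrow> p" for c
  proof -
    have "AE \<omega> in N. T' \<omega> \<noteq> 0"
      using AE_not_in[of "{\<omega>\<in>space N. T' \<omega> = 0}" N] zero AE_space
      by (auto simp: null_sets_def N.emeasure_eq_measure elim: eventually_elim2)
    then have ae: "AE \<omega> in N. (\<lambda>k. unit_clip (real k * T' \<omega> + c)) \<longlonglongrightarrow> indicator {\<omega>\<in>space N. 0 < T' \<omega>} \<omega>"
      using AE_space
    proof eventually_elim
      fix \<omega> assume "T' \<omega> \<noteq> 0" "\<omega> \<in> space N"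
      then show "(\<lambda>k. unit_clip (real k * T' \<omega> + c)) \<longlonglongrightarrow> indicator {\<omega>\<in>space N. 0 < T' \<omega>} \<omega>"
        using unit_clip_tendsto[of "T' \<omega>" c] by (auto simp: indicator_def split: if_splits)
    qed
    have "(\<lambda>k. LINT \<omega>|N. unit_clip (real k * T' \<omega> + c)) \<longlonglongrightarrow> (LINT \<omega>|N. indicator {\<omega>\<in>space N. 0 < T' \<omega>} \<omega>)"
      by (rule integral_dominated_convergence[where w = "\<lambda>_. 1"])
         (use ae unit_clip_bounds in \<open>auto simp: abs_of_nonneg\<close>)
    then show ?thesis unfolding integral_indicator_Collect p_def .
  qed
  obtain k0 where k0: "\<And>k. k \<ge> k0 \<Longrightarrow> \<bar>(LINT \<omega>|N. unit_clip (real k * T' \<omega> + 0)) - p\<bar> < \<epsilon> / 2"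
    using LIMSEQ_D[OF lk[of 0], of "\<epsilon> / 2"] \<epsilon> by auto
  obtain k1 where k1: "\<And>k. k \<ge> k1 \<Longrightarrow> \<bar>(LINT \<omega>|N. unit_clip (real k * T' \<omega> + 1)) - p\<bar> < \<epsilon> / 2"
    using LIMSEQ_D[OF lk[of 1], of "\<epsilon> / 2"] \<epsilon> by auto
  define k where "k = max k0 k1"
  have lims: "(\<lambda>n. LINT \<omega>|M n. unit_clip (real k * T n \<omega> + c)) \<longlonglongrightarrow> (LINT \<omega>|N. unit_clip (real k * T' \<omega> + c))" for c
    by (rule lim[of "real k" "\<lambda>x. unit_clip (real k * x + c)"]) (auto intro: unit_clip_affine_lipschitz unit_clip_bounds)
  obtain n0 where n0: "\<And>n. n \<ge> n0 \<Longrightarrow> \<bar>(LINT \<omega>|M n. unit_clip (real k * T n \<omega> + 0)) - (LINT \<omega>|N. unit_clip (real k * T' \<omega> + 0))\<bar> < \<epsilon> / 2"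
    using LIMSEQ_D[OF lims[of 0], of "\<epsilon> / 2"] \<epsilon> by auto
  obtain n1 where n1: "\<And>n. n \<ge> n1 \<Longrightarrow> \<bar>(LINT \<omega>|M n. unit_clip (real k * T n \<omega> + 1)) - (LINT \<omega>|N. unit_clip (real k * T' \<omega> + 1))\<bar> < \<epsilon> / 2"
    using LIMSEQ_D[OF lims[of 1], of "\<epsilon> / 2"] \<epsilon> by auto
  have sw: "(LINT \<omega>|M n. unit_clip (real k * T n \<omega> + 0)) \<le> measure (M n) {\<omega>\<in>space (M n). 0 < T n \<omega>}"
    "measure (M n) {\<omega>\<in>space (M n). 0 < T n \<omega>} \<le> (LINT \<omega>|M n. unit_clip (real k * T n \<omega> + 1))" for n
  proof -
    interpret M: prob_space "M n" by (rule M)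
    have i: "integrable (M n) (\<lambda>\<omega>. unit_clip (real k * T n \<omega> + c))" for c
      using unit_clip_bounds by (intro M.integrable_const_bound[where B = 1]) (auto simp: abs_of_nonneg)
    have e: "measure (M n) {\<omega>\<in>space (M n). 0 < T n \<omega>} = (LINT \<omega>|M n. indicator {\<omega>\<in>space (M n). 0 < T n \<omega>} \<omega>)"
      by (rule integral_indicator_Collect[symmetric])
    have ii: "integrable (M n) (indicat_real {\<omega>\<in>space (M n). 0 < T n \<omega>})"
      by (intro integrable_real_indicator) (auto simp: less_top[symmetric])
    have c0: "unit_clip (real k * x + 0) \<le> (if 0 < x then 1 else 0)" for x
    proof (cases "0 < x")
      case False
      then have "real k * x \<le> 0" by (intro mult_nonneg_nonpos) auto
      then show ?thesis using False by (simp add: unit_clip_def)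
    qed (use unit_clip_bounds(2) in simp)
    have c1: "(if 0 < x then 1 else 0) \<le> unit_clip (real k * x + 1)" for x
      using unit_clip_bounds(1)[of "real k * x + 1"] by (auto simp: unit_clip_def)
    show "(LINT \<omega>|M n. unit_clip (real k * T n \<omega> + 0)) \<le> measure (M n) {\<omega>\<in>space (M n). 0 < T n \<omega>}"
      unfolding e
    proof (intro integral_mono i ii)
      fix \<omega> assume "\<omega> \<in> space (M n)"
      then show "unit_clip (real k * T n \<omega> + 0) \<le> indicator {\<omega>\<in>space (M n). 0 < T n \<omega>} \<omega>"
        using c0[of "T n \<omega>"] by (cases "0 < T n \<omega>") auto
    qed
    show "measure (M n) {\<omega>\<in>space (M n). 0 < T n \<omega>} \<le> (LINT \<omega>|M n. unit_clip (real k * T n \<omega> + 1))"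
      unfolding e
    proof (intro integral_mono i ii)
      fix \<omega> assume "\<omega> \<in> space (M n)"
      then show "indicator {\<omega>\<in>space (M n). 0 < T n \<omega>} \<omega> \<le> unit_clip (real k * T n \<omega> + 1)"
        using c1[of "T n \<omega>"] by (cases "0 < T n \<omega>") auto
    qed
  qed
  show "\<exists>n2. \<forall>n\<ge>n2. norm (measure (M n) {\<omega>\<in>space (M n). 0 < T n \<omega>} - measure N {\<omega>\<in>space N. 0 < T' \<omega>}) < \<epsilon>"
  proof (intro exI[of _ "max n0 n1"] allI impI)
    fix n assume "max n0 n1 \<le> n"
    then have "n0 \<le> n" "n1 \<le> n" by auto
    have "k0 \<le> k" "k1 \<le> k" by (auto simp: k_def)
    from n0[OF \<open>n0 \<le> n\<close>] n1[OF \<open>n1 \<le> n\<close>] sw[of n] k0[OF this(1)] k1[OF this(2)]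
    show "norm (measure (M n) {\<omega>\<in>space (M n). 0 < T n \<omega>} - measure N {\<omega>\<in>space N. 0 < T' \<omega>}) < \<epsilon>"
      unfolding real_norm_def p_def[symmetric] by linarith
  qed
qed

lemma unit_clip_zero_tendsto:
  fixes V :: "'a \<Rightarrow> real"
  assumes K: "prob_space K" and [measurable]: "V \<in> borel_measurable K"
  shows "(\<lambda>k. LINT \<omega>|K. unit_clip (real k * (- \<bar>V \<omega>\<bar>) + 1)) \<longlonglongrightarrow> measure K {\<omega>\<in>space K. V \<omega> = 0}"
proof -
  interpret K: prob_space K by fact
  have "(\<lambda>k. LINT \<omega>|K. unit_clip (real k * (- \<bar>V \<omega>\<bar>) + 1)) \<longlonglongrightarrow> (LINT \<omega>|K. indicator {\<omega>\<in>space K. V \<omega> = 0} \<omega>)"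
  proof (rule integral_dominated_convergence[where w = "\<lambda>_. 1"])
    show "AE \<omega> in K. (\<lambda>k. unit_clip (real k * (- \<bar>V \<omega>\<bar>) + 1)) \<longlonglongrightarrow> indicator {\<omega>\<in>space K. V \<omega> = 0} \<omega>"
    proof (rule AE_I2)
      fix \<omega> assume "\<omega> \<in> space K"
      then show "(\<lambda>k. unit_clip (real k * (- \<bar>V \<omega>\<bar>) + 1)) \<longlonglongrightarrow> indicator {\<omega>\<in>space K. V \<omega> = 0} \<omega>"
        using unit_clip_tendsto[of "- \<bar>V \<omega>\<bar>" 1] by (auto simp: unit_clip_def split: if_splits)
    qed
  qed (use unit_clip_bounds in \<open>auto simp: abs_of_nonneg\<close>)
  then show ?thesis unfolding integral_indicator_Collect .
qed

text \<open>Clipped functions of - |x| decrease to the indicator of 0, so Lipschitz functions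
  determine the atom at 0. This carries the absence of an atom from one probability space to
  another.\<close>

lemma prob_zero_eq:
  fixes M :: "'a measure" and N :: "'b measure" and T :: "'a \<Rightarrow> real" and T' :: "'b \<Rightarrow> real"
  assumes M: "prob_space M" and N: "prob_space N"
    and T: "T \<in> borel_measurable M" and T': "T' \<in> borel_measurable N"
    and eq: "\<And>g L. 0 \<le> L \<Longrightarrow> (\<And>x y. \<bar>g x - g y\<bar> \<le> L * \<bar>x - y\<bar>) \<Longrightarrow> (\<And>x. 0 \<le> g x) \<Longrightarrow> (\<And>x. g x \<le> 1) \<Longrightarrow>
        (LINT \<omega>|M. g (T \<omega>)) = (LINT \<omega>|N. g (T' \<omega>))"
  shows "measure M {\<omega>\<in>space M. T \<omega> = 0} = measure N {\<omega>\<in>space N. T' \<omega> = 0}"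
proof -
  have "(LINT \<omega>|M. unit_clip (real k * (- \<bar>T \<omega>\<bar>) + 1)) = (LINT \<omega>|N. unit_clip (real k * (- \<bar>T' \<omega>\<bar>) + 1))" for k
  proof (rule eq[of "real k"])
    fix x y :: real
    have "real k * \<bar>- \<bar>x\<bar> - - \<bar>y\<bar>\<bar> \<le> real k * \<bar>x - y\<bar>" by (intro mult_left_mono) auto
    then show "\<bar>unit_clip (real k * - \<bar>x\<bar> + 1) - unit_clip (real k * - \<bar>y\<bar> + 1)\<bar> \<le> real k * \<bar>x - y\<bar>"
      using unit_clip_affine_lipschitz[of k "- \<bar>x\<bar>" 1 "- \<bar>y\<bar>"] by linarith
  qed (auto intro: unit_clip_bounds)
  then show ?thesis
    using LIMSEQ_unique[OF unit_clip_zero_tendsto[OF M T]] unit_clip_zero_tendsto[OF N T'] by simp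
qed

text \<open>Three comparisons: the statistic with a functional of finitely many values of the
  process, uniformly for large n; the convergence of that functional; and the same approximation for
  the limit. The sequence may be constant, in which case the theorem says that equal
  finite-dimensional laws give equal laws of the statistic.\<close>

theorem stat_tendsto:
  fixes M :: "nat \<Rightarrow> 'a measure" and N :: "'b measure" and g :: "real \<Rightarrow> real"
  assumes H: "\<And>n. hellinger_process (M n) (Zn n) (Dn n) (qn n) A C0 C1"
    and H': "hellinger_process N Z {0..} (\<lambda>_. 1) A' C0' C1'"
    and dom: "\<And>K::nat. eventually (\<lambda>n. {0..<real K} \<subseteq> Dn n) sequentially"
    and q: "\<And>(K::nat) \<epsilon>. 0 < \<epsilon> \<Longrightarrow> eventually (\<lambda>n. \<forall>w\<in>{0..<real K}. \<bar>qn n w - 1\<bar> \<le> \<epsilon>) sequentially"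
    and pos: "\<And>n w \<omega>. w \<in> Dn n \<Longrightarrow> 0 < Zn n w \<omega>" "\<And>w \<omega>. 0 < Z w \<omega>"
    and char: "\<And>(k::nat) w t. (\<And>i. i < k \<Longrightarrow> 0 \<le> w i) \<Longrightarrow>
       (\<lambda>n. CLINT \<omega>|M n. iexp (\<Sum>i<k. t i * ln (Zn n (w i) \<omega>))) \<longlonglongrightarrow> (CLINT \<omega>|N. iexp (\<Sum>i<k. t i * ln (Z (w i) \<omega>)))"
    and mom: "\<And>w. 0 \<le> w \<Longrightarrow> \<exists>B. eventually (\<lambda>n. integrable (M n) (\<lambda>\<omega>. ln (Zn n w \<omega>)) \<and> (LINT \<omega>|M n. \<bar>ln (Zn n w \<omega>)\<bar>) \<le> B) sequentially"
    and mom': "\<And>w. 0 \<le> w \<Longrightarrow> integrable N (\<lambda>\<omega>. ln (Z w \<omega>))"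
    and L: "0 \<le> L" and g: "\<And>x y. \<bar>g x - g y\<bar> \<le> L * \<bar>x - y\<bar>" "\<And>x. 0 \<le> g x" "\<And>x. g x \<le> 1"
  shows "(\<lambda>n. LINT \<omega>|M n. g (hellinger_process.stat (Zn n) (Dn n) (qn n) m \<omega>))
     \<longlonglongrightarrow> (LINT \<omega>|N. g (hellinger_process.stat Z {0..} (\<lambda>_. 1) m \<omega>))"
proof -
  interpret N: hellinger_process N Z "{0..}" "\<lambda>_. 1" A' C0' C1' by (rule H')
  have M: "prob_space (M n)" for n using H[of n] by (simp add: hellinger_process_def)
  have gc: "continuous_on UNIV g"
  proof -
    have "L-lipschitz_on UNIV g" using g(1) L by (intro lipschitz_onI) (auto simp: dist_real_def)
    then show ?thesis by (rule lipschitz_on_continuous_on)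
  qed
  have fdd: "(\<lambda>n. LINT \<omega>|M n. g ((\<Sum>i<K * R. Zn n (real i / R) \<omega> / R) - m * Zn n 0 \<omega>))
     \<longlonglongrightarrow> (LINT \<omega>|N. g ((\<Sum>i<K * R. Z (real i / R) \<omega> / R) - m * Z 0 \<omega>))" if "R > 0" for K R :: nat
  proof -
    \<comment> \<open>The nodes of the Riemann sum take the indices below K * R, and the index K * R
      is reserved for the value at 0 that is subtracted. The vector consists of logarithms, whose
      characteristic functions are the ones available; \<open>F\<close> exponentiates them again and
      stays bounded through g.\<close>
    define k where "k = Suc (K * R)"
    define w where "w i = (if i < K * R then real i / R else 0)" for i
    define F where "F y = g ((\<Sum>i<K * R. exp (y i) / R) - m * exp (y (K * R)))" for y :: "nat \<Rightarrow> real"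
    have w0: "0 \<le> w i" for i by (simp add: w_def)
    have wK: "w i < real (Suc K)" for i
    proof (cases "i < K * R")
      case True
      then have "real i < real (K * R)" by (simp only: of_nat_less_iff)
      then have "real i / R < real K" using that by (simp add: divide_less_eq)
      then show ?thesis using True by (simp add: w_def)
    qed (simp add: w_def)
    have Fc: "continuous_on UNIV F"
      unfolding F_def
      by (rule continuous_on_compose2[OF gc]) (auto intro!: continuous_intros continuous_on_product_coordinates)
    define ev where "ev w B \<longleftrightarrow> eventually (\<lambda>n. integrable (M n) (\<lambda>\<omega>. ln (Zn n w \<omega>)) \<and> (LINT \<omega>|M n. \<bar>ln (Zn n w \<omega>)\<bar>) \<le> B) sequentially" for w B
    have "\<exists>B. ev (w i) B" for i using mom[OF w0[of i]] by (simp add: ev_def)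
    then have "\<exists>B. \<forall>i. ev (w i) (B i)" by (intro choice allI)
    then obtain B where B': "\<forall>i. ev (w i) (B i)" by blast
    have B: "eventually (\<lambda>n. integrable (M n) (\<lambda>\<omega>. ln (Zn n (w i) \<omega>)) \<and> (LINT \<omega>|M n. \<bar>ln (Zn n (w i) \<omega>)\<bar>) \<le> B i) sequentially" for i
      using B'[rule_format, of i] by (simp add: ev_def)
    define BB where "BB = (\<Sum>i<k. \<bar>B i\<bar> + (LINT \<omega>|N. \<bar>ln (Z (w i) \<omega>)\<bar>))"
    have BB: "B i \<le> BB" "(LINT \<omega>|N. \<bar>ln (Z (w i) \<omega>)\<bar>) \<le> BB" if "i < k" for i
    proof -
      have "\<bar>B i\<bar> + (LINT \<omega>|N. \<bar>ln (Z (w i) \<omega>)\<bar>) \<le> BB"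
        unfolding BB_def using that by (intro member_le_sum) auto
      moreover have "0 \<le> (LINT \<omega>|N. \<bar>ln (Z (w i) \<omega>)\<bar>)" by simp
      ultimately show "B i \<le> BB" "(LINT \<omega>|N. \<bar>ln (Z (w i) \<omega>)\<bar>) \<le> BB" by linarith+
    qed
    have "eventually (\<lambda>n. \<forall>i\<in>{..<k}. integrable (M n) (\<lambda>\<omega>. ln (Zn n (w i) \<omega>)) \<and> (LINT \<omega>|M n. \<bar>ln (Zn n (w i) \<omega>)\<bar>) \<le> B i) sequentially"
      using B by (intro eventually_ball_finite) auto
    then have "eventually (\<lambda>n. (\<forall>i\<in>{..<k}. integrable (M n) (\<lambda>\<omega>. ln (Zn n (w i) \<omega>)) \<and> (LINT \<omega>|M n. \<bar>ln (Zn n (w i) \<omega>)\<bar>) \<le> B i)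
        \<and> {0..<real (Suc K)} \<subseteq> Dn n) sequentially"
      using dom[of "Suc K"] by (rule eventually_conj)
    then obtain n0 where n0: "\<And>n i. n \<ge> n0 \<Longrightarrow> i < k \<Longrightarrow> integrable (M n) (\<lambda>\<omega>. ln (Zn n (w i) \<omega>))"
      "\<And>n i. n \<ge> n0 \<Longrightarrow> i < k \<Longrightarrow> (LINT \<omega>|M n. \<bar>ln (Zn n (w i) \<omega>)\<bar>) \<le> B i" "\<And>n. n \<ge> n0 \<Longrightarrow> {0..<real (Suc K)} \<subseteq> Dn n"
      unfolding eventually_sequentially by blast
    \<comment> \<open>The continuity theorem asks for moment bounds at every index, so the sequence
      is started at n0.\<close>
    have "(\<lambda>n. LINT \<omega>|M (n + n0). F (\<lambda>i. if i < k then ln (Zn (n + n0) (w i) \<omega>) else 0))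
       \<longlonglongrightarrow> (LINT \<omega>|N. F (\<lambda>i. if i < k then ln (Z (w i) \<omega>) else 0))"
    proof (rule levy_continuity_multi[where B = BB and C = 1])
      show "(\<lambda>n. CLINT \<omega>|M (n + n0). iexp (\<Sum>i<k. t i * ln (Zn (n + n0) (w i) \<omega>))) \<longlonglongrightarrow> (CLINT \<omega>|N. iexp (\<Sum>i<k. t i * ln (Z (w i) \<omega>)))" for t
        using LIMSEQ_ignore_initial_segment[OF char[of k w t], of n0] w0 by simp
      show "(LINT \<omega>|M (n + n0). \<bar>ln (Zn (n + n0) (w i) \<omega>)\<bar>) \<le> BB" if "i < k" for n i
        using n0(2)[of "n + n0" i] BB(1)[OF that] that by simp
      show "\<bar>F y\<bar> \<le> 1" for y using g(2,3) by (simp add: F_def)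
    qed (use M N.prob_space_axioms n0(1) mom' w0 BB(2) Fc in auto)
    moreover have "F (\<lambda>i. if i < k then ln (Zn (n + n0) (w i) \<omega>) else 0) = g ((\<Sum>i<K * R. Zn (n + n0) (real i / R) \<omega> / R) - m * Zn (n + n0) 0 \<omega>)" for n \<omega>
    proof -
      have "w i \<in> Dn (n + n0)" for i using n0(3)[of "n + n0"] w0[of i] wK[of i] by auto
      then have e: "exp (ln (Zn (n + n0) (w i) \<omega>)) = Zn (n + n0) (w i) \<omega>" for i using pos(1) by simp
      show ?thesis unfolding F_def by (simp add: k_def less_Suc_eq e) (simp add: w_def)
    qed
    moreover have "F (\<lambda>i. if i < k then ln (Z (w i) \<omega>) else 0) = g ((\<Sum>i<K * R. Z (real i / R) \<omega> / R) - m * Z 0 \<omega>)" for \<omega>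
      unfolding F_def using pos(2) by (simp add: k_def less_Suc_eq) (simp add: w_def)
    ultimately have "(\<lambda>n. LINT \<omega>|M (n + n0). g ((\<Sum>i<K * R. Zn (n + n0) (real i / R) \<omega> / R) - m * Zn (n + n0) 0 \<omega>))
     \<longlonglongrightarrow> (LINT \<omega>|N. g ((\<Sum>i<K * R. Z (real i / R) \<omega> / R) - m * Z 0 \<omega>))" by simp
    then show ?thesis by (rule LIMSEQ_offset)
  qed
  define a c0 c1 where "a = max A A'" and "c0 = max C0 C0'" and "c1 = max C1 C1'"
  have Hn: "hellinger_process (M n) (Zn n) (Dn n) (qn n) a c0 c1" for n
    by (rule hellinger_process_mono[OF H]) (auto simp: a_def c0_def c1_def)
  have HN: "hellinger_process N Z {0..} (\<lambda>_. 1) a c0 c1"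
    by (rule hellinger_process_mono[OF H']) (auto simp: a_def c0_def c1_def)
  have c: "0 \<le> a" "0 \<le> c0" "0 \<le> c1" using HN by (auto simp: hellinger_process_def hellinger_process_axioms_def)
  show ?thesis
  proof (rule LIMSEQ_I)
    fix e :: real assume e: "e > 0"
    \<comment> \<open>The order of choices is \<delta> from e and L, then K from \<delta>, then R
      and \<epsilon> from K. Each of the four error terms is at most e / 24, so each approximation
      costs e / 6.\<close>
    define \<delta> where "\<delta> = e / (24 * (L + 1))"
    have \<delta>: "\<delta> > 0" using e L by (simp add: \<delta>_def)
    have "L * \<delta> \<le> (L + 1) * \<delta>" using \<delta> by simp
    moreover have canc: "y * (e / (24 * y)) = e / 24" if "y > 0" for y :: real using that by (simp add: field_simps)
    have "(L + 1) * \<delta> = e / 24" unfolding \<delta>_def using L by (intro canc) simp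
    ultimately have L\<delta>: "L * \<delta> \<le> e / 24" by simp
    have h: "(\<lambda>K. x * (1 / 2) ^ K) \<longlonglongrightarrow> x * 0" for x :: real
      by (intro tendsto_mult_left LIMSEQ_realpow_zero) auto
    have "eventually (\<lambda>K. 8 * a * (1 / 2) ^ K < \<delta>) sequentially"
      using order_tendstoD(2)[OF h[of "8 * a"], of \<delta>] \<delta> by simp
    moreover have "eventually (\<lambda>K. (2 * c0 + 16 * a * c1 / \<delta>) * (1 / 2) ^ K < e / 24) sequentially"
      using order_tendstoD(2)[OF h[of "2 * c0 + 16 * a * c1 / \<delta>"], of "e / 24"] e by simp
    ultimately have "eventually (\<lambda>K. 8 * a * (1 / 2) ^ K < \<delta> \<and> (2 * c0 + 16 * a * c1 / \<delta>) * (1 / 2) ^ K < e / 24) sequentially"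
      by (rule eventually_conj)
    then obtain K where K: "8 * a * (1 / 2) ^ K < \<delta>" "(2 * c0 + 16 * a * c1 / \<delta>) * (1 / 2) ^ K < e / 24"
      unfolding eventually_sequentially by blast
    have K1: "8 * a / 2 ^ K \<le> \<delta>" using K(1) by (simp add: power_one_over)
    have K2: "2 * c0 / 2 ^ K + 16 * a * c1 / (\<delta> * 2 ^ K) \<le> e / 24"
    proof -
      have "2 * c0 / 2 ^ K + 16 * a * c1 / (\<delta> * 2 ^ K) = (2 * c0 + 16 * a * c1 / \<delta>) * (1 / 2) ^ K"
        using \<delta> by (simp add: power_one_over field_simps)
      then show ?thesis using K(2) by simp
    qed
    define x where "x = L * (real K * (c1 + 2))"
    have x: "x \<ge> 0" using L c by (simp add: x_def)
    obtain R :: nat where R': "max 1 ((24 * x / e)\<^sup>2) < real R" using reals_Archimedean2 by blast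
    then have R: "(24 * x / e)\<^sup>2 < real R" "R > 0" by auto
    have "24 * x / e < sqrt R" using R(1) real_less_rsqrt by blast
    then have R2: "x / sqrt R \<le> e / 24" using e R by (simp add: divide_less_eq divide_le_eq mult.commute)
    define \<epsilon> where "\<epsilon> = e / (24 * (L * K + 1))"
    have LK: "0 \<le> L * K" using L by simp
    have \<epsilon>: "\<epsilon> > 0" unfolding \<epsilon>_def using e LK by (intro divide_pos_pos) auto
    have "L * K * \<epsilon> \<le> (L * K + 1) * \<epsilon>" using \<epsilon> by simp
    also have "\<dots> = e / 24" unfolding \<epsilon>_def using LK by (intro canc) simp
    finally have LK\<epsilon>: "L * K * \<epsilon> \<le> e / 24" .
    have bound: "2 * c0 / 2 ^ K + 16 * a * c1 / (\<delta> * 2 ^ K) + L * \<delta> + L * (real K * ((c1 + 2) / sqrt R + \<epsilon>)) \<le> e / 6"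
    proof -
      have "L * (real K * ((c1 + 2) / sqrt R + \<epsilon>)) = x / sqrt R + L * K * \<epsilon>" by (simp add: x_def algebra_simps add_divide_distrib)
      then show ?thesis using K2 L\<delta> R2 LK\<epsilon> by linarith
    qed
    have ev: "eventually (\<lambda>n. \<bar>(LINT \<omega>|M n. g (hellinger_process.stat (Zn n) (Dn n) (qn n) m \<omega>))
        - (LINT \<omega>|M n. g ((\<Sum>i<K * R. Zn n (real i / R) \<omega> / R) - m * Zn n 0 \<omega>))\<bar> \<le> e / 6) sequentially"
      using dom[of K] q[OF \<epsilon>, of K]
    proof eventually_elim
      fix n assume n: "{0..<real K} \<subseteq> Dn n" "\<forall>w\<in>{0..<real K}. \<bar>qn n w - 1\<bar> \<le> \<epsilon>"
      interpret P: hellinger_process "M n" "Zn n" "Dn n" "qn n" a c0 c1 by (rule Hn)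
      have "\<bar>(LINT \<omega>|M n. g (P.stat m \<omega>)) - (LINT \<omega>|M n. g (P.riem K R \<omega> - m * Zn n 0 \<omega>))\<bar> \<le> e / 6"
        by (rule order_trans[OF P.stat_approx[where \<epsilon> = \<epsilon> and \<delta> = \<delta> and L = L] bound])
           (use n R \<epsilon> g L \<delta> K1 in auto)
      then show "\<bar>(LINT \<omega>|M n. g (hellinger_process.stat (Zn n) (Dn n) (qn n) m \<omega>))
        - (LINT \<omega>|M n. g ((\<Sum>i<K * R. Zn n (real i / R) \<omega> / R) - m * Zn n 0 \<omega>))\<bar> \<le> e / 6"
        by (simp add: P.riem_def)
    qed
    have evN: "\<bar>(LINT \<omega>|N. g (hellinger_process.stat Z {0..} (\<lambda>_. 1) m \<omega>))
        - (LINT \<omega>|N. g ((\<Sum>i<K * R. Z (real i / R) \<omega> / R) - m * Z 0 \<omega>))\<bar> \<le> e / 6"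
    proof -
      interpret P: hellinger_process N Z "{0..}" "\<lambda>_. 1" a c0 c1 by (rule HN)
      have "\<bar>(LINT \<omega>|N. g (P.stat m \<omega>)) - (LINT \<omega>|N. g (P.riem K R \<omega> - m * Z 0 \<omega>))\<bar> \<le> e / 6"
        by (rule order_trans[OF P.stat_approx[where \<epsilon> = \<epsilon> and \<delta> = \<delta> and L = L] bound])
           (use R \<epsilon> g L \<delta> K1 in auto)
      then show ?thesis by (simp add: P.riem_def)
    qed
    have "eventually (\<lambda>n. \<bar>(LINT \<omega>|M n. g ((\<Sum>i<K * R. Zn n (real i / R) \<omega> / R) - m * Zn n 0 \<omega>))
       - (LINT \<omega>|N. g ((\<Sum>i<K * R. Z (real i / R) \<omega> / R) - m * Z 0 \<omega>))\<bar> < e / 6) sequentially"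
      using tendstoD[OF fdd[OF R(2), of K], of "e / 6"] e by (simp add: dist_real_def)
    with ev have "eventually (\<lambda>n. \<bar>(LINT \<omega>|M n. g (hellinger_process.stat (Zn n) (Dn n) (qn n) m \<omega>))
        - (LINT \<omega>|N. g (hellinger_process.stat Z {0..} (\<lambda>_. 1) m \<omega>))\<bar> < e) sequentially"
    proof eventually_elim
      case (elim n)
      then show ?case using evN e by linarith
    qed
    then show "\<exists>n0. \<forall>n\<ge>n0. norm ((LINT \<omega>|M n. g (hellinger_process.stat (Zn n) (Dn n) (qn n) m \<omega>))
        - (LINT \<omega>|N. g (hellinger_process.stat Z {0..} (\<lambda>_. 1) m \<omega>))) < e"
      unfolding eventually_sequentially real_norm_def .
  qed
qed

section \<open>Fractional Brownian motion\<close>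

lemma has_bochner_integral_pair_mult:
  fixes f :: "'a \<Rightarrow> 'c::{real_normed_field, banach, second_countable_topology}" and g :: "'b \<Rightarrow> 'c"
  assumes "prob_space M1" "prob_space M2" and f: "has_bochner_integral M1 f x" and g: "has_bochner_integral M2 g y"
  shows "has_bochner_integral (M1 \<Otimes>\<^sub>M M2) (\<lambda>\<omega>. f (fst \<omega>) * g (snd \<omega>)) (x * y)"
proof -
  interpret M1: prob_space M1 by fact
  interpret M2: prob_space M2 by fact
  interpret P: pair_sigma_finite M1 M2 ..
  have i: "integrable M1 f" "integrable M2 g" and e: "x = (LINT a|M1. f a)" "y = (LINT b|M2. g b)"
    using f g by (auto simp: has_bochner_integral_iff)
  have [measurable]: "f \<in> borel_measurable M1" "g \<in> borel_measurable M2" using i by (auto simp: borel_measurable_integrable)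
  have int: "integrable (M1 \<Otimes>\<^sub>M M2) (\<lambda>\<omega>. f (fst \<omega>) * g (snd \<omega>))"
  proof (rule P.Fubini_integrable)
    show "integrable M1 (\<lambda>a. LINT b|M2. norm (f (fst (a, b)) * g (snd (a, b))))"
      using i by (simp add: norm_mult)
    show "AE a in M1. integrable M2 (\<lambda>b. f (fst (a, b)) * g (snd (a, b)))" using i by simp
  qed measurable
  have "(LINT \<omega>|(M1 \<Otimes>\<^sub>M M2). f (fst \<omega>) * g (snd \<omega>)) = (LINT a|M1. (LINT b|M2. f a * g b))"
    using P.integral_fst'[of "\<lambda>\<omega>. f (fst \<omega>) * g (snd \<omega>)", OF int] by simp
  also have "\<dots> = x * y" unfolding e using i by simp
  finally show ?thesis using int by (simp add: has_bochner_integral_iff)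
qed

text \<open>Completing the square turns the integrand into a constant times a shifted normal
  density.\<close>

lemma normal_exp_integral:
  assumes "0 < \<sigma>"
  shows "has_bochner_integral lborel (\<lambda>x. normal_density 0 \<sigma> x * exp x) (exp (\<sigma>\<^sup>2 / 2))"
proof -
  have "normal_density 0 \<sigma> x * exp x = exp (\<sigma>\<^sup>2 / 2) * normal_density (\<sigma>\<^sup>2) \<sigma> x" for x
  proof -
    have "- (x - 0)\<^sup>2 / (2 * \<sigma>\<^sup>2) + x = \<sigma>\<^sup>2 / 2 + (- (x - \<sigma>\<^sup>2)\<^sup>2 / (2 * \<sigma>\<^sup>2))"
      using assms by (simp add: field_simps power2_eq_square)
    then show ?thesis unfolding normal_density_def by (simp add: exp_add[symmetric] mult.left_commute)
  qed
  then show ?thesis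
    using has_bochner_integral_mult_right[of "exp (\<sigma>\<^sup>2 / 2)" lborel "normal_density (\<sigma>\<^sup>2) \<sigma>" 1] assms
    by (auto simp: has_bochner_integral_iff)
qed

text \<open>All transforms are expressed by the second moment, also for a degenerate variable, which
  is almost surely 0 because the mean vanishes. Linear combinations therefore need no case
  distinction later.\<close>

lemma (in prob_space) gaussian_variable_transforms:
  assumes G: "gaussian_variable M Y" and mean: "expectation Y = 0"
  shows "integrable M (\<lambda>\<omega>. (Y \<omega>)\<^sup>2)"
    and "integrable M Y"
    and "has_bochner_integral M (\<lambda>\<omega>. exp (Y \<omega>)) (exp (expectation (\<lambda>\<omega>. (Y \<omega>)\<^sup>2) / 2))"
    and "has_bochner_integral M (\<lambda>\<omega>. iexp (Y \<omega>)) (of_real (exp (- expectation (\<lambda>\<omega>. (Y \<omega>)\<^sup>2) / 2)))"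
    and "expectation (\<lambda>\<omega>. (Y \<omega>)\<^sup>2) > 0 \<Longrightarrow> prob {\<omega>\<in>space M. Y \<omega> = c} = 0"
proof -
  have Ym [measurable]: "Y \<in> borel_measurable M" using G by (simp add: gaussian_variable_def)
  have iY: "integrable M (\<lambda>\<omega>. iexp (Y \<omega>))"
    by (rule integrable_const_bound[where B = 1]) auto
  consider (normal) \<mu> \<sigma> where "0 < \<sigma>" "distributed M lborel Y (normal_density \<mu> \<sigma>)" | (const) c where "AE \<omega> in M. Y \<omega> = c"
    using G by (auto simp: gaussian_variable_def)
  then have "integrable M (\<lambda>\<omega>. (Y \<omega>)\<^sup>2) \<and> integrable M Y \<and> has_bochner_integral M (\<lambda>\<omega>. exp (Y \<omega>)) (exp (expectation (\<lambda>\<omega>. (Y \<omega>)\<^sup>2) / 2))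
     \<and> expectation (\<lambda>\<omega>. iexp (Y \<omega>)) = of_real (exp (- expectation (\<lambda>\<omega>. (Y \<omega>)\<^sup>2) / 2))
     \<and> (expectation (\<lambda>\<omega>. (Y \<omega>)\<^sup>2) > 0 \<longrightarrow> prob {\<omega>\<in>space M. Y \<omega> = c} = 0)"
  proof cases
    case normal
    have \<mu>: "\<mu> = 0" using normal_distributed_expectation[OF normal] mean by simp
    note D = normal(2)[unfolded \<mu>]
    have v: "expectation (\<lambda>\<omega>. (Y \<omega>)\<^sup>2) = \<sigma>\<^sup>2"
      using normal_distributed_variance[OF normal(1) D] mean by simp
    have 1: "integrable M (\<lambda>\<omega>. (Y \<omega>)\<^sup>2)"
      using distributed_integrable[OF D, of "\<lambda>x. x\<^sup>2"] integrable_normal_moment[OF normal(1), of 0 2] by simp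
    have 2: "integrable M Y"
      using distributed_integrable[OF D, of "\<lambda>x. x"] integrable_normal_moment[OF normal(1), of 0 1] by simp
    have 3: "has_bochner_integral M (\<lambda>\<omega>. exp (Y \<omega>)) (exp (\<sigma>\<^sup>2 / 2))"
      using distributed_integrable[OF D, of exp] distributed_integral[OF D, of exp] normal_exp_integral[OF normal(1)]
      by (auto simp: has_bochner_integral_iff)
    have "distributed M lborel (\<lambda>x. Y x / \<sigma>) std_normal_density"
      using normal_standard_normal_convert[OF normal(1), of Y 0] D by simp
    then have "distr M lborel (\<lambda>x. Y x / \<sigma>) = std_normal_distribution" by (simp add: distributed_def)
    then have "char (distr M lborel (\<lambda>x. Y x / \<sigma>)) \<sigma> = of_real (exp (- (\<sigma>\<^sup>2) / 2))" by (simp add: char_std_normal_distribution)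
    moreover have "char (distr M lborel (\<lambda>x. Y x / \<sigma>)) \<sigma> = expectation (\<lambda>\<omega>. iexp (Y \<omega>))"
      unfolding char_def using normal(1) by (subst integral_distr) auto
    ultimately have 4: "expectation (\<lambda>\<omega>. iexp (Y \<omega>)) = of_real (exp (- (\<sigma>\<^sup>2) / 2))" by simp
    have 5: "prob {\<omega>\<in>space M. Y \<omega> = c} = 0"
    proof -
      have "emeasure M (Y -` {c} \<inter> space M) = (\<integral>\<^sup>+x. ennreal (normal_density 0 \<sigma> x) * indicator {c} x \<partial>lborel)"
        by (rule distributed_emeasure[OF D]) simp
      also have "\<dots> = 0"
        using AE_lborel_singleton[of c] by (subst nn_integral_0_iff_AE) (auto elim!: eventually_mono)
      also have "Y -` {c} \<inter> space M = {\<omega>\<in>space M. Y \<omega> = c}" by auto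
      finally show ?thesis by (simp add: measure_def)
    qed
    show ?thesis using 1 2 3 4 5 v by simp
  next
    case (const c')
    have "expectation Y = expectation (\<lambda>_. c')" using const by (intro integral_cong_AE) auto
    then have "c' = 0" using mean by (simp add: prob_space)
    with const have ae: "AE \<omega> in M. Y \<omega> = 0" by simp
    have e: "expectation (\<lambda>\<omega>. (Y \<omega>)\<^sup>2) = expectation (\<lambda>_. 0)" using ae by (intro integral_cong_AE) auto
    have 1: "integrable M (\<lambda>\<omega>. (Y \<omega>)\<^sup>2)" "integrable M Y"
      using ae by (auto intro!: integrable_cong_AE_imp[of M "\<lambda>_. 0"])
    have 2: "has_bochner_integral M (\<lambda>\<omega>. exp (Y \<omega>)) (exp 0)"
    proof -
      have "has_bochner_integral M (\<lambda>_. exp (0::real)) (exp 0)" by (simp add: has_bochner_integral_iff prob_space)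
      then show ?thesis by (rule has_bochner_integral_cong_AE[THEN iffD1, rotated 3]) (use ae in auto)
    qed
    have 3: "expectation (\<lambda>\<omega>. iexp (Y \<omega>)) = expectation (\<lambda>_. iexp 0)" using ae by (intro integral_cong_AE) auto
    show ?thesis using e 1 2 3 by (simp add: prob_space)
  qed
  then show "integrable M (\<lambda>\<omega>. (Y \<omega>)\<^sup>2)" "integrable M Y" "has_bochner_integral M (\<lambda>\<omega>. exp (Y \<omega>)) (exp (expectation (\<lambda>\<omega>. (Y \<omega>)\<^sup>2) / 2))"
     "has_bochner_integral M (\<lambda>\<omega>. iexp (Y \<omega>)) (of_real (exp (- expectation (\<lambda>\<omega>. (Y \<omega>)\<^sup>2) / 2)))"
     "expectation (\<lambda>\<omega>. (Y \<omega>)\<^sup>2) > 0 \<Longrightarrow> prob {\<omega>\<in>space M. Y \<omega> = c} = 0"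
    using iY by (auto simp: has_bochner_integral_iff)
qed

section \<open>Processes with the finite-dimensional laws of fractional Brownian motion\<close>

definition fbm_cov :: "real \<Rightarrow> real \<Rightarrow> real \<Rightarrow> real" where
  "fbm_cov H u v = (\<bar>u\<bar> powr (2 * H) + \<bar>v\<bar> powr (2 * H) - \<bar>u - v\<bar> powr (2 * H)) / 2"

text \<open>The variance of the linear combination with coefficients \<open>t i\<close> of the
  values at times \<open>w i\<close>.\<close>

definition fbm_quad :: "real \<Rightarrow> nat \<Rightarrow> (nat \<Rightarrow> real) \<Rightarrow> (nat \<Rightarrow> real) \<Rightarrow> real" where
  "fbm_quad H k t w = (\<Sum>i<k. \<Sum>j<k. t i * t j * fbm_cov H (w i) (w j))"

text \<open>Rounding the time down to a multiple of 1 / (n + 1) leaves countably many times, so the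
  rounded process is jointly measurable; continuity of the paths gives the limit.\<close>

lemma continuous_process_measurable:
  fixes W :: "real \<Rightarrow> 'a \<Rightarrow> real"
  assumes W: "\<And>u. W u \<in> borel_measurable M" and c: "\<And>\<omega>. \<omega> \<in> space M \<Longrightarrow> continuous_on UNIV (\<lambda>u. W u \<omega>)"
  shows "(\<lambda>(\<omega>, u). W u \<omega>) \<in> borel_measurable (M \<Otimes>\<^sub>M lborel)"
proof (rule borel_measurable_LIMSEQ_real)
  fix n :: nat
  have "(\<lambda>x. W (real_of_int \<lfloor>snd x * real (Suc n)\<rfloor> / real (Suc n)) (fst x)) \<in> borel_measurable (M \<Otimes>\<^sub>M lborel)"
    by (rule measurable_compose_countable[where f = "\<lambda>i x. W (real_of_int i / real (Suc n)) (fst x)"])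
       (auto intro!: measurable_compose[OF measurable_fst W])
  then show "(\<lambda>(\<omega>, u). W (real_of_int \<lfloor>u * real (Suc n)\<rfloor> / real (Suc n)) \<omega>) \<in> borel_measurable (M \<Otimes>\<^sub>M lborel)"
    by (simp add: split_beta')
next
  fix x assume "x \<in> space (M \<Otimes>\<^sub>M (lborel :: real measure))"
  then obtain \<omega> and u :: real where x: "x = (\<omega>, u)" "\<omega> \<in> space M" by (auto simp: space_pair_measure)
  have lim: "(\<lambda>n. real_of_int \<lfloor>u * real (Suc n)\<rfloor> / real (Suc n)) \<longlonglongrightarrow> u"
  proof (rule tendsto_sandwich[where f = "\<lambda>n. u - 1 / real (Suc n)" and h = "\<lambda>n. u"])
    have b: "u * real (Suc n) - 1 \<le> real_of_int \<lfloor>u * real (Suc n)\<rfloor>" "real_of_int \<lfloor>u * real (Suc n)\<rfloor> \<le> u * real (Suc n)" for n by linarith+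
    have "(u * real (Suc n) - 1) / real (Suc n) \<le> real_of_int \<lfloor>u * real (Suc n)\<rfloor> / real (Suc n)"
       "real_of_int \<lfloor>u * real (Suc n)\<rfloor> / real (Suc n) \<le> u * real (Suc n) / real (Suc n)" for n
      by (rule divide_right_mono[OF b(1)], simp) (rule divide_right_mono[OF b(2)], simp)
    then show "\<forall>\<^sub>F n in sequentially. u - 1 / real (Suc n) \<le> real_of_int \<lfloor>u * real (Suc n)\<rfloor> / real (Suc n)"
       "\<forall>\<^sub>F n in sequentially. real_of_int \<lfloor>u * real (Suc n)\<rfloor> / real (Suc n) \<le> u"
      by (auto simp: diff_divide_distrib simp del: of_nat_Suc)
    have "(\<lambda>n. u - 1 / real (Suc n)) \<longlonglongrightarrow> u - 0" by (intro tendsto_diff tendsto_const lim_1_over_n LIMSEQ_Suc)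
    then show "(\<lambda>n. u - 1 / real (Suc n)) \<longlonglongrightarrow> u" by simp
  qed simp
  have "isCont (\<lambda>u. W u \<omega>) u" using c[OF x(2)] by (simp add: continuous_on_eq_continuous_at)
  from isCont_tendsto_compose[OF this lim]
  show "(\<lambda>n. case x of (\<omega>, u) \<Rightarrow> W (real_of_int \<lfloor>u * real (Suc n)\<rfloor> / real (Suc n)) \<omega>) \<longlonglongrightarrow> (case x of (\<omega>, u) \<Rightarrow> W u \<omega>)"
    using x by simp
qed

text \<open>Retains only what the analysis of the integral statistic uses: joint measurability and
  the transforms of finite linear combinations. The resampled process is checked against this list
  and not against the full definition of fractional Brownian motion.\<close>

locale fbm_law = prob_space M for M :: "'a measure" +
  fixes H :: real and V :: "real \<Rightarrow> 'a \<Rightarrow> real"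
  assumes H: "1 / 2 < H" "H < 1"
    and V_measurable: "(\<lambda>(\<omega>, u). V u \<omega>) \<in> borel_measurable (M \<Otimes>\<^sub>M lborel)"
    and V_mgf: "has_bochner_integral M (\<lambda>\<omega>. exp (\<Sum>i<k. t i * V (w i) \<omega>)) (exp (fbm_quad H k t w / 2))"
    and V_char: "(CLINT \<omega>|M. iexp (\<Sum>i<k. t i * V (w i) \<omega>)) = of_real (exp (- fbm_quad H k t w / 2))"

text \<open>Since 2 H > 1, the power |w - u| powr (2 * H) outgrows every linear function, in
  particular w * ln 16; a bounded range of w is absorbed in the constant.\<close>

lemma hurst_decay:
  fixes c H u :: real
  assumes c: "0 < c" and H: "1 / 2 < H"
  obtains C where "0 \<le> C" "\<And>w. 0 \<le> w \<Longrightarrow> exp (- c * \<bar>w - u\<bar> powr (2 * H)) \<le> C / 16 ^ nat \<lfloor>w\<rfloor>"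
proof -
  define a where "a = 2 * H - 1"
  have a: "a > 0" using H by (simp add: a_def)
  \<comment> \<open>From y0 on, c * y powr (2 * H) is at least 2 * y * ln 16. Beyond W0 the distance
    y = |w - u| is at least w / 2 and at least y0, so the loss of a factor 2 in y is made
    up.\<close>
  define y0 where "y0 = (2 * ln 16 / c) powr (1 / a)"
  have l16: "ln 16 > (0::real)" by simp
  have y0: "y0 > 0" using c l16 by (simp add: y0_def)
  define W0 where "W0 = max (2 * \<bar>u\<bar>) (2 * y0)"
  have W0: "W0 \<ge> 0" by (simp add: W0_def)
  have key: "w * ln 16 - c * \<bar>w - u\<bar> powr (2 * H) \<le> W0 * ln 16" if "0 \<le> w" for w
  proof (cases "w \<le> W0")
    case True
    have "0 \<le> c * \<bar>w - u\<bar> powr (2 * H)" using c by simp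
    moreover have "w * ln 16 \<le> W0 * ln 16" using True l16 by (intro mult_right_mono) auto
    ultimately show ?thesis by linarith
  next
    case False
    define y where "y = \<bar>w - u\<bar>"
    have yw: "w / 2 \<le> y" "y0 \<le> y" using False by (auto simp: y_def W0_def)
    have y: "y > 0" using yw y0 by linarith
    have "2 * ln 16 / c = y0 powr a" using a c by (simp add: y0_def powr_powr)
    also have "\<dots> \<le> y powr a" using yw y0 a by (intro powr_mono2) auto
    finally have "2 * ln 16 \<le> c * y powr a" using c by (simp add: divide_le_eq mult.commute)
    then have "y * (2 * ln 16) \<le> y * (c * y powr a)" using y by (intro mult_left_mono) auto
    have "y * (c * y powr a) = c * y powr (2 * H)" using y by (simp add: a_def powr_mult_base[symmetric] powr_diff field_simps)
    have "w * ln 16 \<le> c * y powr (2 * H)"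
    proof -
      have "w * ln 16 = w / 2 * (2 * ln 16)" by simp
      also have "\<dots> \<le> y * (2 * ln 16)" using yw(1) l16 by (intro mult_right_mono) auto
      finally show ?thesis using \<open>y * (2 * ln 16) \<le> y * (c * y powr a)\<close> \<open>y * (c * y powr a) = c * y powr (2 * H)\<close> by linarith
    qed
    moreover have "0 \<le> W0 * ln 16" using W0 l16 by simp
    ultimately show ?thesis by (simp add: y_def)
  qed
  show ?thesis
  proof (rule that[of "exp (W0 * ln 16)"])
    fix w :: real assume w: "0 \<le> w"
    have "(16::real) ^ nat \<lfloor>w\<rfloor> = 16 powr real (nat \<lfloor>w\<rfloor>)" by (simp add: powr_realpow)
    also have "\<dots> \<le> 16 powr w" using w by (intro powr_mono) auto
    also have "\<dots> = exp (w * ln 16)" by (simp add: powr_def)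
    finally have "exp (- c * \<bar>w - u\<bar> powr (2 * H)) * 16 ^ nat \<lfloor>w\<rfloor> \<le> exp (- c * \<bar>w - u\<bar> powr (2 * H)) * exp (w * ln 16)"
      by (intro mult_left_mono) auto
    also have "\<dots> = exp (w * ln 16 - c * \<bar>w - u\<bar> powr (2 * H))" by (simp add: exp_add[symmetric])
    also have "\<dots> \<le> exp (W0 * ln 16)" using key[OF w] by simp
    finally show "exp (- c * \<bar>w - u\<bar> powr (2 * H)) \<le> exp (W0 * ln 16) / 16 ^ nat \<lfloor>w\<rfloor>" by (simp add: le_divide_eq)
  qed simp
qed

text \<open>The limit of the likelihood ratio relative to the true local parameter u, with w still
  measured from the null value; hence its value at w = 0 is Z(- u).\<close>

definition shifted_Z :: "real \<Rightarrow> (real \<Rightarrow> 'a \<Rightarrow> real) \<Rightarrow> real \<Rightarrow> real \<Rightarrow> 'a \<Rightarrow> real" where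
  "shifted_Z H V u w = limit_Z H V (w - u)"

context fbm_law
begin

lemma V_meas_pair [measurable (raw)]:
  assumes "f \<in> N \<rightarrow>\<^sub>M M" "e \<in> borel_measurable N"
  shows "(\<lambda>x. V (e x) (f x)) \<in> borel_measurable N"
proof -
  have "(\<lambda>x. (f x, e x)) \<in> N \<rightarrow>\<^sub>M M \<Otimes>\<^sub>M lborel" using assms by simp
  from measurable_compose[OF this V_measurable] show ?thesis by simp
qed

lemma V_mgf1: "has_bochner_integral M (\<lambda>\<omega>. exp (t * V v \<omega>)) (exp (t\<^sup>2 * \<bar>v\<bar> powr (2 * H) / 2))"
  using V_mgf[where k = 1 and t = "\<lambda>_. t" and w = "\<lambda>_. v"] by (simp add: fbm_quad_def fbm_cov_def power2_eq_square)

lemma V_mgf2: "has_bochner_integral M (\<lambda>\<omega>. exp ((V v \<omega> + V v' \<omega>) / 2))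
   (exp ((2 * \<bar>v\<bar> powr (2 * H) + 2 * \<bar>v'\<bar> powr (2 * H) - \<bar>v - v'\<bar> powr (2 * H)) / 8))"
proof -
  have q: "fbm_quad H 2 (\<lambda>_. 1 / 2) (\<lambda>i. if i = 0 then v else v') / 2 = (2 * \<bar>v\<bar> powr (2 * H) + 2 * \<bar>v'\<bar> powr (2 * H) - \<bar>v - v'\<bar> powr (2 * H)) / 8"
    by (simp add: fbm_quad_def fbm_cov_def numeral_2_eq_2 abs_minus_commute) (simp add: field_simps)
  have l: "(\<Sum>i<(2::nat). 1 / 2 * V (if i = 0 then v else v') \<omega>) = (V v \<omega> + V v' \<omega>) / 2" for \<omega>
    by (simp add: numeral_2_eq_2 add_divide_distrib)
  show ?thesis
    using V_mgf[where k = 2 and t = "\<lambda>_. 1 / 2" and w = "\<lambda>i. if i = (0::nat) then v else v'"] unfolding q l .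
qed

lemma V_integrable: "integrable M (V v)"
proof (rule Bochner_Integration.integrable_bound)
  show "integrable M (\<lambda>\<omega>. exp (1 * V v \<omega>) + exp ((-1) * V v \<omega>))"
    using V_mgf1[of 1 v] V_mgf1[of "-1" v] by (intro Bochner_Integration.integrable_add) (auto simp: has_bochner_integral_iff)
  show "AE \<omega> in M. norm (V v \<omega>) \<le> norm (exp (1 * V v \<omega>) + exp ((-1) * V v \<omega>))"
  proof (intro AE_I2)
    fix \<omega>
    have "V v \<omega> \<le> exp (V v \<omega>)" "- V v \<omega> \<le> exp (- V v \<omega>)"
      using exp_ge_add_one_self[of "V v \<omega>"] exp_ge_add_one_self[of "- V v \<omega>"] by linarith+
    then have "\<bar>V v \<omega>\<bar> \<le> exp (V v \<omega>) + exp (- V v \<omega>)"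
      using exp_gt_zero[of "V v \<omega>"] exp_gt_zero[of "- V v \<omega>"] by linarith
    then show "norm (V v \<omega>) \<le> norm (exp (1 * V v \<omega>) + exp ((-1) * V v \<omega>))" by simp
  qed
qed measurable

lemma shifted_Z_pos: "0 < shifted_Z H V u w \<omega>"
  by (simp add: shifted_Z_def limit_Z_def)

lemma ln_shifted_Z: "ln (shifted_Z H V u w \<omega>) = V (w - u) \<omega> - \<bar>w - u\<bar> powr (2 * H) / 2"
  by (simp add: shifted_Z_def limit_Z_def)

lemma ln_shifted_Z_integrable: "integrable M (\<lambda>\<omega>. ln (shifted_Z H V u w \<omega>))"
  unfolding ln_shifted_Z using V_integrable by simp

text \<open>Gaussian exponential moments give the affinity exp (- |w - v| powr (2 * H) / 8), and the
  mean root is the same expression with v = u. The first is at least 1 - |w - v| at distances up to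
  1 because 2 H > 1; the second decays by \<open>hurst_decay\<close>.\<close>

lemma hellinger_shifted_Z:
  obtains C0 where "hellinger_process M (shifted_Z H V u) {0..} (\<lambda>_. 1) 1 C0 1"
proof -
  obtain C where C: "0 \<le> C" "\<And>w. 0 \<le> w \<Longrightarrow> exp (- (1 / 8) * \<bar>w - u\<bar> powr (2 * H)) \<le> C / 16 ^ nat \<lfloor>w\<rfloor>"
    using hurst_decay[of "1 / 8" H u] H by auto
  have sq: "sqrt (exp x) = exp (x / 2)" for x :: real by (rule real_sqrt_unique) (simp_all add: power2_eq_square exp_add[symmetric])
  have "hellinger_process M (shifted_Z H V u) {0..} (\<lambda>_. 1) 1 C 1"
  proof (unfold_locales, goal_cases)
    case 1
    show ?case unfolding shifted_Z_def limit_Z_def split_beta' by measurable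
  next
    case (8 k)
    have e: "{0..} \<inter> {real k..<real k + 1} = {real k..<real k + 1}" by auto
    show ?case unfolding e by (simp add: ennreal_ge_1)
  next
    case (9 w)
    have "has_bochner_integral M (\<lambda>\<omega>. exp (1 * V (w - u) \<omega>) * exp (- (\<bar>w - u\<bar> powr (2 * H) / 2))) (exp (1\<^sup>2 * \<bar>w - u\<bar> powr (2 * H) / 2) * exp (- (\<bar>w - u\<bar> powr (2 * H) / 2)))"
      by (intro has_bochner_integral_mult_left V_mgf1)
    then show ?case
      by (simp add: shifted_Z_def[abs_def] limit_Z_def[abs_def] exp_add[symmetric])
  next
    case (10 w v)
    define X where "X = \<bar>w - u\<bar> powr (2 * H)"
    define Y where "Y = \<bar>v - u\<bar> powr (2 * H)"
    have s: "sqrt (shifted_Z H V u w \<omega> * shifted_Z H V u v \<omega>) = exp ((V (w - u) \<omega> + V (v - u) \<omega>) / 2) * exp (- (X + Y) / 4)" for \<omega>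
      unfolding shifted_Z_def limit_Z_def X_def Y_def exp_add[symmetric] sq by (simp add: field_simps)
    have "expectation (\<lambda>\<omega>. sqrt (shifted_Z H V u w \<omega> * shifted_Z H V u v \<omega>)) = exp ((2 * X + 2 * Y - \<bar>w - v\<bar> powr (2 * H)) / 8) * exp (- (X + Y) / 4)"
      unfolding s using V_mgf2[of "w - u" "v - u"] by (simp add: has_bochner_integral_iff X_def Y_def)
    also have "\<dots> = exp (- (\<bar>w - v\<bar> powr (2 * H)) / 8)" unfolding exp_add[symmetric] by (simp add: field_simps)
    finally have "1 - (\<bar>w - v\<bar> powr (2 * H)) / 8 \<le> expectation (\<lambda>\<omega>. sqrt (shifted_Z H V u w \<omega> * shifted_Z H V u v \<omega>))"
      using exp_ge_add_one_self[of "- (\<bar>w - v\<bar> powr (2 * H)) / 8"] by simp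
    moreover have "(\<bar>w - v\<bar> powr (2 * H)) \<le> \<bar>w - v\<bar> powr 1"
      using 10 H by (intro powr_mono') auto
    ultimately show ?case by simp
  next
    case (11 w)
    define X where "X = \<bar>w - u\<bar> powr (2 * H)"
    have s: "sqrt (shifted_Z H V u w \<omega>) = exp (1 / 2 * V (w - u) \<omega>) * exp (- X / 4)" for \<omega>
      unfolding shifted_Z_def limit_Z_def X_def exp_add[symmetric] sq by (simp add: field_simps)
    have "expectation (\<lambda>\<omega>. sqrt (shifted_Z H V u w \<omega>)) = exp ((1 / 2)\<^sup>2 * X / 2) * exp (- X / 4)"
      unfolding s using V_mgf1[of "1 / 2" "w - u"] by (simp add: has_bochner_integral_iff X_def)
    also have "\<dots> = exp (- (1 / 8) * X)" unfolding exp_add[symmetric] by (simp add: power2_eq_square)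
    also have "\<dots> \<le> C / 16 ^ nat \<lfloor>w\<rfloor>" unfolding X_def using 11 by (intro C) simp
    finally show ?case .
  qed (use C in \<open>auto simp: shifted_Z_pos less_imp_le\<close>)
  then show ?thesis by (rule that)
qed

lemma char_shifted_Z:
  "(CLINT \<omega>|M. iexp (\<Sum>i<k. t i * ln (shifted_Z H V u (w i) \<omega>)))
    = iexp (- (\<Sum>i<k. t i * (\<bar>w i - u\<bar> powr (2 * H) / 2))) * of_real (exp (- fbm_quad H k t (\<lambda>i. w i - u) / 2))"
proof -
  have "iexp (\<Sum>i<k. t i * ln (shifted_Z H V u (w i) \<omega>))
     = iexp (- (\<Sum>i<k. t i * (\<bar>w i - u\<bar> powr (2 * H) / 2))) * iexp (\<Sum>i<k. t i * V (w i - u) \<omega>)" for \<omega>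
    unfolding ln_shifted_Z exp_add[symmetric] distrib_left[symmetric] of_real_add[symmetric]
    by (intro arg_cong[where f = exp] arg_cong[where f = "\<lambda>x. \<i> * complex_of_real x"])
       (simp add: right_diff_distrib sum_subtractf)
  then show ?thesis
    using V_char[where k = k and t = t and w = "\<lambda>i. w i - u"] by simp
qed

end

lemma square_sum_product:
  fixes t :: "'i \<Rightarrow> real"
  shows "(\<Sum>i\<in>I. t i * x i)\<^sup>2 = (\<Sum>i\<in>I. \<Sum>j\<in>I. t i * t j * (x i * x j))"
  unfolding power2_eq_square sum_product by (intro sum.cong) (auto simp: mult_ac)

section \<open>Fractional Brownian motion and the resampled increment\<close>

locale fbm =
  fixes M :: "'a measure" and H :: real and W :: "real \<Rightarrow> 'a \<Rightarrow> real"
  assumes W: "fractional_brownian_motion M H W" and H: "1 / 2 < H" "H < 1"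
begin

sublocale prob_space M using W by (simp add: fractional_brownian_motion_def)

lemma W_gauss: "finite I \<Longrightarrow> gaussian_variable M (\<lambda>\<omega>. \<Sum>i\<in>I. c i * W i \<omega>)" and W_mean: "expectation (W v) = 0"
  using W by (auto simp: fractional_brownian_motion_def centered_gaussian_process_def)

lemma W_zero: "\<omega> \<in> space M \<Longrightarrow> W 0 \<omega> = 0" and W_cont: "\<omega> \<in> space M \<Longrightarrow> continuous_on UNIV (\<lambda>u. W u \<omega>)"
  using W by (auto simp: fractional_brownian_motion_def)

lemma W_inc: "expectation (\<lambda>\<omega>. (W u \<omega> - W v \<omega>)\<^sup>2) = \<bar>u - v\<bar> powr (2 * H)"
  using W by (auto simp: fractional_brownian_motion_def)

lemma W_gauss1: "gaussian_variable M (W v)"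
  using W_gauss[of "{v}" "\<lambda>_. 1"] by simp

lemma W_sq: "integrable M (\<lambda>\<omega>. (W v \<omega>)\<^sup>2)" and W_int: "integrable M (W v)"
  using gaussian_variable_transforms[OF W_gauss1 W_mean] by auto

lemma W_borel [measurable]: "W v \<in> borel_measurable M"
  using W_gauss1 by (simp add: gaussian_variable_def)

lemma W_second: "expectation (\<lambda>\<omega>. (W v \<omega>)\<^sup>2) = \<bar>v\<bar> powr (2 * H)"
proof -
  have "expectation (\<lambda>\<omega>. (W v \<omega>)\<^sup>2) = expectation (\<lambda>\<omega>. (W v \<omega> - W 0 \<omega>)\<^sup>2)"
    by (intro Bochner_Integration.integral_cong) (auto simp: W_zero)
  then show ?thesis by (simp add: W_inc)
qed

lemma W_prod: "integrable M (\<lambda>\<omega>. W u \<omega> * W v \<omega>)"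
proof (rule Bochner_Integration.integrable_bound)
  show "integrable M (\<lambda>\<omega>. (W u \<omega>)\<^sup>2 + (W v \<omega>)\<^sup>2)" using W_sq by simp
  show "AE \<omega> in M. norm (W u \<omega> * W v \<omega>) \<le> norm ((W u \<omega>)\<^sup>2 + (W v \<omega>)\<^sup>2)"
  proof (intro AE_I2)
    fix \<omega>
    have "2 * \<bar>W u \<omega> * W v \<omega>\<bar> \<le> (W u \<omega>)\<^sup>2 + (W v \<omega>)\<^sup>2"
      using sum_squares_bound[of "\<bar>W u \<omega>\<bar>" "\<bar>W v \<omega>\<bar>"] by (simp add: abs_mult)
    then show "norm (W u \<omega> * W v \<omega>) \<le> norm ((W u \<omega>)\<^sup>2 + (W v \<omega>)\<^sup>2)" by simp
  qed
qed measurable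

lemma W_cov: "expectation (\<lambda>\<omega>. W u \<omega> * W v \<omega>) = fbm_cov H u v"
proof -
  have eq: "(W u \<omega> - W v \<omega>)\<^sup>2 = (W u \<omega>)\<^sup>2 + (W v \<omega>)\<^sup>2 - 2 * (W u \<omega> * W v \<omega>)" for \<omega>
    by (simp add: power2_diff)
  have "\<bar>u - v\<bar> powr (2 * H) = \<bar>u\<bar> powr (2 * H) + \<bar>v\<bar> powr (2 * H) - 2 * expectation (\<lambda>\<omega>. W u \<omega> * W v \<omega>)"
    unfolding W_inc[symmetric] eq using W_sq W_prod by (simp add: W_second)
  then show ?thesis by (simp add: fbm_cov_def)
qed

text \<open>Gaussian processes are defined by sums over sets of times, whereas the times
  \<open>w i\<close> may repeat; coefficients of equal times are therefore added up first.\<close>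

lemma W_lin:
  fixes t w :: "nat \<Rightarrow> real"
  shows "gaussian_variable M (\<lambda>\<omega>. \<Sum>i<k. t i * W (w i) \<omega>)" "expectation (\<lambda>\<omega>. \<Sum>i<k. t i * W (w i) \<omega>) = 0"
    "expectation (\<lambda>\<omega>. (\<Sum>i<k. t i * W (w i) \<omega>)\<^sup>2) = fbm_quad H k t w"
proof -
  have "(\<Sum>i<k. t i * W (w i) \<omega>) = (\<Sum>v\<in>w ` {..<k}. (\<Sum>i\<in>{i\<in>{..<k}. w i = v}. t i) * W v \<omega>)" for \<omega>
  proof -
    have "(\<Sum>i<k. t i * W (w i) \<omega>) = (\<Sum>v\<in>w ` {..<k}. \<Sum>i\<in>{i\<in>{..<k}. w i = v}. t i * W (w i) \<omega>)"
      by (rule sum.image_gen) simp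
    also have "\<dots> = (\<Sum>v\<in>w ` {..<k}. (\<Sum>i\<in>{i\<in>{..<k}. w i = v}. t i) * W v \<omega>)"
      unfolding sum_distrib_right by (intro sum.cong) auto
    finally show ?thesis .
  qed
  then show "gaussian_variable M (\<lambda>\<omega>. \<Sum>i<k. t i * W (w i) \<omega>)"
    using W_gauss[of "w ` {..<k}" "\<lambda>v. \<Sum>i\<in>{i\<in>{..<k}. w i = v}. t i"] by simp
  show "expectation (\<lambda>\<omega>. \<Sum>i<k. t i * W (w i) \<omega>) = 0"
    using W_int W_mean by (subst Bochner_Integration.integral_sum) auto
  show "expectation (\<lambda>\<omega>. (\<Sum>i<k. t i * W (w i) \<omega>)\<^sup>2) = fbm_quad H k t w"
    unfolding square_sum_product fbm_quad_def W_cov[symmetric]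
    using W_prod by (simp add: Bochner_Integration.integral_sum Bochner_Integration.integrable_sum)
qed

lemma W_joint: "(\<lambda>(\<omega>, u). W u \<omega>) \<in> borel_measurable (M \<Otimes>\<^sub>M lborel)"
  by (rule continuous_process_measurable[OF W_borel W_cont])

sublocale law: fbm_law M H W
proof
  show "has_bochner_integral M (\<lambda>\<omega>. exp (\<Sum>i<k. t i * W (w i) \<omega>)) (exp (fbm_quad H k t w / 2))" for k and t w :: "nat \<Rightarrow> real"
    using gaussian_variable_transforms(3)[OF W_lin(1,2)[where t = t and w = w and k = k]] by (simp only: W_lin(3))
  show "(CLINT \<omega>|M. iexp (\<Sum>i<k. t i * W (w i) \<omega>)) = of_real (exp (- fbm_quad H k t w / 2))" for k and t w :: "nat \<Rightarrow> real"
    using gaussian_variable_transforms(4)[OF W_lin(1,2)[where t = t and w = w and k = k]] by (simp only: W_lin(3) has_bochner_integral_iff)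
qed (rule H W_joint)+

text \<open>On the product of two copies of the probability space, the increment of \<open>W\<close> over the unit interval to the right
  of \<open>- u\<close> is resampled: the new process has the same law, and conditionally on the second coordinate it is an
  affine function of a single Gaussian variable.\<close>

definition incr :: "real \<Rightarrow> 'a \<Rightarrow> real" where "incr u \<omega> = W (1 - u) \<omega> - W (- u) \<omega>"

text \<open>The increment has variance 1, so this covariance is also the regression coefficient of
  \<open>W v\<close> on it.\<close>

definition incr_cov :: "real \<Rightarrow> real \<Rightarrow> real" where "incr_cov u v = fbm_cov H v (1 - u) - fbm_cov H v (- u)"

definition resampled :: "real \<Rightarrow> real \<Rightarrow> 'a \<times> 'a \<Rightarrow> real" where
  "resampled u v = (\<lambda>(\<omega>\<^sub>1, \<omega>\<^sub>2). W v \<omega>\<^sub>2 + incr_cov u v * (incr u \<omega>\<^sub>1 - incr u \<omega>\<^sub>2))"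

lemma incr_gauss: "gaussian_variable M (\<lambda>\<omega>. s * incr u \<omega>)" "expectation (\<lambda>\<omega>. s * incr u \<omega>) = 0"
  "expectation (\<lambda>\<omega>. (s * incr u \<omega>)\<^sup>2) = s\<^sup>2"
proof -
  have "(\<Sum>i<(2::nat). (if i = 0 then s else - s) * W (if i = 0 then 1 - u else - u) \<omega>) = s * incr u \<omega>" for \<omega>
    by (simp add: numeral_2_eq_2 incr_def algebra_simps)
  then show "gaussian_variable M (\<lambda>\<omega>. s * incr u \<omega>)" "expectation (\<lambda>\<omega>. s * incr u \<omega>) = 0"
    using W_lin(1,2)[where k = 2 and t = "\<lambda>i. if i = 0 then s else - s" and w = "\<lambda>i. if i = 0 then 1 - u else - u"] by simp_all
  show "expectation (\<lambda>\<omega>. (s * incr u \<omega>)\<^sup>2) = s\<^sup>2"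
    using W_inc[of "1 - u" "- u"] by (simp add: power_mult_distrib incr_def)
qed

lemma incr_sq: "integrable M (\<lambda>\<omega>. (incr u \<omega>)\<^sup>2)"
  using gaussian_variable_transforms(1)[OF incr_gauss(1,2), of 1 u] by simp

lemma incr_prod: "integrable M (\<lambda>\<omega>. W v \<omega> * incr u \<omega>)" "expectation (\<lambda>\<omega>. W v \<omega> * incr u \<omega>) = incr_cov u v"
  unfolding incr_def incr_cov_def right_diff_distrib using W_prod by (simp_all add: W_cov)

text \<open>Subtracting the regression on the increment is an orthogonal projection, so the variance
  drops by exactly s^2.\<close>

lemma residual:
  fixes t w :: "nat \<Rightarrow> real" and k :: nat and u :: real
  defines "s \<equiv> \<Sum>i<k. t i * incr_cov u (w i)"
  shows "gaussian_variable M (\<lambda>\<omega>. (\<Sum>i<k. t i * W (w i) \<omega>) - s * incr u \<omega>)"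
    "expectation (\<lambda>\<omega>. (\<Sum>i<k. t i * W (w i) \<omega>) - s * incr u \<omega>) = 0"
    "expectation (\<lambda>\<omega>. ((\<Sum>i<k. t i * W (w i) \<omega>) - s * incr u \<omega>)\<^sup>2) = fbm_quad H k t w - s\<^sup>2"
proof -
  define t' where "t' i = (if i < k then t i else if i = k then - s else s)" for i
  define w' where "w' i = (if i < k then w i else if i = k then 1 - u else - u)" for i
  have "(\<Sum>i<Suc (Suc k). t' i * W (w' i) \<omega>) = (\<Sum>i<k. t i * W (w i) \<omega>) - s * incr u \<omega>" for \<omega>
    by (simp add: t'_def w'_def incr_def algebra_simps)
  then show "gaussian_variable M (\<lambda>\<omega>. (\<Sum>i<k. t i * W (w i) \<omega>) - s * incr u \<omega>)"
    "expectation (\<lambda>\<omega>. (\<Sum>i<k. t i * W (w i) \<omega>) - s * incr u \<omega>) = 0"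
    using W_lin(1,2)[where k = "Suc (Suc k)" and t = t' and w = w'] by simp_all
  have i1: "integrable M (\<lambda>\<omega>. (\<Sum>i<k. t i * W (w i) \<omega>)\<^sup>2)"
    by (rule gaussian_variable_transforms(1)[OF W_lin(1,2)])
  have i2: "integrable M (\<lambda>\<omega>. (\<Sum>i<k. t i * W (w i) \<omega>) * incr u \<omega>)"
    unfolding sum_distrib_right mult.assoc using incr_prod by simp
  have e2: "expectation (\<lambda>\<omega>. (\<Sum>i<k. t i * W (w i) \<omega>) * incr u \<omega>) = s"
    unfolding sum_distrib_right mult.assoc s_def using incr_prod by simp
  have "((\<Sum>i<k. t i * W (w i) \<omega>) - s * incr u \<omega>)\<^sup>2 = (\<Sum>i<k. t i * W (w i) \<omega>)\<^sup>2 - (2 * s) * ((\<Sum>i<k. t i * W (w i) \<omega>) * incr u \<omega>) + s\<^sup>2 * (incr u \<omega>)\<^sup>2" for \<omega>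
    by (simp add: power2_diff power_mult_distrib)
  then have "expectation (\<lambda>\<omega>. ((\<Sum>i<k. t i * W (w i) \<omega>) - s * incr u \<omega>)\<^sup>2)
     = expectation (\<lambda>\<omega>. (\<Sum>i<k. t i * W (w i) \<omega>)\<^sup>2) - (2 * s) * expectation (\<lambda>\<omega>. (\<Sum>i<k. t i * W (w i) \<omega>) * incr u \<omega>) + s\<^sup>2 * expectation (\<lambda>\<omega>. (incr u \<omega>)\<^sup>2)"
    using i1 i2 incr_sq by simp
  also have "\<dots> = fbm_quad H k t w - s\<^sup>2"
    using incr_gauss(3)[of 1 u] unfolding W_lin(3) e2 by (simp add: power2_eq_square[of s])
  finally show "expectation (\<lambda>\<omega>. ((\<Sum>i<k. t i * W (w i) \<omega>) - s * incr u \<omega>)\<^sup>2) = fbm_quad H k t w - s\<^sup>2" .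
qed

text \<open>The new increment sits in the first coordinate and the residual in the second, so
  transforms multiply and the variances s^2 and \<open>fbm_quad H k t w - s\<^sup>2\<close> add up
  to the old one.\<close>

lemma resampled_law: "fbm_law (M \<Otimes>\<^sub>M M) H (resampled u)"
proof -
  interpret P: pair_prob_space M M ..
  have split: "(\<Sum>i<k. t i * resampled u (w i) \<omega>) = (\<Sum>i<k. t i * incr_cov u (w i)) * incr u (fst \<omega>)
      + ((\<Sum>i<k. t i * W (w i) (snd \<omega>)) - (\<Sum>i<k. t i * incr_cov u (w i)) * incr u (snd \<omega>))" for k and t w :: "nat \<Rightarrow> real" and \<omega>
    by (simp add: resampled_def split_beta' algebra_simps sum.distrib sum_subtractf sum_distrib_left)
  show ?thesis
  proof
    note [measurable (raw)] = law.V_meas_pair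
    show "(\<lambda>(\<omega>, v). resampled u v \<omega>) \<in> borel_measurable ((M \<Otimes>\<^sub>M M) \<Otimes>\<^sub>M lborel)"
      unfolding resampled_def incr_def incr_cov_def fbm_cov_def split_beta' by measurable
    fix k and t w :: "nat \<Rightarrow> real"
    define s where "s = (\<Sum>i<k. t i * incr_cov u (w i))"
    note g1 = gaussian_variable_transforms[OF incr_gauss(1,2)[of s u], unfolded incr_gauss(3)]
    note g2 = gaussian_variable_transforms[OF residual(1,2)[where k = k and t = t and w = w and u = u], unfolded residual(3), folded s_def]
    have "has_bochner_integral (M \<Otimes>\<^sub>M M) (\<lambda>\<omega>. exp (s * incr u (fst \<omega>)) * exp ((\<Sum>i<k. t i * W (w i) (snd \<omega>)) - s * incr u (snd \<omega>)))
       (exp (s\<^sup>2 / 2) * exp ((fbm_quad H k t w - s\<^sup>2) / 2))"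
      by (rule has_bochner_integral_pair_mult[OF prob_space_axioms prob_space_axioms g1(3) g2(3)])
    then show "has_bochner_integral (M \<Otimes>\<^sub>M M) (\<lambda>\<omega>. exp (\<Sum>i<k. t i * resampled u (w i) \<omega>)) (exp (fbm_quad H k t w / 2))"
      unfolding split s_def[symmetric] exp_add[symmetric] by (simp add: diff_divide_distrib)
    have "has_bochner_integral (M \<Otimes>\<^sub>M M) (\<lambda>\<omega>. iexp (s * incr u (fst \<omega>)) * iexp ((\<Sum>i<k. t i * W (w i) (snd \<omega>)) - s * incr u (snd \<omega>)))
       (of_real (exp (- s\<^sup>2 / 2)) * of_real (exp (- (fbm_quad H k t w - s\<^sup>2) / 2)))"
      by (rule has_bochner_integral_pair_mult[OF prob_space_axioms prob_space_axioms g1(4) g2(4)])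
    moreover have "complex_of_real (exp (- s\<^sup>2 / 2)) * of_real (exp (- (fbm_quad H k t w - s\<^sup>2) / 2)) = of_real (exp (- fbm_quad H k t w / 2))"
      unfolding of_real_mult[symmetric] exp_add[symmetric] by (simp add: diff_divide_distrib)
    moreover have "iexp (s * incr u (fst \<omega>)) * iexp ((\<Sum>i<k. t i * W (w i) (snd \<omega>)) - s * incr u (snd \<omega>)) = iexp (\<Sum>i<k. t i * resampled u (w i) \<omega>)" for \<omega>
      unfolding split s_def[symmetric] exp_add[symmetric] by (simp add: distrib_left)
    ultimately show "(CLINT \<omega>|(M \<Otimes>\<^sub>M M). iexp (\<Sum>i<k. t i * resampled u (w i) \<omega>)) = of_real (exp (- fbm_quad H k t w / 2))"
      by (simp only: has_bochner_integral_iff)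
  qed (rule H)+
qed

text \<open>The difference is the covariance of the increments over [- u, w - u] and [- u, 1 - u],
  that is (w powr (2 * H) + 1 - |w - 1| powr (2 * H)) / 2. Its positivity is the reason for
  resampling an interval that begins at - u.\<close>

lemma incr_cov_gap:
  assumes "0 < w"
  shows "incr_cov u (- u) < incr_cov u (w - u)"
proof -
  have "\<bar>w - 1\<bar> powr (2 * H) < w powr (2 * H) + 1"
  proof (cases "w < 1")
    case True
    have "\<bar>w - 1\<bar> powr (2 * H) \<le> 1 powr (2 * H)" using True assms H by (intro powr_mono2) auto
    moreover have "0 < w powr (2 * H)" using assms by simp
    moreover have "(1::real) powr (2 * H) = 1" by simp
    ultimately show ?thesis by linarith
  next
    case False
    have "\<bar>w - 1\<bar> powr (2 * H) \<le> w powr (2 * H)" using False H by (intro powr_mono2) auto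
    then show ?thesis by simp
  qed
  then show ?thesis using assms by (simp add: incr_cov_def fbm_cov_def field_simps)
qed

abbreviation Zlim :: "real \<Rightarrow> real \<Rightarrow> 'a \<Rightarrow> real" where "Zlim u \<equiv> shifted_Z H W u"

abbreviation Zres :: "real \<Rightarrow> real \<Rightarrow> 'a \<times> 'a \<Rightarrow> real" where "Zres u \<equiv> shifted_Z H (resampled u) u"

text \<open>The first coordinate enters only through the new increment, in a factor that is
  increasing in it; the other factor is fixed by the second coordinate.\<close>

lemma Zres_ratio:
  "Zres u w (x, y) / Zres u 0 (x, y) = exp ((incr_cov u (w - u) - incr_cov u (- u)) * incr u x)
    * exp (W (w - u) y - W (- u) y - (incr_cov u (w - u) - incr_cov u (- u)) * incr u y - \<bar>w - u\<bar> powr (2 * H) / 2 + \<bar>u\<bar> powr (2 * H) / 2)"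
  unfolding shifted_Z_def limit_Z_def resampled_def exp_diff[symmetric] exp_add[symmetric]
  by (simp add: algebra_simps)

lemma Zres_ratio_strict_mono:
  assumes "0 < w" "incr u x < incr u x'"
  shows "Zres u w (x, y) / Zres u 0 (x, y) < Zres u w (x', y) / Zres u 0 (x', y)"
  unfolding Zres_ratio using assms incr_cov_gap[of w u]
  by (intro mult_strict_right_mono) (auto intro!: mult_strict_left_mono)

text \<open>On the product space almost every fixed second coordinate admits at most one value of
  the new increment for which the statistic vanishes, and that Gaussian increment takes a given
  value with probability 0.\<close>

lemma no_atom:
  "prob {\<omega>\<in>space M. hellinger_process.stat (Zlim u) {0..} (\<lambda>_. 1) m \<omega> = 0} = 0"
proof -
  interpret P: pair_prob_space M M ..
  interpret R: fbm_law "M \<Otimes>\<^sub>M M" H "resampled u" by (rule resampled_law)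
  obtain C0 where h1: "hellinger_process M (Zlim u) {0..} (\<lambda>_. 1) 1 C0 1" by (rule law.hellinger_shifted_Z)
  obtain C0' where h2: "hellinger_process (M \<Otimes>\<^sub>M M) (Zres u) {0..} (\<lambda>_. 1) 1 C0' 1" by (rule R.hellinger_shifted_Z)
  interpret h1: hellinger_process M "Zlim u" "{0..}" "\<lambda>_. 1" 1 C0 1 by (rule h1)
  interpret h2: hellinger_process "M \<Otimes>\<^sub>M M" "Zres u" "{0..}" "\<lambda>_. 1" 1 C0' 1 by (rule h2)
  have "prob {\<omega>\<in>space M. h1.stat m \<omega> = 0} = measure (M \<Otimes>\<^sub>M M) {\<omega>\<in>space (M \<Otimes>\<^sub>M M). h2.stat m \<omega> = 0}"
  proof (rule prob_zero_eq[OF prob_space_axioms P.prob_space_axioms h1.stat_measurable h2.stat_measurable])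
    fix g :: "real \<Rightarrow> real" and L
    assume g: "0 \<le> L" "\<And>x y. \<bar>g x - g y\<bar> \<le> L * \<bar>x - y\<bar>" "\<And>x. 0 \<le> g x" "\<And>x. g x \<le> 1"
    \<comment> \<open>A constant sequence: the two processes have the same finite-dimensional
      characteristic functions, so the convergence is an equality of the laws of the two
      statistics.\<close>
    have "(\<lambda>n::nat. LINT \<omega>|M. g (h1.stat m \<omega>)) \<longlonglongrightarrow> (LINT \<omega>|(M \<Otimes>\<^sub>M M). g (h2.stat m \<omega>))"
    proof (rule stat_tendsto[OF h1 h2])
      show "\<exists>B. \<forall>\<^sub>F n::nat in sequentially. integrable M (\<lambda>\<omega>. ln (Zlim u w \<omega>)) \<and> (LINT \<omega>|M. \<bar>ln (Zlim u w \<omega>)\<bar>) \<le> B" for w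
        using law.ln_shifted_Z_integrable by (intro exI[of _ "LINT \<omega>|M. \<bar>ln (Zlim u w \<omega>)\<bar>"]) simp
      show "(\<lambda>n::nat. CLINT \<omega>|M. iexp (\<Sum>i<k. t i * ln (Zlim u (w i) \<omega>))) \<longlonglongrightarrow> (CLINT \<omega>|(M \<Otimes>\<^sub>M M). iexp (\<Sum>i<k. t i * ln (Zres u (w i) \<omega>)))" for k :: nat and t w
        unfolding law.char_shifted_Z R.char_shifted_Z by simp
    qed (use g in \<open>auto simp: law.shifted_Z_pos R.shifted_Z_pos intro: R.ln_shifted_Z_integrable\<close>)
    then show "(LINT \<omega>|M. g (h1.stat m \<omega>)) = (LINT \<omega>|(M \<Otimes>\<^sub>M M). g (h2.stat m \<omega>))"
      by (simp add: LIMSEQ_const_iff)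
  qed
  also have "\<dots> = 0"
  proof -
    define A where "A = {\<omega>\<in>space (M \<Otimes>\<^sub>M M). h2.stat m \<omega> = 0}"
    have A [measurable]: "A \<in> sets (M \<Otimes>\<^sub>M M)" unfolding A_def by measurable
    \<comment> \<open>Where the total is infinite, \<open>enn2real\<close> returns 0 and the
      statistic does not express an integral; these points are discarded.\<close>
    have "AE \<omega> in M \<Otimes>\<^sub>M M. h2.total \<omega> < \<infinity>" by (rule h2.AE_total_finite) auto
    then have "AE x in M. AE y in M. h2.total (x, y) < \<infinity>"
      by (subst P.AE_pair_iff) auto
    then have fin: "AE y in M. AE x in M. h2.total (x, y) < \<infinity>"
      by (subst (asm) P.AE_commute) auto
    have uniq: "incr u x = incr u x'"
      if s: "x \<in> space M" "x' \<in> space M" "y \<in> space M" and t: "h2.total (x, y) < \<infinity>" "h2.total (x', y) < \<infinity>"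
        and z: "h2.stat m (x, y) = 0" "h2.stat m (x', y) = 0" for x x' y
    proof -
      \<comment> \<open>The value at 0 depends on the new increment as well. Only after division by
        it is the integrand monotone in the increment, and the statistic vanishes exactly if the
        integral of this quotient is m.\<close>
      define f where "f x w = indicator {0..} w * (Zres u w (x, y) / Zres u 0 (x, y))" for x w
      have f: "integrable lborel (f x)" "(LINT w|lborel. f x w) = m"
        if x: "x \<in> space M" and t: "h2.total (x, y) < \<infinity>" and z: "h2.stat m (x, y) = 0" for x
      proof -
        have xy: "(x, y) \<in> space (M \<Otimes>\<^sub>M M)" using x s by (simp add: space_pair_measure)
        note [measurable] = h2.section_measurable[OF xy]
        have Z0: "0 < Zres u 0 (x, y)" by (rule R.shifted_Z_pos)
        have tot: "h2.total (x, y) = (\<integral>\<^sup>+w. ennreal (indicator {0..} w * Zres u w (x, y)) \<partial>lborel)"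
          unfolding h2.total_def by (intro nn_integral_cong) (auto simp: indicator_def)
        have i: "integrable lborel (\<lambda>w. indicator {0..} w * Zres u w (x, y))"
          using t h2.Z_nonneg unfolding tot by (intro integrableI_nonneg) (auto simp: indicator_def)
        have e: "enn2real (h2.total (x, y)) = (LINT w|lborel. indicator {0..} w * Zres u w (x, y))"
          unfolding tot using h2.Z_nonneg by (subst integral_eq_nn_integral) (auto simp: indicator_def)
        have feq: "f x = (\<lambda>w. indicator {0..} w * Zres u w (x, y) / Zres u 0 (x, y))" by (simp add: f_def[abs_def])
        show "integrable lborel (f x)" unfolding feq using i by simp
        have "(LINT w|lborel. f x w) = enn2real (h2.total (x, y)) / Zres u 0 (x, y)" unfolding feq e by simp
        also have "\<dots> = m" using z Z0 by (simp add: h2.stat_def)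
        finally show "(LINT w|lborel. f x w) = m" .
      qed
      have less: False if x: "x \<in> space M" "x' \<in> space M" and t: "h2.total (x, y) < \<infinity>" "h2.total (x', y) < \<infinity>"
        and z: "h2.stat m (x, y) = 0" "h2.stat m (x', y) = 0" and l: "incr u x < incr u x'" for x x'
      proof -
        note fx = f[OF x(1) t(1) z(1)] and fx' = f[OF x(2) t(2) z(2)]
        have lt: "f x w < f x' w" if "0 < w" for w
          using Zres_ratio_strict_mono[OF that l, of y] that by (simp add: f_def)
        have nn: "AE w in lborel. 0 \<le> f x' w - f x w"
          using AE_lborel_singleton[of 0]
        proof eventually_elim
          fix w :: real assume "w \<noteq> 0"
          then show "0 \<le> f x' w - f x w" using lt[of w] by (cases "0 < w") (auto simp: f_def)
        qed
        have "(LINT w|lborel. f x' w - f x w) = 0" using fx fx' by simp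
        then have "AE w in lborel. f x' w - f x w = 0"
          using integral_nonneg_eq_0_iff_AE[OF Bochner_Integration.integrable_diff[OF fx'(1) fx(1)] nn] by simp
        then have "AE w in lborel. w \<notin> {0<..<1::real}" by eventually_elim (use lt in force)
        then have "{0<..<1::real} \<in> null_sets lborel" by (subst AE_iff_null_sets) auto
        from null_setsD1[OF this] show False by simp
      qed
      show ?thesis using less[OF s(1,2) t z] less[OF s(2,1) t(2,1) z(2,1)]
        by (cases "incr u x" "incr u x'" rule: linorder_cases) blast+
    qed
    have sec: "AE y in M. emeasure M ((\<lambda>x. (x, y)) -` A) = 0"
      using fin AE_space
    proof eventually_elim
      fix y assume y: "y \<in> space M" and t: "AE x in M. h2.total (x, y) < \<infinity>"
      have null: "AE x in M. incr u x \<noteq> c" for c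
      proof -
        have "prob {\<omega>\<in>space M. incr u \<omega> = c} = 0"
          using gaussian_variable_transforms(5)[OF incr_gauss(1,2)[of 1 u], of c] incr_gauss(3)[of 1 u] by simp
        moreover have "incr u \<in> borel_measurable M" unfolding incr_def by measurable
        ultimately have "{\<omega>\<in>space M. incr u \<omega> = c} \<in> null_sets M" by (auto simp: null_sets_def emeasure_eq_measure)
        from AE_not_in[OF this] AE_space show ?thesis by eventually_elim auto
      qed
      have "AE x in M. (x, y) \<notin> A"
      proof (cases "\<exists>x0\<in>space M. h2.total (x0, y) < \<infinity> \<and> h2.stat m (x0, y) = 0")
        case True
        then obtain x0 where x0: "x0 \<in> space M" "h2.total (x0, y) < \<infinity>" "h2.stat m (x0, y) = 0" by auto
        show ?thesis using t null[of "incr u x0"] AE_space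
          by eventually_elim (use uniq[OF x0(1) _ y x0(2) _ x0(3)] in \<open>auto simp: A_def\<close>)
      next
        case False
        show ?thesis using t AE_space by eventually_elim (use False in \<open>auto simp: A_def\<close>)
      qed
      moreover have "(\<lambda>x. (x, y)) -` A \<in> sets M" by (rule sets_Pair2[OF A])
      moreover have "(\<lambda>x. (x, y)) -` A \<subseteq> space M" by (auto simp: A_def space_pair_measure)
      ultimately have "(\<lambda>x. (x, y)) -` A \<in> null_sets M" by (subst AE_iff_null_sets) auto
      then show "emeasure M ((\<lambda>x. (x, y)) -` A) = 0" by auto
    qed
    have "emeasure (M \<Otimes>\<^sub>M M) A = (\<integral>\<^sup>+y. emeasure M ((\<lambda>x. (x, y)) -` A) \<partial>M)"
      by (rule P.emeasure_pair_measure_alt2[OF A])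
    also have "\<dots> = (\<integral>\<^sup>+y. 0 \<partial>M)" using sec by (intro nn_integral_cong_AE) auto
    finally show ?thesis by (simp add: A_def[symmetric] measure_def)
  qed
  finally show ?thesis .
qed

lemma limit_event:
  "(inverse (limit_Z H W (- u) \<omega>) * (LINT v:{-u..}|lborel. limit_Z H W v \<omega>) > m)
    \<longleftrightarrow> 0 < hellinger_process.stat (Zlim u) {0..} (\<lambda>_. 1) m \<omega>" if w: "\<omega> \<in> space M"
proof -
  obtain C0 where h1: "hellinger_process M (Zlim u) {0..} (\<lambda>_. 1) 1 C0 1" by (rule law.hellinger_shifted_Z)
  interpret h1: hellinger_process M "Zlim u" "{0..}" "\<lambda>_. 1" 1 C0 1 by (rule h1)
  note [measurable] = h1.section_measurable[OF w]
  have "(LINT v:{-u..}|lborel. limit_Z H W v \<omega>) = (LINT v|lborel. indicator {-u..} v * limit_Z H W v \<omega>)"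
    by (simp add: set_lebesgue_integral_def)
  also have "\<dots> = (LINT v|lborel. indicator {-u..} (- u + 1 * v) * limit_Z H W (- u + 1 * v) \<omega>)"
    by (subst lborel_integral_real_affine[of 1 _ "- u"]) auto
  also have "\<dots> = (LINT v|lborel. indicator {0..} v * Zlim u v \<omega>)"
    by (intro Bochner_Integration.integral_cong) (auto simp: shifted_Z_def indicator_def)
  also have "\<dots> = enn2real (\<integral>\<^sup>+v. ennreal (indicator {0..} v * Zlim u v \<omega>) \<partial>lborel)"
    using h1.Z_nonneg by (subst integral_eq_nn_integral) (auto simp: indicator_def)
  also have "(\<integral>\<^sup>+v. ennreal (indicator {0..} v * Zlim u v \<omega>) \<partial>lborel) = h1.total \<omega>"
    unfolding h1.total_def by (intro nn_integral_cong) (auto simp: indicator_def)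
  finally have e: "(LINT v:{-u..}|lborel. limit_Z H W v \<omega>) = enn2real (h1.total \<omega>)" .
  have "0 < limit_Z H W (- u) \<omega>" by (simp add: limit_Z_def)
  then show ?thesis unfolding e h1.stat_def by (simp add: shifted_Z_def field_simps)
qed

end

section \<open>The cusp model\<close>

text \<open>The remainder has derivative y^2 / (1 + y), which is at most 2 x^2 for |y| \<le> |x|
  \<le> 1/2.\<close>

lemma ln_third_order:
  fixes x :: real
  assumes "\<bar>x\<bar> \<le> 1 / 2"
  shows "\<bar>ln (1 + x) - x + x\<^sup>2 / 2\<bar> \<le> 2 * \<bar>x\<bar> ^ 3"
proof -
  define g where "g y = ln (1 + y) - y + y\<^sup>2 / 2" for y :: real
  have "norm (g x - g 0) \<le> (2 * x\<^sup>2) * norm (x - 0)"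
  proof (rule field_differentiable_bound[where S = "{-\<bar>x\<bar>..\<bar>x\<bar>}" and f' = "\<lambda>y. y\<^sup>2 / (1 + y)"])
    fix y assume y: "y \<in> {-\<bar>x\<bar>..\<bar>x\<bar>}"
    then have y1: "1 + y \<ge> 1 / 2" "y\<^sup>2 \<le> x\<^sup>2" using assms by (auto simp: abs_le_square_iff[symmetric])
    show "(g has_field_derivative y\<^sup>2 / (1 + y)) (at y within {-\<bar>x\<bar>..\<bar>x\<bar>})"
      unfolding g_def using y1 by (auto intro!: derivative_eq_intros simp: field_simps power2_eq_square)
    have "y\<^sup>2 / (1 + y) \<le> y\<^sup>2 / (1 / 2)" using y1 by (intro divide_left_mono) auto
    then show "norm (y\<^sup>2 / (1 + y)) \<le> 2 * x\<^sup>2" using y1 by simp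
  qed auto
  then show ?thesis by (simp add: g_def power3_eq_cube power2_eq_square abs_mult)
qed

text \<open>The error is of third order but is written as the uniform bound \<xi> times the sum of
  squares: after integration the squares are of order 1 / n, while \<xi> tends to 0. The linear term
  is kept on the left because it cancels the compensator of the likelihood ratio.\<close>

lemma iexp_second_order:
  fixes t x :: "nat \<Rightarrow> real"
  assumes x: "\<And>i. i < k \<Longrightarrow> \<bar>x i\<bar> \<le> \<xi>" and \<xi>: "\<xi> \<le> 1 / 2"
  defines "T \<equiv> \<Sum>i<k. \<bar>t i\<bar>" and "s \<equiv> \<Sum>i<k. (x i)\<^sup>2"
  shows "norm (iexp (\<Sum>i<k. t i * ln (1 + x i)) - 1 - \<i> * (\<Sum>i<k. t i * x i)
      - (- \<i> * ((\<Sum>i<k. t i * (x i)\<^sup>2) / 2) - (\<Sum>i<k. t i * x i)\<^sup>2 / 2)) \<le> (2 * T ^ 3 + 2 * T + 3 * T\<^sup>2) * \<xi> * s"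
proof (cases "k = 0")
  case True
  then show ?thesis by (simp add: T_def s_def)
next
  case False
  then have \<xi>0: "0 \<le> \<xi>" using x[of 0] by simp
  define S where "S = (\<Sum>i<k. t i * ln (1 + x i))"
  define P where "P = (\<Sum>i<k. t i * x i)"
  define R where "R = (\<Sum>i<k. t i * (x i)\<^sup>2)"
  have T0: "T \<ge> 0" by (simp add: T_def sum_nonneg)
  have s0: "s \<ge> 0" by (simp add: s_def sum_nonneg)
  have xh: "\<bar>x i\<bar> \<le> 1 / 2" if "i < k" for i using x[OF that] \<xi> by linarith
  have l1: "\<bar>ln (1 + x i) - x i\<bar> \<le> 2 * (x i)\<^sup>2" if "i < k" for i
    using abs_ln_one_plus_x_minus_x_bound[of "x i"] xh[OF that] by auto
  have xs: "(x i)\<^sup>2 \<le> s" if "i < k" for i unfolding s_def using that by (intro member_le_sum) auto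
  have sumT: "\<bar>\<Sum>i<k. t i * y i\<bar> \<le> T * B" if "\<And>i. i < k \<Longrightarrow> \<bar>y i\<bar> \<le> B" for y B
  proof -
    have "\<bar>\<Sum>i<k. t i * y i\<bar> \<le> (\<Sum>i<k. \<bar>t i * y i\<bar>)" by (rule sum_abs)
    also have "\<dots> \<le> (\<Sum>i<k. \<bar>t i\<bar> * B)" using that by (intro sum_mono) (auto simp: abs_mult mult_left_mono)
    finally show ?thesis by (simp add: T_def sum_distrib_right)
  qed
  have tT: "\<bar>t i\<bar> \<le> T" if "i < k" for i unfolding T_def using that by (intro member_le_sum) auto
  have x3: "\<bar>x i\<bar> ^ 3 \<le> \<xi> * (x i)\<^sup>2" if "i < k" for i
    using mult_right_mono[OF x[OF that], of "\<bar>x i\<bar>\<^sup>2"] by (simp add: power3_eq_cube power2_eq_square mult.assoc)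
  have SPR: "\<bar>S - P + R / 2\<bar> \<le> 2 * T * \<xi> * s"
  proof -
    have "S - P + R / 2 = (\<Sum>i<k. t i * (ln (1 + x i) - x i + (x i)\<^sup>2 / 2))"
      by (simp add: S_def P_def R_def sum.distrib sum_subtractf sum_divide_distrib algebra_simps)
    also have "\<bar>\<dots>\<bar> \<le> (\<Sum>i<k. \<bar>t i * (ln (1 + x i) - x i + (x i)\<^sup>2 / 2)\<bar>)" by (rule sum_abs)
    also have "\<dots> \<le> (\<Sum>i<k. T * (2 * (\<xi> * (x i)\<^sup>2)))"
    proof (intro sum_mono)
      fix i assume "i \<in> {..<k}"
      then have i: "i < k" by simp
      have "\<bar>ln (1 + x i) - x i + (x i)\<^sup>2 / 2\<bar> \<le> 2 * (\<xi> * (x i)\<^sup>2)" using ln_third_order[OF xh[OF i]] x3[OF i] by linarith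
      then show "\<bar>t i * (ln (1 + x i) - x i + (x i)\<^sup>2 / 2)\<bar> \<le> T * (2 * (\<xi> * (x i)\<^sup>2))"
        unfolding abs_mult using tT[OF i] T0 by (intro mult_mono) auto
    qed
    also have "\<dots> = 2 * T * \<xi> * s" by (simp add: s_def sum_distrib_left mult_ac)
    finally show ?thesis .
  qed
  have SP: "\<bar>S - P\<bar> \<le> T * (2 * s)"
  proof -
    have "S - P = (\<Sum>i<k. t i * (ln (1 + x i) - x i))" by (simp add: S_def P_def sum_subtractf algebra_simps)
    then show ?thesis using sumT[of "\<lambda>i. ln (1 + x i) - x i" "2 * s"] l1 xs by force
  qed
  have P\<xi>: "\<bar>P\<bar> \<le> T * \<xi>" unfolding P_def using x by (rule sumT)
  have lb: "\<bar>ln (1 + x i)\<bar> \<le> 2 * \<bar>x i\<bar>" if "i < k" for i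
  proof -
    have "\<bar>x i\<bar> * \<bar>x i\<bar> \<le> \<bar>x i\<bar> * (1 / 2)" using xh[OF that] by (intro mult_left_mono) auto
    then have "2 * (x i)\<^sup>2 \<le> \<bar>x i\<bar>" by (simp add: power2_eq_square)
    then show ?thesis using l1[OF that] by linarith
  qed
  have S\<xi>: "\<bar>S\<bar> \<le> T * (2 * \<xi>)" unfolding S_def using lb x by (intro sumT) force
  have Ss: "S\<^sup>2 \<le> 4 * T\<^sup>2 * s"
  proof -
    have "\<bar>x i\<bar> \<le> sqrt s" if "i < k" for i using xs[OF that] real_le_rsqrt[of "\<bar>x i\<bar>" s] by simp
    then have "\<bar>S\<bar> \<le> T * (2 * sqrt s)" unfolding S_def using lb by (intro sumT) force
    then have "\<bar>S\<bar>\<^sup>2 \<le> (T * (2 * sqrt s))\<^sup>2" by (intro power_mono) auto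
    then show ?thesis using s0 by (simp add: power_mult_distrib mult_ac)
  qed
  have e: "norm (iexp S - (1 + \<i> * S - S\<^sup>2 / 2)) \<le> \<bar>S\<bar> ^ 3 / 6"
  proof -
    have "\<bar>S\<bar> ^ 3 = S * (S * \<bar>S\<bar>)" by (simp add: power3_eq_cube mult.assoc)
    then show ?thesis
      using iexp_approx1[of S 2] by (simp add: numeral_2_eq_2 power2_eq_square fact_numeral algebra_simps)
  qed
  have S3: "\<bar>S\<bar> ^ 3 \<le> 8 * T ^ 3 * \<xi> * s"
  proof -
    have "\<bar>S\<bar> ^ 3 = \<bar>S\<bar> * S\<^sup>2" by (simp add: power3_eq_cube power2_eq_square)
    also have "\<dots> \<le> (T * (2 * \<xi>)) * (4 * T\<^sup>2 * s)" using S\<xi> Ss T0 \<xi>0 by (intro mult_mono) auto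
    finally show ?thesis by (simp add: power3_eq_cube power2_eq_square mult_ac)
  qed
  have SP2: "\<bar>S\<^sup>2 - P\<^sup>2\<bar> \<le> 6 * T\<^sup>2 * \<xi> * s"
  proof -
    have "\<bar>S\<^sup>2 - P\<^sup>2\<bar> = \<bar>S - P\<bar> * \<bar>S + P\<bar>" by (simp add: power2_eq_square square_diff_square_factored abs_mult mult.commute)
    also have "\<dots> \<le> (T * (2 * s)) * (3 * (T * \<xi>))" using SP S\<xi> P\<xi> T0 s0 by (intro mult_mono) (auto intro: order_trans[OF abs_triangle_ineq])
    finally show ?thesis by (simp add: power2_eq_square mult_ac)
  qed
  \<comment> \<open>S is the exact exponent, P its linear part, R the sum of weighted squares. The
    error splits into the Taylor remainder of the exponential at S, the error of S as P - R / 2, and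
    the exchange of the squares of S and P.\<close>
  have "iexp S - 1 - \<i> * P - (- \<i> * (R / 2) - P\<^sup>2 / 2)
     = (iexp S - (1 + \<i> * S - S\<^sup>2 / 2)) + \<i> * of_real (S - P + R / 2) + of_real ((P\<^sup>2 - S\<^sup>2) / 2)"
    by (simp add: algebra_simps diff_divide_distrib)
  also have "norm \<dots> \<le> norm (iexp S - (1 + \<i> * S - S\<^sup>2 / 2)) + norm (\<i> * complex_of_real (S - P + R / 2)) + norm (complex_of_real ((P\<^sup>2 - S\<^sup>2) / 2))"
    by (intro order_trans[OF norm_triangle_ineq] add_mono norm_triangle_ineq order_refl)
  also have "\<dots> \<le> \<bar>S\<bar> ^ 3 / 6 + \<bar>S - P + R / 2\<bar> + \<bar>S\<^sup>2 - P\<^sup>2\<bar> / 2"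
    using e by (simp only: norm_mult norm_of_real norm_ii) (simp add: abs_minus_commute)
  also have "\<dots> \<le> (8 * T ^ 3 * \<xi> * s) / 6 + 2 * T * \<xi> * s + (6 * T\<^sup>2 * \<xi> * s) / 2"
    by (intro add_mono divide_right_mono S3 SPR SP2) auto
  also have "\<dots> \<le> (2 * T ^ 3 + 2 * T + 3 * T\<^sup>2) * \<xi> * s"
  proof -
    have "0 \<le> T ^ 3 * \<xi> * s" "0 \<le> T\<^sup>2 * \<xi> * s" using T0 \<xi>0 s0 by auto
    then show ?thesis by (simp add: algebra_simps)
  qed
  finally show ?thesis unfolding S_def P_def R_def by simp
qed

text \<open>The integral of a nonnegative function that is positive on (0, 1/2). It supplies the
  constant of the lower bound for distances between intensities.\<close>

lemma cusp_middle_pos: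
  fixes \<kappa> :: real
  assumes "0 < \<kappa>" "\<kappa> < 1 / 2"
  shows "0 < 2 / (2 * \<kappa> + 1) - 2 * Beta (\<kappa> + 1) (\<kappa> + 1)"
proof -
  let ?f = "\<lambda>x::real. indicator {0..1} x * ((1 - x) powr \<kappa> - x powr \<kappa>)\<^sup>2"
  let ?v = "2 / (2 * \<kappa> + 1) - 2 * Beta (\<kappa> + 1) (\<kappa> + 1)"
  have i: "integrable lborel ?f" and e: "(LINT x|lborel. ?f x) = ?v"
    using cusp_middle_integral[OF assms] by (auto simp: has_bochner_integral_iff)
  have nn: "AE x in lborel. 0 \<le> ?f x" by (auto simp: indicator_def)
  have "0 \<le> ?v" unfolding e[symmetric] by (intro integral_nonneg_AE nn)
  moreover have "?v \<noteq> 0"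
  proof
    assume "?v = 0"
    then have "AE x in lborel. ?f x = 0" using integral_nonneg_eq_0_iff_AE[OF i nn] e by simp
    then have "AE x in lborel. x \<notin> {0<..<1/2::real}"
    proof eventually_elim
      fix x :: real assume x: "?f x = 0"
      show "x \<notin> {0<..<1/2}"
      proof
        assume "x \<in> {0<..<1/2}"
        then have "x powr \<kappa> < (1 - x) powr \<kappa>" using assms by (intro powr_less_mono2) auto
        then show False using x \<open>x \<in> {0<..<1/2}\<close> by (auto simp: indicator_def)
      qed
    qed
    then have "{0<..<1/2::real} \<in> null_sets lborel" by (subst AE_iff_null_sets) auto
    from null_setsD1[OF this] show False by simp
  qed
  ultimately show ?thesis by simp
qed

text \<open>Substitution t = x + (y - x) * s: the squared kernel is homogeneous of degree 2
  \<kappa>, and the differential adds one more factor |x - y|. The second statement keeps only the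
  segment between the cusps, which lies in the observation window whenever both cusps do.\<close>

lemma cusp_scaled:
  fixes \<kappa> x y :: real
  assumes "0 < \<kappa>" "\<kappa> < 1 / 2"
  shows "has_bochner_integral lborel (\<lambda>t. (\<bar>t - x\<bar> powr \<kappa> - \<bar>t - y\<bar> powr \<kappa>)\<^sup>2) (cusp_const \<kappa> * \<bar>x - y\<bar> powr (2 * \<kappa> + 1))"
    and "has_bochner_integral lborel (\<lambda>t. indicator {min x y..max x y} t * (\<bar>t - x\<bar> powr \<kappa> - \<bar>t - y\<bar> powr \<kappa>)\<^sup>2)
       ((2 / (2 * \<kappa> + 1) - 2 * Beta (\<kappa> + 1) (\<kappa> + 1)) * \<bar>x - y\<bar> powr (2 * \<kappa> + 1))"
proof -
  define \<delta> where "\<delta> = y - x"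
  have pw: "\<bar>x - y\<bar> powr (2 * \<kappa> + 1) = \<bar>\<delta>\<bar> * (\<bar>\<delta>\<bar> powr (2 * \<kappa>))" if "\<delta> \<noteq> 0"
    using that by (simp add: powr_mult_base \<delta>_def abs_minus_commute add.commute)
  have v: "(X * (\<bar>\<delta>\<bar> * P)) /\<^sub>R \<bar>\<delta>\<bar> = P * X" if "\<delta> \<noteq> 0" for X P :: real
    using that by (simp add: field_simps)
  have sc: "(\<bar>x + \<delta> * s - x\<bar> powr \<kappa> - \<bar>x + \<delta> * s - y\<bar> powr \<kappa>)\<^sup>2 = \<bar>\<delta>\<bar> powr (2 * \<kappa>) * (\<bar>s - 1\<bar> powr \<kappa> - \<bar>s\<bar> powr \<kappa>)\<^sup>2" for s
  proof -
    have "x + \<delta> * s - y = \<delta> * (s - 1)" by (simp add: \<delta>_def algebra_simps)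
    then have b: "\<bar>x + \<delta> * s - y\<bar> = \<bar>\<delta>\<bar> * \<bar>s - 1\<bar>" by (simp only: abs_mult)
    have a: "\<bar>x + \<delta> * s - x\<bar> = \<bar>\<delta>\<bar> * \<bar>s\<bar>" by (simp add: abs_mult)
    have "(\<bar>x + \<delta> * s - x\<bar> powr \<kappa> - \<bar>x + \<delta> * s - y\<bar> powr \<kappa>)\<^sup>2 = (\<bar>\<delta>\<bar> powr \<kappa> * (\<bar>s\<bar> powr \<kappa> - \<bar>s - 1\<bar> powr \<kappa>))\<^sup>2"
      unfolding a b by (simp add: powr_mult right_diff_distrib)
    also have "\<dots> = \<bar>\<delta>\<bar> powr (2 * \<kappa>) * (\<bar>s - 1\<bar> powr \<kappa> - \<bar>s\<bar> powr \<kappa>)\<^sup>2"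
    proof -
      have "(\<bar>\<delta>\<bar> powr \<kappa>)\<^sup>2 = \<bar>\<delta>\<bar> powr (2 * \<kappa>)" by (simp add: power2_eq_square powr_add[symmetric])
      then show ?thesis unfolding power_mult_distrib by (simp only: power2_commute[of "\<bar>s\<bar> powr \<kappa>"])
    qed
    finally show ?thesis .
  qed
  show "has_bochner_integral lborel (\<lambda>t. (\<bar>t - x\<bar> powr \<kappa> - \<bar>t - y\<bar> powr \<kappa>)\<^sup>2) (cusp_const \<kappa> * \<bar>x - y\<bar> powr (2 * \<kappa> + 1))"
  proof (cases "\<delta> = 0")
    case False
    show ?thesis
      by (subst lborel_has_bochner_integral_real_affine_iff[OF False, of _ _ x], simp only: sc pw[OF False] v[OF False])
         (intro has_bochner_integral_mult_right cusp_integral assms)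
  qed (simp add: \<delta>_def has_bochner_integral_zero)
  show "has_bochner_integral lborel (\<lambda>t. indicator {min x y..max x y} t * (\<bar>t - x\<bar> powr \<kappa> - \<bar>t - y\<bar> powr \<kappa>)\<^sup>2)
       ((2 / (2 * \<kappa> + 1) - 2 * Beta (\<kappa> + 1) (\<kappa> + 1)) * \<bar>x - y\<bar> powr (2 * \<kappa> + 1))"
  proof (cases "\<delta> = 0")
    case False
    have ind: "indicator {min x y..max x y} (x + \<delta> * s) = (indicator {0..1} s :: real)" for s
    proof (cases "\<delta> > 0")
      case True
      have "x + \<delta> * s \<le> y \<longleftrightarrow> \<delta> * s \<le> \<delta> * 1" by (simp add: \<delta>_def algebra_simps)
      then show ?thesis using True by (auto simp: indicator_def \<delta>_def zero_le_mult_iff)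
    next
      case 2: False
      then have n: "\<delta> < 0" using False by simp
      have "y \<le> x + \<delta> * s \<longleftrightarrow> \<delta> * 1 \<le> \<delta> * s" by (simp add: \<delta>_def algebra_simps)
      then show ?thesis using n by (auto simp: indicator_def \<delta>_def mult_le_0_iff)
    qed
    have ab: "indicator {0..1} s * (\<bar>s - 1\<bar> powr \<kappa> - \<bar>s\<bar> powr \<kappa>)\<^sup>2 = indicator {0..1} s * ((1 - s) powr \<kappa> - s powr \<kappa>)\<^sup>2" for s :: real
      by (auto simp: indicator_def abs_if)
    have e: "indicator {0..1} s * (\<bar>\<delta>\<bar> powr (2 * \<kappa>) * (\<bar>s - 1\<bar> powr \<kappa> - \<bar>s\<bar> powr \<kappa>)\<^sup>2)
       = \<bar>\<delta>\<bar> powr (2 * \<kappa>) * (indicator {0..1} s * ((1 - s) powr \<kappa> - s powr \<kappa>)\<^sup>2)" for s :: real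
      using ab[of s] by auto
    show ?thesis
      by (subst lborel_has_bochner_integral_real_affine_iff[OF False, of _ _ x], simp only: sc pw[OF False] ind e v[OF False])
         (intro has_bochner_integral_mult_right cusp_middle_integral assms)
  qed (simp add: \<delta>_def has_bochner_integral_zero)
qed

lemma cusp_const_pos:
  fixes \<kappa> :: real
  assumes "0 < \<kappa>" "\<kappa> < 1 / 2"
  shows "0 < cusp_const \<kappa>"
proof -
  have 1: "has_bochner_integral lborel (\<lambda>t. (\<bar>t - 0\<bar> powr \<kappa> - \<bar>t - 1\<bar> powr \<kappa>)\<^sup>2) (cusp_const \<kappa>)"
    using cusp_scaled(1)[OF assms, of 0 1] by simp
  have 2: "has_bochner_integral lborel (\<lambda>t. indicator {0..1} t * (\<bar>t - 0\<bar> powr \<kappa> - \<bar>t - 1\<bar> powr \<kappa>)\<^sup>2) (2 / (2 * \<kappa> + 1) - 2 * Beta (\<kappa> + 1) (\<kappa> + 1))"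
    using cusp_scaled(2)[OF assms, of 0 1] by simp
  have "(LINT t|lborel. indicator {0..1} t * (\<bar>t - 0\<bar> powr \<kappa> - \<bar>t - 1\<bar> powr \<kappa>)\<^sup>2) \<le> (LINT t|lborel. (\<bar>t - 0\<bar> powr \<kappa> - \<bar>t - 1\<bar> powr \<kappa>)\<^sup>2)"
    using 1 2 by (intro integral_mono) (auto simp: has_bochner_integral_iff indicator_def)
  then have "2 / (2 * \<kappa> + 1) - 2 * Beta (\<kappa> + 1) (\<kappa> + 1) \<le> cusp_const \<kappa>"
    using 1 2 by (simp only: has_bochner_integral_iff)
  then show ?thesis using cusp_middle_pos[OF assms] by linarith
qed

section \<open>Distances between intensities and their local limits\<close>

locale cusp_model =
  fixes \<tau> \<theta>\<^sub>1 b \<kappa> a :: real and h :: "real \<Rightarrow> real" and c \<Lambda> :: real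
  assumes \<tau>: "0 < \<tau>" and \<theta>1: "0 < \<theta>\<^sub>1" "\<theta>\<^sub>1 < b" "b \<le> \<tau>"
    and \<kappa>: "0 < \<kappa>" "\<kappa> < 1 / 2" and a: "a \<noteq> 0"
    and h_measurable: "set_borel_measurable borel {0..\<tau>} h"
    and h_pos: "0 < h \<theta>\<^sub>1" and h_cont: "isCont h \<theta>\<^sub>1"
    and c: "0 < c" and lam_lower: "\<And>\<theta> t. \<theta> \<in> {\<theta>\<^sub>1..<b} \<Longrightarrow> t \<in> {0..\<tau>} \<Longrightarrow> c \<le> cusp_intensity a \<kappa> h \<theta> t"
    and lam_upper: "\<And>\<theta> t. \<theta> \<in> {\<theta>\<^sub>1..<b} \<Longrightarrow> t \<in> {0..\<tau>} \<Longrightarrow> cusp_intensity a \<kappa> h \<theta> t \<le> \<Lambda>"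
begin

abbreviation "\<Theta> \<equiv> {\<theta>\<^sub>1..<b}"

abbreviation lam :: "real \<Rightarrow> real \<Rightarrow> real" where "lam \<equiv> cusp_intensity a \<kappa> h"

abbreviation "H \<equiv> hurst \<kappa>"

lemma H_bounds: "1 / 2 < H" "H < 1" and H_eq: "2 * H = 2 * \<kappa> + 1"
  using \<kappa> by (auto simp: hurst_def)

lemma h_ind [measurable]: "(\<lambda>t. indicator {0..\<tau>} t * h t) \<in> borel_measurable borel"
  using h_measurable by (simp add: set_borel_measurable_def)

text \<open>Outside the observation window the intensity is replaced by 1.\<close>

definition lamx :: "real \<Rightarrow> real \<Rightarrow> real" where
  "lamx \<theta> t = (if t \<in> {0..\<tau>} \<and> \<theta> \<in> \<Theta> then lam \<theta> t else 1)"

lemma lamx_eq: "lamx \<theta> t = indicator \<Theta> \<theta> * (indicator {0..\<tau>} t * (a * \<bar>t - \<theta>\<bar> powr \<kappa>) + indicator {0..\<tau>} t * h t) + (1 - indicator \<Theta> \<theta> * indicator {0..\<tau>} t)"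
  by (auto simp: lamx_def cusp_intensity_def indicator_def)

lemma lamx_joint [measurable]: "(\<lambda>(\<theta>, t). lamx \<theta> t) \<in> borel_measurable (borel \<Otimes>\<^sub>M borel)"
  unfolding lamx_eq split_beta' by measurable

lemma lamx_meas [measurable]: "lamx \<theta> \<in> borel_measurable borel"
  unfolding lamx_eq[abs_def] by measurable

lemma lamx_in: "\<theta> \<in> \<Theta> \<Longrightarrow> t \<in> {0..\<tau>} \<Longrightarrow> lamx \<theta> t = lam \<theta> t"
  by (simp add: lamx_def)

lemma lamx_bounds: "min c 1 \<le> lamx \<theta> t" "lamx \<theta> t \<le> max \<Lambda> 1" "0 < lamx \<theta> t"
  using lam_lower[of \<theta> t] lam_upper[of \<theta> t] c by (auto simp: lamx_def min_def max_def)

lemma lam_bounds: "\<theta> \<in> \<Theta> \<Longrightarrow> t \<in> {0..\<tau>} \<Longrightarrow> c \<le> lam \<theta> t \<and> lam \<theta> t \<le> \<Lambda> \<and> 0 < lam \<theta> t"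
  using lam_lower[of \<theta> t] lam_upper[of \<theta> t] c by auto

lemma \<Lambda>_pos: "0 < \<Lambda>" using lam_bounds[of \<theta>\<^sub>1 0] \<theta>1 \<tau> by auto

lemma bounded_int:
  fixes f :: "real \<Rightarrow> 'b::{banach, second_countable_topology}"
  assumes "f \<in> borel_measurable borel" "\<And>t. t \<in> {0..\<tau>} \<Longrightarrow> norm (f t) \<le> B"
  shows "integrable lborel (\<lambda>t. indicator {0..\<tau>} t *\<^sub>R f t)"
proof (rule Bochner_Integration.integrable_bound)
  show "integrable lborel (\<lambda>t. indicator {0..\<tau>} t * B)"
    by (intro integrable_mult_left integrable_real_indicator) (auto simp: emeasure_lborel_Icc_eq)
  show "AE t in lborel. norm (indicator {0..\<tau>} t *\<^sub>R f t) \<le> norm (indicator {0..\<tau>} t * B)"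
    using assms(2) by (intro AE_I2) (force simp: indicator_def)
qed (use assms(1) in measurable)

lemma lam_diff: "lam \<theta> t - lam \<theta>' t = a * (\<bar>t - \<theta>\<bar> powr \<kappa> - \<bar>t - \<theta>'\<bar> powr \<kappa>)"
  by (simp add: cusp_intensity_def algebra_simps)

definition sqd :: "real \<Rightarrow> real \<Rightarrow> real" where
  "sqd \<theta> \<theta>' = (LINT t|lborel. indicator {0..\<tau>} t * (lamx \<theta> t - lamx \<theta>' t)\<^sup>2)"

lemma lamx_diff_bound: "\<bar>lamx \<theta> t - lamx \<theta>' t\<bar> \<le> max \<Lambda> 1"
  using lamx_bounds[of \<theta> t] lamx_bounds[of \<theta>' t] by linarith

lemma sqd_integrable: "integrable lborel (\<lambda>t. indicator {0..\<tau>} t * (lamx \<theta> t - lamx \<theta>' t)\<^sup>2)"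
proof -
  have "norm ((lamx \<theta> t - lamx \<theta>' t)\<^sup>2) \<le> (max \<Lambda> 1)\<^sup>2" for t
    using power_mono[OF lamx_diff_bound[of \<theta> t \<theta>'], of 2] by simp
  then show ?thesis using bounded_int[of "\<lambda>t. (lamx \<theta> t - lamx \<theta>' t)\<^sup>2" "(max \<Lambda> 1)\<^sup>2"] by simp
qed

lemma sqd_upper:
  assumes "\<theta> \<in> \<Theta>" "\<theta>' \<in> \<Theta>"
  shows "sqd \<theta> \<theta>' \<le> a\<^sup>2 * cusp_const \<kappa> * \<bar>\<theta> - \<theta>'\<bar> powr (2 * H)"
proof -
  note s = has_bochner_integral_mult_right[OF cusp_scaled(1)[OF \<kappa>, of \<theta> \<theta>'], of "a\<^sup>2"]
  have "sqd \<theta> \<theta>' \<le> (LINT t|lborel. a\<^sup>2 * (\<bar>t - \<theta>\<bar> powr \<kappa> - \<bar>t - \<theta>'\<bar> powr \<kappa>)\<^sup>2)"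
    unfolding sqd_def
  proof (intro integral_mono sqd_integrable)
    show "integrable lborel (\<lambda>t. a\<^sup>2 * (\<bar>t - \<theta>\<bar> powr \<kappa> - \<bar>t - \<theta>'\<bar> powr \<kappa>)\<^sup>2)" using s a by (simp add: has_bochner_integral_iff)
    show "indicator {0..\<tau>} t * (lamx \<theta> t - lamx \<theta>' t)\<^sup>2 \<le> a\<^sup>2 * (\<bar>t - \<theta>\<bar> powr \<kappa> - \<bar>t - \<theta>'\<bar> powr \<kappa>)\<^sup>2" for t
      using assms by (auto simp: indicator_def lamx_in lam_diff power_mult_distrib)
  qed
  also have "\<dots> = a\<^sup>2 * cusp_const \<kappa> * \<bar>\<theta> - \<theta>'\<bar> powr (2 * H)" using s a by (simp add: has_bochner_integral_iff H_eq mult.assoc)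
  finally show ?thesis .
qed

definition cm :: real where "cm = 2 / (2 * \<kappa> + 1) - 2 * Beta (\<kappa> + 1) (\<kappa> + 1)"

lemma cm_pos: "0 < cm" unfolding cm_def by (rule cusp_middle_pos[OF \<kappa>])

text \<open>The segment between the two parameters always lies in the window, so the lower bound has
  the same order as the upper one over the whole parameter set. It yields the decay of likelihood
  ratios away from the true value without a separate identifiability condition.\<close>

lemma sqd_lower:
  assumes "\<theta> \<in> \<Theta>" "\<theta>' \<in> \<Theta>"
  shows "a\<^sup>2 * cm * \<bar>\<theta> - \<theta>'\<bar> powr (2 * H) \<le> sqd \<theta> \<theta>'"
proof -
  note s = has_bochner_integral_mult_right[OF cusp_scaled(2)[OF \<kappa>, of \<theta> \<theta>'], of "a\<^sup>2"]
  have "a\<^sup>2 * cm * \<bar>\<theta> - \<theta>'\<bar> powr (2 * H) = (LINT t|lborel. a\<^sup>2 * (indicator {min \<theta> \<theta>'..max \<theta> \<theta>'} t * (\<bar>t - \<theta>\<bar> powr \<kappa> - \<bar>t - \<theta>'\<bar> powr \<kappa>)\<^sup>2))"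
    using s a by (simp add: has_bochner_integral_iff H_eq mult.assoc cm_def)
  also have "\<dots> \<le> sqd \<theta> \<theta>'"
    unfolding sqd_def
  proof (intro integral_mono sqd_integrable)
    show "integrable lborel (\<lambda>t. a\<^sup>2 * (indicator {min \<theta> \<theta>'..max \<theta> \<theta>'} t * (\<bar>t - \<theta>\<bar> powr \<kappa> - \<bar>t - \<theta>'\<bar> powr \<kappa>)\<^sup>2))" using s a by (simp add: has_bochner_integral_iff)
    show "a\<^sup>2 * (indicator {min \<theta> \<theta>'..max \<theta> \<theta>'} t * (\<bar>t - \<theta>\<bar> powr \<kappa> - \<bar>t - \<theta>'\<bar> powr \<kappa>)\<^sup>2) \<le> indicator {0..\<tau>} t * (lamx \<theta> t - lamx \<theta>' t)\<^sup>2" for t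
    proof (cases "t \<in> {min \<theta> \<theta>'..max \<theta> \<theta>'}")
      case True
      then have "t \<in> {0..\<tau>}" using assms \<theta>1 by (auto simp: min_def max_def split: if_splits)
      then show ?thesis using True assms by (simp add: lamx_in lam_diff power_mult_distrib)
    qed simp
  qed
  finally show ?thesis .
qed

text \<open>The squared Hellinger distance of the intensities without the usual factor 1/2; the
  affinity of n observations is exp (- n / 2 * hel).\<close>

definition hel :: "real \<Rightarrow> real \<Rightarrow> real" where
  "hel \<theta> \<theta>' = (LINT t|lborel. indicator {0..\<tau>} t * (sqrt (lamx \<theta> t) - sqrt (lamx \<theta>' t))\<^sup>2)"

text \<open>The quotient of the two squared differences is (sqrt x + sqrt y)^2, which lies between 4
  m and 4 M.\<close>

lemma sqrt_diff_le:
  assumes "0 < m" "m \<le> x" "m \<le> y" "x \<le> M" "y \<le> (M::real)"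
  shows "(x - y)\<^sup>2 / (4 * M) \<le> (sqrt x - sqrt y)\<^sup>2" "(sqrt x - sqrt y)\<^sup>2 \<le> (x - y)\<^sup>2 / (4 * m)"
proof -
  have pos: "0 < x" "0 < y" "0 < M" using assms by auto
  have "x - y = (sqrt x - sqrt y) * (sqrt x + sqrt y)" using pos by (simp add: algebra_simps)
  then have e: "(x - y)\<^sup>2 = (sqrt x - sqrt y)\<^sup>2 * (sqrt x + sqrt y)\<^sup>2" by (simp add: power_mult_distrib)
  have "sqrt m \<le> sqrt x" "sqrt m \<le> sqrt y" "sqrt x \<le> sqrt M" "sqrt y \<le> sqrt M" using assms by simp_all
  then have u: "sqrt x + sqrt y \<le> 2 * sqrt M" "2 * sqrt m \<le> sqrt x + sqrt y" by linarith+
  have "(sqrt x + sqrt y)\<^sup>2 \<le> (2 * sqrt M)\<^sup>2" using u(1) pos by (intro power_mono) auto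
  moreover have "(2 * sqrt m)\<^sup>2 \<le> (sqrt x + sqrt y)\<^sup>2" using u(2) assms(1) by (intro power_mono) auto
  ultimately have b: "(sqrt x + sqrt y)\<^sup>2 \<le> 4 * M" "4 * m \<le> (sqrt x + sqrt y)\<^sup>2"
    using pos assms(1) by (simp_all add: power_mult_distrib)
  show "(x - y)\<^sup>2 / (4 * M) \<le> (sqrt x - sqrt y)\<^sup>2"
    unfolding e using pos mult_left_mono[OF b(1), of "(sqrt x - sqrt y)\<^sup>2"] by (simp add: divide_le_eq)
  show "(sqrt x - sqrt y)\<^sup>2 \<le> (x - y)\<^sup>2 / (4 * m)"
    unfolding e using assms mult_left_mono[OF b(2), of "(sqrt x - sqrt y)\<^sup>2"] by (simp add: le_divide_eq)
qed

lemma hel_integrable: "integrable lborel (\<lambda>t. indicator {0..\<tau>} t * (sqrt (lamx \<theta> t) - sqrt (lamx \<theta>' t))\<^sup>2)"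
proof -
  have "norm ((sqrt (lamx \<theta> t) - sqrt (lamx \<theta>' t))\<^sup>2) \<le> (max \<Lambda> 1)\<^sup>2 / (4 * min c 1)" for t
  proof -
    have "(sqrt (lamx \<theta> t) - sqrt (lamx \<theta>' t))\<^sup>2 \<le> (lamx \<theta> t - lamx \<theta>' t)\<^sup>2 / (4 * min c 1)"
      by (rule sqrt_diff_le(2)[where M = "max \<Lambda> 1"]) (use lamx_bounds c in auto)
    also have "\<dots> \<le> (max \<Lambda> 1)\<^sup>2 / (4 * min c 1)"
      using power_mono[OF lamx_diff_bound[of \<theta> t \<theta>'], of 2] c by (intro divide_right_mono) auto
    finally show ?thesis by simp
  qed
  then show ?thesis using bounded_int[of "\<lambda>t. (sqrt (lamx \<theta> t) - sqrt (lamx \<theta>' t))\<^sup>2" "(max \<Lambda> 1)\<^sup>2 / (4 * min c 1)"] by simp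
qed

lemma hel_bounds:
  assumes "\<theta> \<in> \<Theta>" "\<theta>' \<in> \<Theta>"
  shows "hel \<theta> \<theta>' \<le> sqd \<theta> \<theta>' / (4 * c)" "sqd \<theta> \<theta>' / (4 * \<Lambda>) \<le> hel \<theta> \<theta>'"
proof -
  have i: "integrable lborel (\<lambda>t. indicator {0..\<tau>} t * (lamx \<theta> t - lamx \<theta>' t)\<^sup>2 / x)" for x
    using sqd_integrable[of \<theta> \<theta>'] by simp
  have b: "indicator {0..\<tau>} t * (lamx \<theta> t - lamx \<theta>' t)\<^sup>2 / (4 * \<Lambda>) \<le> indicator {0..\<tau>} t * (sqrt (lamx \<theta> t) - sqrt (lamx \<theta>' t))\<^sup>2"
    "indicator {0..\<tau>} t * (sqrt (lamx \<theta> t) - sqrt (lamx \<theta>' t))\<^sup>2 \<le> indicator {0..\<tau>} t * (lamx \<theta> t - lamx \<theta>' t)\<^sup>2 / (4 * c)" for t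
    using sqrt_diff_le[of c "lam \<theta> t" "lam \<theta>' t" \<Lambda>] assms lam_bounds[of \<theta> t] lam_bounds[of \<theta>' t] c
    by (auto simp: indicator_def lamx_in)
  have "hel \<theta> \<theta>' \<le> (LINT t|lborel. indicator {0..\<tau>} t * (lamx \<theta> t - lamx \<theta>' t)\<^sup>2 / (4 * c))"
    unfolding hel_def by (intro integral_mono hel_integrable i b)
  then show "hel \<theta> \<theta>' \<le> sqd \<theta> \<theta>' / (4 * c)" by (simp add: sqd_def)
  have "(LINT t|lborel. indicator {0..\<tau>} t * (lamx \<theta> t - lamx \<theta>' t)\<^sup>2 / (4 * \<Lambda>)) \<le> hel \<theta> \<theta>'"
    unfolding hel_def by (intro integral_mono hel_integrable i b)
  then show "sqd \<theta> \<theta>' / (4 * \<Lambda>) \<le> hel \<theta> \<theta>'" by (simp add: sqd_def)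
qed

abbreviation "\<Gamma> \<equiv> cusp_Gamma a \<kappa> h \<theta>\<^sub>1"

abbreviation "\<phi> \<equiv> cusp_rate a \<kappa> h \<theta>\<^sub>1"

lemma Gamma_sq: "0 < \<Gamma>" "\<Gamma>\<^sup>2 = a\<^sup>2 * cusp_const \<kappa> / h \<theta>\<^sub>1"
proof -
  have e: "2 * a\<^sup>2 * Beta (\<kappa> + 1) (\<kappa> + 1) / h \<theta>\<^sub>1 * (1 / cos (pi * \<kappa>) - 1) = a\<^sup>2 * cusp_const \<kappa> / h \<theta>\<^sub>1"
    by (simp add: cusp_const_def)
  have p: "0 < a\<^sup>2 * cusp_const \<kappa> / h \<theta>\<^sub>1" using a h_pos cusp_const_pos[OF \<kappa>] by simp
  show "0 < \<Gamma>" "\<Gamma>\<^sup>2 = a\<^sup>2 * cusp_const \<kappa> / h \<theta>\<^sub>1" unfolding cusp_Gamma_def e using p by auto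
qed

lemma phi_pos: "0 < n \<Longrightarrow> 0 < \<phi> n"
  using Gamma_sq by (simp add: cusp_rate_def)

lemma phi_nonneg: "0 \<le> \<phi> n"
  by (simp add: cusp_rate_def)

text \<open>The purpose of the normalisation: n times \<phi> n powr (2 * H) times \<Gamma>^2 is 1,
  so that the limiting variance comes out as |w - w'| powr (2 * H) without a factor.\<close>

lemma phi_scale: "0 < n \<Longrightarrow> real n * \<phi> n powr (2 * H) = 1 / \<Gamma>\<^sup>2"
proof -
  assume n: "0 < n"
  have H0: "H > 0" using H_bounds by simp
  have "\<phi> n powr (2 * H) = real n powr (- 1 / (2 * H) * (2 * H)) * \<Gamma> powr (- 1 / H * (2 * H))"
    unfolding cusp_rate_def using Gamma_sq(1) n by (simp add: powr_mult powr_powr)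
  also have "\<dots> = real n powr (- 1) * \<Gamma> powr (- 2)" using H0 by simp
  also have "\<dots> = 1 / real n * (1 / \<Gamma>\<^sup>2)" using n Gamma_sq(1) by (simp add: powr_minus divide_inverse powr_numeral)
  finally show ?thesis using n by simp
qed

lemma phi_tendsto: "\<phi> \<longlonglongrightarrow> 0"
proof -
  have "(\<lambda>n. real n powr (- 1 / (2 * H))) \<longlonglongrightarrow> 0"
    using H_bounds by (intro tendsto_neg_powr filterlim_real_sequentially) simp
  then have "(\<lambda>n. real n powr (- 1 / (2 * H)) * \<Gamma> powr (- 1 / H)) \<longlonglongrightarrow> 0 * \<Gamma> powr (- 1 / H)"
    by (intro tendsto_mult_right)
  then show ?thesis by (simp add: cusp_rate_def[abs_def])
qed

lemma phi_dom: "eventually (\<lambda>n. \<theta>\<^sub>1 + \<phi> n * w < b \<and> 0 < n) sequentially"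
proof -
  have "(\<lambda>n. \<theta>\<^sub>1 + \<phi> n * w) \<longlonglongrightarrow> \<theta>\<^sub>1 + 0 * w" by (intro tendsto_intros phi_tendsto)
  then have "eventually (\<lambda>n. \<theta>\<^sub>1 + \<phi> n * w < b) sequentially" using \<theta>1 by (intro order_tendstoD) auto
  then show ?thesis using eventually_gt_at_top[of 0] by eventually_elim auto
qed

lemma phi_\<Theta>: "0 \<le> w \<Longrightarrow> eventually (\<lambda>n. \<theta>\<^sub>1 + \<phi> n * w \<in> \<Theta> \<and> 0 < n) sequentially"
  using phi_dom[of w] by eventually_elim (auto intro: mult_nonneg_nonneg less_imp_le[OF phi_pos])

text \<open>Zooming in by t = \<open>\<theta>\<^sub>1 + \<phi> n * s\<close> pulls out \<phi> n powr
  (2 * \<kappa> + 1). In the denominator the cusp term shrinks like \<phi> n powr \<kappa> and h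
  converges by continuity, so the weight tends to the constant \<open>h \<theta>\<^sub>1\<close>.
  The squared kernel, integrable over the line, dominates up to the factor 1 / min c 1.\<close>

lemma scaled_chi_sq:
  assumes w: "0 \<le> w" "0 \<le> w'" "0 \<le> u"
  shows "(\<lambda>n. real n * (LINT t|lborel. indicator {0..\<tau>} t * ((lamx (\<theta>\<^sub>1 + \<phi> n * w) t - lamx (\<theta>\<^sub>1 + \<phi> n * w') t)\<^sup>2 / lamx (\<theta>\<^sub>1 + \<phi> n * u) t)))
    \<longlonglongrightarrow> \<bar>w - w'\<bar> powr (2 * H)"
proof -
  define g where "g s = (\<bar>s - w\<bar> powr \<kappa> - \<bar>s - w'\<bar> powr \<kappa>)\<^sup>2" for s
  define k where "k n s = indicator {0..\<tau>} (\<theta>\<^sub>1 + \<phi> n * s) * (g s / lamx (\<theta>\<^sub>1 + \<phi> n * u) (\<theta>\<^sub>1 + \<phi> n * s))" for n s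
  have gi: "has_bochner_integral lborel g (cusp_const \<kappa> * \<bar>w - w'\<bar> powr (2 * H))"
    unfolding g_def H_eq by (rule cusp_scaled(1)[OF \<kappa>])
  have [measurable]: "g \<in> borel_measurable borel" unfolding g_def by measurable
  have km: "k n \<in> borel_measurable borel" for n unfolding k_def by measurable
  have c1: "0 < min c 1" using c by simp
  have "(\<lambda>n. LINT s|lborel. k n s) \<longlonglongrightarrow> (LINT s|lborel. g s / h \<theta>\<^sub>1)"
  proof (rule integral_dominated_convergence[where w = "\<lambda>s. g s / min c 1"])
    show "integrable lborel (\<lambda>s. g s / min c 1)" using gi by (simp add: has_bochner_integral_iff)
    show "AE s in lborel. norm (k n s) \<le> g s / min c 1" for n
    proof (intro AE_I2)
      fix s
      have "g s / lamx (\<theta>\<^sub>1 + \<phi> n * u) (\<theta>\<^sub>1 + \<phi> n * s) \<le> g s / min c 1"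
        using lamx_bounds[of "\<theta>\<^sub>1 + \<phi> n * u" "\<theta>\<^sub>1 + \<phi> n * s"] c1 by (intro divide_left_mono) (auto simp: g_def)
      moreover have "0 \<le> g s / lamx (\<theta>\<^sub>1 + \<phi> n * u) (\<theta>\<^sub>1 + \<phi> n * s)" "0 \<le> g s / min c 1"
        using lamx_bounds(3)[of "\<theta>\<^sub>1 + \<phi> n * u" "\<theta>\<^sub>1 + \<phi> n * s"] c1 by (auto simp: g_def)
      ultimately have "0 \<le> k n s \<and> k n s \<le> g s / min c 1" unfolding k_def by (cases "\<theta>\<^sub>1 + \<phi> n * s \<in> {0..\<tau>}") simp_all
      then show "norm (k n s) \<le> g s / min c 1" by simp
    qed
    show "AE s in lborel. (\<lambda>n. k n s) \<longlonglongrightarrow> g s / h \<theta>\<^sub>1"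
    proof (intro AE_I2)
      fix s
      have l1: "(\<lambda>n. \<theta>\<^sub>1 + \<phi> n * s) \<longlonglongrightarrow> \<theta>\<^sub>1" using tendsto_add[OF tendsto_const tendsto_mult_left_zero[OF phi_tendsto, of s], of \<theta>\<^sub>1] by simp
      have hl: "(\<lambda>n. h (\<theta>\<^sub>1 + \<phi> n * s)) \<longlonglongrightarrow> h \<theta>\<^sub>1" by (rule isCont_tendsto_compose[OF h_cont l1])
      have pl: "(\<lambda>n. \<phi> n powr \<kappa>) \<longlonglongrightarrow> 0"
        using \<kappa> phi_tendsto by (intro tendsto_zero_powrI[where b = \<kappa>]) (auto simp: phi_nonneg)
      have in\<tau>: "eventually (\<lambda>n. \<theta>\<^sub>1 + \<phi> n * s \<in> {0..\<tau>}) sequentially"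
      proof -
        have "eventually (\<lambda>n. 0 < \<theta>\<^sub>1 + \<phi> n * s) sequentially" "eventually (\<lambda>n. \<theta>\<^sub>1 + \<phi> n * s < \<tau>) sequentially"
          using \<theta>1 by (auto intro!: order_tendstoD[OF l1])
        then show ?thesis by eventually_elim auto
      qed
      have "(\<lambda>n. 1 * (g s / (a * (\<phi> n powr \<kappa> * \<bar>s - u\<bar> powr \<kappa>) + h (\<theta>\<^sub>1 + \<phi> n * s)))) \<longlonglongrightarrow> 1 * (g s / (a * (0 * \<bar>s - u\<bar> powr \<kappa>) + h \<theta>\<^sub>1))"
        using h_pos by (intro tendsto_intros pl hl) auto
      then have "(\<lambda>n. 1 * (g s / (a * (\<phi> n powr \<kappa> * \<bar>s - u\<bar> powr \<kappa>) + h (\<theta>\<^sub>1 + \<phi> n * s)))) \<longlonglongrightarrow> g s / h \<theta>\<^sub>1" by simp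
      moreover have "eventually (\<lambda>n. 1 * (g s / (a * (\<phi> n powr \<kappa> * \<bar>s - u\<bar> powr \<kappa>) + h (\<theta>\<^sub>1 + \<phi> n * s))) = k n s) sequentially"
        using in\<tau> phi_\<Theta>[OF w(3)]
      proof eventually_elim
        case (elim n)
        have "\<theta>\<^sub>1 + \<phi> n * s - (\<theta>\<^sub>1 + \<phi> n * u) = \<phi> n * (s - u)" by (simp add: algebra_simps)
        then have "\<bar>\<theta>\<^sub>1 + \<phi> n * s - (\<theta>\<^sub>1 + \<phi> n * u)\<bar> powr \<kappa> = \<phi> n powr \<kappa> * \<bar>s - u\<bar> powr \<kappa>"
          using phi_pos[of n] elim by (simp add: abs_mult powr_mult)
        then show ?case using elim by (simp add: k_def lamx_in cusp_intensity_def del: atLeastAtMost_iff atLeastLessThan_iff)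
      qed
      ultimately show "(\<lambda>n. k n s) \<longlonglongrightarrow> g s / h \<theta>\<^sub>1" by (rule Lim_transform_eventually)
    qed
  qed (use km in auto)
  then have "(\<lambda>n. a\<^sup>2 / \<Gamma>\<^sup>2 * (LINT s|lborel. k n s)) \<longlonglongrightarrow> a\<^sup>2 / \<Gamma>\<^sup>2 * (LINT s|lborel. g s / h \<theta>\<^sub>1)"
    by (intro tendsto_mult_left)
  also have "a\<^sup>2 / \<Gamma>\<^sup>2 * (LINT s|lborel. g s / h \<theta>\<^sub>1) = \<bar>w - w'\<bar> powr (2 * H)"
    using gi a h_pos cusp_const_pos[OF \<kappa>] unfolding Gamma_sq(2) by (simp add: has_bochner_integral_iff)
  finally have lim: "(\<lambda>n. a\<^sup>2 / \<Gamma>\<^sup>2 * (LINT s|lborel. k n s)) \<longlonglongrightarrow> \<bar>w - w'\<bar> powr (2 * H)" .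
  have ev: "eventually (\<lambda>n. a\<^sup>2 / \<Gamma>\<^sup>2 * (LINT s|lborel. k n s) =
     real n * (LINT t|lborel. indicator {0..\<tau>} t * ((lamx (\<theta>\<^sub>1 + \<phi> n * w) t - lamx (\<theta>\<^sub>1 + \<phi> n * w') t)\<^sup>2 / lamx (\<theta>\<^sub>1 + \<phi> n * u) t))) sequentially"
    using phi_\<Theta>[OF w(1)] phi_\<Theta>[OF w(2)]
  proof eventually_elim
    case (elim n)
    have p: "0 < \<phi> n" using elim phi_pos by auto
    have m: "\<theta>\<^sub>1 + \<phi> n * w \<in> \<Theta>" "\<theta>\<^sub>1 + \<phi> n * w' \<in> \<Theta>" using elim by blast+
    have eq: "indicator {0..\<tau>} (\<theta>\<^sub>1 + \<phi> n * s) * ((lamx (\<theta>\<^sub>1 + \<phi> n * w) (\<theta>\<^sub>1 + \<phi> n * s) - lamx (\<theta>\<^sub>1 + \<phi> n * w') (\<theta>\<^sub>1 + \<phi> n * s))\<^sup>2 / lamx (\<theta>\<^sub>1 + \<phi> n * u) (\<theta>\<^sub>1 + \<phi> n * s))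
       = (a\<^sup>2 * \<phi> n powr (2 * \<kappa>)) * k n s" for s
    proof (cases "\<theta>\<^sub>1 + \<phi> n * s \<in> {0..\<tau>}")
      case True
      have d: "\<bar>\<theta>\<^sub>1 + \<phi> n * s - (\<theta>\<^sub>1 + \<phi> n * v)\<bar> powr \<kappa> = \<phi> n powr \<kappa> * \<bar>s - v\<bar> powr \<kappa>" for v
      proof -
        have "\<theta>\<^sub>1 + \<phi> n * s - (\<theta>\<^sub>1 + \<phi> n * v) = \<phi> n * (s - v)" by (simp add: algebra_simps)
        then show ?thesis using p by (simp add: abs_mult powr_mult)
      qed
      have "lamx (\<theta>\<^sub>1 + \<phi> n * w) (\<theta>\<^sub>1 + \<phi> n * s) - lamx (\<theta>\<^sub>1 + \<phi> n * w') (\<theta>\<^sub>1 + \<phi> n * s) = (a * \<phi> n powr \<kappa>) * (\<bar>s - w\<bar> powr \<kappa> - \<bar>s - w'\<bar> powr \<kappa>)"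
        unfolding lamx_in[OF m(1) True] lamx_in[OF m(2) True] lam_diff d by (simp add: algebra_simps)
      then have "(lamx (\<theta>\<^sub>1 + \<phi> n * w) (\<theta>\<^sub>1 + \<phi> n * s) - lamx (\<theta>\<^sub>1 + \<phi> n * w') (\<theta>\<^sub>1 + \<phi> n * s))\<^sup>2 = (a\<^sup>2 * \<phi> n powr (2 * \<kappa>)) * g s"
        by (simp only: power_mult_distrib g_def) (simp add: power2_eq_square powr_add[symmetric])
      then show ?thesis using True by (simp add: k_def)
    qed (simp add: k_def)
    have "(LINT t|lborel. indicator {0..\<tau>} t * ((lamx (\<theta>\<^sub>1 + \<phi> n * w) t - lamx (\<theta>\<^sub>1 + \<phi> n * w') t)\<^sup>2 / lamx (\<theta>\<^sub>1 + \<phi> n * u) t))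
       = \<bar>\<phi> n\<bar> *\<^sub>R (LINT s|lborel. (a\<^sup>2 * \<phi> n powr (2 * \<kappa>)) * k n s)"
      by (subst lborel_integral_real_affine[of "\<phi> n" _ \<theta>\<^sub>1], use p in simp, simp only: eq)
    also have "\<dots> = (\<phi> n * \<phi> n powr (2 * \<kappa>)) * (a\<^sup>2 * (LINT s|lborel. k n s))" using p by simp
    also have "\<phi> n * \<phi> n powr (2 * \<kappa>) = \<phi> n powr (2 * H)" using p unfolding H_eq by (simp add: powr_mult_base add.commute)
    finally have fin: "(LINT t|lborel. indicator {0..\<tau>} t * ((lamx (\<theta>\<^sub>1 + \<phi> n * w) t - lamx (\<theta>\<^sub>1 + \<phi> n * w') t)\<^sup>2 / lamx (\<theta>\<^sub>1 + \<phi> n * u) t))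
       = \<phi> n powr (2 * H) * (a\<^sup>2 * (LINT s|lborel. k n s))" .
    have "real n * \<phi> n powr (2 * H) = 1 / \<Gamma>\<^sup>2" using phi_scale[of n] elim by simp
    then show ?case unfolding fin mult.assoc[symmetric, of "real n"] by simp
  qed
  show ?thesis by (rule Lim_transform_eventually[OF lim ev])
qed

end

text \<open>Subadditivity of the power on the positive half-line, which is Hoelder continuity with
  constant 1. It makes intensities of neighbouring parameters close uniformly in t.\<close>

lemma powr_abs_diff_le:
  fixes \<kappa> x y :: real
  assumes "0 < \<kappa>" "\<kappa> < 1"
  shows "\<bar>\<bar>x\<bar> powr \<kappa> - \<bar>y\<bar> powr \<kappa>\<bar> \<le> \<bar>x - y\<bar> powr \<kappa>"
proof -
  have sub: "p powr \<kappa> \<le> q powr \<kappa> + (p - q) powr \<kappa>" if "0 \<le> q" "q \<le> p" for p q :: real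
  proof (cases "q = 0 \<or> q = p")
    case False
    then have pq: "0 < q" "q < p" using that by auto
    have "p powr \<kappa> = p * p powr (\<kappa> - 1)" using pq by (simp add: powr_mult_base)
    also have "\<dots> = q * p powr (\<kappa> - 1) + (p - q) * p powr (\<kappa> - 1)" by (simp add: algebra_simps)
    also have "\<dots> \<le> q * q powr (\<kappa> - 1) + (p - q) * (p - q) powr (\<kappa> - 1)"
      using pq assms by (intro add_mono mult_left_mono powr_mono2') auto
    also have "\<dots> = q powr \<kappa> + (p - q) powr \<kappa>" using pq by (simp add: powr_mult_base)
    finally show ?thesis .
  qed (use that in auto)
  have "\<bar>p powr \<kappa> - q powr \<kappa>\<bar> \<le> \<bar>p - q\<bar> powr \<kappa>" if "0 \<le> p" "0 \<le> q" for p q :: real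
  proof (cases "q \<le> p")
    case True
    then show ?thesis using sub[of q p] powr_mono2[of \<kappa> q p] that assms by simp
  next
    case False
    then show ?thesis using sub[of p q] powr_mono2[of \<kappa> p q] that assms by simp
  qed
  from this[of "\<bar>x\<bar>" "\<bar>y\<bar>"] have "\<bar>\<bar>x\<bar> powr \<kappa> - \<bar>y\<bar> powr \<kappa>\<bar> \<le> \<bar>\<bar>x\<bar> - \<bar>y\<bar>\<bar> powr \<kappa>" by simp
  also have "\<dots> \<le> \<bar>x - y\<bar> powr \<kappa>" using assms by (intro powr_mono2) auto
  finally show ?thesis .
qed

section \<open>Expansion of the characteristic exponent\<close>

context cusp_model
begin

text \<open>A chi-square type distance whose first argument selects the weighting intensity: the
  true one in the characteristic exponent, but that of \<theta> itself in the mean of the inverse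
  likelihood ratio.\<close>

definition chi :: "real \<Rightarrow> real \<Rightarrow> real \<Rightarrow> real" where
  "chi \<theta>' \<theta> \<theta>'' = (LINT t|lborel. indicator {0..\<tau>} t * ((lamx \<theta> t - lamx \<theta>'' t)\<^sup>2 / lamx \<theta>' t))"

lemma chi_integrable: "integrable lborel (\<lambda>t. indicator {0..\<tau>} t * ((lamx \<theta> t - lamx \<theta>'' t)\<^sup>2 / lamx \<theta>' t))"
proof -
  have "norm ((lamx \<theta> t - lamx \<theta>'' t)\<^sup>2 / lamx \<theta>' t) \<le> (max \<Lambda> 1)\<^sup>2 / min c 1" for t
  proof -
    have "(lamx \<theta> t - lamx \<theta>'' t)\<^sup>2 \<le> (max \<Lambda> 1)\<^sup>2" using power_mono[OF lamx_diff_bound[of \<theta> t \<theta>''], of 2] by simp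
    then show ?thesis using lamx_bounds[of \<theta>' t] c by (auto intro!: frac_le)
  qed
  then show ?thesis
    using bounded_int[of "\<lambda>t. (lamx \<theta> t - lamx \<theta>'' t)\<^sup>2 / lamx \<theta>' t" "(max \<Lambda> 1)\<^sup>2 / min c 1"] by simp
qed

lemma lamx_diff_small:
  assumes "\<theta> \<in> \<Theta>" "\<theta>' \<in> \<Theta>"
  shows "\<bar>lamx \<theta> t - lamx \<theta>' t\<bar> \<le> \<bar>a\<bar> * \<bar>\<theta> - \<theta>'\<bar> powr \<kappa>"
proof (cases "t \<in> {0..\<tau>}")
  case True
  have "\<bar>lamx \<theta> t - lamx \<theta>' t\<bar> = \<bar>a\<bar> * \<bar>\<bar>t - \<theta>\<bar> powr \<kappa> - \<bar>t - \<theta>'\<bar> powr \<kappa>\<bar>"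
    unfolding lamx_in[OF assms(1) True] lamx_in[OF assms(2) True] lam_diff by (simp add: abs_mult)
  also have "\<dots> \<le> \<bar>a\<bar> * \<bar>(t - \<theta>) - (t - \<theta>')\<bar> powr \<kappa>" using \<kappa> by (intro mult_left_mono powr_abs_diff_le) auto
  finally show ?thesis by (simp add: abs_minus_commute)
next
  case False
  then have "lamx \<theta> t = 1" "lamx \<theta>' t = 1" by (simp_all only: lamx_def) auto
  then show ?thesis by simp
qed

text \<open>The logarithm of the characteristic function of the log-likelihood ratios of a single observation.\<close>

definition cexp :: "real \<Rightarrow> nat \<Rightarrow> (nat \<Rightarrow> real) \<Rightarrow> (nat \<Rightarrow> real) \<Rightarrow> complex" where
  "cexp \<theta>' k t \<theta> = (CLINT s|lborel. indicator {0..\<tau>} s *\<^sub>R (of_real (lamx \<theta>' s) *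
     (iexp (\<Sum>i<k. t i * ln (lamx (\<theta> i) s / lamx \<theta>' s)) - 1 - \<i> * (\<Sum>i<k. t i * (lamx (\<theta> i) s / lamx \<theta>' s - 1)))))"

text \<open>\<open>iexp_second_order\<close> is applied pointwise to the relative deviations of the
  intensities from the true one. Multiplied by the true intensity, the second-order terms become the
  integrands of \<open>chi\<close>, and so does the sum of squares in the error.\<close>

lemma cexp_bound:
  fixes \<theta> t :: "nat \<Rightarrow> real"
  assumes \<theta>': "\<theta>' \<in> \<Theta>" and \<theta>: "\<And>i. i < k \<Longrightarrow> \<theta> i \<in> \<Theta>"
    and \<xi>: "\<And>i. i < k \<Longrightarrow> \<bar>a\<bar> * \<bar>\<theta> i - \<theta>'\<bar> powr \<kappa> / c \<le> \<xi>" "\<xi> \<le> 1 / 2"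
  defines "T \<equiv> \<Sum>i<k. \<bar>t i\<bar>"
  shows "norm (cexp \<theta>' k t \<theta> - (- \<i> * ((\<Sum>i<k. t i * chi \<theta>' (\<theta> i) \<theta>') / 2)
      - (\<Sum>i<k. \<Sum>j<k. t i * t j * ((chi \<theta>' (\<theta> i) \<theta>' + chi \<theta>' (\<theta> j) \<theta>' - chi \<theta>' (\<theta> i) (\<theta> j)) / 2)) / 2))
    \<le> (2 * T ^ 3 + 2 * T + 3 * T\<^sup>2) * \<xi> * (\<Sum>i<k. chi \<theta>' (\<theta> i) \<theta>')"
proof -
  define I where "I s = indicat_real {0..\<tau>} s" for s
  define x where "x i s = lamx (\<theta> i) s / lamx \<theta>' s - 1" for i s
  define G where "G s = I s *\<^sub>R (complex_of_real (lamx \<theta>' s) * (iexp (\<Sum>i<k. t i * ln (1 + x i s)) - 1 - \<i> * (\<Sum>i<k. t i * x i s)))" for s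
  define e where "e \<theta>1 \<theta>2 s = I s * ((lamx \<theta>1 s - lamx \<theta>2 s)\<^sup>2 / lamx \<theta>' s)" for \<theta>1 \<theta>2 s
  have ei: "integrable lborel (e \<theta>1 \<theta>2)" and ee: "(LINT s|lborel. e \<theta>1 \<theta>2 s) = chi \<theta>' \<theta>1 \<theta>2" for \<theta>1 \<theta>2
    unfolding e_def I_def using chi_integrable by (auto simp: chi_def)
  define Q where "Q s = - \<i> * of_real ((\<Sum>i<k. t i * e (\<theta> i) \<theta>' s) / 2)
      - of_real ((\<Sum>i<k. \<Sum>j<k. t i * t j * ((e (\<theta> i) \<theta>' s + e (\<theta> j) \<theta>' s - e (\<theta> i) (\<theta> j) s) / 2)) / 2)" for s
  have lp: "0 < lamx \<theta>' s" for s by (rule lamx_bounds)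
  have x1: "1 + x i s = lamx (\<theta> i) s / lamx \<theta>' s" for i s by (simp add: x_def)
  have xe: "x i s = (lamx (\<theta> i) s - lamx \<theta>' s) / lamx \<theta>' s" for i s using lp[of s] by (simp add: x_def diff_divide_distrib)
  have Qi: "integrable lborel Q"
    unfolding Q_def using ei by (intro Bochner_Integration.integrable_diff integrable_mult_right integrable_of_real
      integrable_divide_zero Bochner_Integration.integrable_sum Bochner_Integration.integrable_add) auto
  have QI: "(CLINT s|lborel. Q s) = - \<i> * ((\<Sum>i<k. t i * chi \<theta>' (\<theta> i) \<theta>') / 2)
      - (\<Sum>i<k. \<Sum>j<k. t i * t j * ((chi \<theta>' (\<theta> i) \<theta>' + chi \<theta>' (\<theta> j) \<theta>' - chi \<theta>' (\<theta> i) (\<theta> j)) / 2)) / 2"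
  proof -
    have "has_bochner_integral lborel Q (- \<i> * of_real ((\<Sum>i<k. t i * chi \<theta>' (\<theta> i) \<theta>') / 2)
      - of_real ((\<Sum>i<k. \<Sum>j<k. t i * t j * ((chi \<theta>' (\<theta> i) \<theta>' + chi \<theta>' (\<theta> j) \<theta>' - chi \<theta>' (\<theta> i) (\<theta> j)) / 2)) / 2))"
      unfolding Q_def ee[symmetric] using ei
      by (intro has_bochner_integral_diff has_bochner_integral_mult_right has_bochner_integral_of_real has_bochner_integral_divide_zero
          has_bochner_integral_sum has_bochner_integral_add has_bochner_integral_integrable)
    then show ?thesis by (simp add: has_bochner_integral_iff)
  qed
  have pw: "norm (G s - Q s) \<le> (2 * T ^ 3 + 2 * T + 3 * T\<^sup>2) * \<xi> * (\<Sum>i<k. e (\<theta> i) \<theta>' s)" for s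
  proof (cases "s \<in> {0..\<tau>}")
    case True
    have I1: "I s = 1" using True by (simp add: I_def)
    define l where "l = lamx \<theta>' s"
    have l: "0 < l" "c \<le> l" using lp[of s] lam_bounds[OF \<theta>' True] lamx_in[OF \<theta>' True] by (auto simp: l_def)
    have x\<xi>: "\<bar>x i s\<bar> \<le> \<xi>" if "i < k" for i
    proof -
      have "\<bar>x i s\<bar> = \<bar>lamx (\<theta> i) s - lamx \<theta>' s\<bar> / l" unfolding xe using l by (simp add: l_def)
      also have "\<dots> \<le> (\<bar>a\<bar> * \<bar>\<theta> i - \<theta>'\<bar> powr \<kappa>) / c"
        using lamx_diff_small[OF \<theta>[OF that] \<theta>'] l c by (intro frac_le) auto
      finally show ?thesis using \<xi>(1)[OF that] by simp
    qed
    have e1: "e (\<theta> i) \<theta>' s = l * (x i s)\<^sup>2" for i using l by (simp add: e_def I1 xe l_def[symmetric] power_divide power2_eq_square)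
    \<comment> \<open>Polarisation: three squared differences of intensities give the mixed product
      of two relative deviations. In the limit the same combination of powers is the covariance
      \<open>fbm_cov\<close>.\<close>
    have e2: "(e (\<theta> i) \<theta>' s + e (\<theta> j) \<theta>' s - e (\<theta> i) (\<theta> j) s) / 2 = l * (x i s * x j s)" for i j
    proof -
      have d: "lamx (\<theta> i) s - lamx (\<theta> j) s = l * (x i s - x j s)" using l by (simp add: xe l_def[symmetric] field_simps)
      have "e (\<theta> i) (\<theta> j) s = l * (x i s - x j s)\<^sup>2" unfolding e_def I1 d using l by (simp add: l_def[symmetric] power_mult_distrib power2_eq_square)
      then show ?thesis unfolding e1 by (simp add: power2_eq_square algebra_simps)
    qed
    have sq: "(\<Sum>i<k. \<Sum>j<k. t i * t j * (l * (x i s * x j s))) = l * (\<Sum>i<k. t i * x i s)\<^sup>2"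
      by (simp add: square_sum_product sum_distrib_left mult_ac)
    have Qs: "Q s = of_real l * (- \<i> * ((\<Sum>i<k. t i * (x i s)\<^sup>2) / 2) - (\<Sum>i<k. t i * x i s)\<^sup>2 / 2)"
    proof -
      have "(\<Sum>i<k. t i * e (\<theta> i) \<theta>' s) = l * (\<Sum>i<k. t i * (x i s)\<^sup>2)" unfolding e1 by (simp add: sum_distrib_left mult_ac)
      then show ?thesis unfolding Q_def e2 sq by (simp add: algebra_simps)
    qed
    have "G s - Q s = of_real l * (iexp (\<Sum>i<k. t i * ln (1 + x i s)) - 1 - \<i> * (\<Sum>i<k. t i * x i s)
      - (- \<i> * ((\<Sum>i<k. t i * (x i s)\<^sup>2) / 2) - (\<Sum>i<k. t i * x i s)\<^sup>2 / 2))"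
      unfolding Qs G_def I1 l_def[symmetric] scaleR_one right_diff_distrib[of "complex_of_real l", symmetric] ..
    then have "norm (G s - Q s) = l * norm (iexp (\<Sum>i<k. t i * ln (1 + x i s)) - 1 - \<i> * (\<Sum>i<k. t i * x i s)
      - (- \<i> * ((\<Sum>i<k. t i * (x i s)\<^sup>2) / 2) - (\<Sum>i<k. t i * x i s)\<^sup>2 / 2))"
      using l by (simp only: norm_mult norm_of_real abs_of_pos)
    also have "\<dots> \<le> l * ((2 * T ^ 3 + 2 * T + 3 * T\<^sup>2) * \<xi> * (\<Sum>i<k. (x i s)\<^sup>2))"
      unfolding T_def using l x\<xi> \<xi>(2) by (intro mult_left_mono iexp_second_order) auto
    also have "\<dots> = (2 * T ^ 3 + 2 * T + 3 * T\<^sup>2) * \<xi> * (\<Sum>i<k. e (\<theta> i) \<theta>' s)"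
      unfolding e1 by (simp add: sum_distrib_left mult_ac)
    finally show ?thesis .
  next
    case False
    then have "I s = 0" by (simp add: I_def)
    then show ?thesis by (simp add: G_def Q_def e_def)
  qed
  have Gm: "G \<in> borel_measurable lborel" unfolding G_def I_def x_def by measurable
  have bi: "integrable lborel (\<lambda>s. (2 * T ^ 3 + 2 * T + 3 * T\<^sup>2) * \<xi> * (\<Sum>i<k. e (\<theta> i) \<theta>' s))"
    using ei by (intro integrable_mult_right Bochner_Integration.integrable_sum) auto
  have di: "integrable lborel (\<lambda>s. G s - Q s)"
  proof (rule Bochner_Integration.integrable_bound[OF bi])
    show "AE s in lborel. norm (G s - Q s) \<le> norm ((2 * T ^ 3 + 2 * T + 3 * T\<^sup>2) * \<xi> * (\<Sum>i<k. e (\<theta> i) \<theta>' s))"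
      using pw by (intro AE_I2) (auto intro: order_trans[OF _ abs_ge_self])
    show "(\<lambda>s. G s - Q s) \<in> borel_measurable lborel" using Gm borel_measurable_integrable[OF Qi] by measurable
  qed
  have Gi: "integrable lborel G"
    using Bochner_Integration.integrable_add[OF di Qi] by simp
  have "cexp \<theta>' k t \<theta> = (CLINT s|lborel. G s)" unfolding cexp_def G_def I_def x1 by (simp add: x_def)
  then have "cexp \<theta>' k t \<theta> - (CLINT s|lborel. Q s) = (CLINT s|lborel. G s - Q s)" using Gi Qi by simp
  then have "norm (cexp \<theta>' k t \<theta> - (CLINT s|lborel. Q s)) \<le> (LINT s|lborel. norm (G s - Q s))" by simp
  also have "\<dots> \<le> (LINT s|lborel. (2 * T ^ 3 + 2 * T + 3 * T\<^sup>2) * \<xi> * (\<Sum>i<k. e (\<theta> i) \<theta>' s))"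
    using di bi pw by (intro integral_mono) auto
  also have "\<dots> = (2 * T ^ 3 + 2 * T + 3 * T\<^sup>2) * \<xi> * (\<Sum>i<k. chi \<theta>' (\<theta> i) \<theta>')"
    using ei by (simp add: Bochner_Integration.integral_sum ee)
  finally show ?thesis unfolding QI .
qed

text \<open>All n * chi converge by \<open>scaled_chi_sq\<close>. The error is a bounded quantity
  times \<xi> n, which bounds the relative deviations and is of order \<phi> n powr
  \<kappa>.\<close>

lemma cexp_tendsto:
  fixes t w :: "nat \<Rightarrow> real"
  assumes u: "0 \<le> u" and w: "\<And>i. i < k \<Longrightarrow> 0 \<le> w i"
  shows "(\<lambda>n. of_nat n * cexp (\<theta>\<^sub>1 + \<phi> n * u) k t (\<lambda>i. \<theta>\<^sub>1 + \<phi> n * w i))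
    \<longlonglongrightarrow> - \<i> * (\<Sum>i<k. t i * (\<bar>w i - u\<bar> powr (2 * H) / 2)) - fbm_quad H k t (\<lambda>i. w i - u) / 2"
proof -
  define T where "T = (\<Sum>i<k. \<bar>t i\<bar>)"
  define K where "K = 2 * T ^ 3 + 2 * T + 3 * T\<^sup>2"
  define \<theta>s where "\<theta>s n = \<theta>\<^sub>1 + \<phi> n * u" for n
  define \<theta> where "\<theta> n i = \<theta>\<^sub>1 + \<phi> n * w i" for n i
  define \<xi> where "\<xi> n = (\<Sum>i<k. \<bar>a\<bar> * (\<phi> n powr \<kappa> * \<bar>w i - u\<bar> powr \<kappa>) / c)" for n
  have chi_lim: "(\<lambda>n. real n * chi (\<theta>s n) (\<theta>\<^sub>1 + \<phi> n * v) (\<theta>\<^sub>1 + \<phi> n * v')) \<longlonglongrightarrow> \<bar>v - v'\<bar> powr (2 * H)" if "0 \<le> v" "0 \<le> v'" for v v'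
    unfolding chi_def \<theta>s_def by (rule scaled_chi_sq[OF that u])
  have c1: "(\<lambda>n. real n * chi (\<theta>s n) (\<theta> n i) (\<theta>s n)) \<longlonglongrightarrow> \<bar>w i - u\<bar> powr (2 * H)" if "i < k" for i
    using chi_lim[OF w[OF that] u] by (simp add: \<theta>_def \<theta>s_def)
  have c2: "(\<lambda>n. real n * chi (\<theta>s n) (\<theta> n i) (\<theta> n j)) \<longlonglongrightarrow> \<bar>w i - w j\<bar> powr (2 * H)" if "i < k" "j < k" for i j
    using chi_lim[OF w[OF that(1)] w[OF that(2)]] by (simp add: \<theta>_def)
  define q where "q n = - \<i> * complex_of_real ((\<Sum>i<k. t i * chi (\<theta>s n) (\<theta> n i) (\<theta>s n)) / 2)
      - of_real ((\<Sum>i<k. \<Sum>j<k. t i * t j * ((chi (\<theta>s n) (\<theta> n i) (\<theta>s n) + chi (\<theta>s n) (\<theta> n j) (\<theta>s n) - chi (\<theta>s n) (\<theta> n i) (\<theta> n j)) / 2)) / 2)" for n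
  have q: "of_nat n * q n = - \<i> * complex_of_real (\<Sum>i<k. t i * ((real n * chi (\<theta>s n) (\<theta> n i) (\<theta>s n)) / 2))
      - of_real ((\<Sum>i<k. \<Sum>j<k. t i * t j * (((real n * chi (\<theta>s n) (\<theta> n i) (\<theta>s n)) + (real n * chi (\<theta>s n) (\<theta> n j) (\<theta>s n)) - (real n * chi (\<theta>s n) (\<theta> n i) (\<theta> n j))) / 2)) / 2)" for n
  proof -
    have s1: "(\<Sum>i<k. t i * ((real n * chi (\<theta>s n) (\<theta> n i) (\<theta>s n)) / 2)) = real n * ((\<Sum>i<k. t i * chi (\<theta>s n) (\<theta> n i) (\<theta>s n)) / 2)"
      by (simp add: sum_distrib_left sum_divide_distrib mult_ac)
    have s2: "(\<Sum>i<k. \<Sum>j<k. t i * t j * (((real n * chi (\<theta>s n) (\<theta> n i) (\<theta>s n)) + (real n * chi (\<theta>s n) (\<theta> n j) (\<theta>s n)) - (real n * chi (\<theta>s n) (\<theta> n i) (\<theta> n j))) / 2)) / 2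
      = real n * ((\<Sum>i<k. \<Sum>j<k. t i * t j * ((chi (\<theta>s n) (\<theta> n i) (\<theta>s n) + chi (\<theta>s n) (\<theta> n j) (\<theta>s n) - chi (\<theta>s n) (\<theta> n i) (\<theta> n j)) / 2)) / 2)"
      unfolding times_divide_eq_right sum_distrib_left by (intro arg_cong2[where f = "(/)"] sum.cong refl) (simp add: algebra_simps add_divide_distrib diff_divide_distrib)
    have "of_nat n * (- \<i> * complex_of_real A - of_real B) = - \<i> * of_real (real n * A) - of_real (real n * B)" for A B
      by (simp add: algebra_simps)
    then show ?thesis unfolding q_def s1 s2 .
  qed
  have qlim: "(\<lambda>n. of_nat n * q n) \<longlonglongrightarrow> - \<i> * complex_of_real (\<Sum>i<k. t i * (\<bar>w i - u\<bar> powr (2 * H) / 2))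
     - of_real ((\<Sum>i<k. \<Sum>j<k. t i * t j * ((\<bar>w i - u\<bar> powr (2 * H) + \<bar>w j - u\<bar> powr (2 * H) - \<bar>w i - w j\<bar> powr (2 * H)) / 2)) / 2)"
    unfolding q by (intro tendsto_intros c1 c2) auto
  have \<xi>lim: "\<xi> \<longlonglongrightarrow> 0"
  proof -
    have "(\<lambda>n. \<phi> n powr \<kappa>) \<longlonglongrightarrow> 0"
      using \<kappa> phi_tendsto by (intro tendsto_zero_powrI[where b = \<kappa>]) (auto simp: phi_nonneg)
    then have "\<xi> \<longlonglongrightarrow> (\<Sum>i<k. \<bar>a\<bar> * (0 * \<bar>w i - u\<bar> powr \<kappa>) / c)" unfolding \<xi>_def using c by (intro tendsto_intros) auto
    then show ?thesis by simp
  qed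
  have err: "(\<lambda>n. of_nat n * (cexp (\<theta>s n) k t (\<theta> n) - q n)) \<longlonglongrightarrow> 0"
  proof (rule Lim_null_comparison)
    have "eventually (\<lambda>n. \<forall>i\<in>{..<k}. \<theta> n i \<in> \<Theta>) sequentially"
    proof (intro eventually_ball_finite ballI)
      fix i assume "i \<in> {..<k}"
      then have "0 \<le> w i" using w by simp
      then show "eventually (\<lambda>n. \<theta> n i \<in> \<Theta>) sequentially" unfolding \<theta>_def by (rule eventually_mono[OF phi_\<Theta>]) blast
    qed simp
    moreover have "eventually (\<lambda>n. \<xi> n < 1 / 2) sequentially" using order_tendstoD(2)[OF \<xi>lim, of "1 / 2"] by simp
    ultimately show "\<forall>\<^sub>F n in sequentially. norm (of_nat n * (cexp (\<theta>s n) k t (\<theta> n) - q n)) \<le> K * \<xi> n * (\<Sum>i<k. real n * chi (\<theta>s n) (\<theta> n i) (\<theta>s n))"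
      using phi_\<Theta>[OF u]
    proof eventually_elim
      case (elim n)
      have "\<bar>a\<bar> * \<bar>\<theta> n i - \<theta>s n\<bar> powr \<kappa> / c \<le> \<xi> n" if "i < k" for i
      proof -
        have "\<theta> n i - \<theta>s n = \<phi> n * (w i - u)" by (simp add: \<theta>_def \<theta>s_def algebra_simps)
        then have "\<bar>\<theta> n i - \<theta>s n\<bar> powr \<kappa> = \<phi> n powr \<kappa> * \<bar>w i - u\<bar> powr \<kappa>" using phi_nonneg[of n] by (simp add: abs_mult powr_mult)
        then have "\<bar>a\<bar> * \<bar>\<theta> n i - \<theta>s n\<bar> powr \<kappa> / c = \<bar>a\<bar> * (\<phi> n powr \<kappa> * \<bar>w i - u\<bar> powr \<kappa>) / c" by simp
        also have "\<dots> \<le> \<xi> n" unfolding \<xi>_def using that c by (intro member_le_sum) auto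
        finally show ?thesis .
      qed
      then have "norm (cexp (\<theta>s n) k t (\<theta> n) - q n) \<le> K * \<xi> n * (\<Sum>i<k. chi (\<theta>s n) (\<theta> n i) (\<theta>s n))"
        using cexp_bound[of "\<theta>s n" k "\<theta> n" "\<xi> n" t] elim unfolding K_def T_def q_def \<theta>s_def by auto
      then have "real n * norm (cexp (\<theta>s n) k t (\<theta> n) - q n) \<le> real n * (K * \<xi> n * (\<Sum>i<k. chi (\<theta>s n) (\<theta> n i) (\<theta>s n)))"
        by (intro mult_left_mono) auto
      also have "\<dots> = K * \<xi> n * (\<Sum>i<k. real n * chi (\<theta>s n) (\<theta> n i) (\<theta>s n))" by (simp add: sum_distrib_left mult_ac)
      finally show ?case by (simp add: norm_mult)
    qed
    have "(\<lambda>n. K * \<xi> n * (\<Sum>i<k. real n * chi (\<theta>s n) (\<theta> n i) (\<theta>s n))) \<longlonglongrightarrow> K * 0 * (\<Sum>i<k. \<bar>w i - u\<bar> powr (2 * H))"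
      by (intro tendsto_intros \<xi>lim c1) auto
    then show "(\<lambda>n. K * \<xi> n * (\<Sum>i<k. real n * chi (\<theta>s n) (\<theta> n i) (\<theta>s n))) \<longlonglongrightarrow> 0" by simp
  qed
  have lim: "(\<lambda>n. of_nat n * (cexp (\<theta>s n) k t (\<theta> n) - q n) + of_nat n * q n) \<longlonglongrightarrow> 0 + (- \<i> * complex_of_real (\<Sum>i<k. t i * (\<bar>w i - u\<bar> powr (2 * H) / 2))
     - of_real ((\<Sum>i<k. \<Sum>j<k. t i * t j * ((\<bar>w i - u\<bar> powr (2 * H) + \<bar>w j - u\<bar> powr (2 * H) - \<bar>w i - w j\<bar> powr (2 * H)) / 2)) / 2))"
    by (intro tendsto_add err qlim)
  have eq: "of_nat n * (cexp (\<theta>s n) k t (\<theta> n) - q n) + of_nat n * q n = of_nat n * cexp (\<theta>\<^sub>1 + \<phi> n * u) k t (\<lambda>i. \<theta>\<^sub>1 + \<phi> n * w i)" for n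
    by (simp add: \<theta>s_def \<theta>_def[abs_def] algebra_simps)
  have quad: "(\<Sum>i<k. \<Sum>j<k. t i * t j * ((\<bar>w i - u\<bar> powr (2 * H) + \<bar>w j - u\<bar> powr (2 * H) - \<bar>w i - w j\<bar> powr (2 * H)) / 2)) = fbm_quad H k t (\<lambda>i. w i - u)"
    by (simp add: fbm_quad_def fbm_cov_def)
  show ?thesis using lim unfolding eq quad by simp
qed

end

section \<open>Likelihood ratios\<close>

lemma (in path) path_integral_sum:
  fixes k :: nat and s :: "nat \<Rightarrow> real"
  assumes "\<And>i. i < k \<Longrightarrow> f i \<in> borel_measurable borel" "\<And>i t. i < k \<Longrightarrow> \<bar>f i t\<bar> \<le> B"
  shows "path_integral \<tau> (\<lambda>t. \<Sum>i<k. s i * f i t) x = (\<Sum>i<k. s i * path_integral \<tau> (f i) x)"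
proof -
  have i: "integrable (jump_measure \<tau> x) (\<lambda>t. indicator {0..\<tau>} t * f i t)" if "i < k" for i
    using assms that by (intro integrable_jump[where B = B]) auto
  have "path_integral \<tau> (\<lambda>t. \<Sum>i<k. s i * f i t) x = (LINT t|jump_measure \<tau> x. (\<Sum>i<k. s i * (indicator {0..\<tau>} t * f i t)))"
    unfolding path_integral_eq set_lebesgue_integral_def by (simp add: sum_distrib_left mult.left_commute)
  also have "\<dots> = (\<Sum>i<k. s i * (LINT t|jump_measure \<tau> x. indicator {0..\<tau>} t * f i t))"
    using i by (subst Bochner_Integration.integral_sum) auto
  finally show ?thesis unfolding path_integral_eq set_lebesgue_integral_def by simp
qed

lemma sum_affine:
  fixes s A d :: "'i \<Rightarrow> real"
  shows "(\<Sum>i\<in>I. s i * (A i - r * d i)) = (\<Sum>i\<in>I. s i * A i) - r * (\<Sum>i\<in>I. s i * d i)"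
  by (simp add: sum_subtractf[symmetric] sum_distrib_left algebra_simps)

lemma sample_laplace_real:
  assumes ps: "poisson_sample M \<tau> lam n X" and \<tau>: "0 < \<tau>"
    and lam: "set_integrable lborel {0..\<tau>} lam" "0 < c" "\<And>t. t \<in> {0..\<tau>} \<Longrightarrow> c \<le> lam t"
    and f: "f \<in> borel_measurable borel" and B: "\<And>t. \<bar>f t\<bar> \<le> B"
  shows "has_bochner_integral M (\<lambda>\<omega>. exp (\<Sum>j=1..n. path_integral \<tau> f (X j \<omega>)))
     (exp (real n * (LINT t|density lborel (\<lambda>t. ennreal (indicator {0..\<tau>} t * lam t)). exp (f t) - 1)))"
proof -
  have z: "path_integral \<tau> (\<lambda>_. 0) x = 0" for x by (simp add: path_integral_eq set_lebesgue_integral_def)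
  have "0 \<le> B" using B[of 0] by linarith
  then have "has_bochner_integral M (\<lambda>\<omega>. exp (of_real (\<Sum>j=1..n. path_integral \<tau> f (X j \<omega>)) + \<i> * of_real (\<Sum>j=1..n. path_integral \<tau> (\<lambda>_. 0) (X j \<omega>))))
     (exp (of_nat n * (CLINT t|density lborel (\<lambda>t. ennreal (indicator {0..\<tau>} t * lam t)). exp (of_real (f t) + \<i> * of_real 0) - 1)))"
    by (intro sample_laplace[OF ps \<tau> lam f _ B]) auto
  moreover have "(\<lambda>t. exp (complex_of_real (f t) + \<i> * of_real 0) - 1) = (\<lambda>t. complex_of_real (exp (f t) - 1))"
    by (simp add: exp_of_real)
  ultimately have "has_bochner_integral M (\<lambda>\<omega>. complex_of_real (exp (\<Sum>j=1..n. path_integral \<tau> f (X j \<omega>))))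
     (complex_of_real (exp (real n * (LINT t|density lborel (\<lambda>t. ennreal (indicator {0..\<tau>} t * lam t)). exp (f t) - 1))))"
    by (simp add: z exp_of_real[symmetric] integral_complex_of_real del: of_real_diff)
  from has_bochner_integral_Re[OF this] show ?thesis by simp
qed

context cusp_model
begin

definition lnr :: "real \<Rightarrow> real \<Rightarrow> real \<Rightarrow> real" where "lnr \<theta>' \<theta> t = ln (lamx \<theta> t / lamx \<theta>' t)"

definition Bl :: real where "Bl = 2 * (\<bar>ln (min c 1)\<bar> + \<bar>ln (max \<Lambda> 1)\<bar>)"

lemma ln_lamx_bound: "\<bar>ln (lamx \<theta> t)\<bar> \<le> Bl / 2" "\<bar>ln (lamx \<theta> t)\<bar> \<le> Bl"
proof -
  have l: "ln (min c 1) \<le> ln (lamx \<theta> t)" "ln (lamx \<theta> t) \<le> ln (max \<Lambda> 1)"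
    using lamx_bounds[of \<theta> t] c by (auto simp del: min_less_iff_conj max_less_iff_conj)
  have half: "2 * y / 2 = y" for y :: real by simp
  have "\<bar>z\<bar> \<le> \<bar>x\<bar> + \<bar>y\<bar>" if "x \<le> z" "z \<le> y" for x y z :: real using that by linarith
  from this[OF l] show "\<bar>ln (lamx \<theta> t)\<bar> \<le> Bl / 2" unfolding Bl_def half .
  then show "\<bar>ln (lamx \<theta> t)\<bar> \<le> Bl" by simp
qed

lemma lnr_eq: "lnr \<theta>' \<theta> t = ln (lamx \<theta> t) - ln (lamx \<theta>' t)"
  unfolding lnr_def using lamx_bounds(3)[of \<theta> t] lamx_bounds(3)[of \<theta>' t] by (simp add: ln_div)

lemma lnr_bound: "\<bar>lnr \<theta>' \<theta> t\<bar> \<le> Bl"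
  unfolding lnr_eq using ln_lamx_bound(1)[of \<theta> t] ln_lamx_bound(1)[of \<theta>' t] by linarith

lemma lnr_meas [measurable]: "lnr \<theta>' \<theta> \<in> borel_measurable borel"
  unfolding lnr_def by measurable

definition J :: "real \<Rightarrow> real" where "J \<theta> = (LINT t|lborel. indicator {0..\<tau>} t * lamx \<theta> t)"

lemma lamx_integrable: "integrable lborel (\<lambda>t. indicator {0..\<tau>} t * lamx \<theta> t)"
  using bounded_int[of "lamx \<theta>" "max \<Lambda> 1"] lamx_bounds by (auto simp: abs_of_pos)

lemma J_measurable [measurable]: "J \<in> borel_measurable borel"
  unfolding J_def by measurable

text \<open>The constants 1 in the two compensators cancel in the ratio. With the intensity extended
  to all arguments, the formula makes sense and is jointly measurable for every \<theta>.\<close>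

definition lr :: "nat \<Rightarrow> real \<Rightarrow> real \<Rightarrow> (nat \<Rightarrow> real \<Rightarrow> nat) \<Rightarrow> real" where
  "lr n \<theta>' \<theta> x = exp ((\<Sum>j=1..n. path_integral \<tau> (lnr \<theta>' \<theta>) (x j)) - real n * (J \<theta> - J \<theta>'))"

lemma lr_pos: "0 < lr n \<theta>' \<theta> x" by (simp add: lr_def)

lemma path_integral_lnr:
  assumes "x \<in> space (path_space \<tau>)"
  shows "path_integral \<tau> (lnr \<theta>' \<theta>) x = path_integral \<tau> (\<lambda>t. ln (lamx \<theta> t)) x - path_integral \<tau> (\<lambda>t. ln (lamx \<theta>' t)) x"
proof -
  interpret path \<tau> x using \<tau> assms by unfold_locales
  have "integrable (jump_measure \<tau> x) (\<lambda>t. indicator {0..\<tau>} t * ln (lamx \<theta> t))" for \<theta>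
    by (rule integrable_jump[where B = Bl]) (use ln_lamx_bound in auto)
  then show ?thesis unfolding path_integral_eq set_lebesgue_integral_def lnr_eq by (simp add: right_diff_distrib)
qed

lemma likelihood_ratio_eq:
  assumes x: "\<And>j. j \<in> {1..n} \<Longrightarrow> x j \<in> space (path_space \<tau>)" and \<theta>: "\<theta> \<in> \<Theta>" "\<theta>' \<in> \<Theta>"
  shows "likelihood_ratio \<tau> lam n \<theta> \<theta>' x = lr n \<theta>' \<theta> x"
proof -
  have pl: "path_integral \<tau> (\<lambda>t. ln (lam \<theta> t)) y = path_integral \<tau> (\<lambda>t. ln (lamx \<theta> t)) y" if "\<theta> \<in> \<Theta>" for \<theta> y
    unfolding path_integral_eq by (intro set_lebesgue_integral_cong) (auto simp: lamx_def that simp del: atLeastLessThan_iff)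
  have JJ: "(LINT t:{0..\<tau>}|lborel. lam \<theta> t - 1) = J \<theta> - \<tau>" if "\<theta> \<in> \<Theta>" for \<theta>
  proof -
    have "(LINT t:{0..\<tau>}|lborel. lam \<theta> t - 1) = (LINT t|lborel. indicator {0..\<tau>} t * lamx \<theta> t - indicator {0..\<tau>} t)"
      unfolding set_lebesgue_integral_def using that by (intro Bochner_Integration.integral_cong) (auto simp: indicator_def lamx_def)
    also have "\<dots> = J \<theta> - (LINT t|lborel. indicator {0..\<tau>} t)"
      unfolding J_def using lamx_integrable by (intro Bochner_Integration.integral_diff integrable_real_indicator) (auto simp: emeasure_lborel_Icc_eq)
    finally show ?thesis using \<tau> by simp
  qed
  have "likelihood_ratio \<tau> lam n \<theta> \<theta>' x = exp (((\<Sum>j=1..n. path_integral \<tau> (\<lambda>t. ln (lamx \<theta> t)) (x j)) - real n * (J \<theta> - \<tau>))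
     - ((\<Sum>j=1..n. path_integral \<tau> (\<lambda>t. ln (lamx \<theta>' t)) (x j)) - real n * (J \<theta>' - \<tau>)))"
    unfolding likelihood_ratio_def likelihood_def pl[OF \<theta>(1)] pl[OF \<theta>(2)] JJ[OF \<theta>(1)] JJ[OF \<theta>(2)] exp_diff[symmetric] ..
  also have "\<dots> = lr n \<theta>' \<theta> x"
    unfolding lr_def using x by (simp add: path_integral_lnr sum_subtractf algebra_simps)
  finally show ?thesis .
qed

text \<open>Replaces the reference value of the test by the true value, so that the statistic is
  studied under the measure that generates the sample.\<close>

lemma lr_chain:
  assumes x: "\<And>j. j \<in> {1..n} \<Longrightarrow> x j \<in> space (path_space \<tau>)"
  shows "lr n \<theta>'' \<theta> x = lr n \<theta>' \<theta> x / lr n \<theta>' \<theta>'' x"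
  unfolding lr_def exp_diff[symmetric] using x by (simp add: path_integral_lnr sum_subtractf algebra_simps)

lemma lr_joint: "(\<lambda>(x, \<theta>). lr n \<theta>' \<theta> x) \<in> borel_measurable (Pi\<^sub>M {1..n} (\<lambda>_. path_space \<tau>) \<Otimes>\<^sub>M borel)"
proof -
  have "(\<lambda>(\<theta>, t). lnr \<theta>' \<theta> t) \<in> borel_measurable (borel \<Otimes>\<^sub>M borel)"
    unfolding lnr_def split_beta' by measurable
  from path_integral_measurable[OF \<tau> this lnr_bound]
  have p: "(\<lambda>(\<theta>, x). path_integral \<tau> (lnr \<theta>' \<theta>) x) \<in> borel_measurable (borel \<Otimes>\<^sub>M path_space \<tau>)" by simp
  have j: "(\<lambda>y. path_integral \<tau> (lnr \<theta>' (snd y)) (fst y j)) \<in> borel_measurable (Pi\<^sub>M {1..n} (\<lambda>_. path_space \<tau>) \<Otimes>\<^sub>M borel)" if "j \<in> {1..n}" for j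
  proof -
    have "(\<lambda>y. (snd y, fst y j)) \<in> (Pi\<^sub>M {1..n} (\<lambda>_. path_space \<tau>) \<Otimes>\<^sub>M borel) \<rightarrow>\<^sub>M borel \<Otimes>\<^sub>M path_space \<tau>"
      by (intro measurable_Pair measurable_snd measurable_compose[OF measurable_fst measurable_component_singleton[OF that]])
    from measurable_compose[OF this p] show ?thesis by simp
  qed
  have "(\<lambda>y. \<Sum>j=1..n. path_integral \<tau> (lnr \<theta>' (snd y)) (fst y j)) \<in> borel_measurable (Pi\<^sub>M {1..n} (\<lambda>_. path_space \<tau>) \<Otimes>\<^sub>M borel)"
    by (rule borel_measurable_sum) (rule j)
  then show ?thesis unfolding lr_def split_beta' by measurable
qed

end

section \<open>Transforms of the likelihood ratio under the true value\<close>

locale cusp_sample = cusp_model + prob_space M for M :: "'w measure" +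
  fixes n :: nat and X :: "nat \<Rightarrow> 'w \<Rightarrow> real \<Rightarrow> nat" and \<theta>' :: real
  assumes \<theta>': "\<theta>' \<in> {\<theta>\<^sub>1..<b}" and ps: "poisson_sample M \<tau> (cusp_intensity a \<kappa> h \<theta>') n X"
begin

definition tup :: "'w \<Rightarrow> nat \<Rightarrow> real \<Rightarrow> nat" where "tup \<omega> = (\<lambda>j\<in>{1..n}. X j \<omega>)"

lemma X_path_meas: "j \<in> {1..n} \<Longrightarrow> X j \<in> M \<rightarrow>\<^sub>M path_space \<tau>"
  using ps by (auto simp: poisson_sample_def poisson_process_def)

lemma tup_measurable [measurable]: "tup \<in> M \<rightarrow>\<^sub>M Pi\<^sub>M {1..n} (\<lambda>_. path_space \<tau>)"
  unfolding tup_def[abs_def] by (intro measurable_restrict X_path_meas)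

lemma tup_path: "\<omega> \<in> space M \<Longrightarrow> j \<in> {1..n} \<Longrightarrow> tup \<omega> j \<in> space (path_space \<tau>)"
  using measurable_space[OF X_path_meas[of j]] by (simp add: tup_def)

definition L :: "real \<Rightarrow> 'w \<Rightarrow> real" where "L \<theta> \<omega> = lr n \<theta>' \<theta> (tup \<omega>)"

lemma L_joint: "(\<lambda>(\<omega>, \<theta>). L \<theta> \<omega>) \<in> borel_measurable (M \<Otimes>\<^sub>M borel)"
proof -
  have "(\<lambda>y. (tup (fst y), snd y)) \<in> M \<Otimes>\<^sub>M borel \<rightarrow>\<^sub>M Pi\<^sub>M {1..n} (\<lambda>_. path_space \<tau>) \<Otimes>\<^sub>M borel"
    by measurable
  from measurable_compose[OF this lr_joint[of n \<theta>']] show ?thesis by (simp add: L_def split_beta')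
qed

lemma L_meas [measurable]: "L \<theta> \<in> borel_measurable M"
  using measurable_compose[OF measurable_Pair2' L_joint, of \<theta>] by simp

lemma lam_int: "set_integrable lborel {0..\<tau>} (cusp_intensity a \<kappa> h \<theta>')"
proof -
  have "(\<lambda>t. indicator {0..\<tau>} t *\<^sub>R cusp_intensity a \<kappa> h \<theta>' t) = (\<lambda>t. indicator {0..\<tau>} t * lamx \<theta>' t)"
    using \<theta>' by (auto simp: indicator_def lamx_def)
  then show ?thesis unfolding set_integrable_def using lamx_integrable by simp
qed

lemma density_integral:
  fixes f :: "real \<Rightarrow> 'b::{banach, second_countable_topology}"
  assumes [measurable]: "f \<in> borel_measurable borel"
  shows "(LINT t|density lborel (\<lambda>t. ennreal (indicator {0..\<tau>} t * cusp_intensity a \<kappa> h \<theta>' t)). f t) = (LINT t|lborel. indicator {0..\<tau>} t *\<^sub>R (lamx \<theta>' t *\<^sub>R f t))"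
proof -
  have e: "indicator {0..\<tau>} t * cusp_intensity a \<kappa> h \<theta>' t = indicator {0..\<tau>} t * lamx \<theta>' t" for t
    using \<theta>' by (auto simp: indicator_def lamx_def)
  show ?thesis unfolding e using less_imp_le[OF lamx_bounds(3)] by (subst integral_density) auto
qed

lemma L_exp: "\<omega> \<in> space M \<Longrightarrow> L \<theta> \<omega> = exp ((\<Sum>j=1..n. path_integral \<tau> (lnr \<theta>' \<theta>) (X j \<omega>)) - real n * (J \<theta> - J \<theta>'))"
  by (simp add: L_def lr_def tup_def)

lemma lin_path:
  assumes "\<omega> \<in> space M"
  shows "(\<Sum>j=1..n. path_integral \<tau> (\<lambda>r. \<Sum>i<k. s i * lnr \<theta>' (\<theta> i) r) (X j \<omega>)) = (\<Sum>i<(k::nat). s i * (\<Sum>j=1..n. path_integral \<tau> (lnr \<theta>' (\<theta> i)) (X j \<omega>)))"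
proof -
  have "(\<Sum>j=1..n. path_integral \<tau> (\<lambda>r. \<Sum>i<k. s i * lnr \<theta>' (\<theta> i) r) (X j \<omega>)) = (\<Sum>j=1..n. \<Sum>i<k. s i * path_integral \<tau> (lnr \<theta>' (\<theta> i)) (X j \<omega>))"
  proof (rule sum.cong[OF refl])
    fix j assume j: "j \<in> {1..n}"
    interpret path \<tau> "X j \<omega>" using \<tau> measurable_space[OF X_path_meas[OF j] assms] by unfold_locales
    show "path_integral \<tau> (\<lambda>r. \<Sum>i<k. s i * lnr \<theta>' (\<theta> i) r) (X j \<omega>) = (\<Sum>i<k. s i * path_integral \<tau> (lnr \<theta>' (\<theta> i)) (X j \<omega>))"
      by (rule path_integral_sum[where B = Bl]) (auto intro: lnr_bound)
  qed
  then show ?thesis by (subst (asm) sum.swap) (simp add: sum_distrib_left)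
qed

lemma lin_bound: "\<bar>\<Sum>i<k. s i * lnr \<theta>' (\<theta> i) r\<bar> \<le> (\<Sum>i<(k::nat). \<bar>s i\<bar> * Bl)"
proof -
  have "\<bar>\<Sum>i<k. s i * lnr \<theta>' (\<theta> i) r\<bar> \<le> (\<Sum>i<k. \<bar>s i * lnr \<theta>' (\<theta> i) r\<bar>)" by (rule sum_abs)
  also have "\<dots> \<le> (\<Sum>i<k. \<bar>s i\<bar> * Bl)" unfolding abs_mult by (intro sum_mono mult_left_mono lnr_bound) auto
  finally show ?thesis .
qed

text \<open>Two exponents 1/2 will give the affinities, a single exponent -1 the mean of the
  inverse.\<close>

lemma L_mgf:
  fixes s \<theta> :: "nat \<Rightarrow> real"
  shows "has_bochner_integral M (\<lambda>\<omega>. exp (\<Sum>i<k. s i * ln (L (\<theta> i) \<omega>)))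
    (exp (real n * ((LINT r|lborel. indicator {0..\<tau>} r * (lamx \<theta>' r * (exp (\<Sum>i<k. s i * lnr \<theta>' (\<theta> i) r) - 1))) - (\<Sum>i<k. s i * (J (\<theta> i) - J \<theta>')))))"
proof -
  let ?f = "\<lambda>r. \<Sum>i<k. s i * lnr \<theta>' (\<theta> i) r"
  define C where "C = (\<Sum>i<k. s i * (J (\<theta> i) - J \<theta>'))"
  have "has_bochner_integral M (\<lambda>\<omega>. exp (\<Sum>j=1..n. path_integral \<tau> ?f (X j \<omega>)))
     (exp (real n * (LINT r|lborel. indicator {0..\<tau>} r * (lamx \<theta>' r * (exp (?f r) - 1)))))"
    using sample_laplace_real[OF ps \<tau> lam_int c lam_lower[OF \<theta>'] _ lin_bound[where k = k and s = s and \<theta> = \<theta>]] by (simp add: density_integral)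
  then have "has_bochner_integral M (\<lambda>\<omega>. exp (\<Sum>j=1..n. path_integral \<tau> ?f (X j \<omega>)) * exp (- real n * C))
     (exp (real n * (LINT r|lborel. indicator {0..\<tau>} r * (lamx \<theta>' r * (exp (?f r) - 1)))) * exp (- real n * C))"
    by (intro has_bochner_integral_mult_left) auto
  also have "exp (real n * (LINT r|lborel. indicator {0..\<tau>} r * (lamx \<theta>' r * (exp (?f r) - 1)))) * exp (- real n * C)
    = exp (real n * ((LINT r|lborel. indicator {0..\<tau>} r * (lamx \<theta>' r * (exp (?f r) - 1))) - C))"
    unfolding exp_add[symmetric] by (simp add: right_diff_distrib)
  finally show ?thesis
    unfolding C_def[symmetric]
  proof (rule has_bochner_integral_cong[THEN iffD1, rotated 3])
    fix \<omega> assume w: "\<omega> \<in> space M"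
    have "(\<Sum>i<k. s i * ln (L (\<theta> i) \<omega>)) = (\<Sum>j=1..n. path_integral \<tau> ?f (X j \<omega>)) - real n * C"
      unfolding lin_path[OF w] C_def L_exp[OF w] ln_exp sum_affine by simp
    then show "exp (\<Sum>j=1..n. path_integral \<tau> ?f (X j \<omega>)) * exp (- real n * C) = exp (\<Sum>i<k. s i * ln (L (\<theta> i) \<omega>))"
      by (simp add: exp_add[symmetric])
  qed auto
qed

text \<open>The compensator is the integral of the linear term subtracted in \<open>cexp\<close>,
  because the true intensity times the relative deviation is the difference of the intensities. The
  remaining integrand is of second order, hence of size 1 / n locally.\<close>

lemma L_char:
  fixes s \<theta> :: "nat \<Rightarrow> real"
  shows "(CLINT \<omega>|M. iexp (\<Sum>i<k. s i * ln (L (\<theta> i) \<omega>))) = exp (of_nat n * cexp \<theta>' k s \<theta>)"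
proof -
  let ?f = "\<lambda>r. \<Sum>i<k. s i * lnr \<theta>' (\<theta> i) r"
  define C where "C = (\<Sum>i<k. s i * (J (\<theta> i) - J \<theta>'))"
  define B where "B = (\<Sum>i<k. \<bar>s i\<bar> * Bl)"
  have B0: "0 \<le> B" using lin_bound[where k = k and s = s and \<theta> = \<theta> and r = 0] by (simp add: B_def)
  have z: "path_integral \<tau> (\<lambda>_. 0) x = 0" for x by (simp add: path_integral_eq set_lebesgue_integral_def)
  have "has_bochner_integral M (\<lambda>\<omega>. exp (of_real (\<Sum>j=1..n. path_integral \<tau> (\<lambda>_. 0) (X j \<omega>)) + \<i> * of_real (\<Sum>j=1..n. path_integral \<tau> ?f (X j \<omega>))))
     (exp (of_nat n * (CLINT t|density lborel (\<lambda>t. ennreal (indicator {0..\<tau>} t * cusp_intensity a \<kappa> h \<theta>' t)). exp (of_real 0 + \<i> * of_real (?f t)) - 1)))"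
    using B0 lin_bound[where k = k and s = s and \<theta> = \<theta>] by (intro sample_laplace[OF ps \<tau> lam_int c lam_lower[OF \<theta>'], where B = B]) (auto simp: B_def)
  then have e: "(CLINT \<omega>|M. iexp (\<Sum>j=1..n. path_integral \<tau> ?f (X j \<omega>))) = exp (of_nat n * (CLINT r|lborel. indicator {0..\<tau>} r *\<^sub>R (lamx \<theta>' r *\<^sub>R (iexp (?f r) - 1))))"
    by (subst (asm) density_integral) (simp_all add: z has_bochner_integral_iff)
  have "(CLINT \<omega>|M. iexp (\<Sum>i<k. s i * ln (L (\<theta> i) \<omega>))) = (CLINT \<omega>|M. iexp (- real n * C) * iexp (\<Sum>j=1..n. path_integral \<tau> ?f (X j \<omega>)))"
  proof (rule Bochner_Integration.integral_cong[OF refl])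
    fix \<omega> assume w: "\<omega> \<in> space M"
    have "(\<Sum>i<k. s i * ln (L (\<theta> i) \<omega>)) = - real n * C + (\<Sum>j=1..n. path_integral \<tau> ?f (X j \<omega>))"
      unfolding lin_path[OF w] C_def L_exp[OF w] ln_exp sum_affine by simp
    then show "iexp (\<Sum>i<k. s i * ln (L (\<theta> i) \<omega>)) = iexp (- real n * C) * iexp (\<Sum>j=1..n. path_integral \<tau> ?f (X j \<omega>))"
      by (simp only: exp_add[symmetric] of_real_add distrib_left)
  qed
  also have "\<dots> = iexp (- real n * C) * (CLINT \<omega>|M. iexp (\<Sum>j=1..n. path_integral \<tau> ?f (X j \<omega>)))"
    by (rule integral_mult_right_zero)
  also have "\<dots> = exp (of_nat n * ((CLINT r|lborel. indicator {0..\<tau>} r *\<^sub>R (lamx \<theta>' r *\<^sub>R (iexp (?f r) - 1))) - \<i> * C))"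
    unfolding e exp_add[symmetric] by (rule arg_cong[where f = exp]) (simp add: right_diff_distrib)
  also have "(CLINT r|lborel. indicator {0..\<tau>} r *\<^sub>R (lamx \<theta>' r *\<^sub>R (iexp (?f r) - 1))) - \<i> * C = cexp \<theta>' k s \<theta>"
  proof -
    have i1: "integrable lborel (\<lambda>r. indicator {0..\<tau>} r *\<^sub>R (lamx \<theta>' r *\<^sub>R (iexp (?f r) - 1)))"
    proof (rule bounded_int[where B = "max \<Lambda> 1 * 2"])
      fix r
      have "norm (iexp (?f r) - 1) \<le> norm (iexp (?f r)) + norm (1::complex)" by (rule norm_triangle_ineq4)
      then have "norm (iexp (?f r) - 1) \<le> 2" by (simp only: norm_exp_i_times norm_one)
      then show "norm (lamx \<theta>' r *\<^sub>R (iexp (?f r) - 1)) \<le> max \<Lambda> 1 * 2"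
        unfolding norm_scaleR using lamx_bounds[of \<theta>' r] by (intro mult_mono) auto
    qed measurable
    define d where "d r = indicator {0..\<tau>} r * (\<Sum>i<k. s i * (lamx (\<theta> i) r - lamx \<theta>' r))" for r
    have dsum: "d r = (\<Sum>i<k. s i * (indicator {0..\<tau>} r * lamx (\<theta> i) r - indicator {0..\<tau>} r * lamx \<theta>' r))" for r
      by (simp add: d_def sum_distrib_left algebra_simps)
    have i2: "integrable lborel d" and e2: "(LINT r|lborel. d r) = C"
      unfolding dsum[abs_def] C_def J_def using lamx_integrable by (simp_all add: Bochner_Integration.integral_sum)
    have "has_bochner_integral lborel (\<lambda>r. \<i> * complex_of_real (d r)) (\<i> * of_real C)"
      using i2 e2 by (intro has_bochner_integral_mult_right has_bochner_integral_of_real) (auto simp: has_bochner_integral_iff)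
    then have i3: "integrable lborel (\<lambda>r. \<i> * complex_of_real (d r))" and e3: "\<i> * of_real C = (CLINT r|lborel. \<i> * complex_of_real (d r))"
      by (auto simp: has_bochner_integral_iff)
    show ?thesis
      unfolding e3 cexp_def Bochner_Integration.integral_diff[OF i1 i3, symmetric]
    proof (rule Bochner_Integration.integral_cong[OF refl])
      fix r
      have p: "lamx \<theta>' r \<noteq> 0" using lamx_bounds(3)[of \<theta>' r] by simp
      have "lamx \<theta>' r * (\<Sum>i<k. s i * (lamx (\<theta> i) r / lamx \<theta>' r - 1)) = (\<Sum>i<k. s i * (lamx (\<theta> i) r - lamx \<theta>' r))"
        unfolding sum_distrib_left using p by (intro sum.cong refl) (simp add: field_simps)
      then have "d r = indicator {0..\<tau>} r * (lamx \<theta>' r * (\<Sum>i<k. s i * (lamx (\<theta> i) r / lamx \<theta>' r - 1)))" by (simp add: d_def)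
      then show "indicator {0..\<tau>} r *\<^sub>R (lamx \<theta>' r *\<^sub>R (iexp (?f r) - 1)) - \<i> * complex_of_real (d r)
        = indicator {0..\<tau>} r *\<^sub>R (of_real (lamx \<theta>' r) * (iexp (\<Sum>i<k. s i * ln (lamx (\<theta> i) r / lamx \<theta>' r)) - 1 - \<i> * (\<Sum>i<k. s i * (lamx (\<theta> i) r / lamx \<theta>' r - 1))))"
        unfolding lnr_def by (simp add: scaleR_conv_of_real right_diff_distrib mult_ac)
    qed
  qed
  finally show ?thesis .
qed

lemma L_pos: "0 < L \<theta> \<omega>"
  by (simp add: L_def lr_pos)

lemma L_true: "\<omega> \<in> space M \<Longrightarrow> L \<theta>' \<omega> = 1"
proof -
  have "lnr \<theta>' \<theta>' = (\<lambda>_. 0)" by (rule ext) (simp add: lnr_eq)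
  then show "L \<theta>' \<omega> = 1" by (simp add: L_def lr_def path_integral_def set_lebesgue_integral_def)
qed

lemma sqrt_eq_exp:
  fixes x y :: real
  assumes "0 < x" "0 < y"
  shows "exp (1 / 2 * ln x + 1 / 2 * ln y) = sqrt (x * y)"
proof -
  have "1 / 2 * ln x + 1 / 2 * ln y = ln (sqrt (x * y))" using assms by (simp add: ln_sqrt ln_mult add_divide_distrib)
  then show ?thesis using assms by simp
qed

text \<open>With exponents summing to 1 the true intensity cancels: the integrand is the geometric
  mean of the two intensities minus the true one, and the compensators complete it to minus half the
  squared difference of roots.\<close>

lemma L_affinity: "has_bochner_integral M (\<lambda>\<omega>. sqrt (L \<theta> \<omega> * L \<theta>'' \<omega>)) (exp (- (real n / 2) * hel \<theta> \<theta>''))"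
proof -
  define \<theta>s where "\<theta>s i = (if i = 0 then \<theta> else \<theta>'')" for i :: nat
  have two: "(\<Sum>i<2. f i) = f 0 + f 1" for f :: "nat \<Rightarrow> real" by (simp add: numeral_2_eq_2)
  have e: "indicator {0..\<tau>} r * (lamx \<theta>' r * (exp (\<Sum>i<2. 1 / 2 * lnr \<theta>' (\<theta>s i) r) - 1))
    = (indicator {0..\<tau>} r * lamx \<theta> r + indicator {0..\<tau>} r * lamx \<theta>'' r - indicator {0..\<tau>} r * (sqrt (lamx \<theta> r) - sqrt (lamx \<theta>'' r))\<^sup>2) / 2 - indicator {0..\<tau>} r * lamx \<theta>' r" for r
  proof -
    note p = lamx_bounds(3)[of \<theta>' r] lamx_bounds(3)[of \<theta> r] lamx_bounds(3)[of \<theta>'' r]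
    have "(\<Sum>i<2. 1 / 2 * lnr \<theta>' (\<theta>s i) r) = 1 / 2 * ln (lamx \<theta> r) + 1 / 2 * ln (lamx \<theta>'' r) - ln (lamx \<theta>' r)"
      unfolding two lnr_eq by (simp add: \<theta>s_def diff_divide_distrib)
    then have "lamx \<theta>' r * (exp (\<Sum>i<2. 1 / 2 * lnr \<theta>' (\<theta>s i) r) - 1) = sqrt (lamx \<theta> r * lamx \<theta>'' r) - lamx \<theta>' r"
      using sqrt_eq_exp[OF p(2,3)] p(1) by (simp only: exp_diff exp_ln) (simp add: right_diff_distrib)
    moreover have "(sqrt (lamx \<theta> r) - sqrt (lamx \<theta>'' r))\<^sup>2 = lamx \<theta> r + lamx \<theta>'' r - 2 * sqrt (lamx \<theta> r * lamx \<theta>'' r)"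
      using p by (simp add: power2_diff real_sqrt_mult)
    ultimately show ?thesis by (simp add: indicator_def)
  qed
  have i: "(LINT r|lborel. indicator {0..\<tau>} r * (lamx \<theta>' r * (exp (\<Sum>i<2. 1 / 2 * lnr \<theta>' (\<theta>s i) r) - 1)))
    = (J \<theta> + J \<theta>'' - hel \<theta> \<theta>'') / 2 - J \<theta>'"
    unfolding e J_def hel_def using lamx_integrable hel_integrable by simp
  have c: "(J \<theta> + J \<theta>'' - hel \<theta> \<theta>'') / 2 - J \<theta>' - (\<Sum>i<2. 1 / 2 * (J (\<theta>s i) - J \<theta>')) = - (hel \<theta> \<theta>'' / 2)"
    unfolding two by (simp add: \<theta>s_def field_simps)
  have s: "exp (\<Sum>i<2. 1 / 2 * ln (L (\<theta>s i) \<omega>)) = sqrt (L \<theta> \<omega> * L \<theta>'' \<omega>)" for \<omega>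
    unfolding two using sqrt_eq_exp[OF L_pos L_pos] by (simp add: \<theta>s_def)
  from L_mgf[where k = 2 and s = "\<lambda>_. 1 / 2" and \<theta> = \<theta>s] show ?thesis unfolding i c s by simp
qed

lemma L_mean: "has_bochner_integral M (L \<theta>) 1"
  using L_affinity[of \<theta> \<theta>] less_imp_le[OF L_pos] by (simp add: hel_def)

text \<open>Exponent -1 produces the true intensity squared over that of \<theta>, which with the
  compensators completes to a square over the intensity of \<theta>.\<close>

lemma L_inverse_mean: "has_bochner_integral M (\<lambda>\<omega>. 1 / L \<theta> \<omega>) (exp (real n * chi \<theta> \<theta> \<theta>'))"
proof -
  have e: "indicator {0..\<tau>} r * (lamx \<theta>' r * (exp (\<Sum>i<1::nat. - 1 * lnr \<theta>' \<theta> r) - 1))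
    = indicator {0..\<tau>} r * ((lamx \<theta> r - lamx \<theta>' r)\<^sup>2 / lamx \<theta> r) - (indicator {0..\<tau>} r * lamx \<theta> r - indicator {0..\<tau>} r * lamx \<theta>' r)" for r
  proof -
    note p = lamx_bounds(3)[of \<theta>' r] lamx_bounds(3)[of \<theta> r]
    have "exp (\<Sum>i<1::nat. - 1 * lnr \<theta>' \<theta> r) = lamx \<theta>' r / lamx \<theta> r"
      using p by (simp add: lnr_eq exp_diff)
    then show ?thesis using p by (auto simp: indicator_def field_simps power2_eq_square)
  qed
  have i: "(LINT r|lborel. indicator {0..\<tau>} r * (lamx \<theta>' r * (exp (\<Sum>i<1::nat. - 1 * lnr \<theta>' \<theta> r) - 1))) = chi \<theta> \<theta> \<theta>' - (J \<theta> - J \<theta>')"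
    unfolding e J_def chi_def using lamx_integrable chi_integrable by simp
  have s: "exp (\<Sum>i<1::nat. - 1 * ln (L \<theta> \<omega>)) = 1 / L \<theta> \<omega>" for \<omega>
    using L_pos[of \<theta> \<omega>] by (simp add: exp_minus divide_inverse)
  from L_mgf[where k = 1 and s = "\<lambda>_. - 1" and \<theta> = "\<lambda>_. \<theta>"] show ?thesis unfolding i s by simp
qed

text \<open>|ln x| \<le> x + 1 / x reduces the first moment of the logarithm, needed for the
  continuity theorem, to the means of the ratio and of its inverse.\<close>

lemma ln_L_moment:
  "integrable M (\<lambda>\<omega>. ln (L \<theta> \<omega>))" "expectation (\<lambda>\<omega>. \<bar>ln (L \<theta> \<omega>)\<bar>) \<le> 1 + exp (real n * chi \<theta> \<theta> \<theta>')"
proof -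
  have b: "\<bar>ln x\<bar> \<le> x + 1 / x" if "0 < x" for x :: real
  proof -
    have "ln x \<le> x - 1" "ln (1 / x) \<le> 1 / x - 1" using that by (auto intro: ln_le_minus_one)
    moreover have "ln (1 / x) = - ln x" "0 < 1 / x" using that by (auto simp: ln_div)
    ultimately show ?thesis using that by linarith
  qed
  have i: "has_bochner_integral M (\<lambda>\<omega>. L \<theta> \<omega> + 1 / L \<theta> \<omega>) (1 + exp (real n * chi \<theta> \<theta> \<theta>'))"
    by (intro has_bochner_integral_add L_mean L_inverse_mean)
  show 1: "integrable M (\<lambda>\<omega>. ln (L \<theta> \<omega>))"
    by (rule Bochner_Integration.integrable_bound[of _ "\<lambda>\<omega>. L \<theta> \<omega> + 1 / L \<theta> \<omega>"])
      (use i b[OF L_pos] in \<open>auto simp: has_bochner_integral_iff intro!: AE_I2 order_trans[OF _ abs_ge_self]\<close>)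
  have "expectation (\<lambda>\<omega>. \<bar>ln (L \<theta> \<omega>)\<bar>) \<le> expectation (\<lambda>\<omega>. L \<theta> \<omega> + 1 / L \<theta> \<omega>)"
    using i 1 b[OF L_pos] by (intro integral_mono) (auto simp: has_bochner_integral_iff)
  then show "expectation (\<lambda>\<omega>. \<bar>ln (L \<theta> \<omega>)\<bar>) \<le> 1 + exp (real n * chi \<theta> \<theta> \<theta>')"
    using i by (simp add: has_bochner_integral_iff)
qed

end

section \<open>Bounds on the local scale, uniform in the sample size\<close>

context cusp_model
begin

lemma chi_le_sqd:
  assumes "\<theta> \<in> \<Theta>"
  shows "chi \<theta> \<theta> \<theta>' \<le> sqd \<theta> \<theta>' / c"
proof -
  have "chi \<theta> \<theta> \<theta>' \<le> (LINT t|lborel. indicator {0..\<tau>} t * (lamx \<theta> t - lamx \<theta>' t)\<^sup>2 / c)"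
    unfolding chi_def
  proof (rule integral_mono[OF chi_integrable])
    show "integrable lborel (\<lambda>t. indicator {0..\<tau>} t * (lamx \<theta> t - lamx \<theta>' t)\<^sup>2 / c)" using sqd_integrable by simp
    show "indicator {0..\<tau>} t * ((lamx \<theta> t - lamx \<theta>' t)\<^sup>2 / lamx \<theta> t) \<le> indicator {0..\<tau>} t * (lamx \<theta> t - lamx \<theta>' t)\<^sup>2 / c" for t
    proof (cases "t \<in> {0..\<tau>}")
      case True
      then have "c \<le> lamx \<theta> t" using lam_lower[OF assms True] lamx_in[OF assms True] by simp
      then show ?thesis using True c by (auto intro!: divide_left_mono mult_pos_pos lamx_bounds(3))
    qed simp
  qed
  then show ?thesis by (simp add: sqd_def)
qed

lemma local_scale: "0 < n \<Longrightarrow> real n * \<bar>(\<theta>\<^sub>1 + \<phi> n * w) - (\<theta>\<^sub>1 + \<phi> n * v)\<bar> powr (2 * H) = \<bar>w - v\<bar> powr (2 * H) / \<Gamma>\<^sup>2"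
proof -
  assume n: "0 < n"
  have "(\<theta>\<^sub>1 + \<phi> n * w) - (\<theta>\<^sub>1 + \<phi> n * v) = \<phi> n * (w - v)" by (simp add: algebra_simps)
  then have "real n * \<bar>(\<theta>\<^sub>1 + \<phi> n * w) - (\<theta>\<^sub>1 + \<phi> n * v)\<bar> powr (2 * H) = (real n * \<phi> n powr (2 * H)) * \<bar>w - v\<bar> powr (2 * H)"
    using phi_nonneg[of n] by (simp add: abs_mult powr_mult)
  then show ?thesis unfolding phi_scale[OF n] by simp
qed

definition K1 :: real where "K1 = a\<^sup>2 * cusp_const \<kappa> / \<Gamma>\<^sup>2"

definition K2 :: real where "K2 = a\<^sup>2 * cm / \<Gamma>\<^sup>2"

lemma K_pos: "0 < K1" "0 < K2"
  using a cusp_const_pos[OF \<kappa>] cm_pos Gamma_sq(1) by (auto simp: K1_def K2_def)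

lemma local_sqd:
  assumes n: "0 < n" and \<theta>: "\<theta>\<^sub>1 + \<phi> n * w \<in> \<Theta>" "\<theta>\<^sub>1 + \<phi> n * v \<in> \<Theta>"
  shows "real n * sqd (\<theta>\<^sub>1 + \<phi> n * w) (\<theta>\<^sub>1 + \<phi> n * v) \<le> K1 * \<bar>w - v\<bar> powr (2 * H)"
    "K2 * \<bar>w - v\<bar> powr (2 * H) \<le> real n * sqd (\<theta>\<^sub>1 + \<phi> n * w) (\<theta>\<^sub>1 + \<phi> n * v)"
proof -
  note s = local_scale[OF n, of w v]
  let ?x = "\<bar>(\<theta>\<^sub>1 + \<phi> n * w) - (\<theta>\<^sub>1 + \<phi> n * v)\<bar> powr (2 * H)"
  have "real n * sqd (\<theta>\<^sub>1 + \<phi> n * w) (\<theta>\<^sub>1 + \<phi> n * v) \<le> real n * (a\<^sup>2 * cusp_const \<kappa> * ?x)"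
    using sqd_upper[OF \<theta>] by (rule mult_left_mono) simp
  also have "\<dots> = a\<^sup>2 * cusp_const \<kappa> * (real n * ?x)" by (simp only: mult_ac)
  finally show "real n * sqd (\<theta>\<^sub>1 + \<phi> n * w) (\<theta>\<^sub>1 + \<phi> n * v) \<le> K1 * \<bar>w - v\<bar> powr (2 * H)"
    unfolding s by (simp add: K1_def)
  have "real n * (a\<^sup>2 * cm * ?x) \<le> real n * sqd (\<theta>\<^sub>1 + \<phi> n * w) (\<theta>\<^sub>1 + \<phi> n * v)"
    using sqd_lower[OF \<theta>] by (rule mult_left_mono) simp
  moreover have "real n * (a\<^sup>2 * cm * ?x) = a\<^sup>2 * cm * (real n * ?x)" by (simp only: mult_ac)
  ultimately show "K2 * \<bar>w - v\<bar> powr (2 * H) \<le> real n * sqd (\<theta>\<^sub>1 + \<phi> n * w) (\<theta>\<^sub>1 + \<phi> n * v)"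
    unfolding s by (simp add: K2_def)
qed

text \<open>The comparison of roots with differences costs 4 c or 4 \<Lambda>, and the exponent n /
  2 doubles this. The lower estimate is 1 - x \<le> exp (- x).\<close>

lemma local_hel:
  assumes n: "0 < n" and \<theta>: "\<theta>\<^sub>1 + \<phi> n * w \<in> \<Theta>" "\<theta>\<^sub>1 + \<phi> n * v \<in> \<Theta>"
  shows "1 - K1 / (8 * c) * \<bar>w - v\<bar> powr (2 * H) \<le> exp (- (real n / 2) * hel (\<theta>\<^sub>1 + \<phi> n * w) (\<theta>\<^sub>1 + \<phi> n * v))"
    "exp (- (real n / 2) * hel (\<theta>\<^sub>1 + \<phi> n * w) (\<theta>\<^sub>1 + \<phi> n * v)) \<le> exp (- (K2 / (8 * \<Lambda>)) * \<bar>w - v\<bar> powr (2 * H))"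
proof -
  let ?h = "hel (\<theta>\<^sub>1 + \<phi> n * w) (\<theta>\<^sub>1 + \<phi> n * v)" and ?s = "sqd (\<theta>\<^sub>1 + \<phi> n * w) (\<theta>\<^sub>1 + \<phi> n * v)"
  have "real n / 2 * ?h \<le> real n / 2 * (?s / (4 * c))" using hel_bounds(1)[OF \<theta>] by (rule mult_left_mono) simp
  also have "\<dots> = (real n * ?s) / (8 * c)" by simp
  also have "\<dots> \<le> (K1 * \<bar>w - v\<bar> powr (2 * H)) / (8 * c)" using local_sqd(1)[OF n \<theta>] c by (intro divide_right_mono) auto
  finally show "1 - K1 / (8 * c) * \<bar>w - v\<bar> powr (2 * H) \<le> exp (- (real n / 2) * ?h)"
    using exp_ge_add_one_self[of "- (real n / 2) * ?h"] by simp
  have "(K2 * \<bar>w - v\<bar> powr (2 * H)) / (8 * \<Lambda>) \<le> (real n * ?s) / (8 * \<Lambda>)" using local_sqd(2)[OF n \<theta>] \<Lambda>_pos by (intro divide_right_mono) auto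
  also have "\<dots> = real n / 2 * (?s / (4 * \<Lambda>))" by simp
  also have "\<dots> \<le> real n / 2 * ?h" using hel_bounds(2)[OF \<theta>] by (rule mult_left_mono) simp
  finally show "exp (- (real n / 2) * ?h) \<le> exp (- (K2 / (8 * \<Lambda>)) * \<bar>w - v\<bar> powr (2 * H))" by simp
qed

end

section \<open>The Bayes test\<close>

locale cusp_prior = cusp_model +
  fixes p :: "real \<Rightarrow> real"
  assumes p_cont: "continuous_on {\<theta>\<^sub>1..<b} p" and p_pos: "\<And>\<theta>. \<theta> \<in> {\<theta>\<^sub>1..<b} \<Longrightarrow> 0 < p \<theta>"
    and p_integrable: "set_integrable lborel {\<theta>\<^sub>1..<b} p"
    and p_density: "(LINT \<theta>:{\<theta>\<^sub>1..<b}|lborel. p \<theta>) = 1"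
begin

lemma p_ind [measurable]: "(\<lambda>\<theta>. indicator \<Theta> \<theta> * p \<theta>) \<in> borel_measurable borel"
  using borel_measurable_integrable[OF p_integrable[unfolded set_integrable_def]] by simp

lemma p1: "0 < p \<theta>\<^sub>1" using p_pos \<theta>1 by simp

lemma p_near:
  assumes "0 < \<epsilon>"
  obtains \<delta> where "0 < \<delta>" "\<And>\<theta>. \<theta> \<in> \<Theta> \<Longrightarrow> \<bar>\<theta> - \<theta>\<^sub>1\<bar> < \<delta> \<Longrightarrow> \<bar>p \<theta> / p \<theta>\<^sub>1 - 1\<bar> \<le> \<epsilon>"
proof -
  have "\<theta>\<^sub>1 \<in> \<Theta>" "0 < \<epsilon> * p \<theta>\<^sub>1" using \<theta>1 p1 assms by auto
  then obtain \<delta> where d: "0 < \<delta>" "\<And>\<theta>. \<theta> \<in> \<Theta> \<Longrightarrow> dist \<theta> \<theta>\<^sub>1 < \<delta> \<Longrightarrow> dist (p \<theta>) (p \<theta>\<^sub>1) < \<epsilon> * p \<theta>\<^sub>1"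
    using p_cont unfolding continuous_on_iff by blast
  show thesis
  proof (rule that[OF d(1)])
    fix \<theta> assume "\<theta> \<in> \<Theta>" "\<bar>\<theta> - \<theta>\<^sub>1\<bar> < \<delta>"
    then have "\<bar>p \<theta> - p \<theta>\<^sub>1\<bar> < \<epsilon> * p \<theta>\<^sub>1" using d(2)[of \<theta>] by (simp add: dist_real_def)
    moreover have "\<bar>p \<theta> / p \<theta>\<^sub>1 - 1\<bar> = \<bar>p \<theta> - p \<theta>\<^sub>1\<bar> / p \<theta>\<^sub>1"
    proof -
      have "p \<theta> / p \<theta>\<^sub>1 - 1 = (p \<theta> - p \<theta>\<^sub>1) / p \<theta>\<^sub>1" using p1 by (simp add: diff_divide_distrib)
      then show ?thesis using p1 by simp
    qed
    ultimately show "\<bar>p \<theta> / p \<theta>\<^sub>1 - 1\<bar> \<le> \<epsilon>" using p1 by (simp add: divide_le_eq)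
  qed
qed

definition Dn :: "nat \<Rightarrow> real set" where "Dn n = {w. 0 \<le> w \<and> \<theta>\<^sub>1 + \<phi> n * w < b}"

definition qn :: "nat \<Rightarrow> real \<Rightarrow> real" where "qn n w = indicator \<Theta> (\<theta>\<^sub>1 + \<phi> n * w) * p (\<theta>\<^sub>1 + \<phi> n * w) / p \<theta>\<^sub>1"

lemma Dn_\<Theta>: "w \<in> Dn n \<Longrightarrow> \<theta>\<^sub>1 + \<phi> n * w \<in> \<Theta>"
  using phi_nonneg[of n] by (auto simp: Dn_def)

lemma Dn_iff: "0 < n \<Longrightarrow> w \<in> Dn n \<longleftrightarrow> \<theta>\<^sub>1 + \<phi> n * w \<in> \<Theta>"
  using phi_pos[of n] by (auto simp: Dn_def zero_le_mult_iff)

lemma Dn_borel [measurable]: "Dn n \<in> sets borel"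
  unfolding Dn_def by measurable

lemma Dn_interval: "\<theta>\<^sub>1 + \<phi> n * K < b \<Longrightarrow> {0..<K} \<subseteq> Dn n"
  using mult_left_mono[OF less_imp_le phi_nonneg[of n]] by (fastforce simp: Dn_def)

lemma qn_measurable [measurable]: "qn n \<in> borel_measurable borel"
proof -
  have "(\<lambda>w. indicator \<Theta> (\<theta>\<^sub>1 + \<phi> n * w) * p (\<theta>\<^sub>1 + \<phi> n * w)) \<in> borel_measurable borel"
    by (rule measurable_compose[OF _ p_ind]) simp
  then show ?thesis unfolding qn_def[abs_def] by measurable
qed

lemma qn_nonneg: "0 \<le> qn n w"
  using p_pos[of "\<theta>\<^sub>1 + \<phi> n * w"] p1 by (auto simp: qn_def indicator_def)

lemma qn_near:
  assumes "0 < \<epsilon>"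
  shows "eventually (\<lambda>n. \<forall>w\<in>{0..<real K}. \<bar>qn n w - 1\<bar> \<le> \<epsilon>) sequentially"
proof -
  obtain \<delta> where d: "0 < \<delta>" "\<And>\<theta>. \<theta> \<in> \<Theta> \<Longrightarrow> \<bar>\<theta> - \<theta>\<^sub>1\<bar> < \<delta> \<Longrightarrow> \<bar>p \<theta> / p \<theta>\<^sub>1 - 1\<bar> \<le> \<epsilon>" using p_near[OF assms] by blast
  have "(\<lambda>n. \<phi> n * real K) \<longlonglongrightarrow> 0 * real K" by (intro tendsto_intros phi_tendsto)
  then have "eventually (\<lambda>n. \<phi> n * real K < \<delta>) sequentially" using d(1) by (intro order_tendstoD(2)) auto
  then show ?thesis using phi_dom[of "real K"]
  proof eventually_elim
    case (elim n)
    show ?case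
    proof
      fix w assume w: "w \<in> {0..<real K}"
      then have "w \<in> Dn n" using Dn_interval[of n "real K"] elim by blast
      then have t: "\<theta>\<^sub>1 + \<phi> n * w \<in> \<Theta>" by (rule Dn_\<Theta>)
      have "\<phi> n * w \<le> \<phi> n * real K" using w phi_nonneg by (intro mult_left_mono) auto
      then have "\<bar>(\<theta>\<^sub>1 + \<phi> n * w) - \<theta>\<^sub>1\<bar> < \<delta>" using elim w phi_nonneg[of n] by simp
      from d(2)[OF t this] show "\<bar>qn n w - 1\<bar> \<le> \<epsilon>" using t by (simp add: qn_def)
    qed
  qed
qed

lemma p_mass: "(\<integral>\<^sup>+\<theta>. ennreal (indicator \<Theta> \<theta> * p \<theta> / p \<theta>\<^sub>1) \<partial>lborel) = ennreal (1 / p \<theta>\<^sub>1)"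
proof -
  have i: "integrable lborel (\<lambda>\<theta>. indicator \<Theta> \<theta> * p \<theta>)" "(LINT \<theta>|lborel. indicator \<Theta> \<theta> * p \<theta>) = 1"
    using p_integrable p_density by (simp_all add: set_integrable_def set_lebesgue_integral_def)
  have "(\<integral>\<^sup>+\<theta>. ennreal (indicator \<Theta> \<theta> * p \<theta> / p \<theta>\<^sub>1) \<partial>lborel) = ennreal (LINT \<theta>|lborel. indicator \<Theta> \<theta> * p \<theta> / p \<theta>\<^sub>1)"
    using i(1) p_pos p1 by (intro nn_integral_eq_integral) (auto simp: indicator_def less_imp_le)
  then show ?thesis using i(2) by simp
qed

lemma qn_mass:
  assumes n: "0 < n"
  shows "(\<integral>\<^sup>+w. ennreal (qn n w) \<partial>lborel) = ennreal (1 / (p \<theta>\<^sub>1 * \<phi> n))"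
proof -
  have ph: "0 < \<phi> n" using phi_pos[OF n] .
  have m: "(\<lambda>\<theta>. ennreal (indicator \<Theta> \<theta> * p \<theta> / p \<theta>\<^sub>1)) \<in> borel_measurable borel" by measurable
  have e: "ennreal (1 / p \<theta>\<^sub>1) = ennreal (\<phi> n) * (\<integral>\<^sup>+w. ennreal (qn n w) \<partial>lborel)"
    using nn_integral_real_affine[OF m, of "\<phi> n" \<theta>\<^sub>1] ph p_mass by (simp add: qn_def)
  have "(\<integral>\<^sup>+w. ennreal (qn n w) \<partial>lborel) = ennreal (1 / \<phi> n) * (ennreal (\<phi> n) * (\<integral>\<^sup>+w. ennreal (qn n w) \<partial>lborel))"
    using ph by (simp add: mult.assoc[symmetric] ennreal_mult[symmetric])
  also have "\<dots> = ennreal (1 / (p \<theta>\<^sub>1 * \<phi> n))" unfolding e[symmetric] using ph p1 by (simp add: ennreal_mult[symmetric] mult.commute)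
  finally show ?thesis .
qed

text \<open>The prior may be unbounded near \<open>b\<close>. On blocks that are not close to \<open>\<theta>\<^sub>1\<close> only its total mass is used, which costs a
  factor \<open>1 / \<phi> n\<close>; there \<open>\<phi> n * (k + 1)\<close> is bounded from below, and \<open>k + 1 \<le> 2 ^ k\<close>.\<close>

lemma qn_block:
  obtains A where "0 \<le> A" "\<And>n k. 0 < n \<Longrightarrow> (\<integral>\<^sup>+w. ennreal (qn n w) * indicator (Dn n \<inter> {real k..<real k + 1}) w \<partial>lborel) \<le> ennreal (A * 2 ^ k)"
proof -
  obtain \<delta> where d: "0 < \<delta>" "\<And>\<theta>. \<theta> \<in> \<Theta> \<Longrightarrow> \<bar>\<theta> - \<theta>\<^sub>1\<bar> < \<delta> \<Longrightarrow> \<bar>p \<theta> / p \<theta>\<^sub>1 - 1\<bar> \<le> 1" using p_near[of 1] by auto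
  \<comment> \<open>The summand 2 serves blocks within \<delta> of \<open>\<theta>\<^sub>1\<close>,
    where the prior is at most twice its value there. The other one serves blocks with
    \<open>\<phi> n * (real k + 1) > \<delta>\<close>, where the total mass
    \<open>1 / (p \<theta>\<^sub>1 * \<phi> n)\<close> is at most
    \<open>(real k + 1) / (\<delta> * p \<theta>\<^sub>1)\<close>.\<close>
  define A where "A = 2 + 1 / (\<delta> * p \<theta>\<^sub>1)"
  have A: "2 \<le> A" "1 / (\<delta> * p \<theta>\<^sub>1) \<le> A" using d(1) p1 by (auto simp: A_def)
  show thesis
  proof (rule that[of A])
    fix n k :: nat assume n: "0 < n"
    have ph: "0 < \<phi> n" using phi_pos[OF n] .
    let ?I = "\<integral>\<^sup>+w. ennreal (qn n w) * indicator (Dn n \<inter> {real k..<real k + 1}) w \<partial>lborel"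
    show "?I \<le> ennreal (A * 2 ^ k)"
    proof (cases "\<phi> n * (real k + 1) \<le> \<delta>")
      case True
      have "?I \<le> (\<integral>\<^sup>+w. 2 * indicator {real k..<real k + 1} w \<partial>lborel)"
      proof (rule nn_integral_mono)
        fix w
        show "ennreal (qn n w) * indicator (Dn n \<inter> {real k..<real k + 1}) w \<le> 2 * indicator {real k..<real k + 1} w"
        proof (cases "w \<in> Dn n \<inter> {real k..<real k + 1}")
          case w: True
          then have t: "\<theta>\<^sub>1 + \<phi> n * w \<in> \<Theta>" using Dn_\<Theta> by blast
          have "\<phi> n * w < \<phi> n * (real k + 1)" using w ph by (intro mult_strict_left_mono) auto
          moreover have "0 \<le> \<phi> n * w" using w ph by auto
          ultimately have "\<bar>(\<theta>\<^sub>1 + \<phi> n * w) - \<theta>\<^sub>1\<bar> < \<delta>" using True by simp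
          from d(2)[OF t this] have "\<bar>qn n w - 1\<bar> \<le> 1" using t by (simp add: qn_def)
          then have "ennreal (qn n w) \<le> ennreal 2" by (intro ennreal_leI) linarith
          then show ?thesis using w by simp
        qed simp
      qed
      also have "\<dots> = 2" by (subst nn_integral_cmult) auto
      also have "\<dots> \<le> ennreal (A * 2 ^ k)"
      proof -
        have "2 * 1 \<le> A * 2 ^ k" using A(1) by (intro mult_mono) auto
        then have "ennreal 2 \<le> ennreal (A * 2 ^ k)" by (intro ennreal_leI) simp
        then show ?thesis by simp
      qed
      finally show ?thesis .
    next
      case False
      have "?I \<le> (\<integral>\<^sup>+w. ennreal (qn n w) \<partial>lborel)" by (intro nn_integral_mono) (auto simp: indicator_def)
      also have "\<dots> = ennreal (1 / (p \<theta>\<^sub>1 * \<phi> n))" by (rule qn_mass[OF n])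
      also have "\<dots> \<le> ennreal (A * 2 ^ k)"
      proof (rule ennreal_leI)
        have "1 / \<phi> n \<le> (real k + 1) / \<delta>" using False ph d(1) by (simp add: field_simps)
        from divide_right_mono[OF this, of "p \<theta>\<^sub>1"] have "1 / (p \<theta>\<^sub>1 * \<phi> n) \<le> (real k + 1) * (1 / (\<delta> * p \<theta>\<^sub>1))"
          using p1 by (simp add: mult.commute)
        also have "\<dots> \<le> 2 ^ k * A"
        proof (rule mult_mono)
          have "1 + real k \<le> (1 + 1) ^ k" using Bernoulli_inequality[of 1 k] by simp
          then show "real k + 1 \<le> 2 ^ k" by simp
        qed (use A d(1) p1 in auto)
        finally show "1 / (p \<theta>\<^sub>1 * \<phi> n) \<le> A * 2 ^ k" by (simp add: mult.commute)
      qed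
      finally show ?thesis .
    qed
  qed (use A in auto)
qed

section \<open>The normalised likelihood ratio process and the test\<close>

definition Zn :: "nat \<Rightarrow> (nat \<Rightarrow> 'w \<Rightarrow> real \<Rightarrow> nat) \<Rightarrow> real \<Rightarrow> real \<Rightarrow> 'w \<Rightarrow> real" where
  "Zn n X u w \<omega> = (if w \<in> Dn n then lr n (\<theta>\<^sub>1 + \<phi> n * u) (\<theta>\<^sub>1 + \<phi> n * w) (\<lambda>j\<in>{1..n}. X j \<omega>) else 0)"

lemma Zn_pos: "w \<in> Dn n \<Longrightarrow> 0 < Zn n X u w \<omega>"
  by (simp add: Zn_def lr_pos)

lemma cusp_sampleI: "poisson_sample M \<tau> (lam \<theta>') n X \<Longrightarrow> \<theta>' \<in> \<Theta> \<Longrightarrow> cusp_sample \<tau> \<theta>\<^sub>1 b \<kappa> a h c \<Lambda> M n X \<theta>'"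
  by (intro cusp_sample.intro cusp_sample_axioms.intro cusp_model_axioms) (auto simp: poisson_sample_def)

text \<open>The affinity of two values does not involve the true value, which gives the increment
  bound. The decay is the same formula once more: the root of Z at w is its affinity with the true
  value, where the likelihood ratio is 1. None of the constants depends on n.\<close>

lemma hellinger_Zn:
  assumes ps: "poisson_sample M \<tau> (lam (\<theta>\<^sub>1 + \<phi> n * u)) n X" and n: "0 < n" and u: "\<theta>\<^sub>1 + \<phi> n * u \<in> \<Theta>"
    and A: "0 \<le> A" "\<And>k. (\<integral>\<^sup>+w. ennreal (qn n w) * indicator (Dn n \<inter> {real k..<real k + 1}) w \<partial>lborel) \<le> ennreal (A * 2 ^ k)"
    and C0: "0 \<le> C0" "\<And>w. 0 \<le> w \<Longrightarrow> exp (- (K2 / (8 * \<Lambda>)) * \<bar>w - u\<bar> powr (2 * H)) \<le> C0 / 16 ^ nat \<lfloor>w\<rfloor>"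
  shows "hellinger_process M (Zn n X u) (Dn n) (qn n) A C0 (K1 / (8 * c))"
proof -
  interpret cusp_sample \<tau> \<theta>\<^sub>1 b \<kappa> a h c \<Lambda> M n X "\<theta>\<^sub>1 + \<phi> n * u" using ps u by (rule cusp_sampleI)
  have ZL: "Zn n X u w = L (\<theta>\<^sub>1 + \<phi> n * w)" if "w \<in> Dn n" for w
    using that by (simp add: Zn_def L_def tup_def fun_eq_iff)
  show ?thesis
  proof (unfold_locales)
    have "(\<lambda>y. (fst y, \<theta>\<^sub>1 + \<phi> n * snd y)) \<in> M \<Otimes>\<^sub>M lborel \<rightarrow>\<^sub>M M \<Otimes>\<^sub>M borel" by measurable
    from measurable_compose[OF this L_joint]
    have [measurable]: "(\<lambda>y. L (\<theta>\<^sub>1 + \<phi> n * snd y) (fst y)) \<in> borel_measurable (M \<Otimes>\<^sub>M lborel)" by simp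
    have "(\<lambda>(\<omega>, w). Zn n X u w \<omega>) = (\<lambda>y. if snd y \<in> Dn n then L (\<theta>\<^sub>1 + \<phi> n * snd y) (fst y) else 0)"
      by (auto simp: fun_eq_iff Zn_def L_def tup_def)
    then show "(\<lambda>(\<omega>, w). Zn n X u w \<omega>) \<in> borel_measurable (M \<Otimes>\<^sub>M lborel)" by simp
  next
    show "0 \<le> Zn n X u w \<omega>" for w \<omega> using less_imp_le[OF lr_pos] by (simp add: Zn_def)
  next
    show "v \<in> Dn n" if "w \<in> Dn n" "0 \<le> v" "v \<le> w" for w v
      using that mult_left_mono[OF that(3) phi_nonneg[of n]] by (auto simp: Dn_def)
  next
    show "has_bochner_integral M (Zn n X u w) 1" if "w \<in> Dn n" for w unfolding ZL[OF that] by (rule L_mean)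
  next
    fix w v assume w: "w \<in> Dn n" "v \<in> Dn n" and d: "\<bar>w - v\<bar> \<le> 1"
    have p: "\<bar>w - v\<bar> powr (2 * H) \<le> \<bar>w - v\<bar>"
      using powr_le_one_le[of "\<bar>w - v\<bar>" "2 * H"] d H_bounds(1) by (cases "w = v") auto
    have "K1 / (8 * c) * \<bar>w - v\<bar> powr (2 * H) \<le> K1 / (8 * c) * \<bar>w - v\<bar>" using K_pos c by (intro mult_left_mono p) auto
    then have "1 - K1 / (8 * c) * \<bar>w - v\<bar> \<le> 1 - K1 / (8 * c) * \<bar>w - v\<bar> powr (2 * H)" by linarith
    also have "\<dots> \<le> exp (- (real n / 2) * hel (\<theta>\<^sub>1 + \<phi> n * w) (\<theta>\<^sub>1 + \<phi> n * v))"
      by (rule local_hel(1)[OF n Dn_\<Theta>[OF w(1)] Dn_\<Theta>[OF w(2)]])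
    also have "\<dots> = expectation (\<lambda>\<omega>. sqrt (Zn n X u w \<omega> * Zn n X u v \<omega>))"
      unfolding ZL[OF w(1)] ZL[OF w(2)] using L_affinity by (simp add: has_bochner_integral_iff)
    finally show "1 - K1 / (8 * c) * \<bar>w - v\<bar> \<le> expectation (\<lambda>\<omega>. sqrt (Zn n X u w \<omega> * Zn n X u v \<omega>))" .
  next
    fix w assume w: "w \<in> Dn n"
    have "expectation (\<lambda>\<omega>. sqrt (Zn n X u w \<omega>)) = expectation (\<lambda>\<omega>. sqrt (L (\<theta>\<^sub>1 + \<phi> n * w) \<omega> * L (\<theta>\<^sub>1 + \<phi> n * u) \<omega>))"
      unfolding ZL[OF w] by (intro Bochner_Integration.integral_cong refl) (simp add: L_true)
    also have "\<dots> = exp (- (real n / 2) * hel (\<theta>\<^sub>1 + \<phi> n * w) (\<theta>\<^sub>1 + \<phi> n * u))" using L_affinity by (simp add: has_bochner_integral_iff)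
    also have "\<dots> \<le> exp (- (K2 / (8 * \<Lambda>)) * \<bar>w - u\<bar> powr (2 * H))" by (rule local_hel(2)[OF n Dn_\<Theta>[OF w] u])
    also have "\<dots> \<le> C0 / 16 ^ nat \<lfloor>w\<rfloor>" using w by (intro C0) (simp add: Dn_def)
    finally show "expectation (\<lambda>\<omega>. sqrt (Zn n X u w \<omega>)) \<le> C0 / 16 ^ nat \<lfloor>w\<rfloor>" .
  qed (use A C0 qn_nonneg K_pos c in \<open>auto simp: Dn_def\<close>)
qed

text \<open>Changing the reference from \<open>\<theta>\<^sub>1\<close> to the true value divides
  the likelihood by Z at 0, which is positive and can be moved to the other side. The substitution
  produces the factor \<phi> n, which cancels together with
  \<open>p \<theta>\<^sub>1\<close>.\<close>

lemma bayes_event: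
  assumes ps: "poisson_sample M \<tau> (lam (\<theta>\<^sub>1 + \<phi> n * u)) n X" and n: "0 < n" and u: "\<theta>\<^sub>1 + \<phi> n * u \<in> \<Theta>"
    and hp: "hellinger_process M (Zn n X u) (Dn n) (qn n) A C0 C1" and \<omega>: "\<omega> \<in> space M"
  shows "bayes_statistic \<tau> b lam p \<phi> \<theta>\<^sub>1 n (\<lambda>j\<in>{1..n}. X j \<omega>) > m \<longleftrightarrow> 0 < hellinger_process.stat (Zn n X u) (Dn n) (qn n) m \<omega>"
proof -
  interpret cusp_sample \<tau> \<theta>\<^sub>1 b \<kappa> a h c \<Lambda> M n X "\<theta>\<^sub>1 + \<phi> n * u" using ps u by (rule cusp_sampleI)
  interpret hp: hellinger_process M "Zn n X u" "Dn n" "qn n" A C0 C1 by fact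
  let ?x = "\<lambda>j\<in>{1..n}. X j \<omega>" and ?\<theta>' = "\<theta>\<^sub>1 + \<phi> n * u"
  have ph: "0 < \<phi> n" using phi_pos[OF n] .
  have x: "?x j \<in> space (path_space \<tau>)" if "j \<in> {1..n}" for j using tup_path[OF \<omega> that] by (simp add: tup_def)
  have D0: "0 \<in> Dn n" using \<theta>1 by (simp add: Dn_def)
  have Z0: "Zn n X u 0 \<omega> = lr n ?\<theta>' \<theta>\<^sub>1 ?x" using D0 by (simp add: Zn_def)
  have Z0p: "0 < Zn n X u 0 \<omega>" by (rule Zn_pos[OF D0])
  note [measurable] = hp.section_measurable[OF \<omega>]
  have "bayes_likelihood \<tau> b lam p \<theta>\<^sub>1 n ?x = (LINT \<theta>|lborel. inverse (Zn n X u 0 \<omega>) * (indicator \<Theta> \<theta> * (lr n ?\<theta>' \<theta> ?x * p \<theta>)))"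
    unfolding bayes_likelihood_def set_lebesgue_integral_def
  proof (rule Bochner_Integration.integral_cong[OF refl])
    fix \<theta>
    show "indicator \<Theta> \<theta> *\<^sub>R (likelihood_ratio \<tau> lam n \<theta> \<theta>\<^sub>1 ?x * p \<theta>) = inverse (Zn n X u 0 \<omega>) * (indicator \<Theta> \<theta> * (lr n ?\<theta>' \<theta> ?x * p \<theta>))"
    proof (cases "\<theta> \<in> \<Theta>")
      case True
      have "likelihood_ratio \<tau> lam n \<theta> \<theta>\<^sub>1 ?x = lr n \<theta>\<^sub>1 \<theta> ?x" using True \<theta>1 by (intro likelihood_ratio_eq x) auto
      also have "\<dots> = lr n ?\<theta>' \<theta> ?x / lr n ?\<theta>' \<theta>\<^sub>1 ?x" by (intro lr_chain x)
      finally show ?thesis using True unfolding Z0 by (simp add: divide_inverse mult_ac)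
    qed simp
  qed
  also have "\<dots> = inverse (Zn n X u 0 \<omega>) * (LINT \<theta>|lborel. indicator \<Theta> \<theta> * (lr n ?\<theta>' \<theta> ?x * p \<theta>))" by simp
  also have "(LINT \<theta>|lborel. indicator \<Theta> \<theta> * (lr n ?\<theta>' \<theta> ?x * p \<theta>))
    = \<bar>\<phi> n\<bar> *\<^sub>R (LINT w|lborel. p \<theta>\<^sub>1 * (indicator (Dn n) w * (Zn n X u w \<omega> * qn n w)))"
  proof (subst lborel_integral_real_affine[of "\<phi> n" _ \<theta>\<^sub>1])
    have "indicator \<Theta> (\<theta>\<^sub>1 + \<phi> n * w) * (lr n ?\<theta>' (\<theta>\<^sub>1 + \<phi> n * w) ?x * p (\<theta>\<^sub>1 + \<phi> n * w)) = p \<theta>\<^sub>1 * (indicator (Dn n) w * (Zn n X u w \<omega> * qn n w))" for w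
      using Dn_iff[OF n, of w] p1 by (cases "w \<in> Dn n") (simp_all add: Zn_def qn_def)
    then show "\<bar>\<phi> n\<bar> *\<^sub>R (LINT w|lborel. indicator \<Theta> (\<theta>\<^sub>1 + \<phi> n * w) * (lr n ?\<theta>' (\<theta>\<^sub>1 + \<phi> n * w) ?x * p (\<theta>\<^sub>1 + \<phi> n * w)))
      = \<bar>\<phi> n\<bar> *\<^sub>R (LINT w|lborel. p \<theta>\<^sub>1 * (indicator (Dn n) w * (Zn n X u w \<omega> * qn n w)))" by (simp only:)
  qed (use ph in simp)
  also have "(LINT w|lborel. p \<theta>\<^sub>1 * (indicator (Dn n) w * (Zn n X u w \<omega> * qn n w))) = p \<theta>\<^sub>1 * enn2real (hp.total \<omega>)"
  proof -
    have "(LINT w|lborel. indicator (Dn n) w * (Zn n X u w \<omega> * qn n w)) = enn2real (\<integral>\<^sup>+w. ennreal (indicator (Dn n) w * (Zn n X u w \<omega> * qn n w)) \<partial>lborel)"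
      using hp.Z_nonneg qn_nonneg by (intro integral_eq_nn_integral) (auto simp: indicator_def)
    also have "(\<integral>\<^sup>+w. ennreal (indicator (Dn n) w * (Zn n X u w \<omega> * qn n w)) \<partial>lborel) = hp.total \<omega>"
      unfolding hp.total_def by (intro nn_integral_cong) (auto simp: indicator_def)
    finally show ?thesis by simp
  qed
  finally have bl: "bayes_likelihood \<tau> b lam p \<theta>\<^sub>1 n ?x = inverse (Zn n X u 0 \<omega>) * (\<bar>\<phi> n\<bar> *\<^sub>R (p \<theta>\<^sub>1 * enn2real (hp.total \<omega>)))" .
  have "bayes_statistic \<tau> b lam p \<phi> \<theta>\<^sub>1 n ?x = enn2real (hp.total \<omega>) / Zn n X u 0 \<omega>"
    unfolding bayes_statistic_def bl using ph p1 by (simp add: divide_inverse mult_ac)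
  then show ?thesis using Z0p by (simp add: hp.stat_def less_divide_eq)
qed

text \<open>Joint measurability is available for \<open>lr\<close>, which agrees with the likelihood
  ratio for all samples of paths and all \<theta> in the range of integration.\<close>

lemma bayes_is_test: "is_test \<tau> (bayes_test2 \<tau> b lam p \<phi> \<theta>\<^sub>1 m)"
proof -
  have "bayes_likelihood \<tau> b lam p \<theta>\<^sub>1 n \<in> borel_measurable (Pi\<^sub>M {1..n} (\<lambda>_. path_space \<tau>))" for n
  proof -
    let ?N = "Pi\<^sub>M {1..n} (\<lambda>_. path_space \<tau>)"
    have "(\<lambda>(x, \<theta>). lr n \<theta>\<^sub>1 \<theta> x) \<in> borel_measurable (?N \<Otimes>\<^sub>M borel)" by (rule lr_joint)
    then have [measurable]: "(\<lambda>y. lr n \<theta>\<^sub>1 (snd y) (fst y)) \<in> borel_measurable (?N \<Otimes>\<^sub>M lborel)" by (simp add: split_beta' cong: measurable_cong_sets)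
    have "(\<lambda>y. (indicator \<Theta> (snd y) * p (snd y)) * lr n \<theta>\<^sub>1 (snd y) (fst y)) \<in> borel_measurable (?N \<Otimes>\<^sub>M lborel)"
      by (intro borel_measurable_times measurable_compose[OF _ p_ind]) measurable
    then have m: "(\<lambda>x. LINT \<theta>|lborel. (indicator \<Theta> \<theta> * p \<theta>) * lr n \<theta>\<^sub>1 \<theta> x) \<in> borel_measurable ?N"
      by (intro lborel.borel_measurable_lebesgue_integral) (simp add: split_beta')
    show ?thesis
    proof (rule measurable_cong[THEN iffD1, OF _ m])
      fix x assume "x \<in> space ?N"
      then have x: "x j \<in> space (path_space \<tau>)" if "j \<in> {1..n}" for j using that by (auto simp: space_PiM)
      show "(LINT \<theta>|lborel. (indicator \<Theta> \<theta> * p \<theta>) * lr n \<theta>\<^sub>1 \<theta> x) = bayes_likelihood \<tau> b lam p \<theta>\<^sub>1 n x"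
        unfolding bayes_likelihood_def set_lebesgue_integral_def
      proof (rule Bochner_Integration.integral_cong[OF refl])
        fix \<theta>
        show "(indicator \<Theta> \<theta> * p \<theta>) * lr n \<theta>\<^sub>1 \<theta> x = indicator \<Theta> \<theta> *\<^sub>R (likelihood_ratio \<tau> lam n \<theta> \<theta>\<^sub>1 x * p \<theta>)"
          using likelihood_ratio_eq[OF x, where \<theta> = \<theta> and \<theta>' = \<theta>\<^sub>1] \<theta>1 by (cases "\<theta> \<in> \<Theta>") simp_all
      qed
    qed
  qed
  note [measurable] = this
  have "bayes_test2 \<tau> b lam p \<phi> \<theta>\<^sub>1 m n \<in> borel_measurable (Pi\<^sub>M {1..n} (\<lambda>_. path_space \<tau>))" for n
    unfolding bayes_test2_def[abs_def] bayes_statistic_def by measurable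
  then show ?thesis by (simp add: is_test_def bayes_test2_def)
qed

lemma char_Zn:
  fixes t w :: "nat \<Rightarrow> real"
  assumes ps: "poisson_sample M \<tau> (lam (\<theta>\<^sub>1 + \<phi> n * u)) n X" and u: "\<theta>\<^sub>1 + \<phi> n * u \<in> \<Theta>"
    and w: "\<And>i. i < k \<Longrightarrow> w i \<in> Dn n"
  shows "(CLINT \<omega>|M. iexp (\<Sum>i<k. t i * ln (Zn n X u (w i) \<omega>))) = exp (of_nat n * cexp (\<theta>\<^sub>1 + \<phi> n * u) k t (\<lambda>i. \<theta>\<^sub>1 + \<phi> n * w i))"
proof -
  interpret cusp_sample \<tau> \<theta>\<^sub>1 b \<kappa> a h c \<Lambda> M n X "\<theta>\<^sub>1 + \<phi> n * u" using ps u by (rule cusp_sampleI)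
  have "(\<Sum>i<k. t i * ln (Zn n X u (w i) \<omega>)) = (\<Sum>i<k. t i * ln (L (\<theta>\<^sub>1 + \<phi> n * w i) \<omega>))" for \<omega>
    using w by (intro sum.cong refl) (simp add: Zn_def L_def tup_def)
  then show ?thesis using L_char[where k = k and s = t and \<theta> = "\<lambda>i. \<theta>\<^sub>1 + \<phi> n * w i"] by simp
qed

text \<open>The bound depends on w and u but not on n, as the continuity theorem requires.\<close>

lemma ln_Zn_moment:
  assumes ps: "poisson_sample M \<tau> (lam (\<theta>\<^sub>1 + \<phi> n * u)) n X" and n: "0 < n" and u: "\<theta>\<^sub>1 + \<phi> n * u \<in> \<Theta>" and w: "w \<in> Dn n"
  shows "integrable M (\<lambda>\<omega>. ln (Zn n X u w \<omega>)) \<and> (LINT \<omega>|M. \<bar>ln (Zn n X u w \<omega>)\<bar>) \<le> 1 + exp (K1 * \<bar>w - u\<bar> powr (2 * H) / c)"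
proof -
  interpret cusp_sample \<tau> \<theta>\<^sub>1 b \<kappa> a h c \<Lambda> M n X "\<theta>\<^sub>1 + \<phi> n * u" using ps u by (rule cusp_sampleI)
  have ZL: "Zn n X u w = L (\<theta>\<^sub>1 + \<phi> n * w)" using w by (simp add: Zn_def L_def tup_def fun_eq_iff)
  note \<theta> = Dn_\<Theta>[OF w]
  have "real n * chi (\<theta>\<^sub>1 + \<phi> n * w) (\<theta>\<^sub>1 + \<phi> n * w) (\<theta>\<^sub>1 + \<phi> n * u) \<le> real n * (sqd (\<theta>\<^sub>1 + \<phi> n * w) (\<theta>\<^sub>1 + \<phi> n * u) / c)"
    by (intro mult_left_mono chi_le_sqd[OF \<theta>]) simp
  also have "\<dots> = real n * sqd (\<theta>\<^sub>1 + \<phi> n * w) (\<theta>\<^sub>1 + \<phi> n * u) / c" by simp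
  also have "\<dots> \<le> K1 * \<bar>w - u\<bar> powr (2 * H) / c" using local_sqd(1)[OF n \<theta> u] c by (intro divide_right_mono) auto
  finally have "1 + exp (real n * chi (\<theta>\<^sub>1 + \<phi> n * w) (\<theta>\<^sub>1 + \<phi> n * w) (\<theta>\<^sub>1 + \<phi> n * u)) \<le> 1 + exp (K1 * \<bar>w - u\<bar> powr (2 * H) / c)" by simp
  then show ?thesis unfolding ZL using ln_L_moment[of "\<theta>\<^sub>1 + \<phi> n * w"] by (meson order_trans)
qed

lemma bayes_power_tendsto:
  fixes P :: "nat \<Rightarrow> 'w measure" and X :: "nat \<Rightarrow> nat \<Rightarrow> 'w \<Rightarrow> real \<Rightarrow> nat" and Q :: "'s measure"
  assumes sample: "\<And>n. \<theta>\<^sub>1 + \<phi> n * u \<in> \<Theta> \<Longrightarrow> poisson_sample (P n) \<tau> (lam (\<theta>\<^sub>1 + \<phi> n * u)) n (X n)"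
    and fb: "fractional_brownian_motion Q H W" and u: "0 \<le> u"
  shows "(\<lambda>n. LINT \<omega>|P n. bayes_test2 \<tau> b lam p \<phi> \<theta>\<^sub>1 m n (\<lambda>j\<in>{1..n}. X n j \<omega>))
    \<longlonglongrightarrow> \<P>(\<omega> in Q. inverse (limit_Z H W (- u) \<omega>) * (LINT v:{-u..}|lborel. limit_Z H W v \<omega>) > m)"
proof -
  interpret Q: fbm Q H W using fb H_bounds by unfold_locales
  \<comment> \<open>The true value lies in the parameter set, and n is positive, only from some
    index on. The convergence theorems are applied to the shifted sequence and the shift is undone
    at the end.\<close>
  obtain n0 where n0: "\<And>n. n0 \<le> n \<Longrightarrow> \<theta>\<^sub>1 + \<phi> n * u \<in> \<Theta> \<and> 0 < n"
    using phi_\<Theta>[OF u] unfolding eventually_sequentially by blast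
  obtain A where A: "0 \<le> A" "\<And>n k. 0 < n \<Longrightarrow> (\<integral>\<^sup>+w. ennreal (qn n w) * indicator (Dn n \<inter> {real k..<real k + 1}) w \<partial>lborel) \<le> ennreal (A * 2 ^ k)"
    using qn_block by blast
  have K': "0 < K2 / (8 * \<Lambda>)" using K_pos \<Lambda>_pos by simp
  obtain C0 where C0: "0 \<le> C0" "\<And>w. 0 \<le> w \<Longrightarrow> exp (- (K2 / (8 * \<Lambda>)) * \<bar>w - u\<bar> powr (2 * H)) \<le> C0 / 16 ^ nat \<lfloor>w\<rfloor>"
    using hurst_decay[OF K' H_bounds(1), of u] by blast
  obtain C0' where H': "hellinger_process Q (shifted_Z H W u) {0..} (\<lambda>_. 1) 1 C0' 1" using Q.law.hellinger_shifted_Z by blast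
  define S where "S n = hellinger_process.stat (Zn n (X n) u) (Dn n) (qn n) m" for n
  define T where "T = hellinger_process.stat (shifted_Z H W u) {0..} (\<lambda>_. 1) m"
  have ps: "poisson_sample (P n) \<tau> (lam (\<theta>\<^sub>1 + \<phi> n * u)) n (X n)" and n: "0 < n" and \<Theta>u: "\<theta>\<^sub>1 + \<phi> n * u \<in> \<Theta>" if "n0 \<le> n" for n
    using n0[OF that] sample[of n] by auto
  have HP: "hellinger_process (P n) (Zn n (X n) u) (Dn n) (qn n) A C0 (K1 / (8 * c))" if "n0 \<le> n" for n
    using hellinger_Zn[OF ps[OF that] n[OF that] \<Theta>u[OF that] A(1) A(2)[OF n[OF that]] C0] .
  have ev_n0: "eventually (\<lambda>n. n0 \<le> n) sequentially" by (rule eventually_ge_at_top)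
  have ev_D: "eventually (\<lambda>n. w \<in> Dn n) sequentially" if "0 \<le> w" for w
    using phi_dom[of w] that by (auto simp: Dn_def elim: eventually_mono)
  have char: "(\<lambda>n. CLINT \<omega>|P n. iexp (\<Sum>i<k. t i * ln (Zn n (X n) u (w i) \<omega>)))
      \<longlonglongrightarrow> (CLINT \<omega>|Q. iexp (\<Sum>i<k. t i * ln (shifted_Z H W u (w i) \<omega>)))" if w: "\<And>i. i < k \<Longrightarrow> 0 \<le> w i" for k :: nat and w t :: "nat \<Rightarrow> real"
  proof (rule Lim_transform_eventually)
    have "(\<lambda>n. exp (of_nat n * cexp (\<theta>\<^sub>1 + \<phi> n * u) k t (\<lambda>i. \<theta>\<^sub>1 + \<phi> n * w i)))
      \<longlonglongrightarrow> exp (- \<i> * (\<Sum>i<k. t i * (\<bar>w i - u\<bar> powr (2 * H) / 2)) - fbm_quad H k t (\<lambda>i. w i - u) / 2)"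
      by (intro tendsto_exp cexp_tendsto u w)
    also have "exp (- \<i> * (\<Sum>i<k. t i * (\<bar>w i - u\<bar> powr (2 * H) / 2)) - fbm_quad H k t (\<lambda>i. w i - u) / 2)
      = (CLINT \<omega>|Q. iexp (\<Sum>i<k. t i * ln (shifted_Z H W u (w i) \<omega>)))"
      unfolding Q.law.char_shifted_Z by (simp add: exp_of_real[symmetric] exp_add[symmetric])
    finally show "(\<lambda>n. exp (of_nat n * cexp (\<theta>\<^sub>1 + \<phi> n * u) k t (\<lambda>i. \<theta>\<^sub>1 + \<phi> n * w i)))
      \<longlonglongrightarrow> (CLINT \<omega>|Q. iexp (\<Sum>i<k. t i * ln (shifted_Z H W u (w i) \<omega>)))" .
    have "eventually (\<lambda>n. \<forall>i\<in>{..<k}. w i \<in> Dn n) sequentially"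
      using ev_D w by (intro eventually_ball_finite) auto
    then show "eventually (\<lambda>n. exp (of_nat n * cexp (\<theta>\<^sub>1 + \<phi> n * u) k t (\<lambda>i. \<theta>\<^sub>1 + \<phi> n * w i))
      = (CLINT \<omega>|P n. iexp (\<Sum>i<k. t i * ln (Zn n (X n) u (w i) \<omega>)))) sequentially"
      using ev_n0
    proof eventually_elim
      case (elim n)
      then show ?case using char_Zn[OF ps[OF elim(2)] \<Theta>u[OF elim(2)], of k w t] by simp
    qed
  qed
  have lim: "(\<lambda>k. LINT \<omega>|P (k + n0). g (S (k + n0) \<omega>)) \<longlonglongrightarrow> (LINT \<omega>|Q. g (T \<omega>))"
    if g: "0 \<le> L" "\<And>x y. \<bar>g x - g y\<bar> \<le> L * \<bar>x - y\<bar>" "\<And>x. 0 \<le> g x" "\<And>x. g x \<le> 1" for g :: "real \<Rightarrow> real" and L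
    unfolding S_def T_def
  proof (rule stat_tendsto[where M = "\<lambda>k. P (k + n0)" and Zn = "\<lambda>k. Zn (k + n0) (X (k + n0)) u" and Dn = "\<lambda>k. Dn (k + n0)" and qn = "\<lambda>k. qn (k + n0)", OF HP H'])
    show "eventually (\<lambda>k. {0..<real K} \<subseteq> Dn (k + n0)) sequentially" for K :: nat
      unfolding eventually_sequentially_seg[of "\<lambda>n. {0..<real K} \<subseteq> Dn n"]
      using phi_dom[of "real K"] by eventually_elim (simp add: Dn_interval)
    show "eventually (\<lambda>k. \<forall>w\<in>{0..<real K}. \<bar>qn (k + n0) w - 1\<bar> \<le> \<epsilon>) sequentially" if "0 < \<epsilon>" for K :: nat and \<epsilon>
      unfolding eventually_sequentially_seg[of "\<lambda>n. \<forall>w\<in>{0..<real K}. \<bar>qn n w - 1\<bar> \<le> \<epsilon>"] by (rule qn_near[OF that])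
    show "(\<lambda>k. CLINT \<omega>|P (k + n0). iexp (\<Sum>i<j. t i * ln (Zn (k + n0) (X (k + n0)) u (w i) \<omega>)))
      \<longlonglongrightarrow> (CLINT \<omega>|Q. iexp (\<Sum>i<j. t i * ln (shifted_Z H W u (w i) \<omega>)))" if "\<And>i. i < j \<Longrightarrow> 0 \<le> w i" for j :: nat and w t
      using char[of j w t, OF that] by (rule LIMSEQ_ignore_initial_segment)
    show "\<exists>B. eventually (\<lambda>k. integrable (P (k + n0)) (\<lambda>\<omega>. ln (Zn (k + n0) (X (k + n0)) u w \<omega>))
        \<and> (LINT \<omega>|P (k + n0). \<bar>ln (Zn (k + n0) (X (k + n0)) u w \<omega>)\<bar>) \<le> B) sequentially" if w: "0 \<le> w" for w
    proof (rule exI)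
      show "eventually (\<lambda>k. integrable (P (k + n0)) (\<lambda>\<omega>. ln (Zn (k + n0) (X (k + n0)) u w \<omega>))
        \<and> (LINT \<omega>|P (k + n0). \<bar>ln (Zn (k + n0) (X (k + n0)) u w \<omega>)\<bar>) \<le> 1 + exp (K1 * \<bar>w - u\<bar> powr (2 * H) / c)) sequentially"
        unfolding eventually_sequentially_seg[of "\<lambda>n. integrable (P n) (\<lambda>\<omega>. ln (Zn n (X n) u w \<omega>)) \<and> (LINT \<omega>|P n. \<bar>ln (Zn n (X n) u w \<omega>)\<bar>) \<le> 1 + exp (K1 * \<bar>w - u\<bar> powr (2 * H) / c)"]
        using ev_n0 ev_D[OF w]
      proof eventually_elim
        case (elim n)
        show ?case by (rule ln_Zn_moment[OF ps[OF elim(1)] n[OF elim(1)] \<Theta>u[OF elim(1)] elim(2)])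
      qed
    qed
    show "integrable Q (\<lambda>\<omega>. ln (shifted_Z H W u w \<omega>))" for w by (rule Q.law.ln_shifted_Z_integrable)
  qed (use g Zn_pos Q.law.shifted_Z_pos in auto)
  have "(\<lambda>k. measure (P (k + n0)) {\<omega>\<in>space (P (k + n0)). 0 < S (k + n0) \<omega>}) \<longlonglongrightarrow> measure Q {\<omega>\<in>space Q. 0 < T \<omega>}"
  proof (rule prob_pos_tendsto[OF _ _ _ _ lim])
    show "prob_space (P (k + n0))" for k using ps[of "k + n0"] by (simp add: poisson_sample_def)
    show "prob_space Q" by (rule Q.prob_space_axioms)
    show "S (k + n0) \<in> borel_measurable (P (k + n0))" for k unfolding S_def by (rule hellinger_process.stat_measurable[OF HP]) simp
    show "T \<in> borel_measurable Q" unfolding T_def by (rule hellinger_process.stat_measurable[OF H'])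
    show "measure Q {\<omega>\<in>space Q. T \<omega> = 0} = 0" unfolding T_def by (rule Q.no_atom)
  qed
  also have "measure Q {\<omega>\<in>space Q. 0 < T \<omega>} = \<P>(\<omega> in Q. inverse (limit_Z H W (- u) \<omega>) * (LINT v:{-u..}|lborel. limit_Z H W v \<omega>) > m)"
    unfolding T_def using Q.limit_event[of _ m u] by (intro arg_cong[where f = "measure Q"]) auto
  also have "(\<lambda>k. measure (P (k + n0)) {\<omega>\<in>space (P (k + n0)). 0 < S (k + n0) \<omega>})
    = (\<lambda>k. LINT \<omega>|P (k + n0). bayes_test2 \<tau> b lam p \<phi> \<theta>\<^sub>1 m (k + n0) (\<lambda>j\<in>{1..k + n0}. X (k + n0) j \<omega>))"
  proof
    fix k
    have k: "n0 \<le> k + n0" by simp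
    have "(LINT \<omega>|P (k + n0). bayes_test2 \<tau> b lam p \<phi> \<theta>\<^sub>1 m (k + n0) (\<lambda>j\<in>{1..k + n0}. X (k + n0) j \<omega>))
      = (LINT \<omega>|P (k + n0). indicator {\<omega>\<in>space (P (k + n0)). 0 < S (k + n0) \<omega>} \<omega>)"
      using bayes_event[OF ps[OF k] n[OF k] \<Theta>u[OF k] HP[OF k], of _ m]
      by (intro Bochner_Integration.integral_cong refl) (simp add: bayes_test2_def S_def indicator_def)
    then show "measure (P (k + n0)) {\<omega>\<in>space (P (k + n0)). 0 < S (k + n0) \<omega>}
      = (LINT \<omega>|P (k + n0). bayes_test2 \<tau> b lam p \<phi> \<theta>\<^sub>1 m (k + n0) (\<lambda>j\<in>{1..k + n0}. X (k + n0) j \<omega>))"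
      by (simp only: integral_indicator_Collect)
  qed
  finally show ?thesis by (rule LIMSEQ_offset)
qed

end

theorem proposition4:
  fixes \<tau> \<theta>\<^sub>1 b \<kappa> a \<epsilon> m :: real
    and h p :: "real \<Rightarrow> real"
    and lam :: "real \<Rightarrow> real \<Rightarrow> real"
    and \<phi> :: "nat \<Rightarrow> real"
    and P :: "nat \<Rightarrow> real \<Rightarrow> 'w measure"
    and X :: "nat \<Rightarrow> nat \<Rightarrow> 'w \<Rightarrow> real \<Rightarrow> nat"
    and Q :: "'s measure"
    and W :: "real \<Rightarrow> 's \<Rightarrow> real"
    and Z :: "real \<Rightarrow> 's \<Rightarrow> real"
  assumes "0 < \<tau>" and "0 < \<theta>\<^sub>1" and "\<theta>\<^sub>1 < b" and "b \<le> \<tau>"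
    and "0 < \<kappa>" and "\<kappa> < 1 / 2" and "a \<noteq> 0"
    and h_measurable: "set_borel_measurable borel {0..\<tau>} h"
    and h_pos: "\<And>t. t \<in> {0..\<tau>} \<Longrightarrow> 0 < h t"
    and h_bounded: "bounded (h ` {0..\<tau>})"
    and h_cont: "isCont h \<theta>\<^sub>1"
    and lam_def: "lam = cusp_intensity a \<kappa> h"
    and lam_separated: "\<exists>c>0. \<forall>\<theta>\<in>{\<theta>\<^sub>1..<b}. \<forall>t\<in>{0..\<tau>}. c \<le> lam \<theta> t"
    and sample: "\<And>n \<theta>. \<theta> \<in> {\<theta>\<^sub>1..<b} \<Longrightarrow> poisson_sample (P n \<theta>) \<tau> (lam \<theta>) n (X n)"
    and p_cont: "continuous_on {\<theta>\<^sub>1..<b} p"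
    and p_pos: "\<And>\<theta>. \<theta> \<in> {\<theta>\<^sub>1..<b} \<Longrightarrow> 0 < p \<theta>"
    and p_integrable: "set_integrable lborel {\<theta>\<^sub>1..<b} p"
    and p_density: "(LINT \<theta>:{\<theta>\<^sub>1..<b}|lborel. p \<theta>) = 1"
    and phi_def: "\<phi> = cusp_rate a \<kappa> h \<theta>\<^sub>1"
    and fbm: "fractional_brownian_motion Q (hurst \<kappa>) W"
    and Z_def: "Z = limit_Z (hurst \<kappa>) W"
    and "0 < \<epsilon>" and "\<epsilon> < 1"
    and m_quantile: "\<P>(\<omega> in Q. (LINT v:{0..}|lborel. Z v \<omega>) > m) = \<epsilon>"
  shows "bayes_test2 \<tau> b lam p \<phi> \<theta>\<^sub>1 m \<in> test_class P X \<tau> \<theta>\<^sub>1 \<epsilon> \<and>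
    (\<forall>u>0. (\<lambda>n. test_expectation P X (bayes_test2 \<tau> b lam p \<phi> \<theta>\<^sub>1 m) n (\<theta>\<^sub>1 + \<phi> n * u))
       \<longlonglongrightarrow> \<P>(\<omega> in Q. inverse (Z (- u) \<omega>) * (LINT v:{-u..}|lborel. Z v \<omega>) > m))"
proof -
  obtain c where c: "0 < c" "\<And>\<theta> t. \<theta> \<in> {\<theta>\<^sub>1..<b} \<Longrightarrow> t \<in> {0..\<tau>} \<Longrightarrow> c \<le> cusp_intensity a \<kappa> h \<theta> t"
    using lam_separated unfolding lam_def by blast
  obtain B where B: "\<And>t. t \<in> {0..\<tau>} \<Longrightarrow> \<bar>h t\<bar> \<le> B" using h_bounded unfolding bounded_iff by (metis image_eqI real_norm_def)
  have upper: "cusp_intensity a \<kappa> h \<theta> t \<le> \<bar>a\<bar> * \<tau> powr \<kappa> + B" if "\<theta> \<in> {\<theta>\<^sub>1..<b}" "t \<in> {0..\<tau>}" for \<theta> t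
  proof -
    have "\<bar>t - \<theta>\<bar> powr \<kappa> \<le> \<tau> powr \<kappa>" using that assms(1-7) by (intro powr_mono2) auto
    then have "\<bar>a\<bar> * \<bar>t - \<theta>\<bar> powr \<kappa> \<le> \<bar>a\<bar> * \<tau> powr \<kappa>" by (rule mult_left_mono) simp
    moreover have "a * \<bar>t - \<theta>\<bar> powr \<kappa> \<le> \<bar>a\<bar> * \<bar>t - \<theta>\<bar> powr \<kappa>" by (intro mult_right_mono) auto
    ultimately show ?thesis using B[OF that(2)] unfolding cusp_intensity_def by linarith
  qed
  interpret cusp_prior \<tau> \<theta>\<^sub>1 b \<kappa> a h c "\<bar>a\<bar> * \<tau> powr \<kappa> + B" p
    by unfold_locales (use assms(1-7) h_measurable h_pos h_cont c upper p_cont p_pos p_integrable p_density in auto)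
  interpret Q: fbm Q "hurst \<kappa>" W using fbm H_bounds by unfold_locales
  have power: "(\<lambda>n. test_expectation P X (bayes_test2 \<tau> b lam p \<phi> \<theta>\<^sub>1 m) n (\<theta>\<^sub>1 + \<phi> n * u))
       \<longlonglongrightarrow> \<P>(\<omega> in Q. inverse (Z (- u) \<omega>) * (LINT v:{-u..}|lborel. Z v \<omega>) > m)" if "0 \<le> u" for u
    unfolding test_expectation_def phi_def lam_def Z_def
    by (rule bayes_power_tendsto[OF _ fbm that]) (use sample in \<open>simp add: lam_def\<close>)
  \<comment> \<open>Z is 1 at 0 because W vanishes there, so for u = 0 the limit is the probability
    that fixes m.\<close>
  have "{\<omega>\<in>space Q. inverse (Z (- 0) \<omega>) * (LINT v:{-0..}|lborel. Z v \<omega>) > m} = {\<omega>\<in>space Q. (LINT v:{0..}|lborel. Z v \<omega>) > m}"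
    by (auto simp: Z_def limit_Z_def[of _ _ 0] Q.W_zero)
  then have "(\<lambda>n. test_expectation P X (bayes_test2 \<tau> b lam p \<phi> \<theta>\<^sub>1 m) n \<theta>\<^sub>1) \<longlonglongrightarrow> \<epsilon>"
    using power[of 0] m_quantile by simp
  moreover have "is_test \<tau> (bayes_test2 \<tau> b lam p \<phi> \<theta>\<^sub>1 m)"
    unfolding phi_def lam_def by (rule bayes_is_test)
  ultimately show ?thesis using power by (simp add: test_class_def)
qed

end
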